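(* Let $\rho$ be the sub-Riemannian distance of the first Heisenberg group $\mathbb{H}$, and let $\mathcal{H}^3_\rho$ be the $3$-dimensional Hausdorff measure constructed from $\rho$. There exists a geometric constant $0<\gamma_\rho<1$, only depending on $\rho$, such that for each $\mathbb{H}$-rectifiable set $\Sigma\subset\mathbb{H}$ we have $$\Theta^{*3}(\mathcal{H}^3_\rho\llcorner\Sigma,x)\le\gamma_\rho$$ for $\mathcal{H}^3_\rho$-a.e. $x\in\Sigma$.
   Context: **Heisenberg group.** $\mathbb{H}$ is $\mathbb{R}^3$ with the group operation $$(x,y,t)\cdot(x',y',t')=(x+x',\,y+y',\,t+t'-2xy'+2x'y)$$ and the left invariant vector fields $X=\partial_x+2y\,\partial_t$, $Y=\partial_y-2x\,\partial_t$, $T=\partial_t$. **Sub-Riemannian distance.** A horizontal curve is an absolutely continuous curve $\gamma:[0,1]\to\mathbb{H}$ such that $\dot\gamma(s)$ is a linear combination of $X(\gamma(s))$ and $Y(\gamma(s))$ for a.e. $s\in[0,1]$. For $p,q\in\mathbb{H}$, $$\rho(p,q)=\inf\left\{\int_0^1|\dot\gamma(s)|\,ds:\ \gamma \text{ is horizontal and connects } p \text{ with } q\right\},$$ where here $|\cdot|$ is the norm of the left invariant Riemannian metric making $X,Y,T$ everywhere orthonormal. Write $\mathbb{B}(x,r)=\{p\in\mathbb{H}:\rho(p,x)\le r\}$ and $\mathbb{B}_\rho=\mathbb{B}(0,1)$. **Normalizing constant.** Let $\mathcal{H}^2_{|\cdot|}$ be the Euclidean $2$-dimensional Hausdorff measure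 in $\mathbb{R}^3$ (equal to area on planes), $N_0=\{(x,0,z)\in\mathbb{R}^3\}$, $wN_0=\{w\cdot n:n\in N_0\}$, and set $$\beta_\rho=\max_{w\in\mathbb{B}_\rho}\mathcal{H}^2_{|\cdot|}(\mathbb{B}_\rho\cap wN_0),\qquad c_3=\beta_\rho\,2^{-3}.$$ **Hausdorff measure.** For $E\subset\mathbb{H}$, $$\mathcal{H}^3_\rho(E)=\sup_{\delta>0}\ \inf\left\{\sum_{j=0}^\infty c_3\,\mathrm{diam}(B_j)^3:\ E\subset\bigcup_{j\in\mathbb{N}}B_j,\ \mathrm{diam}(B_j)\le\delta,\ B_j\subset\mathbb{H}\text{ closed}\right\},$$ where diameters are taken with respect to $\rho$. **Upper density.** For a measure $\mu$ on $\mathbb{H}$ and $x\in\mathbb{H}$, $$\Theta^{*3}(\mu,x)=\limsup_{r\to0^+}\frac{\mu(\mathbb{B}(x,r))}{c_3\,(2r)^3}=\limsup_{r\to0^+}\frac{\mu(\mathbb{B}(x,r))}{\beta_\rho\,r^3}.$$ The restriction is $(\mu\llcorner\Sigma)(A)=\mu(A\cap\Sigma)$. **$\mathbb{H}$-rectifiable sets.** These are essentially countable unions of level sets of functions with nonvanishing differential along the horizontal directions. Precisely, an $\mathbb{H}$-regular hypersurface is a set $S\subset\mathbb{H}$ such that every $p\in S$ has an open neighborhood $U\subset\mathbb{H}$ and a continuous function $f:U\to\mathbb{R}$ whose distributional derivatives $Xf,Yf$ are continuous functions on $U$, with $(Xf,Yf)\neq(0,0)$ everywhere in $U$ and $S\cap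 U=\{q\in U:f(q)=0\}$. A set $\Sigma\subset\mathbb{H}$ is $\mathbb{H}$-rectifiable if there is a sequence $(S_j)_{j\in\mathbb{N}}$ of $\mathbb{H}$-regular hypersurfaces with $\mathcal{H}^3_\rho\big(\Sigma\setminus\bigcup_{j}S_j\big)=0$.
   Formalization: Added assumption: for H^3-a.e. x in Σ some ball B(x,r), r>0, has H^3(Σ∩B(x,r)) < ∞. Without it the claim fails: the union of the vertical planes {x=q}, q rational, is H-rectifiable with upper density ∞ at each point. The conclusion itself implies this condition. *)

theory Defs
  imports "HOL-Analysis.Analysis"
begin

section \<open>The Heisenberg group\<close>

text \<open>The topology, the norm and Lebesgue measure of this type are the Euclidean ones of
  three-dimensional space. The metric topology of the sub-Riemannian distance is the same
  topology, so \<^const>\<open>open\<close>, \<^const>\<open>closed\<close> and \<^const>\<open>continuous_on\<close> need no decoration.\<close>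

type_synonym heis = "real \<times> real \<times> real"

fun heis_mult :: "heis \<Rightarrow> heis \<Rightarrow> heis" (infixl "\<cdot>\<^sub>H" 70) where
  "(x, y, t) \<cdot>\<^sub>H (x', y', t') = (x + x', y + y', t + t' - 2 * x * y' + 2 * x' * y)"

fun X_field :: "heis \<Rightarrow> heis" where
  "X_field (x, y, t) = (1, 0, 2 * y)"

fun Y_field :: "heis \<Rightarrow> heis" where
  "Y_field (x, y, t) = (0, 1, - 2 * x)"

fun T_field :: "heis \<Rightarrow> heis" where
  "T_field (x, y, t) = (0, 0, 1)"

text \<open>The first argument is the base point, the second one a tangent vector in Euclidean
  coordinates. Its coefficients in the frame of the three fields are
  \<open>a\<close>, \<open>b\<close> and \<open>c - 2 * y * a + 2 * x * b\<close>.\<close>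

fun riem_norm :: "heis \<Rightarrow> heis \<Rightarrow> real" where
  "riem_norm (x, y, t) (a, b, c) = sqrt (a\<^sup>2 + b\<^sup>2 + (c - 2 * y * a + 2 * x * b)\<^sup>2)"

lemma riem_norm_frame:
  "riem_norm p (a *\<^sub>R X_field p + b *\<^sub>R Y_field p + c *\<^sub>R T_field p) = sqrt (a\<^sup>2 + b\<^sup>2 + c\<^sup>2)"
  by (cases p) (simp add: algebra_simps)

section \<open>The sub-Riemannian distance\<close>

text \<open>Absolute continuity of a curve; the finite set \<open>D\<close> lists the end points of
  non-overlapping subintervals.\<close>

definition abs_continuous_on_interval :: "real \<Rightarrow> real \<Rightarrow> (real \<Rightarrow> 'a::metric_space) \<Rightarrow> bool" where
  "abs_continuous_on_interval a b f \<longleftrightarrow>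
     (\<forall>\<epsilon>>0. \<exists>\<delta>>0. \<forall>D. finite D \<and> (\<forall>(u, v)\<in>D. a \<le> u \<and> u \<le> v \<and> v \<le> b) \<and>
        disjoint_family_on (\<lambda>(u, v). {u<..<v}) D \<and> (\<Sum>(u, v)\<in>D. v - u) < \<delta> \<longrightarrow>
        (\<Sum>(u, v)\<in>D. dist (f u) (f v)) < \<epsilon>)"

definition horizontal_curve :: "(real \<Rightarrow> heis) \<Rightarrow> bool" where
  "horizontal_curve \<gamma> \<longleftrightarrow> abs_continuous_on_interval 0 1 \<gamma> \<and>
     (AE s in lebesgue. s \<in> {0..1} \<longrightarrow>
        (\<exists>a b. (\<gamma> has_vector_derivative a *\<^sub>R X_field (\<gamma> s) + b *\<^sub>R Y_field (\<gamma> s))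
                (at s within {0..1})))"

definition curve_length :: "(real \<Rightarrow> heis) \<Rightarrow> real" where
  "curve_length \<gamma> =
     (LINT s:{0..1}|lebesgue. riem_norm (\<gamma> s) (vector_derivative \<gamma> (at s within {0..1})))"

definition \<rho> :: "heis \<Rightarrow> heis \<Rightarrow> real" where
  "\<rho> p q = Inf {curve_length \<gamma> |\<gamma>. horizontal_curve \<gamma> \<and> \<gamma> 0 = p \<and> \<gamma> 1 = q}"

definition \<rho>_ball :: "heis \<Rightarrow> real \<Rightarrow> heis set" where
  "\<rho>_ball x r = {p. \<rho> p x \<le> r}"

section \<open>Hausdorff measures\<close>

text \<open>The diameter of an unbounded set is \<open>\<infinity>\<close>, that of the empty set is \<open>0\<close>.\<close>

definition ediam :: "('a \<Rightarrow> 'a \<Rightarrow> real) \<Rightarrow> 'a set \<Rightarrow> ennreal" where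
  "ediam d B = (SUP x\<in>B. SUP y\<in>B. ennreal (d x y))"

text \<open>The Hausdorff (outer) measure of dimension \<open>k\<close> for the distance \<open>d\<close> with normalizing
  constant \<open>c\<close>, built from coverings by closed sets and defined on all sets.\<close>

definition hausdorff_measure ::
    "('a::topological_space \<Rightarrow> 'a \<Rightarrow> real) \<Rightarrow> ennreal \<Rightarrow> nat \<Rightarrow> 'a set \<Rightarrow> ennreal" where
  "hausdorff_measure d c k E =
     (SUP \<delta>\<in>{0::real<..}.
        INF B\<in>{B :: nat \<Rightarrow> 'a set. E \<subseteq> (\<Union>j. B j) \<and>
                 (\<forall>j. ediam d (B j) \<le> ennreal \<delta> \<and> closed (B j))}.
          (\<Sum>j. c * ediam d (B j) ^ k))"

text \<open>The constant \<open>\<pi> / 4\<close> is the area of a planar disc of diameter \<open>1\<close>; it makes the measure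
  equal to area on planes.\<close>

definition H2_euclid :: "heis set \<Rightarrow> ennreal" where
  "H2_euclid = hausdorff_measure dist (ennreal (pi / 4)) 2"

definition N\<^sub>0 :: "heis set" where
  "N\<^sub>0 = {(x, 0, z) |x z. True}"

text \<open>The supremum is attained, hence is the maximum over the closed unit ball.\<close>

definition \<beta>\<^sub>\<rho> :: ennreal where
  "\<beta>\<^sub>\<rho> = (SUP w\<in>\<rho>_ball 0 1. H2_euclid (\<rho>_ball 0 1 \<inter> (\<lambda>n. w \<cdot>\<^sub>H n) ` N\<^sub>0))"

definition c\<^sub>3 :: ennreal where
  "c\<^sub>3 = \<beta>\<^sub>\<rho> / 2 ^ 3"

definition H3 :: "heis set \<Rightarrow> ennreal" where
  "H3 = hausdorff_measure \<rho> c\<^sub>3 3"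

definition H3_ae_on :: "heis set \<Rightarrow> (heis \<Rightarrow> bool) \<Rightarrow> bool" where
  "H3_ae_on E P \<longleftrightarrow> H3 {x\<in>E. \<not> P x} = 0"

definition measure_restriction :: "('a set \<Rightarrow> ennreal) \<Rightarrow> 'a set \<Rightarrow> 'a set \<Rightarrow> ennreal"
    (infixl "\<llcorner>" 80) where
  "(\<mu> \<llcorner> E) A = \<mu> (A \<inter> E)"

definition upper_density3 :: "(heis set \<Rightarrow> ennreal) \<Rightarrow> heis \<Rightarrow> ennreal" where
  "upper_density3 \<mu> x =
     Limsup (at_right (0::real)) (\<lambda>r. \<mu> (\<rho>_ball x r) / (c\<^sub>3 * ennreal ((2 * r) ^ 3)))"

section \<open>Rectifiable sets\<close>

primrec Ck :: "nat \<Rightarrow> ('a::euclidean_space \<Rightarrow> real) \<Rightarrow> bool" where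
  "Ck 0 \<phi> \<longleftrightarrow> continuous_on UNIV \<phi>"
| "Ck (Suc k) \<phi> \<longleftrightarrow> (\<forall>x. \<phi> differentiable (at x)) \<and>
     (\<forall>e\<in>Basis. Ck k (\<lambda>x. frechet_derivative \<phi> (at x) e))"

definition test_function :: "'a::euclidean_space set \<Rightarrow> ('a \<Rightarrow> real) \<Rightarrow> bool" where
  "test_function U \<phi> \<longleftrightarrow>
     (\<forall>k. Ck k \<phi>) \<and> compact (closure {x. \<phi> x \<noteq> 0}) \<and> closure {x. \<phi> x \<noteq> 0} \<subseteq> U"

text \<open>The function \<open>g\<close> represents the distributional derivative of \<open>f\<close> along \<open>V\<close> in the open
  set \<open>U\<close>. The formula is only valid for divergence free fields \<open>V\<close>, such as \<^const>\<open>X_field\<close> and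
  \<^const>\<open>Y_field\<close>: their formal adjoints are \<open>- V\<close>.\<close>

definition distributional_derivative_on ::
    "heis set \<Rightarrow> (heis \<Rightarrow> heis) \<Rightarrow> (heis \<Rightarrow> real) \<Rightarrow> (heis \<Rightarrow> real) \<Rightarrow> bool" where
  "distributional_derivative_on U V f g \<longleftrightarrow>
     (\<forall>\<phi>. test_function U \<phi> \<longrightarrow>
        (LINT p:U|lborel. g p * \<phi> p) =
        - (LINT p:U|lborel. f p * frechet_derivative \<phi> (at p) (V p)))"

definition H_regular_hypersurface :: "heis set \<Rightarrow> bool" where
  "H_regular_hypersurface S \<longleftrightarrow>
     (\<forall>p\<in>S. \<exists>U f Xf Yf. open U \<and> p \<in> U \<and>
        continuous_on U f \<and> continuous_on U Xf \<and> continuous_on U Yf \<and>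
        distributional_derivative_on U X_field f Xf \<and>
        distributional_derivative_on U Y_field f Yf \<and>
        (\<forall>q\<in>U. (Xf q, Yf q) \<noteq> (0, 0)) \<and>
        S \<inter> U = {q\<in>U. f q = 0})"

definition H_rectifiable :: "heis set \<Rightarrow> bool" where
  "H_rectifiable \<Sigma> \<longleftrightarrow>
     (\<exists>S :: nat \<Rightarrow> heis set. (\<forall>j. H_regular_hypersurface (S j)) \<and> H3 (\<Sigma> - (\<Union>j. S j)) = 0)"

text \<open>Local finiteness of the restricted measure at almost every point of the set. It is implicit
  in any finite bound for the upper density: the union of the planes \<open>x = q\<close> with rational \<open>q\<close>
  is \<open>H_rectifiable\<close>, but each of its points has upper density \<open>\<infinity>\<close>.\<close>

definition H3_locally_finite_ae :: "heis set \<Rightarrow> bool" where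
  "H3_locally_finite_ae \<Sigma> \<longleftrightarrow> H3_ae_on \<Sigma> (\<lambda>x. \<exists>r>0. (H3 \<llcorner> \<Sigma>) (\<rho>_ball x r) < \<infinity>)"

end

theory Submission
  imports Defs
begin

text \<open>The normalization of the Hausdorff measure cancels in the density, so that the theorem compares two
  areas. Near almost all of its points a rectifiable set is, up to a set of density zero, a regular hypersurface,
  and a regular hypersurface is infinitesimally a vertical plane; vertical planes are abelian subgroups that
  act on themselves by translations. Let \<open>A\<close> be the area of the unit ball of such a plane and \<open>L\<close> the area of
  a planar set of diameter \<open>2\<close>. Small translated copies of the second set, scaled to diameter \<open>2 s\<close>, cover
  the plane efficiently, so that a piece of area \<open>a\<close> has unnormalized measure at most \<open>8 a / L\<close>. The piece in
  a ball of radius \<open>r\<close> has area \<open>A r\<^sup>3\<close>, hence the density is at most \<open>A / L\<close>.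

  The constant is smaller than \<open>1\<close> because the unit ball does not have the largest area among planar sets of
  diameter \<open>2\<close>. Let \<open>c\<close> be the distance of \<open>(0, 0, 1)\<close> from the origin. The ball meets
  the vertical axis in a segment whose end points are the poles \<open>(0, \<plusminus> 1 / c\<^sup>2)\<close>, and the distance of a point \<open>(x, y, t)\<close> from the origin
  is at most the square root of \<open>x\<^sup>2 + y\<^sup>2 + c\<^sup>2 |t|\<close> (\<open>gauge_norm_sq_le\<close>). On the differences of a point of
  the ball and a pole this bound is less than \<open>4\<close>, so that small boxes around the poles, which stick out of
  the ball, can be added to it (\<open>large_set_diameter\<close>, \<open>large_set_area\<close>). The inequality itself comes from
  cutting a nearly optimal loop at a point far from its start and inserting a horizontal segment there; no
  formula for geodesics is involved.

  Three steps transfer the planar estimate to rectifiable sets. A function with continuous distributional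
  derivatives along the frame satisfies a uniform first order expansion along horizontal directions
  (\<open>frame_differentiability\<close>, by testing with thin smooth bumps around segments). Its zero set is
  therefore, up to a rotation, a set whose points differ by little in the normal direction compared with their
  distance. For such sets a packing argument bounds the measure by \<open>8 / L\<close> times the area of the projection to
  the plane, up to a factor close to \<open>1\<close> (\<open>cone_area_bound\<close>); this gives the density of a hypersurface
  (\<open>hypersurface_density\<close>). Finally the part of a set of finite measure that lies outside of a hypersurface
  has density zero at almost every point of the hypersurface (\<open>density_zero\<close>), by a Vitali selection.\<close>

hide_const (open) Polynomial.content

section \<open>Absolutely continuous curves\<close>

lemma abs_continuousD:
  assumes "abs_continuous_on_interval a b f" "e > 0"
  obtains d where "d > 0"
    "\<And>D. finite D \<Longrightarrow> (\<And>u v. (u, v) \<in> D \<Longrightarrow> a \<le> u \<and> u \<le> v \<and> v \<le> b) \<Longrightarrow>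
        disjoint_family_on (\<lambda>(u, v). {u<..<v}) D \<Longrightarrow> (\<Sum>(u, v)\<in>D. v - u) < d \<Longrightarrow>
        (\<Sum>(u, v)\<in>D. dist (f u) (f v)) < e"
proof -
  obtain d where "d > 0" and d: "\<forall>D. finite D \<and> (\<forall>(u, v)\<in>D. a \<le> u \<and> u \<le> v \<and> v \<le> b) \<and>
        disjoint_family_on (\<lambda>(u, v). {u<..<v}) D \<and> (\<Sum>(u, v)\<in>D. v - u) < d \<longrightarrow>
        (\<Sum>(u, v)\<in>D. dist (f u) (f v)) < e"
    using assms unfolding abs_continuous_on_interval_def by blast
  show ?thesis
    by (rule that[OF \<open>d > 0\<close>]) (use d in blast)
qed

lemma abs_continuousI:
  assumes "\<And>e. e > 0 \<Longrightarrow> \<exists>d>0. \<forall>D. finite D \<longrightarrow> (\<forall>u v. (u, v) \<in> D \<longrightarrow> a \<le> u \<and> u \<le> v \<and> v \<le> b) \<longrightarrow>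
        disjoint_family_on (\<lambda>(u, v). {u<..<v}) D \<longrightarrow> (\<Sum>(u, v)\<in>D. v - u) < d \<longrightarrow>
        (\<Sum>(u, v)\<in>D. dist (f u) (f v)) < e"
  shows "abs_continuous_on_interval a b f"
  unfolding abs_continuous_on_interval_def
proof (intro allI impI)
  fix e :: real assume "e > 0"
  from assms[OF this] obtain d where "d > 0" and d: "\<And>D. finite D \<Longrightarrow> (\<forall>u v. (u, v) \<in> D \<longrightarrow> a \<le> u \<and> u \<le> v \<and> v \<le> b) \<Longrightarrow>
        disjoint_family_on (\<lambda>(u, v). {u<..<v}) D \<Longrightarrow> (\<Sum>(u, v)\<in>D. v - u) < d \<Longrightarrow>
        (\<Sum>(u, v)\<in>D. dist (f u) (f v)) < e" by blast
  show "\<exists>\<delta>>0. \<forall>D. finite D \<and> (\<forall>(u, v)\<in>D. a \<le> u \<and> u \<le> v \<and> v \<le> b) \<and>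
        disjoint_family_on (\<lambda>(u, v). {u<..<v}) D \<and> (\<Sum>(u, v)\<in>D. v - u) < \<delta> \<longrightarrow>
        (\<Sum>(u, v)\<in>D. dist (f u) (f v)) < e"
    by (rule exI[of _ d], intro conjI allI impI \<open>d > 0\<close>, rule d) auto
qed

lemma abs_continuous_imp_continuous:
  assumes "abs_continuous_on_interval a b f"
  shows "continuous_on {a..b} f"
  unfolding continuous_on_iff
proof (intro ballI allI impI)
  fix x e :: real assume x: "x \<in> {a..b}" and "0 < e"
  obtain d where "d > 0" and d: "\<And>D. finite D \<Longrightarrow> (\<And>u v. (u, v) \<in> D \<Longrightarrow> a \<le> u \<and> u \<le> v \<and> v \<le> b) \<Longrightarrow>
        disjoint_family_on (\<lambda>(u, v). {u<..<v}) D \<Longrightarrow> (\<Sum>(u, v)\<in>D. v - u) < d \<Longrightarrow>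
        (\<Sum>(u, v)\<in>D. dist (f u) (f v)) < e"
    using abs_continuousD[OF assms \<open>0 < e\<close>] by blast
  show "\<exists>d>0. \<forall>x'\<in>{a..b}. dist x' x < d \<longrightarrow> dist (f x') (f x) < e"
  proof (intro exI conjI ballI impI)
    fix y assume y: "y \<in> {a..b}" "dist y x < d"
    show "dist (f y) (f x) < e"
    proof (cases "x \<le> y")
      case True
      then show ?thesis
        using d[of "{(x, y)}"] x y by (auto simp: disjoint_family_on_def dist_real_def dist_commute)
    next
      case False
      then show ?thesis
        using d[of "{(y, x)}"] x y by (auto simp: disjoint_family_on_def dist_real_def dist_commute)
    qed
  qed (fact \<open>d > 0\<close>)
qed

lemma abs_continuous_subinterval:
  assumes "abs_continuous_on_interval a b f" "a \<le> a'" "b' \<le> b"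
  shows "abs_continuous_on_interval a' b' f"
proof (rule abs_continuousI)
  fix e :: real assume "e > 0"
  obtain d where "d > 0" and d: "\<And>D. finite D \<Longrightarrow> (\<And>u v. (u, v) \<in> D \<Longrightarrow> a \<le> u \<and> u \<le> v \<and> v \<le> b) \<Longrightarrow>
        disjoint_family_on (\<lambda>(u, v). {u<..<v}) D \<Longrightarrow> (\<Sum>(u, v)\<in>D. v - u) < d \<Longrightarrow>
        (\<Sum>(u, v)\<in>D. dist (f u) (f v)) < e"
    using abs_continuousD[OF assms(1) \<open>0 < e\<close>] by blast
  show "\<exists>d>0. \<forall>D. finite D \<longrightarrow> (\<forall>u v. (u, v) \<in> D \<longrightarrow> a' \<le> u \<and> u \<le> v \<and> v \<le> b') \<longrightarrow>
        disjoint_family_on (\<lambda>(u, v). {u<..<v}) D \<longrightarrow> (\<Sum>(u, v)\<in>D. v - u) < d \<longrightarrow>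
        (\<Sum>(u, v)\<in>D. dist (f u) (f v)) < e"
    by (intro exI[of _ d] conjI allI impI \<open>d > 0\<close>, rule d) (use assms(2,3) in \<open>auto, force+\<close>)
qed

lemma abs_continuous_lipschitz_compose:
  assumes "abs_continuous_on_interval a b f"
    and lip: "\<And>u v. a \<le> u \<Longrightarrow> u \<le> b \<Longrightarrow> a \<le> v \<Longrightarrow> v \<le> b \<Longrightarrow> dist (g u) (g v) \<le> C * dist (f u) (f v)"
  shows "abs_continuous_on_interval a b g"
proof (rule abs_continuousI)
  fix e :: real assume "e > 0"
  define C' where "C' = \<bar>C\<bar> + 1"
  have C': "C' > 0" "C \<le> C'" by (auto simp: C'_def)
  with \<open>e > 0\<close> have "e / C' > 0" by simp
  obtain d where "d > 0" and d: "\<And>D. finite D \<Longrightarrow> (\<And>u v. (u, v) \<in> D \<Longrightarrow> a \<le> u \<and> u \<le> v \<and> v \<le> b) \<Longrightarrow>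
        disjoint_family_on (\<lambda>(u, v). {u<..<v}) D \<Longrightarrow> (\<Sum>(u, v)\<in>D. v - u) < d \<Longrightarrow>
        (\<Sum>(u, v)\<in>D. dist (f u) (f v)) < e / C'"
    using abs_continuousD[OF assms(1) \<open>e / C' > 0\<close>] by blast
  show "\<exists>d>0. \<forall>D. finite D \<longrightarrow> (\<forall>u v. (u, v) \<in> D \<longrightarrow> a \<le> u \<and> u \<le> v \<and> v \<le> b) \<longrightarrow>
        disjoint_family_on (\<lambda>(u, v). {u<..<v}) D \<longrightarrow> (\<Sum>(u, v)\<in>D. v - u) < d \<longrightarrow>
        (\<Sum>(u, v)\<in>D. dist (g u) (g v)) < e"
  proof (intro exI[of _ d] conjI allI impI \<open>d > 0\<close>)
    fix D assume D: "finite D" "\<forall>u v. (u, v) \<in> D \<longrightarrow> a \<le> u \<and> u \<le> v \<and> v \<le> b"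
        "disjoint_family_on (\<lambda>(u, v). {u<..<v}) D" "(\<Sum>(u, v)\<in>D. v - u) < d"
    have "(\<Sum>(u, v)\<in>D. dist (g u) (g v)) \<le> (\<Sum>(u, v)\<in>D. C' * dist (f u) (f v))"
    proof (rule sum_mono)
      fix p assume p: "p \<in> D"
      obtain u v where uv: "p = (u, v)" by fastforce
      then have "a \<le> u" "u \<le> v" "v \<le> b" using D(2) p by auto
      then have "dist (g u) (g v) \<le> C * dist (f u) (f v)" by (intro lip) auto
      also have "\<dots> \<le> C' * dist (f u) (f v)" by (intro mult_right_mono C') auto
      finally show "(case p of (u, v) \<Rightarrow> dist (g u) (g v)) \<le> (case p of (u, v) \<Rightarrow> C' * dist (f u) (f v))"
        by (simp add: uv)
    qed
    also have "\<dots> = C' * (\<Sum>(u, v)\<in>D. dist (f u) (f v))"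
      by (simp add: sum_distrib_left case_prod_unfold)
    also have "\<dots> < C' * (e / C')"
      using d[OF D(1) _ D(3,4)] D(2) C' by (intro mult_strict_left_mono) auto
    finally show "(\<Sum>(u, v)\<in>D. dist (g u) (g v)) < e" using C' by simp
  qed
qed

lemma abs_continuous_affine:
  assumes "abs_continuous_on_interval (m * a + c) (m * b + c) f" "m > 0"
  shows "abs_continuous_on_interval a b (\<lambda>s. f (m * s + c))"
proof (rule abs_continuousI)
  fix e :: real assume "e > 0"
  obtain d where "d > 0" and d: "\<And>D. finite D \<Longrightarrow> (\<And>u v. (u, v) \<in> D \<Longrightarrow> m * a + c \<le> u \<and> u \<le> v \<and> v \<le> m * b + c) \<Longrightarrow>
        disjoint_family_on (\<lambda>(u, v). {u<..<v}) D \<Longrightarrow> (\<Sum>(u, v)\<in>D. v - u) < d \<Longrightarrow>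
        (\<Sum>(u, v)\<in>D. dist (f u) (f v)) < e"
    using abs_continuousD[OF assms(1) \<open>e > 0\<close>] by blast
  have "d / m > 0" using \<open>d > 0\<close> assms by simp
  show "\<exists>d>0. \<forall>D. finite D \<longrightarrow> (\<forall>u v. (u, v) \<in> D \<longrightarrow> a \<le> u \<and> u \<le> v \<and> v \<le> b) \<longrightarrow>
        disjoint_family_on (\<lambda>(u, v). {u<..<v}) D \<longrightarrow> (\<Sum>(u, v)\<in>D. v - u) < d \<longrightarrow>
        (\<Sum>(u, v)\<in>D. dist (f (m * u + c)) (f (m * v + c))) < e"
  proof (intro exI[of _ "d / m"] conjI allI impI \<open>d / m > 0\<close>)
    fix D assume D: "finite D" "\<forall>u v. (u, v) \<in> D \<longrightarrow> a \<le> u \<and> u \<le> v \<and> v \<le> b"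
        "disjoint_family_on (\<lambda>(u, v). {u<..<v}) D" "(\<Sum>(u, v)\<in>D. v - u) < d / m"
    define h where "h = (\<lambda>(u, v). (m * u + c, m * v + c))"
    have inj: "inj_on h D" using assms(2) by (auto simp: inj_on_def h_def)
    have sumh: "(\<Sum>p\<in>h ` D. F p) = (\<Sum>p\<in>D. F (h p))" for F :: "real \<times> real \<Rightarrow> real"
      using inj by (simp add: sum.reindex)
    have "(\<Sum>(u, v)\<in>h ` D. dist (f u) (f v)) < e"
    proof (rule d)
      show "finite (h ` D)" using D by simp
      show "m * a + c \<le> u \<and> u \<le> v \<and> v \<le> m * b + c" if "(u, v) \<in> h ` D" for u v
        using that D(2) assms(2) by (auto simp: h_def)
      show "disjoint_family_on (\<lambda>(u, v). {u<..<v}) (h ` D)"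
        unfolding disjoint_family_on_def
      proof (intro ballI impI)
        fix p q assume "p \<in> h ` D" "q \<in> h ` D" "p \<noteq> q"
        then obtain u v u' v' where uv: "(u, v) \<in> D" "p = h (u, v)" "(u', v') \<in> D" "q = h (u', v')"
          "(u, v) \<noteq> (u', v')" by auto
        have dj: "{u<..<v} \<inter> {u'<..<v'} = {}"
          using D(3) uv unfolding disjoint_family_on_def by fastforce
        have "(x - c) / m \<in> {u<..<v} \<inter> {u'<..<v'}" if "x \<in> {m * u + c<..<m * v + c} \<inter> {m * u' + c<..<m * v' + c}" for x
          using that assms(2) by (auto simp: field_simps)
        with dj have "{m * u + c<..<m * v + c} \<inter> {m * u' + c<..<m * v' + c} = {}" by blast
        then show "(case p of (u, v) \<Rightarrow> {u<..<v}) \<inter> (case q of (u, v) \<Rightarrow> {u<..<v}) = {}"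
          by (simp add: uv h_def)
      qed
      have "(\<Sum>(u, v)\<in>h ` D. v - u) = m * (\<Sum>(u, v)\<in>D. v - u)"
        unfolding sumh by (simp add: h_def case_prod_unfold sum_distrib_left algebra_simps)
      also have "\<dots> < m * (d / m)" using D(4) assms(2) by (intro mult_strict_left_mono)
      finally show "(\<Sum>(u, v)\<in>h ` D. v - u) < d" using assms(2) by simp
    qed
    then show "(\<Sum>(u, v)\<in>D. dist (f (m * u + c)) (f (m * v + c))) < e"
      unfolding sumh by (simp add: h_def case_prod_unfold)
  qed
qed

text \<open>At most one of finitely many non-overlapping intervals contains the joint \<open>c\<close> in its
  interior; it is cut there.\<close>

lemma abs_continuous_combine:
  fixes c :: real
  assumes ac: "abs_continuous_on_interval a c f" "abs_continuous_on_interval c b f"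
  shows "abs_continuous_on_interval a b f"
proof (cases "a \<le> c \<and> c \<le> b")
  case False
  then show ?thesis
  proof (cases "a \<le> c")
    case True
    with False have "b < c" by simp
    then show ?thesis using abs_continuous_subinterval[OF ac(1), of a b] by simp
  next
    case False
    then show ?thesis using abs_continuous_subinterval[OF ac(2), of a b] by simp
  qed
next
  case ac_le: True
  show ?thesis
  proof (rule abs_continuousI)
    fix e :: real assume "e > 0"
    then have "e / 2 > 0" by simp
    obtain d1 where "d1 > 0" and d1: "\<And>D. finite D \<Longrightarrow> (\<And>u v. (u, v) \<in> D \<Longrightarrow> a \<le> u \<and> u \<le> v \<and> v \<le> c) \<Longrightarrow>
        disjoint_family_on (\<lambda>(u, v). {u<..<v}) D \<Longrightarrow> (\<Sum>(u, v)\<in>D. v - u) < d1 \<Longrightarrow>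
        (\<Sum>(u, v)\<in>D. dist (f u) (f v)) < e / 2"
      using abs_continuousD[OF ac(1) \<open>e / 2 > 0\<close>] by blast
    obtain d2 where "d2 > 0" and d2: "\<And>D. finite D \<Longrightarrow> (\<And>u v. (u, v) \<in> D \<Longrightarrow> c \<le> u \<and> u \<le> v \<and> v \<le> b) \<Longrightarrow>
        disjoint_family_on (\<lambda>(u, v). {u<..<v}) D \<Longrightarrow> (\<Sum>(u, v)\<in>D. v - u) < d2 \<Longrightarrow>
        (\<Sum>(u, v)\<in>D. dist (f u) (f v)) < e / 2"
      using abs_continuousD[OF ac(2) \<open>e / 2 > 0\<close>] by blast
    define l where "l = (\<lambda>(u, v). (min u c, min v c))"
    define r where "r = (\<lambda>(u, v). (max u c, max v c))"
    show "\<exists>d>0. \<forall>D. finite D \<longrightarrow> (\<forall>u v. (u, v) \<in> D \<longrightarrow> a \<le> u \<and> u \<le> v \<and> v \<le> b) \<longrightarrow>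
        disjoint_family_on (\<lambda>(u, v). {u<..<v}) D \<longrightarrow> (\<Sum>(u, v)\<in>D. v - u) < d \<longrightarrow>
        (\<Sum>(u, v)\<in>D. dist (f u) (f v)) < e"
    proof (intro exI[of _ "min d1 d2"] conjI allI impI)
      show "0 < min d1 d2" using \<open>d1 > 0\<close> \<open>d2 > 0\<close> by simp
      fix D :: "(real \<times> real) set"
      assume D: "finite D" "\<forall>u v. (u, v) \<in> D \<longrightarrow> a \<le> u \<and> u \<le> v \<and> v \<le> b"
        "disjoint_family_on (\<lambda>(u, v). {u<..<v}) D" "(\<Sum>(u, v)\<in>D. v - u) < min d1 d2"
      have dj: "{u<..<v} \<inter> {u'<..<v'} = {}" if "(u, v) \<in> D" "(u', v') \<in> D" "(u, v) \<noteq> (u', v')" for u v u' v'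
        using D(3) that unfolding disjoint_family_on_def by fastforce
      define L where "L = {p\<in>D. fst p < c \<and> fst p < snd p}"
      define R where "R = {p\<in>D. c < snd p \<and> fst p < snd p}"
      have fin: "finite L" "finite R" using D(1) by (auto simp: L_def R_def)
      have injl: "inj_on l L"
      proof (rule inj_onI)
        fix p q assume pq: "p \<in> L" "q \<in> L" "l p = l q"
        obtain u v u' v' where uv: "p = (u, v)" "q = (u', v')" by fastforce
        have "u = u'" using pq by (auto simp: L_def l_def uv min_def split: if_splits)
        moreover have "(u + min (min v v') c) / 2 \<in> {u<..<v} \<inter> {u'<..<v'}"
          using pq \<open>u = u'\<close> by (auto simp: L_def uv min_def field_simps split: if_splits)
        ultimately show "p = q" using dj[of u v u' v'] pq unfolding L_def uv by blast
      qed
      have injr: "inj_on r R"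
      proof (rule inj_onI)
        fix p q assume pq: "p \<in> R" "q \<in> R" "r p = r q"
        obtain u v u' v' where uv: "p = (u, v)" "q = (u', v')" by fastforce
        have "v = v'" using pq by (auto simp: R_def r_def uv max_def split: if_splits)
        moreover have "(v + max (max u u') c) / 2 \<in> {u<..<v} \<inter> {u'<..<v'}"
          using pq \<open>v = v'\<close> by (auto simp: R_def uv max_def field_simps split: if_splits)
        ultimately show "p = q" using dj[of u v u' v'] pq unfolding R_def uv by blast
      qed
      have sumL: "(\<Sum>p\<in>l ` L. F p) = (\<Sum>p\<in>L. F (l p))" for F :: "real \<times> real \<Rightarrow> real"
        using injl by (simp add: sum.reindex)
      have sumR: "(\<Sum>p\<in>r ` R. F p) = (\<Sum>p\<in>R. F (r p))" for F :: "real \<times> real \<Rightarrow> real"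
        using injr by (simp add: sum.reindex)
      have l: "(\<Sum>(u, v)\<in>l ` L. dist (f u) (f v)) < e / 2"
      proof (rule d1)
        show "finite (l ` L)" using fin by simp
        show "a \<le> u \<and> u \<le> v \<and> v \<le> c" if "(u, v) \<in> l ` L" for u v
          using that D(2) ac_le by (auto simp: l_def L_def min_def)
        show "disjoint_family_on (\<lambda>(u, v). {u<..<v}) (l ` L)"
          unfolding disjoint_family_on_def
        proof (intro ballI impI)
          fix p q assume "p \<in> l ` L" "q \<in> l ` L" "p \<noteq> q"
          then obtain u v u' v' where uv: "(u, v) \<in> D" "p = l (u, v)" "(u', v') \<in> D" "q = l (u', v')"
            "(u, v) \<noteq> (u', v')" by (auto simp: L_def)
          have "{min u c<..<min v c} \<inter> {min u' c<..<min v' c} \<subseteq> {u<..<v} \<inter> {u'<..<v'}"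
            by (auto simp: min_def)
          with dj[OF uv(1,3,5)] show "(case p of (u, v) \<Rightarrow> {u<..<v}) \<inter> (case q of (u, v) \<Rightarrow> {u<..<v}) = {}"
            by (auto simp: uv l_def)
        qed
        have "(\<Sum>(u, v)\<in>l ` L. v - u) \<le> (\<Sum>(u, v)\<in>L. v - u)"
          unfolding sumL by (rule sum_mono) (auto simp: l_def L_def min_def)
        also have "\<dots> \<le> (\<Sum>(u, v)\<in>D. v - u)"
          using D(1,2) by (intro sum_mono2) (auto simp: L_def)
        finally show "(\<Sum>(u, v)\<in>l ` L. v - u) < d1" using D(4) by simp
      qed
      have r: "(\<Sum>(u, v)\<in>r ` R. dist (f u) (f v)) < e / 2"
      proof (rule d2)
        show "finite (r ` R)" using fin by simp
        show "c \<le> u \<and> u \<le> v \<and> v \<le> b" if "(u, v) \<in> r ` R" for u v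
          using that D(2) ac_le by (auto simp: r_def R_def max_def)
        show "disjoint_family_on (\<lambda>(u, v). {u<..<v}) (r ` R)"
          unfolding disjoint_family_on_def
        proof (intro ballI impI)
          fix p q assume "p \<in> r ` R" "q \<in> r ` R" "p \<noteq> q"
          then obtain u v u' v' where uv: "(u, v) \<in> D" "p = r (u, v)" "(u', v') \<in> D" "q = r (u', v')"
            "(u, v) \<noteq> (u', v')" by (auto simp: R_def)
          have "{max u c<..<max v c} \<inter> {max u' c<..<max v' c} \<subseteq> {u<..<v} \<inter> {u'<..<v'}"
            by (auto simp: max_def split: if_splits)
          with dj[OF uv(1,3,5)] show "(case p of (u, v) \<Rightarrow> {u<..<v}) \<inter> (case q of (u, v) \<Rightarrow> {u<..<v}) = {}"
            by (auto simp: uv r_def)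
        qed
        have "(\<Sum>(u, v)\<in>r ` R. v - u) \<le> (\<Sum>(u, v)\<in>R. v - u)"
          unfolding sumR by (rule sum_mono) (auto simp: r_def R_def max_def)
        also have "\<dots> \<le> (\<Sum>(u, v)\<in>D. v - u)"
          using D(1,2) by (intro sum_mono2) (auto simp: R_def)
        finally show "(\<Sum>(u, v)\<in>r ` R. v - u) < d2" using D(4) by simp
      qed
      have "(\<Sum>(u, v)\<in>D. dist (f u) (f v)) \<le>
            (\<Sum>p\<in>D. (if p \<in> L then dist (f (fst (l p))) (f (snd (l p))) else 0) +
                     (if p \<in> R then dist (f (fst (r p))) (f (snd (r p))) else 0))"
      proof (rule sum_mono)
        fix p assume p: "p \<in> D"
        obtain u v where uv: "p = (u, v)" by fastforce
        have "u \<le> v" using p D(2) uv by auto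
        have "dist (f u) (f v) \<le> dist (f u) (f c) + dist (f c) (f v)" by (rule dist_triangle)
        show "(case p of (u, v) \<Rightarrow> dist (f u) (f v)) \<le>
          (if p \<in> L then dist (f (fst (l p))) (f (snd (l p))) else 0) +
                     (if p \<in> R then dist (f (fst (r p))) (f (snd (r p))) else 0)"
        proof (cases "u < v")
          case True
          with p \<open>dist (f u) (f v) \<le> _\<close> show ?thesis
            by (cases "u < c"; cases "c < v") (auto simp: uv l_def r_def L_def R_def min_def max_def)
        qed (use \<open>u \<le> v\<close> in \<open>simp add: uv\<close>)
      qed
      also have "\<dots> = (\<Sum>p\<in>L. dist (f (fst (l p))) (f (snd (l p)))) + (\<Sum>p\<in>R. dist (f (fst (r p))) (f (snd (r p))))"
      proof -
        have "D \<inter> L = L" "D \<inter> R = R" by (auto simp: L_def R_def)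
        then show ?thesis using D(1) by (simp add: sum.distrib flip: sum.inter_restrict)
      qed
      also have "\<dots> < e"
        using l r unfolding sumL sumR by (simp add: case_prod_unfold)
      finally show "(\<Sum>(u, v)\<in>D. dist (f u) (f v)) < e" .
    qed
  qed
qed

text \<open>The fundamental theorem of calculus for absolutely continuous functions. In a Riemann sum
  that is fine enough, the intervals whose tag is a bad point lie in an open set of small measure;
  absolute continuity controls their share of the increment of \<open>f\<close>.\<close>

theorem abs_continuous_has_integral:
  fixes f :: "real \<Rightarrow> 'a::euclidean_space"
  assumes "a \<le> b" and ac: "abs_continuous_on_interval a b f" and S: "negligible S"
    and deriv: "\<And>s. s \<in> {a..b} - S \<Longrightarrow> (f has_vector_derivative f' s) (at s within {a..b})"
  shows "(f' has_integral (f b - f a)) {a..b}"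
proof -
  define g where "g = (\<lambda>s. if s \<in> S then 0 else f' s)"
  have "(g has_integral (f b - f a)) {a..b}"
    unfolding has_integral_real
  proof (intro allI impI)
    fix e :: real assume "e > 0"
    then have "e / 2 > 0" by simp
    obtain \<delta> where "\<delta> > 0" and \<delta>: "\<And>D. finite D \<Longrightarrow> (\<And>u v. (u, v) \<in> D \<Longrightarrow> a \<le> u \<and> u \<le> v \<and> v \<le> b) \<Longrightarrow>
        disjoint_family_on (\<lambda>(u, v). {u<..<v}) D \<Longrightarrow> (\<Sum>(u, v)\<in>D. v - u) < \<delta> \<Longrightarrow>
        (\<Sum>(u, v)\<in>D. dist (f u) (f v)) < e / 2"
      using abs_continuousD[OF ac \<open>e / 2 > 0\<close>] by blast
    obtain U where U: "open U" "S \<subseteq> U" "(U - S) \<in> lmeasurable" "emeasure lebesgue (U - S) < ennreal \<delta>"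
      using sets_lebesgue_outer_open[OF negligible_imp_sets[OF S] \<open>\<delta> > 0\<close>] by metis
    have Um: "U \<in> lmeasurable"
    proof -
      have "U = (U - S) \<union> S" using U by auto
      then show ?thesis using U(3) negligible_imp_measurable[OF S] by (metis fmeasurable.Un)
    qed
    have "measure lebesgue U = measure lebesgue (U - S)"
      using S Um by (simp add: measure_Diff_null_set negligible_iff_null_sets fmeasurableD)
    also have "\<dots> < \<delta>" using U(3,4) \<open>\<delta> > 0\<close>
      by (metis emeasure_eq_measure2 ennreal_less_iff measure_nonneg)
    finally have mU: "measure lebesgue U < \<delta>" .
    define \<epsilon> where "\<epsilon> = e / (2 * (b - a + 1))"
    have "\<epsilon> > 0" using \<open>e > 0\<close> \<open>a \<le> b\<close> by (simp add: \<epsilon>_def)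
    have "\<exists>d>0. (x \<in> S \<longrightarrow> ball x d \<subseteq> U) \<and> (x \<in> {a..b} - S \<longrightarrow>
         (\<forall>y\<in>{a..b}. norm (y-x) < d \<longrightarrow> norm (f y - f x - (y-x) *\<^sub>R f' x) \<le> \<epsilon> * norm (y-x)))" for x
    proof (cases "x \<in> S")
      case True
      then show ?thesis using U openE by blast
    next
      case False
      show ?thesis
      proof (cases "x \<in> {a..b}")
        case True
        with False deriv show ?thesis using \<open>\<epsilon> > 0\<close>
          unfolding has_vector_derivative_def has_derivative_within_alt by blast
      next
        case out: False
        then show ?thesis using False zero_less_one by blast
      qed
    qed
    then obtain d where d0: "\<And>x. d x > 0" and dS: "\<And>x. x \<in> S \<Longrightarrow> ball x (d x) \<subseteq> U"
      and dd: "\<And>x y. x \<in> {a..b} - S \<Longrightarrow> y \<in> {a..b} \<Longrightarrow> norm (y-x) < d x \<Longrightarrow>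
         norm (f y - f x - (y-x) *\<^sub>R f' x) \<le> \<epsilon> * norm (y-x)"
      by metis
    show "\<exists>\<gamma>. gauge \<gamma> \<and> (\<forall>\<D>. \<D> tagged_division_of {a..b} \<and> \<gamma> fine \<D> \<longrightarrow>
              norm ((\<Sum>(x, k)\<in>\<D>. content k *\<^sub>R g x) - (f b - f a)) < e)"
    proof (rule exI[of _ "\<lambda>x. ball x (d x)"], safe)
      show "gauge (\<lambda>x. ball x (d x))" using d0 gauge_ball_dependent by blast
      fix p assume ptag: "p tagged_division_of {a..b}" and fine: "(\<lambda>x. ball x (d x)) fine p"
      note pD = tagged_division_ofD[OF ptag]
      have fp: "finite p" using pD by blast
      have ba: "b - a = (\<Sum>(x,K)\<in>p. Sup K - Inf K)" "f b - f a = (\<Sum>(x,K)\<in>p. f(Sup K) - f(Inf K))"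
        using additive_tagged_division_1[where f= "\<lambda>x. x"] additive_tagged_division_1[where f= f]
            \<open>a \<le> b\<close> ptag by auto
      have K: "\<exists>u v. K = {u..v} \<and> u \<le> v \<and> a \<le> u \<and> v \<le> b \<and> x \<in> K \<and> Sup K = v \<and> Inf K = u \<and> {u..v} \<subseteq> ball x (d x)"
        if xK: "(x, K) \<in> p" for x K
      proof -
        obtain u v where "K = cbox u v" using pD(4)[OF xK] by blast
        then have kk: "K = {u..v}" by simp
        have "x \<in> K" "K \<subseteq> {a..b}" using pD xK by auto
        then have "u \<le> v" "a \<le> u" "v \<le> b" using kk by auto
        moreover have "K \<subseteq> ball x (d x)" using fine xK by (auto simp: fine_def)
        ultimately show ?thesis using kk \<open>x \<in> K\<close> by auto
      qed
      define P where "P = {(x, K) \<in> p. x \<in> S \<and> Inf K < Sup K}"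
      have "P \<subseteq> p" by (auto simp: P_def)
      then have fP: "finite P" using fp finite_subset by blast
      have partial: "P tagged_partial_division_of {a..b}"
        using tagged_partial_division_subset[OF _ \<open>P \<subseteq> p\<close>] ptag
        by (simp add: tagged_division_of_def)
      define h where "h = (\<lambda>(x::real, K::real set). (Inf K, Sup K))"
      have disj: "{Inf K<..<Sup K} \<inter> {Inf K'<..<Sup K'} = {}"
        if xK: "(x, K) \<in> p" "(x', K') \<in> p" "(x, K) \<noteq> (x', K')" for x K x' K'
      proof -
        have "interior K \<inter> interior K' = {}" using pD(5)[OF xK] .
        moreover obtain u v where "K = {u..v}" "Sup K = v" "Inf K = u"
          using K[OF xK(1)] by auto
        moreover obtain u' v' where "K' = {u'..v'}" "Sup K' = v'" "Inf K' = u'"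
          using K[OF xK(2)] by auto
        ultimately show ?thesis by (metis interior_atLeastAtMost_real)
      qed
      have inj: "inj_on h P"
      proof (rule inj_onI)
        fix y z assume yz: "y \<in> P" "z \<in> P" "h y = h z"
        obtain x K x' K' where xK: "y = (x, K)" "z = (x', K')" by fastforce
        have "(Inf K + Sup K) / 2 \<in> {Inf K<..<Sup K} \<inter> {Inf K'<..<Sup K'}"
          using yz by (auto simp: P_def h_def xK)
        then show "y = z" using disj[of x K x' K'] yz unfolding xK P_def by blast
      qed
      have sumh: "(\<Sum>q\<in>h ` P. F q) = (\<Sum>q\<in>P. F (h q))" for F :: "real \<times> real \<Rightarrow> real"
        using inj by (simp add: sum.reindex)
      have "(\<Sum>(u, v)\<in>h ` P. dist (f u) (f v)) < e / 2"
      proof (rule \<delta>)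
        show "finite (h ` P)" using fP by simp
        show "a \<le> u \<and> u \<le> v \<and> v \<le> b" if uv: "(u, v) \<in> h ` P" for u v
        proof -
          obtain x K where "(x, K) \<in> P" "u = Inf K" "v = Sup K" using uv by (auto simp: h_def)
          with K[of x K] show ?thesis by (auto simp: P_def)
        qed
        show "disjoint_family_on (\<lambda>(u, v). {u<..<v}) (h ` P)"
          unfolding disjoint_family_on_def
        proof (intro ballI impI)
          fix y z assume "y \<in> h ` P" "z \<in> h ` P" "y \<noteq> z"
          then obtain x K x' K' where xK: "(x, K) \<in> P" "y = h (x, K)" "(x', K') \<in> P" "z = h (x', K')"
            "(x, K) \<noteq> (x', K')" by auto
          then show "(case y of (u, v) \<Rightarrow> {u<..<v}) \<inter> (case z of (u, v) \<Rightarrow> {u<..<v}) = {}"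
            using disj[of x K x' K'] \<open>P \<subseteq> p\<close> by (auto simp: h_def)
        qed
        have "(\<Sum>(u, v)\<in>h ` P. v - u) = (\<Sum>(x, K)\<in>P. content K)"
          unfolding sumh
        proof (rule sum.cong[OF refl])
          fix y assume "y \<in> P"
          obtain x K' where y: "y = (x, K')" by fastforce
          have "(x, K') \<in> p" using \<open>y \<in> P\<close> \<open>P \<subseteq> p\<close> y by auto
          from K[OF this] obtain u v where "K' = {u..v}" "u \<le> v" "Sup K' = v" "Inf K' = u" by blast
          then show "(case h y of (u, v) \<Rightarrow> v - u) = (case y of (x, K) \<Rightarrow> content K)"
            by (simp add: y h_def)
        qed
        also have "\<dots> = (\<Sum>K\<in>snd ` P. content K)"
        proof -
          have "inj_on snd P"
          proof (rule inj_onI)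
            fix y z assume "y \<in> P" "z \<in> P" "snd y = snd z"
            then show "y = z" using inj by (auto simp: inj_on_def h_def case_prod_unfold)
          qed
          then show ?thesis by (simp add: sum.reindex case_prod_unfold)
        qed
        also have "\<dots> = measure lebesgue (\<Union>(snd ` P))"
        proof -
          have "snd ` P division_of \<Union>(snd ` P)" by (rule partial_division_of_tagged_division[OF partial])
          note dv = this
          have "(\<Sum>K\<in>snd ` P. content K) = (\<Sum>K\<in>snd ` P. measure lebesgue K)"
          proof (rule sum.cong[OF refl])
            fix K assume "K \<in> snd ` P"
            then obtain u v where "K = cbox u v" using division_ofD(4)[OF dv] by blast
            then show "content K = measure lebesgue K" by simp
          qed
          then show ?thesis using content_division[OF dv] by simp
        qed
        also have "\<dots> \<le> measure lebesgue U"
        proof (rule measure_mono_fmeasurable)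
          show "\<Union>(snd ` P) \<subseteq> U"
          proof
            fix y assume "y \<in> \<Union>(snd ` P)"
            then obtain x K' where "(x, K') \<in> P" "y \<in> K'" by auto
            then show "y \<in> U" using K[of x K'] dS[of x] by (auto simp: P_def)
          qed
          show "\<Union>(snd ` P) \<in> sets lebesgue"
            using lmeasurable_division[OF partial_division_of_tagged_division[OF partial]] by (simp add: fmeasurableD)
        qed (fact Um)
        finally show "(\<Sum>(u, v)\<in>h ` P. v - u) < \<delta>" using mU by simp
      qed
      then have bad: "(\<Sum>(x, K)\<in>P. dist (f (Inf K)) (f (Sup K))) < e / 2"
        unfolding sumh by (simp add: h_def case_prod_unfold)
      have "norm (\<Sum>(x, K)\<in>p. content K *\<^sub>R g x - (f (Sup K) - f (Inf K))) \<le>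
         (\<Sum>y\<in>p. (if y \<in> P then dist (f (Inf (snd y))) (f (Sup (snd y))) else 0) + \<epsilon> * (Sup (snd y) - Inf (snd y)))"
      proof (rule sum_norm_le)
        fix y assume yp: "y \<in> p"
        obtain x K' where y: "y = (x, K')" by fastforce
        have "(x, K') \<in> p" using yp y by simp
        from K[OF this] obtain u v where uv: "K' = {u..v}" "u \<le> v" "a \<le> u" "v \<le> b" "x \<in> K'" "Sup K' = v" "Inf K' = u" "{u..v} \<subseteq> ball x (d x)"
          by blast
        have c: "content K' = v - u" using uv by simp
        have "norm (content K' *\<^sub>R g x - (f v - f u)) \<le>
          (if y \<in> P then dist (f u) (f v) else 0) + \<epsilon> * (v - u)"
        proof (cases "x \<in> S")
          case True
          then show ?thesis
          proof (cases "u < v")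
            case True
            then have "y \<in> P" using \<open>x \<in> S\<close> yp uv y by (auto simp: P_def)
            then show ?thesis using \<open>x \<in> S\<close> \<open>\<epsilon> > 0\<close> \<open>u \<le> v\<close> by (simp add: g_def dist_norm norm_minus_commute)
          next
            case False
            then show ?thesis using uv(2) by (simp add: c)
          qed
        next
          case False
          then have "x \<in> {a..b} - S" using uv by auto
          have "norm ((v - u) *\<^sub>R f' x - (f v - f u)) = norm (f u - f x - (u - x) *\<^sub>R f' x - (f v - f x - (v - x) *\<^sub>R f' x))"
            by (auto simp: algebra_simps)
          also have "\<dots> \<le> norm (f u - f x - (u - x) *\<^sub>R f' x) + norm (f v - f x - (v - x) *\<^sub>R f' x)"
            by (rule norm_triangle_ineq4)
          also have "\<dots> \<le> \<epsilon> * norm (u - x) + \<epsilon> * norm (v - x)"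
          proof (intro add_mono dd \<open>x \<in> {a..b} - S\<close>)
            have "u \<in> {u..v}" "v \<in> {u..v}" using uv(2) by auto
            then have "u \<in> ball x (d x)" "v \<in> ball x (d x)" using uv(8) by blast+
            then show "norm (u - x) < d x" "norm (v - x) < d x"
              by (simp_all add: dist_norm norm_minus_commute)
          qed (use uv in auto)
          also have "\<dots> = \<epsilon> * (v - u)" using uv by (auto simp: field_simps)
          finally show ?thesis using False by (simp add: c g_def P_def y)
        qed
        then show "norm (case y of (x, K) \<Rightarrow> content K *\<^sub>R g x - (f (Sup K) - f (Inf K))) \<le>
          (if y \<in> P then dist (f (Inf (snd y))) (f (Sup (snd y))) else 0) + \<epsilon> * (Sup (snd y) - Inf (snd y))"
          by (simp only: y uv(6,7) split_conv snd_conv)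
      qed
      also have "\<dots> = (\<Sum>(x, K)\<in>P. dist (f (Inf K)) (f (Sup K))) + \<epsilon> * (b - a)"
      proof -
        have "p \<inter> P = P" using \<open>P \<subseteq> p\<close> by auto
        then show ?thesis unfolding ba(1)
          using fp by (simp add: sum.distrib sum_distrib_left case_prod_unfold flip: sum.inter_restrict)
      qed
      also have "\<dots> < e / 2 + e / 2"
      proof (rule add_less_le_mono[OF bad])
        have "\<epsilon> * (b - a) \<le> \<epsilon> * (b - a + 1)" using \<open>\<epsilon> > 0\<close> by simp
        also have "\<dots> = e / 2" using \<open>a \<le> b\<close> by (simp add: \<epsilon>_def field_simps)
        finally show "\<epsilon> * (b - a) \<le> e / 2" .
      qed
      finally show "norm ((\<Sum>(x, k)\<in>p. content k *\<^sub>R g x) - (f b - f a)) < e"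
        by (simp add: ba(2) case_prod_unfold sum_subtractf)
    qed
  qed
  then show ?thesis
    by (rule has_integral_spike[OF S, rotated]) (auto simp: g_def)
qed

text \<open>A derivative is absolutely integrable if the function has bounded variation. Over an interval shorter than
  the \<open>\<delta>\<close> that belongs to \<open>\<epsilon> = 1\<close> the variation of \<open>f\<close> is at most
  \<open>1\<close>; the whole interval is a finite union of such pieces.\<close>

lemma abs_continuous_absolutely_integrable:
  fixes f :: "real \<Rightarrow> 'a::euclidean_space"
  assumes "a \<le> b" and ac: "abs_continuous_on_interval a b f" and S: "negligible S"
    and deriv: "\<And>s. s \<in> {a..b} - S \<Longrightarrow> (f has_vector_derivative f' s) (at s within {a..b})"
  shows "f' absolutely_integrable_on {a..b}"
proof -
  obtain \<delta> where "\<delta> > 0" and \<delta>: "\<And>D. finite D \<Longrightarrow> (\<And>u v. (u, v) \<in> D \<Longrightarrow> a \<le> u \<and> u \<le> v \<and> v \<le> b) \<Longrightarrow>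
        disjoint_family_on (\<lambda>(u, v). {u<..<v}) D \<Longrightarrow> (\<Sum>(u, v)\<in>D. v - u) < \<delta> \<Longrightarrow>
        (\<Sum>(u, v)\<in>D. dist (f u) (f v)) < 1"
    using abs_continuousD[OF ac zero_less_one] by blast
  have ftc: "(f' has_integral (f v - f u)) {u..v}" if "a \<le> u" "u \<le> v" "v \<le> b" for u v
  proof (rule abs_continuous_has_integral[OF \<open>u \<le> v\<close> abs_continuous_subinterval[OF ac] S])
    fix s assume "s \<in> {u..v} - S"
    then show "(f has_vector_derivative f' s) (at s within {u..v})"
      using that by (intro has_vector_derivative_within_subset[OF deriv]) auto
  qed (use that in auto)
  have small: "f' absolutely_integrable_on {u..v}" if uv: "a \<le> u" "u \<le> v" "v \<le> b" "v - u < \<delta>" for u v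
  proof -
    have "f' absolutely_integrable_on cbox u v"
    proof (rule bounded_variation_absolutely_integrable_interval[where B = 1])
      show "f' integrable_on cbox u v" using ftc uv by auto
      fix d assume d: "d division_of cbox u v"
      note dD = division_ofD[OF d]
      have K: "K = {Inf K..Sup K} \<and> u \<le> Inf K \<and> Inf K \<le> Sup K \<and> Sup K \<le> v" if Kd: "K \<in> d" for K
      proof -
        obtain x y where "K = cbox x y" using dD(4)[OF Kd] by blast
        moreover have "K \<noteq> {}" "K \<subseteq> {u..v}" using dD(2,3)[OF Kd] by auto
        ultimately have "K = {x..y}" "x \<le> y" "u \<le> x" "y \<le> v" by auto
        then show ?thesis by simp
      qed
      define P where "P = {K\<in>d. Inf K < Sup K}"
      have fP: "finite P" using dD(1) by (simp add: P_def)
      define h where "h = (\<lambda>K::real set. (Inf K, Sup K))"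
      have inj: "inj_on h P"
      proof (rule inj_onI)
        fix K1 K2 assume "K1 \<in> P" "K2 \<in> P" and eq: "h K1 = h K2"
        then have "K1 \<in> d" "K2 \<in> d" by (auto simp: P_def)
        have "K1 = {Inf K1..Sup K1}" using K[OF \<open>K1 \<in> d\<close>] by (rule conjunct1)
        also have "\<dots> = {Inf K2..Sup K2}" using eq by (simp add: h_def)
        also have "\<dots> = K2" using K[OF \<open>K2 \<in> d\<close>, THEN conjunct1, symmetric] .
        finally show "K1 = K2" .
      qed
      have sumh: "(\<Sum>q\<in>h ` P. F q) = (\<Sum>q\<in>P. F (h q))" for F :: "real \<times> real \<Rightarrow> real"
        using inj by (simp add: sum.reindex)
      have int: "integral K f' = f (Sup K) - f (Inf K)" if Kd: "K \<in> d" for K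
      proof -
        have "(f' has_integral (f (Sup K) - f (Inf K))) {Inf K..Sup K}"
          by (rule ftc) (use K[OF Kd, THEN conjunct2] uv in auto)
        then have "(f' has_integral (f (Sup K) - f (Inf K))) K"
          using K[OF Kd, THEN conjunct1] by (rule back_subst[of "\<lambda>A. (f' has_integral (f (Sup K) - f (Inf K))) A", OF _ sym])
        then show ?thesis by (rule integral_unique)
      qed
      have "(\<Sum>K\<in>d. norm (integral K f')) = (\<Sum>K\<in>P. norm (integral K f'))"
      proof (rule sum.mono_neutral_right[OF dD(1)])
        show "\<forall>K\<in>d - P. norm (integral K f') = 0"
        proof
          fix K assume "K \<in> d - P"
          then have "K \<in> d" "\<not> Inf K < Sup K" by (auto simp: P_def)
          then have "Inf K = Sup K" using K[of K, THEN conjunct2] by linarith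
          then show "norm (integral K f') = 0" using int[OF \<open>K \<in> d\<close>] by simp
        qed
      qed (auto simp: P_def)
      also have "\<dots> = (\<Sum>K\<in>P. dist (f (Inf K)) (f (Sup K)))"
        by (rule sum.cong[OF refl]) (simp add: int P_def dist_norm norm_minus_commute)
      also have "\<dots> = (\<Sum>(x, y)\<in>h ` P. dist (f x) (f y))"
        unfolding sumh by (simp add: h_def)
      also have "\<dots> < 1"
      proof (rule \<delta>)
        show "finite (h ` P)" using fP by simp
        show "a \<le> x \<and> x \<le> y \<and> y \<le> b" if xy: "(x, y) \<in> h ` P" for x y
        proof -
          from xy obtain K' where "K' \<in> d" "x = Inf K'" "y = Sup K'" by (auto simp: h_def P_def)
          then show ?thesis using K[of K', THEN conjunct2] uv by auto
        qed
        show "disjoint_family_on (\<lambda>(u, v). {u<..<v}) (h ` P)"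
          unfolding disjoint_family_on_def
        proof (intro ballI impI)
          fix y z assume "y \<in> h ` P" "z \<in> h ` P" "y \<noteq> z"
          then obtain K1 K2 where K12: "K1 \<in> d" "y = h K1" "K2 \<in> d" "z = h K2" "K1 \<noteq> K2" by (auto simp: P_def)
          have "interior K1 \<inter> interior K2 = {}" using dD(5) K12 by blast
          moreover have "interior K' = {Inf K'<..<Sup K'}" if "K' \<in> d" for K'
            using arg_cong[OF K[OF that, THEN conjunct1], of interior] by (rule trans) simp
          ultimately show "(case y of (u, v) \<Rightarrow> {u<..<v}) \<inter> (case z of (u, v) \<Rightarrow> {u<..<v}) = {}"
            using K12(1,3) unfolding K12(2,4) h_def split_conv by blast
        qed
        have "(\<Sum>(x, y)\<in>h ` P. y - x) = (\<Sum>K\<in>P. content K)"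
          unfolding sumh
        proof (rule sum.cong[OF refl])
          fix K' assume "K' \<in> P"
          then have "K' \<in> d" by (simp add: P_def)
          have "content K' = content {Inf K'..Sup K'}"
            by (rule arg_cong[OF K[OF \<open>K' \<in> d\<close>, THEN conjunct1]])
          then show "(case h K' of (x, y) \<Rightarrow> y - x) = content K'"
            using K[OF \<open>K' \<in> d\<close>, THEN conjunct2] by (simp add: h_def)
        qed
        also have "\<dots> \<le> (\<Sum>K\<in>d. content K)"
          using dD(1) by (intro sum_mono2) (auto simp: P_def)
        also have "\<dots> = v - u" using additive_content_division[OF d] uv by simp
        finally show "(\<Sum>(x, y)\<in>h ` P. y - x) < \<delta>" using uv by simp
      qed
      finally show "(\<Sum>K\<in>d. norm (integral K f')) \<le> 1" by simp
    qed
    then show ?thesis by simp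
  qed
  have "f' absolutely_integrable_on {a..min b (a + of_nat n * (\<delta> / 2))}" for n :: nat
  proof (induction n)
    case 0
    have "{a..min b (a + of_nat 0 * (\<delta> / 2))} = {a..a}" using \<open>a \<le> b\<close> by simp
    then show ?case using small[of a a] \<open>a \<le> b\<close> \<open>\<delta> > 0\<close> by simp
  next
    case (Suc n)
    show ?case
    proof (rule absolutely_integrable_on_combine[OF Suc])
      show "f' absolutely_integrable_on {min b (a + of_nat n * (\<delta> / 2))..min b (a + of_nat (Suc n) * (\<delta> / 2))}"
        using \<open>\<delta> > 0\<close> \<open>a \<le> b\<close> by (intro small) (auto simp: min_def field_simps)
    qed (use \<open>\<delta> > 0\<close> \<open>a \<le> b\<close> in \<open>auto simp: min_def field_simps\<close>)
  qed
  moreover obtain n where "real n > (b - a) / (\<delta> / 2)" using reals_Archimedean2 by blast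
  then have "min b (a + of_nat n * (\<delta> / 2)) = b" using \<open>\<delta> > 0\<close> by (simp add: field_simps)
  ultimately show ?thesis by metis
qed

lemma abs_continuous_binop:
  assumes f: "abs_continuous_on_interval a b f" and g: "abs_continuous_on_interval a b g"
    and lip: "\<And>u v. a \<le> u \<Longrightarrow> u \<le> b \<Longrightarrow> a \<le> v \<Longrightarrow> v \<le> b \<Longrightarrow>
      dist (h u) (h v) \<le> C * (dist (f u) (f v) + dist (g u) (g v))"
  shows "abs_continuous_on_interval a b h"
proof -
  have "abs_continuous_on_interval a b (\<lambda>s. (f s, g s))"
  proof (rule abs_continuousI)
    fix e :: real assume "e > 0"
    then have "e / 2 > 0" by simp
    obtain d1 where "d1 > 0" and d1: "\<And>D. finite D \<Longrightarrow> (\<And>u v. (u, v) \<in> D \<Longrightarrow> a \<le> u \<and> u \<le> v \<and> v \<le> b) \<Longrightarrow>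
        disjoint_family_on (\<lambda>(u, v). {u<..<v}) D \<Longrightarrow> (\<Sum>(u, v)\<in>D. v - u) < d1 \<Longrightarrow>
        (\<Sum>(u, v)\<in>D. dist (f u) (f v)) < e / 2"
      using abs_continuousD[OF f \<open>e / 2 > 0\<close>] by blast
    obtain d2 where "d2 > 0" and d2: "\<And>D. finite D \<Longrightarrow> (\<And>u v. (u, v) \<in> D \<Longrightarrow> a \<le> u \<and> u \<le> v \<and> v \<le> b) \<Longrightarrow>
        disjoint_family_on (\<lambda>(u, v). {u<..<v}) D \<Longrightarrow> (\<Sum>(u, v)\<in>D. v - u) < d2 \<Longrightarrow>
        (\<Sum>(u, v)\<in>D. dist (g u) (g v)) < e / 2"
      using abs_continuousD[OF g \<open>e / 2 > 0\<close>] by blast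
    show "\<exists>d>0. \<forall>D. finite D \<longrightarrow> (\<forall>u v. (u, v) \<in> D \<longrightarrow> a \<le> u \<and> u \<le> v \<and> v \<le> b) \<longrightarrow>
        disjoint_family_on (\<lambda>(u, v). {u<..<v}) D \<longrightarrow> (\<Sum>(u, v)\<in>D. v - u) < d \<longrightarrow>
        (\<Sum>(u, v)\<in>D. dist (f u, g u) (f v, g v)) < e"
    proof (intro exI[of _ "min d1 d2"] conjI allI impI)
      fix D :: "(real \<times> real) set"
      assume D: "finite D" "\<forall>u v. (u, v) \<in> D \<longrightarrow> a \<le> u \<and> u \<le> v \<and> v \<le> b"
        "disjoint_family_on (\<lambda>(u, v). {u<..<v}) D" "(\<Sum>(u, v)\<in>D. v - u) < min d1 d2"
      have "(\<Sum>(u, v)\<in>D. dist (f u, g u) (f v, g v)) \<le>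
          (\<Sum>(u, v)\<in>D. dist (f u) (f v)) + (\<Sum>(u, v)\<in>D. dist (g u) (g v))"
        unfolding sum.distrib[symmetric]
        by (rule sum_mono) (auto simp: dist_Pair_Pair intro: sqrt_sum_squares_le_sum)
      also have "\<dots> < e / 2 + e / 2"
        using D by (intro add_strict_mono d1 d2) auto
      finally show "(\<Sum>(u, v)\<in>D. dist (f u, g u) (f v, g v)) < e" by simp
    qed (use \<open>d1 > 0\<close> \<open>d2 > 0\<close> in simp)
  qed
  then show ?thesis
  proof (rule abs_continuous_lipschitz_compose)
    fix u v assume uv: "a \<le> u" "u \<le> b" "a \<le> v" "v \<le> b"
    have "dist (f u) (f v) + dist (g u) (g v) \<le> 2 * dist (f u, g u) (f v, g v)"
      using dist_fst_le[of "(f u, g u)" "(f v, g v)"] dist_snd_le[of "(f u, g u)" "(f v, g v)"] by simp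
    then have "\<bar>C\<bar> * (dist (f u) (f v) + dist (g u) (g v)) \<le> \<bar>C\<bar> * (2 * dist (f u, g u) (f v, g v))"
      by (rule mult_left_mono) simp
    moreover have "C * (dist (f u) (f v) + dist (g u) (g v)) \<le> \<bar>C\<bar> * (dist (f u) (f v) + dist (g u) (g v))"
      by (rule mult_right_mono) auto
    ultimately show "dist (h u) (h v) \<le> (2 * \<bar>C\<bar>) * dist (f u, g u) (f v, g v)"
      using lip[OF uv] by linarith
  qed
qed

lemma abs_continuous_add:
  fixes f g :: "real \<Rightarrow> real"
  assumes "abs_continuous_on_interval a b f" "abs_continuous_on_interval a b g"
  shows "abs_continuous_on_interval a b (\<lambda>s. f s + g s)"
  by (rule abs_continuous_binop[OF assms, where C = 1]) (simp add: dist_real_def)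

lemma abs_continuous_mult:
  fixes f g :: "real \<Rightarrow> real"
  assumes f: "abs_continuous_on_interval a b f" and g: "abs_continuous_on_interval a b g"
  shows "abs_continuous_on_interval a b (\<lambda>s. f s * g s)"
proof -
  have "bounded (f ` {a..b})" "bounded (g ` {a..b})"
    using compact_continuous_image[OF abs_continuous_imp_continuous compact_Icc] f g
    by (auto intro: compact_imp_bounded)
  then obtain B1 B2 where "\<forall>x\<in>f ` {a..b}. norm x \<le> B1" "\<forall>x\<in>g ` {a..b}. norm x \<le> B2"
    unfolding bounded_iff by blast
  then have B: "\<And>s. s \<in> {a..b} \<Longrightarrow> \<bar>f s\<bar> \<le> B1" "\<And>s. s \<in> {a..b} \<Longrightarrow> \<bar>g s\<bar> \<le> B2"
    by auto
  show ?thesis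
  proof (rule abs_continuous_binop[OF f g])
    fix u v assume uv: "a \<le> u" "u \<le> b" "a \<le> v" "v \<le> b"
    have "dist (f u * g u) (f v * g v) = \<bar>f u * (g u - g v) + (f u - f v) * g v\<bar>"
      by (simp add: dist_real_def algebra_simps)
    also have "\<dots> \<le> \<bar>f u\<bar> * \<bar>g u - g v\<bar> + \<bar>f u - f v\<bar> * \<bar>g v\<bar>"
      by (metis abs_mult abs_triangle_ineq)
    also have "\<dots> \<le> (\<bar>B1\<bar> + \<bar>B2\<bar>) * \<bar>g u - g v\<bar> + \<bar>f u - f v\<bar> * (\<bar>B1\<bar> + \<bar>B2\<bar>)"
      using B(1)[of u] B(2)[of v] uv by (intro add_mono mult_right_mono mult_left_mono) auto
    finally show "dist (f u * g u) (f v * g v) \<le> (\<bar>B1\<bar> + \<bar>B2\<bar>) * (dist (f u) (f v) + dist (g u) (g v))"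
      by (simp add: dist_real_def algebra_simps)
  qed
qed

lemma abs_continuous_reflect:
  assumes "abs_continuous_on_interval (c - b) (c - a) f"
  shows "abs_continuous_on_interval a b (\<lambda>s. f (c - s))"
proof (rule abs_continuousI)
  fix e :: real assume "e > 0"
  obtain d where "d > 0" and d: "\<And>D. finite D \<Longrightarrow> (\<And>u v. (u, v) \<in> D \<Longrightarrow> c - b \<le> u \<and> u \<le> v \<and> v \<le> c - a) \<Longrightarrow>
        disjoint_family_on (\<lambda>(u, v). {u<..<v}) D \<Longrightarrow> (\<Sum>(u, v)\<in>D. v - u) < d \<Longrightarrow>
        (\<Sum>(u, v)\<in>D. dist (f u) (f v)) < e"
    using abs_continuousD[OF assms(1) \<open>e > 0\<close>] by blast
  show "\<exists>d>0. \<forall>D. finite D \<longrightarrow> (\<forall>u v. (u, v) \<in> D \<longrightarrow> a \<le> u \<and> u \<le> v \<and> v \<le> b) \<longrightarrow>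
        disjoint_family_on (\<lambda>(u, v). {u<..<v}) D \<longrightarrow> (\<Sum>(u, v)\<in>D. v - u) < d \<longrightarrow>
        (\<Sum>(u, v)\<in>D. dist (f (c - u)) (f (c - v))) < e"
  proof (intro exI[of _ d] conjI allI impI \<open>d > 0\<close>)
    fix D assume D: "finite D" "\<forall>u v. (u, v) \<in> D \<longrightarrow> a \<le> u \<and> u \<le> v \<and> v \<le> b"
        "disjoint_family_on (\<lambda>(u, v). {u<..<v}) D" "(\<Sum>(u, v)\<in>D. v - u) < d"
    define h where "h = (\<lambda>(u, v). (c - v, c - u))"
    have inj: "inj_on h D" by (auto simp: inj_on_def h_def)
    have sumh: "(\<Sum>p\<in>h ` D. F p) = (\<Sum>p\<in>D. F (h p))" for F :: "real \<times> real \<Rightarrow> real"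
      using inj by (simp add: sum.reindex)
    have "(\<Sum>(u, v)\<in>h ` D. dist (f u) (f v)) < e"
    proof (rule d)
      show "finite (h ` D)" using D by simp
      show "c - b \<le> u \<and> u \<le> v \<and> v \<le> c - a" if "(u, v) \<in> h ` D" for u v
        using that D(2) by (auto simp: h_def)
      show "disjoint_family_on (\<lambda>(u, v). {u<..<v}) (h ` D)"
        unfolding disjoint_family_on_def
      proof (intro ballI impI)
        fix p q assume "p \<in> h ` D" "q \<in> h ` D" "p \<noteq> q"
        then obtain u v u' v' where uv: "(u, v) \<in> D" "p = h (u, v)" "(u', v') \<in> D" "q = h (u', v')"
          "(u, v) \<noteq> (u', v')" by auto
        have dj: "{u<..<v} \<inter> {u'<..<v'} = {}"
          using D(3) uv unfolding disjoint_family_on_def by fastforce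
        have "c - x \<in> {u<..<v} \<inter> {u'<..<v'}" if "x \<in> {c - v<..<c - u} \<inter> {c - v'<..<c - u'}" for x
          using that by auto
        with dj have "{c - v<..<c - u} \<inter> {c - v'<..<c - u'} = {}" by blast
        then show "(case p of (u, v) \<Rightarrow> {u<..<v}) \<inter> (case q of (u, v) \<Rightarrow> {u<..<v}) = {}"
          by (simp add: uv h_def)
      qed
      show "(\<Sum>(u, v)\<in>h ` D. v - u) < d"
        unfolding sumh using D(4) by (simp add: h_def case_prod_unfold)
    qed
    then show "(\<Sum>(u, v)\<in>D. dist (f (c - u)) (f (c - v))) < e"
      unfolding sumh by (simp add: h_def case_prod_unfold dist_commute)
  qed
qed

lemma abs_continuous_lipschitz:
  assumes "\<And>u v. a \<le> u \<Longrightarrow> u \<le> b \<Longrightarrow> a \<le> v \<Longrightarrow> v \<le> b \<Longrightarrow> dist (g u) (g v) \<le> C * \<bar>u - v\<bar>"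
  shows "abs_continuous_on_interval a b g"
proof (rule abs_continuous_lipschitz_compose[where f = "\<lambda>s. s" and C = C])
  show "abs_continuous_on_interval a b (\<lambda>s::real. s)"
  proof (rule abs_continuousI)
    fix e :: real assume "e > 0"
    have "(\<Sum>(u, v)\<in>D. dist u v) = (\<Sum>(u, v)\<in>D. v - u)"
      if "\<forall>u v. (u, v) \<in> D \<longrightarrow> a \<le> u \<and> u \<le> v \<and> v \<le> b" for D :: "(real \<times> real) set"
      using that by (intro sum.cong) (auto simp: dist_real_def)
    then show "\<exists>d>0. \<forall>D. finite D \<longrightarrow> (\<forall>u v. (u, v) \<in> D \<longrightarrow> a \<le> u \<and> u \<le> v \<and> v \<le> b) \<longrightarrow>
        disjoint_family_on (\<lambda>(u, v). {u<..<v}) D \<longrightarrow> (\<Sum>(u, v)\<in>D. v - u) < d \<longrightarrow>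
        (\<Sum>(u, v)\<in>D. dist u v) < e"
      using \<open>e > 0\<close> by auto
  qed
qed (use assms in \<open>simp add: dist_real_def\<close>)

lemma abs_continuous_cong:
  assumes "\<And>s. a \<le> s \<Longrightarrow> s \<le> b \<Longrightarrow> f s = g s" "abs_continuous_on_interval a b f"
  shows "abs_continuous_on_interval a b g"
  by (rule abs_continuous_lipschitz_compose[OF assms(2), where C = 1]) (simp add: assms(1))

section \<open>The group structure\<close>

lemma heis_mult_assoc: "(p \<cdot>\<^sub>H q) \<cdot>\<^sub>H r = p \<cdot>\<^sub>H (q \<cdot>\<^sub>H r)"
  by (cases p; cases q; cases r) (simp add: algebra_simps)

lemma heis_mult_zero [simp]: "0 \<cdot>\<^sub>H p = p" "p \<cdot>\<^sub>H 0 = p"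
  by (cases p; simp add: zero_prod_def)+

lemma heis_mult_uminus [simp]: "- p \<cdot>\<^sub>H p = 0" "p \<cdot>\<^sub>H - p = 0"
  by (cases p; simp add: zero_prod_def algebra_simps)+

lemma heis_mult_cancel [simp]: "- p \<cdot>\<^sub>H (p \<cdot>\<^sub>H q) = q" "p \<cdot>\<^sub>H (- p \<cdot>\<^sub>H q) = q"
  by (simp_all flip: heis_mult_assoc)

lemma uminus_heis_mult: "- (p \<cdot>\<^sub>H q) = - q \<cdot>\<^sub>H - p"
  by (cases p; cases q) (simp add: algebra_simps)

text \<open>The differential of a left translation.\<close>

definition left_linear :: "heis \<Rightarrow> heis \<Rightarrow> heis" where
  "left_linear g v = (fst v, fst (snd v), snd (snd v) - 2 * fst g * fst (snd v) + 2 * fst (snd g) * fst v)"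

lemma heis_mult_left_linear: "g \<cdot>\<^sub>H p = g + left_linear g p"
  by (cases g; cases p) (simp add: left_linear_def)

lemma bounded_linear_left_linear: "bounded_linear (left_linear g)"
  unfolding left_linear_def
  by (rule linear_conv_bounded_linear[THEN iffD1], rule linearI) (auto simp: algebra_simps)

definition dil :: "real \<Rightarrow> heis \<Rightarrow> heis" where
  "dil l p = (l * fst p, l * fst (snd p), l\<^sup>2 * snd (snd p))"

definition rot :: "real \<Rightarrow> real \<Rightarrow> heis \<Rightarrow> heis" where
  "rot a b p = (a * fst p - b * fst (snd p), b * fst p + a * fst (snd p), snd (snd p))"

lemma bounded_linear_dil: "bounded_linear (dil l)"
  unfolding dil_def
  by (rule linear_conv_bounded_linear[THEN iffD1], rule linearI) (auto simp: algebra_simps)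

lemma bounded_linear_rot: "bounded_linear (rot a b)"
  unfolding rot_def
  by (rule linear_conv_bounded_linear[THEN iffD1], rule linearI) (auto simp: algebra_simps)

section \<open>Horizontal curves and the distance\<close>

text \<open>The velocity coefficients and the exceptional null set are kept as data, so that curves can be cut,
  joined and transformed together with their lengths.\<close>

definition controlled_curve ::
  "real \<Rightarrow> real \<Rightarrow> (real \<Rightarrow> heis) \<Rightarrow> (real \<Rightarrow> real) \<Rightarrow> (real \<Rightarrow> real) \<Rightarrow> real set \<Rightarrow> bool" where
  "controlled_curve a b \<gamma> u w S \<longleftrightarrow> abs_continuous_on_interval a b \<gamma> \<and> negligible S \<and>
     (\<forall>s\<in>{a..b} - S. (\<gamma> has_vector_derivative u s *\<^sub>R X_field (\<gamma> s) + w s *\<^sub>R Y_field (\<gamma> s))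
        (at s within {a..b}))"

definition control_length :: "real \<Rightarrow> real \<Rightarrow> (real \<Rightarrow> real) \<Rightarrow> (real \<Rightarrow> real) \<Rightarrow> real" where
  "control_length a b u w = integral {a..b} (\<lambda>s. sqrt ((u s)\<^sup>2 + (w s)\<^sup>2))"

lemma XY_field_eq: "u *\<^sub>R X_field p + w *\<^sub>R Y_field p = (u, w, 2 * fst (snd p) * u - 2 * fst p * w)"
  by (cases p) (simp add: algebra_simps)

lemma controlled_curve_integrable:
  assumes "controlled_curve a b \<gamma> u w S" "a \<le> b"
  shows "(\<lambda>s. sqrt ((u s)\<^sup>2 + (w s)\<^sup>2)) absolutely_integrable_on {a..b}"
proof -
  define v where "v = (\<lambda>s. u s *\<^sub>R X_field (\<gamma> s) + w s *\<^sub>R Y_field (\<gamma> s))"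
  have v: "v absolutely_integrable_on {a..b}"
    using assms unfolding controlled_curve_def
    by (intro abs_continuous_absolutely_integrable[of a b \<gamma> S]) (auto simp: v_def)
  have "bounded_linear (\<lambda>p::heis. (fst p, fst (snd p)))"
    by (intro bounded_linear_intros)
  from absolutely_integrable_linear[OF v this]
  have "(\<lambda>s. (fst (v s), fst (snd (v s)))) absolutely_integrable_on {a..b}"
    by (simp add: o_def)
  from absolutely_integrable_norm[OF this, unfolded o_def]
  have "(\<lambda>s. norm (fst (v s), fst (snd (v s)))) absolutely_integrable_on {a..b}" .
  then show ?thesis by (simp add: v_def XY_field_eq norm_Pair)
qed

lemma controlled_curve_has_integral:
  assumes "controlled_curve a b \<gamma> u w S" "a \<le> b"
  shows "((\<lambda>s. sqrt ((u s)\<^sup>2 + (w s)\<^sup>2)) has_integral control_length a b u w) {a..b}"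
  using controlled_curve_integrable[OF assms] unfolding control_length_def
  by (simp add: absolutely_integrable_on_def integrable_integral)

lemma controlled_curve_length:
  assumes "controlled_curve 0 1 \<gamma> u w S"
  shows "curve_length \<gamma> = control_length 0 1 u w"
proof -
  define N where "N = S \<union> {0, 1}"
  have N: "negligible N" using assms by (auto simp: N_def controlled_curve_def)
  have eq: "riem_norm (\<gamma> s) (vector_derivative \<gamma> (at s within {0..1})) = sqrt ((u s)\<^sup>2 + (w s)\<^sup>2)"
    if "s \<in> {0..1} - S" for s
  proof -
    have "(\<gamma> has_vector_derivative u s *\<^sub>R X_field (\<gamma> s) + w s *\<^sub>R Y_field (\<gamma> s)) (at s within {0..1})"
      using assms that by (simp add: controlled_curve_def)
    then have "vector_derivative \<gamma> (at s within {0..1}) = u s *\<^sub>R X_field (\<gamma> s) + w s *\<^sub>R Y_field (\<gamma> s)"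
      using that vector_derivative_within_cbox[of 0 1 s \<gamma>] by auto
    also have "\<dots> = u s *\<^sub>R X_field (\<gamma> s) + w s *\<^sub>R Y_field (\<gamma> s) + 0 *\<^sub>R T_field (\<gamma> s)" by simp
    finally show ?thesis using riem_norm_frame[of "\<gamma> s" "u s" "w s" 0] by simp
  qed
  have abs: "(\<lambda>s. riem_norm (\<gamma> s) (vector_derivative \<gamma> (at s within {0..1}))) absolutely_integrable_on {0..1}"
    by (rule absolutely_integrable_spike[OF controlled_curve_integrable[OF assms] N])
      (use eq in \<open>auto simp: N_def\<close>)
  have "curve_length \<gamma> = integral {0..1} (\<lambda>s. riem_norm (\<gamma> s) (vector_derivative \<gamma> (at s within {0..1})))"
    unfolding curve_length_def using set_lebesgue_integral_eq_integral(2)[OF abs] .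
  also have "\<dots> = control_length 0 1 u w"
    unfolding control_length_def by (rule integral_spike[OF N]) (use eq in \<open>auto simp: N_def\<close>)
  finally show ?thesis .
qed

lemma horizontal_curve_iff: "horizontal_curve \<gamma> \<longleftrightarrow> (\<exists>u w S. controlled_curve 0 1 \<gamma> u w S)"
proof
  assume h: "horizontal_curve \<gamma>"
  then obtain S where "S \<in> null_sets lebesgue" and S: "\<And>s. s \<notin> S \<Longrightarrow> s \<in> {0..1} \<longrightarrow>
        (\<exists>a b. (\<gamma> has_vector_derivative a *\<^sub>R X_field (\<gamma> s) + b *\<^sub>R Y_field (\<gamma> s)) (at s within {0..1}))"
    unfolding horizontal_curve_def by (auto elim!: AE_E3)
  then obtain u w where "\<And>s. s \<in> {0..1} - S \<Longrightarrow>
     (\<gamma> has_vector_derivative u s *\<^sub>R X_field (\<gamma> s) + w s *\<^sub>R Y_field (\<gamma> s)) (at s within {0..1})"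
    by (metis Diff_iff)
  then have "controlled_curve 0 1 \<gamma> u w S"
    using h \<open>S \<in> null_sets lebesgue\<close> by (simp add: controlled_curve_def horizontal_curve_def negligible_iff_null_sets)
  then show "\<exists>u w S. controlled_curve 0 1 \<gamma> u w S" by blast
next
  assume "\<exists>u w S. controlled_curve 0 1 \<gamma> u w S"
  then obtain u w S where c: "controlled_curve 0 1 \<gamma> u w S" by blast
  show "horizontal_curve \<gamma>"
    unfolding horizontal_curve_def
  proof
    show "abs_continuous_on_interval 0 1 \<gamma>" using c by (simp add: controlled_curve_def)
    have "S \<in> null_sets lebesgue" using c by (simp add: controlled_curve_def negligible_iff_null_sets)
    then show "AE s in lebesgue. s \<in> {0..1} \<longrightarrow>
        (\<exists>a b. (\<gamma> has_vector_derivative a *\<^sub>R X_field (\<gamma> s) + b *\<^sub>R Y_field (\<gamma> s)) (at s within {0..1}))"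
    proof (rule AE_I')
      show "{s \<in> space lebesgue. \<not> (s \<in> {0..1} \<longrightarrow>
        (\<exists>a b. (\<gamma> has_vector_derivative a *\<^sub>R X_field (\<gamma> s) + b *\<^sub>R Y_field (\<gamma> s)) (at s within {0..1})))} \<subseteq> S"
        using c unfolding controlled_curve_def by blast
    qed
  qed
qed

lemma control_length_nonneg: "control_length a b u w \<ge> 0"
proof (cases "(\<lambda>s. sqrt ((u s)\<^sup>2 + (w s)\<^sup>2)) integrable_on {a..b}")
  case True
  then show ?thesis unfolding control_length_def by (rule integral_nonneg) simp
qed (simp add: control_length_def not_integrable_integral)

lemma curve_lengths_eq:
  "{curve_length \<gamma> |\<gamma>. horizontal_curve \<gamma> \<and> \<gamma> 0 = p \<and> \<gamma> 1 = q} =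
   {control_length 0 1 u w |\<gamma> u w S. controlled_curve 0 1 \<gamma> u w S \<and> \<gamma> 0 = p \<and> \<gamma> 1 = q}"
  by (rule Collect_cong) (metis horizontal_curve_iff controlled_curve_length)

lemma rho_le_control_length_unit:
  assumes "controlled_curve 0 1 \<gamma> u w S"
  shows "\<rho> (\<gamma> 0) (\<gamma> 1) \<le> control_length 0 1 u w"
  unfolding \<rho>_def curve_lengths_eq
proof (rule cInf_lower)
  show "control_length 0 1 u w \<in> {control_length 0 1 u w |\<gamma>' u w S. controlled_curve 0 1 \<gamma>' u w S \<and> \<gamma>' 0 = \<gamma> 0 \<and> \<gamma>' 1 = \<gamma> 1}"
    using assms by blast
  show "bdd_below {control_length 0 1 u w |\<gamma>' u w S. controlled_curve 0 1 \<gamma>' u w S \<and> \<gamma>' 0 = \<gamma> 0 \<and> \<gamma>' 1 = \<gamma> 1}"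
    by (rule bdd_belowI[of _ 0]) (auto simp: control_length_nonneg)
qed

lemma controlled_curve_subinterval:
  assumes "controlled_curve a b \<gamma> u w S" "a \<le> a'" "b' \<le> b"
  shows "controlled_curve a' b' \<gamma> u w S"
  unfolding controlled_curve_def
proof (intro conjI ballI)
  show "abs_continuous_on_interval a' b' \<gamma>"
    using assms abs_continuous_subinterval unfolding controlled_curve_def by blast
  show "negligible S" using assms by (simp add: controlled_curve_def)
  fix s assume s: "s \<in> {a'..b'} - S"
  then have "(\<gamma> has_vector_derivative u s *\<^sub>R X_field (\<gamma> s) + w s *\<^sub>R Y_field (\<gamma> s)) (at s within {a..b})"
    using assms by (simp add: controlled_curve_def)
  then show "(\<gamma> has_vector_derivative u s *\<^sub>R X_field (\<gamma> s) + w s *\<^sub>R Y_field (\<gamma> s)) (at s within {a'..b'})"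
    using assms by (elim has_vector_derivative_within_subset) auto
qed

lemma controlled_curve_cong:
  assumes "controlled_curve a b \<gamma> u w S" "\<And>s. a \<le> s \<Longrightarrow> s \<le> b \<Longrightarrow> \<gamma>' s = \<gamma> s"
    "\<And>s. a \<le> s \<Longrightarrow> s \<le> b \<Longrightarrow> s \<notin> S \<Longrightarrow> u' s = u s \<and> w' s = w s"
  shows "controlled_curve a b \<gamma>' u' w' S"
  unfolding controlled_curve_def
proof (intro conjI ballI)
  show "abs_continuous_on_interval a b \<gamma>'"
    using assms by (intro abs_continuous_cong[of a b \<gamma> \<gamma>']) (auto simp: controlled_curve_def)
  show "negligible S" using assms by (simp add: controlled_curve_def)
  fix s assume s: "s \<in> {a..b} - S"
  then have "(\<gamma> has_vector_derivative u s *\<^sub>R X_field (\<gamma> s) + w s *\<^sub>R Y_field (\<gamma> s)) (at s within {a..b})"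
    using assms by (simp add: controlled_curve_def)
  then have "(\<gamma>' has_vector_derivative u s *\<^sub>R X_field (\<gamma> s) + w s *\<^sub>R Y_field (\<gamma> s)) (at s within {a..b})"
    by (rule has_vector_derivative_transform[rotated 2]) (use s assms in auto)
  then show "(\<gamma>' has_vector_derivative u' s *\<^sub>R X_field (\<gamma>' s) + w' s *\<^sub>R Y_field (\<gamma>' s)) (at s within {a..b})"
    using assms s by simp
qed

lemma controlled_curve_combine:
  assumes c1: "controlled_curve a c \<gamma> u w S" and c2: "controlled_curve c b \<gamma> u w S'"
    and "a \<le> c" "c \<le> b"
  shows "controlled_curve a b \<gamma> u w (S \<union> S' \<union> {c})"
  unfolding controlled_curve_def
proof (intro conjI ballI)
  show "abs_continuous_on_interval a b \<gamma>"
    using c1 c2 abs_continuous_combine unfolding controlled_curve_def by blast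
  show "negligible (S \<union> S' \<union> {c})" using c1 c2 by (auto simp: controlled_curve_def)
  fix s assume s: "s \<in> {a..b} - (S \<union> S' \<union> {c})"
  show "(\<gamma> has_vector_derivative u s *\<^sub>R X_field (\<gamma> s) + w s *\<^sub>R Y_field (\<gamma> s)) (at s within {a..b})"
  proof (cases "s < c")
    case True
    have "at s within {a..c} = at s within {a..b}"
      by (rule at_within_nhd[of _ "{..<c}"]) (use True \<open>c \<le> b\<close> in auto)
    moreover have "(\<gamma> has_vector_derivative u s *\<^sub>R X_field (\<gamma> s) + w s *\<^sub>R Y_field (\<gamma> s)) (at s within {a..c})"
      using c1 s True by (simp add: controlled_curve_def)
    ultimately show ?thesis by simp
  next
    case False
    then have "c < s" using s by auto
    have "at s within {c..b} = at s within {a..b}"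
      by (rule at_within_nhd[of _ "{c<..}"]) (use \<open>c < s\<close> \<open>a \<le> c\<close> in auto)
    moreover have "(\<gamma> has_vector_derivative u s *\<^sub>R X_field (\<gamma> s) + w s *\<^sub>R Y_field (\<gamma> s)) (at s within {c..b})"
      using c2 s \<open>c < s\<close> by (simp add: controlled_curve_def)
    ultimately show ?thesis by simp
  qed
qed

lemma control_length_combine:
  assumes c: "controlled_curve a b \<gamma> u w S" and "a \<le> c" "c \<le> b"
  shows "control_length a b u w = control_length a c u w + control_length c b u w"
  unfolding control_length_def
  by (rule Henstock_Kurzweil_Integration.integral_combine[symmetric])
    (use assms controlled_curve_integrable[OF c] in \<open>auto simp: absolutely_integrable_on_def\<close>)

lemma controlled_curve_affine:
  assumes c: "controlled_curve (m * a + d) (m * b + d) \<gamma> u w S" and "m > 0" "a \<le> b"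
  shows "controlled_curve a b (\<lambda>s. \<gamma> (m * s + d)) (\<lambda>s. m * u (m * s + d)) (\<lambda>s. m * w (m * s + d))
           ((\<lambda>s. (s - d) / m) ` S)"
    and "control_length a b (\<lambda>s. m * u (m * s + d)) (\<lambda>s. m * w (m * s + d)) =
         control_length (m * a + d) (m * b + d) u w"
proof -
  show "controlled_curve a b (\<lambda>s. \<gamma> (m * s + d)) (\<lambda>s. m * u (m * s + d)) (\<lambda>s. m * w (m * s + d))
           ((\<lambda>s. (s - d) / m) ` S)"
    unfolding controlled_curve_def
  proof (intro conjI ballI)
    show "abs_continuous_on_interval a b (\<lambda>s. \<gamma> (m * s + d))"
      using c \<open>m > 0\<close> by (intro abs_continuous_affine) (auto simp: controlled_curve_def)
    show "negligible ((\<lambda>s. (s - d) / m) ` S)"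
      using c unfolding divide_inverse by (intro negligible_differentiable_image_negligible)
        (auto simp: controlled_curve_def intro!: derivative_intros)
    fix s assume s: "s \<in> {a..b} - (\<lambda>s. (s - d) / m) ` S"
    have "m * s + d \<notin> S"
    proof
      assume "m * s + d \<in> S"
      then have "(m * s + d - d) / m \<in> (\<lambda>s. (s - d) / m) ` S" by (rule imageI)
      then show False using s \<open>m > 0\<close> by simp
    qed
    let ?v = "u (m * s + d) *\<^sub>R X_field (\<gamma> (m * s + d)) + w (m * s + d) *\<^sub>R Y_field (\<gamma> (m * s + d))"
    have im: "(\<lambda>s. m * s + d) ` {a..b} \<subseteq> {m * a + d..m * b + d}" using \<open>m > 0\<close> by auto
    have "(\<gamma> has_vector_derivative ?v) (at (m * s + d) within {m * a + d..m * b + d})"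
      using c s \<open>m * s + d \<notin> S\<close> \<open>m > 0\<close> by (auto simp: controlled_curve_def)
    then have "(\<gamma> has_vector_derivative ?v) (at (m * s + d) within (\<lambda>s. m * s + d) ` {a..b})"
      by (rule has_vector_derivative_within_subset[OF _ im])
    moreover have "((\<lambda>s. m * s + d) has_vector_derivative m) (at s within {a..b})"
      by (auto intro!: derivative_eq_intros simp: has_vector_derivative_def)
    ultimately have "(\<gamma> \<circ> (\<lambda>s. m * s + d) has_vector_derivative m *\<^sub>R ?v) (at s within {a..b})"
      by (intro vector_diff_chain_within)
    then show "((\<lambda>s. \<gamma> (m * s + d)) has_vector_derivative (m * u (m * s + d)) *\<^sub>R X_field (\<gamma> (m * s + d)) +
         (m * w (m * s + d)) *\<^sub>R Y_field (\<gamma> (m * s + d))) (at s within {a..b})"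
      by (simp add: o_def scaleR_add_right)
  qed
  have "m * a + d \<le> m * b + d" using assms by simp
  from controlled_curve_has_integral[OF c this]
  have "((\<lambda>s. sqrt ((u s)\<^sup>2 + (w s)\<^sup>2)) has_integral control_length (m * a + d) (m * b + d) u w) (cbox (m * a + d) (m * b + d))"
    by simp
  from has_integral_affinity[OF this, of m d] \<open>m > 0\<close>
  have "((\<lambda>s. sqrt ((u (m * s + d))\<^sup>2 + (w (m * s + d))\<^sup>2)) has_integral
      (1 / m) *\<^sub>R control_length (m * a + d) (m * b + d) u w) ((\<lambda>x. (1 / m) *\<^sub>R x + - ((1 / m) *\<^sub>R d)) ` {m * a + d..m * b + d})"
    by simp
  moreover have "(\<lambda>x. (1 / m) *\<^sub>R x + - ((1 / m) *\<^sub>R d)) ` {m * a + d..m * b + d} = {a..b}"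
  proof (intro equalityI subsetI)
    fix s assume "s \<in> {a..b}"
    then have "m * s + d \<in> {m * a + d..m * b + d}" using \<open>m > 0\<close> by auto
    moreover have "s = (1 / m) *\<^sub>R (m * s + d) + - ((1 / m) *\<^sub>R d)" using \<open>m > 0\<close> by (simp add: field_simps)
    ultimately show "s \<in> (\<lambda>x. (1 / m) *\<^sub>R x + - ((1 / m) *\<^sub>R d)) ` {m * a + d..m * b + d}" by blast
  qed (use \<open>m > 0\<close> in \<open>auto simp: field_simps\<close>)
  ultimately have "((\<lambda>s. m * sqrt ((u (m * s + d))\<^sup>2 + (w (m * s + d))\<^sup>2)) has_integral
      m * ((1 / m) *\<^sub>R control_length (m * a + d) (m * b + d) u w)) {a..b}"
    by (intro has_integral_mult_right) simp
  moreover have "m * sqrt (x\<^sup>2 + y\<^sup>2) = sqrt ((m * x)\<^sup>2 + (m * y)\<^sup>2)" for x y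
  proof -
    have "(m * x)\<^sup>2 + (m * y)\<^sup>2 = m\<^sup>2 * (x\<^sup>2 + y\<^sup>2)" by (simp add: power_mult_distrib distrib_left)
    then show ?thesis using \<open>m > 0\<close> by (simp add: real_sqrt_mult)
  qed
  ultimately show "control_length a b (\<lambda>s. m * u (m * s + d)) (\<lambda>s. m * w (m * s + d)) =
         control_length (m * a + d) (m * b + d) u w"
    using \<open>m > 0\<close> unfolding control_length_def by (intro integral_unique) simp
qed

lemma rho_le_control_length:
  assumes c: "controlled_curve a b \<gamma> u w S" and "a < b"
  shows "\<rho> (\<gamma> a) (\<gamma> b) \<le> control_length a b u w"
proof -
  have c': "controlled_curve ((b - a) * 0 + a) ((b - a) * 1 + a) \<gamma> u w S" using c by simp
  from rho_le_control_length_unit[OF controlled_curve_affine(1)[OF c']] controlled_curve_affine(2)[OF c'] \<open>a < b\<close>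
  show ?thesis by simp
qed

text \<open>This is how a nearly optimal loop is cut at one of its points.\<close>

lemma rho_split_curve:
  assumes c: "controlled_curve 0 1 \<gamma> u w S" and s: "0 < s" "s < 1"
  shows "\<rho> (\<gamma> 0) (\<gamma> s) + \<rho> (\<gamma> s) (\<gamma> 1) \<le> control_length 0 1 u w"
proof -
  have "\<rho> (\<gamma> 0) (\<gamma> s) \<le> control_length 0 s u w" "\<rho> (\<gamma> s) (\<gamma> 1) \<le> control_length s 1 u w"
    using s by (auto intro!: rho_le_control_length controlled_curve_subinterval[OF c])
  then show ?thesis using control_length_combine[OF c, of s] s by simp
qed

lemma controlled_curve_concat:
  assumes c1: "controlled_curve 0 1 \<gamma>1 u1 w1 S1" and c2: "controlled_curve 0 1 \<gamma>2 u2 w2 S2"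
    and eq: "\<gamma>1 1 = \<gamma>2 0"
  obtains \<gamma> u w S where "controlled_curve 0 1 \<gamma> u w S" "\<gamma> 0 = \<gamma>1 0" "\<gamma> 1 = \<gamma>2 1"
    "control_length 0 1 u w = control_length 0 1 u1 w1 + control_length 0 1 u2 w2"
proof -
  have c2': "controlled_curve (1 * 1 + (-1)) (1 * 2 + (-1)) \<gamma>2 u2 w2 S2" using c2 by simp
  note shift = controlled_curve_affine[OF c2']
  define \<gamma> where "\<gamma> = (\<lambda>s. if s \<le> 1 then \<gamma>1 s else \<gamma>2 (s - 1))"
  define u where "u = (\<lambda>s. if s < 1 then u1 s else u2 (s - 1))"
  define w where "w = (\<lambda>s. if s < 1 then w1 s else w2 (s - 1))"
  define T where "T = (\<lambda>s. s + 1) ` S2"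
  have d1: "controlled_curve 0 1 \<gamma> u w (S1 \<union> {1})"
  proof (rule controlled_curve_cong)
    show "controlled_curve 0 1 \<gamma>1 u1 w1 (S1 \<union> {1})" using c1 by (auto simp: controlled_curve_def)
  qed (auto simp: \<gamma>_def u_def w_def)
  have d2: "controlled_curve 1 2 \<gamma> u w T"
  proof (rule controlled_curve_cong)
    show "controlled_curve 1 2 (\<lambda>s. \<gamma>2 (s - 1)) (\<lambda>s. u2 (s - 1)) (\<lambda>s. w2 (s - 1)) T"
      using shift(1) by (simp add: T_def)
  qed (use eq in \<open>auto simp: \<gamma>_def u_def w_def\<close>)
  \<comment> \<open>the joined curve has the parameter interval \<open>[0, 2]\<close>, which is then shrunk to \<open>[0, 1]\<close>\<close>
  have d: "controlled_curve (2 * 0 + 0) (2 * 1 + 0) \<gamma> u w (S1 \<union> {1} \<union> T \<union> {1})"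
    using controlled_curve_combine[OF d1 d2] by simp
  have "control_length 0 1 u w = control_length 0 1 u1 w1"
    unfolding control_length_def
    by (rule integral_spike[of "{1}"]) (auto simp: u_def w_def)
  moreover have "control_length 1 2 u w = control_length 0 1 u2 w2"
  proof -
    have "control_length 1 2 u w = control_length 1 2 (\<lambda>s. 1 * u2 (1 * s + - 1)) (\<lambda>s. 1 * w2 (1 * s + - 1))"
      unfolding control_length_def by (rule integral_cong) (auto simp: u_def w_def)
    then show ?thesis using shift(2) by simp
  qed
  ultimately have len: "control_length 0 2 u w = control_length 0 1 u1 w1 + control_length 0 1 u2 w2"
    using control_length_combine[of 0 2 \<gamma> u w "S1 \<union> {1} \<union> T \<union> {1}" 1] d by simp
  show ?thesis
    by (rule that[OF controlled_curve_affine(1)[OF d]])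
      (use controlled_curve_affine(2)[OF d] len in \<open>auto simp: \<gamma>_def\<close>)
qed

lemma controlled_curve_reverse:
  assumes c: "controlled_curve 0 1 \<gamma> u w S"
  obtains u' w' S' where "controlled_curve 0 1 (\<lambda>s. \<gamma> (1 - s)) u' w' S'"
    "control_length 0 1 u' w' = control_length 0 1 u w"
proof
  show "controlled_curve 0 1 (\<lambda>s. \<gamma> (1 - s)) (\<lambda>s. - u (1 - s)) (\<lambda>s. - w (1 - s)) ((\<lambda>s. 1 - s) ` S)"
    unfolding controlled_curve_def
  proof (intro conjI ballI)
    show "abs_continuous_on_interval 0 1 (\<lambda>s. \<gamma> (1 - s))"
      by (rule abs_continuous_reflect) (use c in \<open>simp add: controlled_curve_def\<close>)
    show "negligible ((\<lambda>s. 1 - s) ` S)"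
      using c by (intro negligible_differentiable_image_negligible)
        (auto simp: controlled_curve_def intro!: derivative_intros)
    fix s :: real assume s: "s \<in> {0..1} - (\<lambda>s. 1 - s) ` S"
    have "1 - s \<notin> S"
    proof
      assume "1 - s \<in> S"
      then have "1 - (1 - s) \<in> (\<lambda>s. 1 - s) ` S" by (rule imageI)
      then show False using s by simp
    qed
    let ?v = "u (1 - s) *\<^sub>R X_field (\<gamma> (1 - s)) + w (1 - s) *\<^sub>R Y_field (\<gamma> (1 - s))"
    have im: "(\<lambda>s. 1 - s) ` {0..1} \<subseteq> {0..1::real}" by auto
    have "(\<gamma> has_vector_derivative ?v) (at (1 - s) within {0..1})"
      using c s \<open>1 - s \<notin> S\<close> by (auto simp: controlled_curve_def)
    then have "(\<gamma> has_vector_derivative ?v) (at (1 - s) within (\<lambda>s. 1 - s) ` {0..1})"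
      by (rule has_vector_derivative_within_subset[OF _ im])
    moreover have "((\<lambda>s. 1 - s) has_vector_derivative - 1) (at s within {0..1})"
      by (auto intro!: derivative_eq_intros simp: has_vector_derivative_def)
    ultimately have "(\<gamma> \<circ> (\<lambda>s. 1 - s) has_vector_derivative (- 1) *\<^sub>R ?v) (at s within {0..1})"
      by (intro vector_diff_chain_within)
    then show "((\<lambda>s. \<gamma> (1 - s)) has_vector_derivative (- u (1 - s)) *\<^sub>R X_field (\<gamma> (1 - s)) +
         (- w (1 - s)) *\<^sub>R Y_field (\<gamma> (1 - s))) (at s within {0..1})"
      by (simp add: o_def algebra_simps)
  qed
  have "((\<lambda>s. sqrt ((u s)\<^sup>2 + (w s)\<^sup>2)) has_integral control_length 0 1 u w) (cbox 0 1)"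
    using controlled_curve_has_integral[OF c] by simp
  from has_integral_affinity[OF this, of "-1" 1]
  have "((\<lambda>s. sqrt ((u (1 - s))\<^sup>2 + (w (1 - s))\<^sup>2)) has_integral control_length 0 1 u w) ((\<lambda>x. 1 - x) ` {0..1})"
    by simp
  moreover have "(\<lambda>x. 1 - x) ` {0..1} = {0..1::real}"
  proof (intro equalityI subsetI)
    fix x :: real assume "x \<in> {0..1}"
    then have "1 - (1 - x) \<in> (\<lambda>x. 1 - x) ` {0..1}" by (intro imageI) auto
    then show "x \<in> (\<lambda>x. 1 - x) ` {0..1}" by simp
  qed auto
  ultimately show "control_length 0 1 (\<lambda>s. - u (1 - s)) (\<lambda>s. - w (1 - s)) = control_length 0 1 u w"
    unfolding control_length_def by (intro integral_unique) simp
qed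

section \<open>The distance is a homogeneous left invariant metric\<close>

text \<open>Left translations, dilations and rotations are affine maps that send the horizontal frame to a
  rotated and scaled horizontal frame, so that they multiply lengths by a constant.\<close>

lemma X_field_eq: "X_field p = (1, 0, 2 * fst (snd p))" and Y_field_eq: "Y_field p = (0, 1, - 2 * fst p)"
  by (cases p; simp)+

lemma controlled_curve_map:
  assumes c: "controlled_curve a b \<gamma> u w S"
    and lin: "bounded_linear A" and phi: "\<And>p. \<phi> p = g + A p"
    and X: "\<And>p. A (X_field p) = \<alpha> *\<^sub>R X_field (\<phi> p) + \<beta> *\<^sub>R Y_field (\<phi> p)"
    and Y: "\<And>p. A (Y_field p) = (- \<beta>) *\<^sub>R X_field (\<phi> p) + \<alpha> *\<^sub>R Y_field (\<phi> p)"
  shows "controlled_curve a b (\<lambda>s. \<phi> (\<gamma> s)) (\<lambda>s. \<alpha> * u s - \<beta> * w s) (\<lambda>s. \<beta> * u s + \<alpha> * w s) S"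
  unfolding controlled_curve_def
proof (intro conjI ballI)
  interpret bounded_linear A by fact
  obtain K where K: "\<And>x. norm (A x) \<le> norm x * K" using bounded by blast
  have "abs_continuous_on_interval a b \<gamma>" using c by (simp add: controlled_curve_def)
  then show "abs_continuous_on_interval a b (\<lambda>s. \<phi> (\<gamma> s))"
  proof (rule abs_continuous_lipschitz_compose)
    fix s t
    have "dist (\<phi> (\<gamma> s)) (\<phi> (\<gamma> t)) = norm (A (\<gamma> s - \<gamma> t))"
      by (simp add: phi dist_norm diff)
    then show "dist (\<phi> (\<gamma> s)) (\<phi> (\<gamma> t)) \<le> K * dist (\<gamma> s) (\<gamma> t)"
      using K[of "\<gamma> s - \<gamma> t"] by (simp add: dist_norm mult.commute)
  qed
  show "negligible S" using c by (simp add: controlled_curve_def)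
  fix s assume "s \<in> {a..b} - S"
  then have "(\<gamma> has_vector_derivative u s *\<^sub>R X_field (\<gamma> s) + w s *\<^sub>R Y_field (\<gamma> s)) (at s within {a..b})"
    using c by (simp add: controlled_curve_def)
  then have "((\<lambda>s. A (\<gamma> s)) has_vector_derivative A (u s *\<^sub>R X_field (\<gamma> s) + w s *\<^sub>R Y_field (\<gamma> s))) (at s within {a..b})"
    by (rule has_vector_derivative)
  then have "((\<lambda>s. \<phi> (\<gamma> s)) has_vector_derivative A (u s *\<^sub>R X_field (\<gamma> s) + w s *\<^sub>R Y_field (\<gamma> s))) (at s within {a..b})"
    unfolding phi by (auto intro!: derivative_eq_intros)
  moreover have "A (u s *\<^sub>R X_field (\<gamma> s) + w s *\<^sub>R Y_field (\<gamma> s)) =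
     (\<alpha> * u s - \<beta> * w s) *\<^sub>R X_field (\<phi> (\<gamma> s)) + (\<beta> * u s + \<alpha> * w s) *\<^sub>R Y_field (\<phi> (\<gamma> s))"
    by (simp add: add scaleR X Y algebra_simps)
  ultimately show "((\<lambda>s. \<phi> (\<gamma> s)) has_vector_derivative (\<alpha> * u s - \<beta> * w s) *\<^sub>R X_field (\<phi> (\<gamma> s)) +
     (\<beta> * u s + \<alpha> * w s) *\<^sub>R Y_field (\<phi> (\<gamma> s))) (at s within {a..b})"
    by simp
qed

lemma control_length_map:
  assumes "\<alpha>\<^sup>2 + \<beta>\<^sup>2 = l\<^sup>2" "l \<ge> 0"
  shows "control_length a b (\<lambda>s. \<alpha> * u s - \<beta> * w s) (\<lambda>s. \<beta> * u s + \<alpha> * w s) = l * control_length a b u w"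
proof -
  have "sqrt ((\<alpha> * x - \<beta> * y)\<^sup>2 + (\<beta> * x + \<alpha> * y)\<^sup>2) = l * sqrt (x\<^sup>2 + y\<^sup>2)" for x y
  proof -
    have "(\<alpha> * x - \<beta> * y)\<^sup>2 + (\<beta> * x + \<alpha> * y)\<^sup>2 = (\<alpha>\<^sup>2 + \<beta>\<^sup>2) * (x\<^sup>2 + y\<^sup>2)"
      by (simp add: power2_eq_square algebra_simps)
    then show ?thesis using assms by (simp add: real_sqrt_mult)
  qed
  then show ?thesis by (simp add: control_length_def)
qed

lemma controlled_line:
  "controlled_curve 0 1 (\<lambda>s. p \<cdot>\<^sub>H (s * a, s * b, 0)) (\<lambda>_. a) (\<lambda>_. b) {}"
  "control_length 0 1 (\<lambda>_. a) (\<lambda>_. b) = sqrt (a\<^sup>2 + b\<^sup>2)"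
proof -
  define v where "v = left_linear p (a, b, 0)"
  have lin: "p \<cdot>\<^sub>H (s * a, s * b, 0) = p + s *\<^sub>R v" for s
    by (simp add: heis_mult_left_linear v_def left_linear_def algebra_simps)
  show "controlled_curve 0 1 (\<lambda>s. p \<cdot>\<^sub>H (s * a, s * b, 0)) (\<lambda>_. a) (\<lambda>_. b) {}"
    unfolding controlled_curve_def
  proof (intro conjI ballI)
    show "abs_continuous_on_interval 0 1 (\<lambda>s. p \<cdot>\<^sub>H (s * a, s * b, 0))"
    proof (rule abs_continuous_lipschitz)
      fix s t :: real
      have "dist (p + s *\<^sub>R v) (p + t *\<^sub>R v) = norm ((s - t) *\<^sub>R v)"
        by (simp add: dist_norm algebra_simps)
      then show "dist (p \<cdot>\<^sub>H (s * a, s * b, 0)) (p \<cdot>\<^sub>H (t * a, t * b, 0)) \<le> norm v * \<bar>s - t\<bar>"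
        by (simp add: lin)
    qed
    fix s :: real
    have "a *\<^sub>R X_field (p + s *\<^sub>R v) + b *\<^sub>R Y_field (p + s *\<^sub>R v) = v"
      by (simp add: XY_field_eq v_def left_linear_def algebra_simps)
    then show "((\<lambda>s. p \<cdot>\<^sub>H (s * a, s * b, 0)) has_vector_derivative
       a *\<^sub>R X_field (p \<cdot>\<^sub>H (s * a, s * b, 0)) + b *\<^sub>R Y_field (p \<cdot>\<^sub>H (s * a, s * b, 0))) (at s within {0..1})"
      unfolding lin by (auto intro!: derivative_eq_intros)
  qed simp
  show "control_length 0 1 (\<lambda>_. a) (\<lambda>_. b) = sqrt (a\<^sup>2 + b\<^sup>2)" by (simp add: control_length_def)
qed

lemma connecting_curve_exists:
  obtains \<gamma> u w S where "controlled_curve 0 1 \<gamma> u w S" "\<gamma> 0 = p" "\<gamma> 1 = q"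
proof -
  define conn where "conn p q \<longleftrightarrow> (\<exists>\<gamma> u w S. controlled_curve 0 1 \<gamma> u w S \<and> \<gamma> 0 = p \<and> \<gamma> 1 = q)" for p q
  have trans: "conn p r" if "conn p q" "conn q r" for p q r
    using that controlled_curve_concat unfolding conn_def by metis
  have line: "conn p (p \<cdot>\<^sub>H (a, b, 0))" for p a b
  proof -
    have "p \<cdot>\<^sub>H (0 * a, 0 * b, 0) = p" "p \<cdot>\<^sub>H (1 * a, 1 * b, 0) = p \<cdot>\<^sub>H (a, b, 0)"
      by (simp_all flip: zero_prod_def)
    then show ?thesis unfolding conn_def using controlled_line(1)[of p a b] by blast
  qed
  obtain x y t where xyt: "- p \<cdot>\<^sub>H q = (x, y, t)" by (cases "- p \<cdot>\<^sub>H q")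
  \<comment> \<open>a rectangle of area \<open>t / 4\<close> moves the point vertically by \<open>t\<close>\<close>
  define r where "r = p \<cdot>\<^sub>H (x, y, 0)"
  have "conn p ((((r \<cdot>\<^sub>H (0, t / 4, 0)) \<cdot>\<^sub>H (1, 0, 0)) \<cdot>\<^sub>H (0, - (t / 4), 0)) \<cdot>\<^sub>H (-1, 0, 0))"
    unfolding r_def by (intro trans[OF _ line] line)
  also have "(((r \<cdot>\<^sub>H (0, t / 4, 0)) \<cdot>\<^sub>H (1, 0, 0)) \<cdot>\<^sub>H (0, - (t / 4), 0)) \<cdot>\<^sub>H (-1, 0, 0) = r \<cdot>\<^sub>H (0, 0, t)"
    by (simp add: heis_mult_assoc)
  also have "r \<cdot>\<^sub>H (0, 0, t) = p \<cdot>\<^sub>H (- p \<cdot>\<^sub>H q)"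
    by (simp add: r_def heis_mult_assoc xyt)
  finally have "conn p q" by simp
  then show ?thesis unfolding conn_def by (elim exE conjE) (rule that)
qed

lemma rho_nearly_attained:
  assumes "e > 0"
  obtains \<gamma> u w S where "controlled_curve 0 1 \<gamma> u w S" "\<gamma> 0 = p" "\<gamma> 1 = q"
    "control_length 0 1 u w < \<rho> p q + e"
proof -
  let ?L = "{control_length 0 1 u w |\<gamma> u w S. controlled_curve 0 1 \<gamma> u w S \<and> \<gamma> 0 = p \<and> \<gamma> 1 = q}"
  obtain \<gamma> u w S where "controlled_curve 0 1 \<gamma> u w S" "\<gamma> 0 = p" "\<gamma> 1 = q"
    by (rule connecting_curve_exists)
  then have "control_length 0 1 u w \<in> ?L" by blast
  then have "?L \<noteq> {}" by (metis empty_iff)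
  moreover have "Inf ?L < Inf ?L + e" using assms by simp
  ultimately have "\<exists>l\<in>?L. l < Inf ?L + e" by (rule cInf_lessD)
  then obtain l where "l \<in> ?L" and l: "l < Inf ?L + e" ..
  from this(1) obtain \<gamma> u w S where c: "l = control_length 0 1 u w" "controlled_curve 0 1 \<gamma> u w S" "\<gamma> 0 = p" "\<gamma> 1 = q"
    by (elim CollectE exE conjE)
  have "\<rho> p q = Inf ?L" unfolding \<rho>_def curve_lengths_eq ..
  with l c(1) have "control_length 0 1 u w < \<rho> p q + e" by simp
  then show ?thesis by (rule that[OF c(2-4)])
qed

lemma rho_nonneg [simp]: "0 \<le> \<rho> p q"
proof (rule ccontr)
  assume "\<not> ?thesis"
  then have neg: "- \<rho> p q > 0" by simp
  obtain \<gamma> u w S where "controlled_curve 0 1 \<gamma> u w S" "\<gamma> 0 = p" "\<gamma> 1 = q"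
    "control_length 0 1 u w < \<rho> p q + - \<rho> p q"
    using rho_nearly_attained[OF neg] .
  then show False using control_length_nonneg[of 0 1 u w] by simp
qed

lemma rho_triangle: "\<rho> p r \<le> \<rho> p q + \<rho> q r"
proof (rule field_le_epsilon)
  fix e :: real assume "e > 0"
  then have "e / 2 > 0" by simp
  obtain \<gamma> u w S where 1: "controlled_curve 0 1 \<gamma> u w S" "\<gamma> 0 = p" "\<gamma> 1 = q"
    "control_length 0 1 u w < \<rho> p q + e / 2" using rho_nearly_attained[OF \<open>e / 2 > 0\<close>] .
  obtain \<gamma>' u' w' S' where 2: "controlled_curve 0 1 \<gamma>' u' w' S'" "\<gamma>' 0 = q" "\<gamma>' 1 = r"
    "control_length 0 1 u' w' < \<rho> q r + e / 2" using rho_nearly_attained[OF \<open>e / 2 > 0\<close>] .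
  have "\<gamma> 1 = \<gamma>' 0" using 1 2 by simp
  obtain \<gamma>'' u'' w'' S'' where 3: "controlled_curve 0 1 \<gamma>'' u'' w'' S''" "\<gamma>'' 0 = \<gamma> 0" "\<gamma>'' 1 = \<gamma>' 1"
    "control_length 0 1 u'' w'' = control_length 0 1 u w + control_length 0 1 u' w'"
    using controlled_curve_concat[OF 1(1) 2(1) \<open>\<gamma> 1 = \<gamma>' 0\<close>] .
  show "\<rho> p r \<le> \<rho> p q + \<rho> q r + e"
    using rho_le_control_length_unit[OF 3(1)] 1 2 3 by simp
qed

lemma rho_commute: "\<rho> p q = \<rho> q p"
proof -
  have "\<rho> p q \<le> \<rho> q p" for p q
  proof (rule field_le_epsilon)
    fix e :: real assume "e > 0"
    obtain \<gamma> u w S where 1: "controlled_curve 0 1 \<gamma> u w S" "\<gamma> 0 = q" "\<gamma> 1 = p"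
      "control_length 0 1 u w < \<rho> q p + e" using rho_nearly_attained[OF \<open>e > 0\<close>] .
    obtain u' w' S' where "controlled_curve 0 1 (\<lambda>s. \<gamma> (1 - s)) u' w' S'"
      "control_length 0 1 u' w' = control_length 0 1 u w"
      using controlled_curve_reverse[OF 1(1)] .
    with rho_le_control_length_unit[OF this(1)] 1 show "\<rho> p q \<le> \<rho> q p + e" by simp
  qed
  then show ?thesis by (simp add: antisym)
qed

lemma rho_map_le:
  assumes lin: "bounded_linear A" and phi: "\<And>p. \<phi> p = g + A p"
    and X: "\<And>p. A (X_field p) = \<alpha> *\<^sub>R X_field (\<phi> p) + \<beta> *\<^sub>R Y_field (\<phi> p)"
    and Y: "\<And>p. A (Y_field p) = (- \<beta>) *\<^sub>R X_field (\<phi> p) + \<alpha> *\<^sub>R Y_field (\<phi> p)"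
    and l: "\<alpha>\<^sup>2 + \<beta>\<^sup>2 = l\<^sup>2" "l \<ge> 0"
  shows "\<rho> (\<phi> p) (\<phi> q) \<le> l * \<rho> p q"
proof (rule field_le_epsilon)
  fix e :: real assume "e > 0"
  then have e': "e / (l + 1) > 0" using l by simp
  obtain \<gamma> u w S where 1: "controlled_curve 0 1 \<gamma> u w S" "\<gamma> 0 = p" "\<gamma> 1 = q"
      "control_length 0 1 u w < \<rho> p q + e / (l + 1)" using rho_nearly_attained[OF e'] .
  have "\<rho> (\<phi> p) (\<phi> q) \<le> l * control_length 0 1 u w"
    using rho_le_control_length_unit[OF controlled_curve_map[OF 1(1) lin phi X Y]] 1
    by (simp add: control_length_map[OF l])
  also have "\<dots> \<le> l * (\<rho> p q + e / (l + 1))" using 1(4) l by (intro mult_left_mono) auto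
  also have "\<dots> \<le> l * \<rho> p q + e" using l \<open>e > 0\<close> by (simp add: field_simps)
  finally show "\<rho> (\<phi> p) (\<phi> q) \<le> l * \<rho> p q + e" .
qed

lemma rho_left_invariant [simp]: "\<rho> (g \<cdot>\<^sub>H p) (g \<cdot>\<^sub>H q) = \<rho> p q"
proof -
  have le: "\<rho> (g \<cdot>\<^sub>H p) (g \<cdot>\<^sub>H q) \<le> \<rho> p q" for g p q
  proof -
    have "\<rho> (g \<cdot>\<^sub>H p) (g \<cdot>\<^sub>H q) \<le> 1 * \<rho> p q"
    proof (rule rho_map_le[OF bounded_linear_left_linear[of g], where \<alpha> = 1 and \<beta> = 0])
      show "g \<cdot>\<^sub>H p = g + left_linear g p" for p by (rule heis_mult_left_linear)
      show "left_linear g (X_field p) = 1 *\<^sub>R X_field (g \<cdot>\<^sub>H p) + 0 *\<^sub>R Y_field (g \<cdot>\<^sub>H p)"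
        "left_linear g (Y_field p) = - 0 *\<^sub>R X_field (g \<cdot>\<^sub>H p) + 1 *\<^sub>R Y_field (g \<cdot>\<^sub>H p)" for p
        by (simp_all add: left_linear_def X_field_eq Y_field_eq heis_mult_left_linear)
    qed auto
    then show ?thesis by simp
  qed
  have "\<rho> p q \<le> \<rho> (g \<cdot>\<^sub>H p) (g \<cdot>\<^sub>H q)"
    using le[of "- g" "g \<cdot>\<^sub>H p" "g \<cdot>\<^sub>H q"] by simp
  with le show ?thesis by (simp add: antisym)
qed

lemma rho_dil: "l \<ge> 0 \<Longrightarrow> \<rho> (dil l p) (dil l q) = l * \<rho> p q"
proof -
  have le: "\<rho> (dil l p) (dil l q) \<le> l * \<rho> p q" if "l \<ge> 0" for l p q
    by (rule rho_map_le[OF bounded_linear_dil[of l], where g = 0 and \<alpha> = l and \<beta> = 0])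
      (use that in \<open>simp_all add: dil_def X_field_eq Y_field_eq power2_eq_square\<close>)
  assume l: "l \<ge> 0"
  show ?thesis
  proof (cases "l = 0")
    case True
    then show ?thesis using le[of 0 p q] rho_nonneg[of "dil 0 p" "dil 0 q"] by simp
  next
    case False
    then have "dil (1 / l) (dil l p) = p" for p by (simp add: dil_def power2_eq_square)
    then have "\<rho> p q \<le> 1 / l * \<rho> (dil l p) (dil l q)"
      using le[of "1 / l" "dil l p" "dil l q"] l by simp
    then have "l * \<rho> p q \<le> \<rho> (dil l p) (dil l q)" using False l by (simp add: field_simps)
    with le[OF l] show ?thesis by (simp add: antisym)
  qed
qed

lemma rot_inverse: "a\<^sup>2 + b\<^sup>2 = 1 \<Longrightarrow> rot a (- b) (rot a b p) = p"
proof -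
  assume ab: "a\<^sup>2 + b\<^sup>2 = 1"
  have "rot a (- b) (rot a b p) = ((a\<^sup>2 + b\<^sup>2) * fst p, (a\<^sup>2 + b\<^sup>2) * fst (snd p), snd (snd p))"
    by (simp add: rot_def algebra_simps power2_eq_square)
  then show ?thesis by (simp add: ab)
qed

lemma rho_rot: "a\<^sup>2 + b\<^sup>2 = 1 \<Longrightarrow> \<rho> (rot a b p) (rot a b q) = \<rho> p q"
proof -
  have le: "\<rho> (rot a b p) (rot a b q) \<le> \<rho> p q" if ab: "a\<^sup>2 + b\<^sup>2 = 1" for a b p q
  proof -
    have "\<rho> (rot a b p) (rot a b q) \<le> 1 * \<rho> p q"
    proof (rule rho_map_le[OF bounded_linear_rot[of a b], where g = 0 and \<alpha> = a and \<beta> = b])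
      fix p :: heis
      have y: "a * (2 * (b * fst p) + 2 * (a * fst (snd p))) + b * (2 * (b * fst (snd p)) - 2 * (a * fst p)) =
          2 * ((a\<^sup>2 + b\<^sup>2) * fst (snd p))"
        and x: "a * (2 * (b * fst (snd p)) - 2 * (a * fst p)) - b * (2 * (b * fst p) + 2 * (a * fst (snd p))) =
          - (2 * ((a\<^sup>2 + b\<^sup>2) * fst p))"
        by (simp_all add: power2_eq_square algebra_simps)
      show "rot a b (X_field p) = a *\<^sub>R X_field (rot a b p) + b *\<^sub>R Y_field (rot a b p)"
       "rot a b (Y_field p) = - b *\<^sub>R X_field (rot a b p) + a *\<^sub>R Y_field (rot a b p)"
        by (simp_all add: rot_def X_field_eq Y_field_eq x y ab)
    qed (use ab in auto)
    then show ?thesis by simp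
  qed
  assume ab: "a\<^sup>2 + b\<^sup>2 = 1"
  then have "\<rho> p q \<le> \<rho> (rot a b p) (rot a b q)"
    using le[of a "- b" "rot a b p" "rot a b q"] by (simp add: rot_inverse)
  with le[OF ab] show ?thesis by (simp add: antisym)
qed

definition gauge_norm :: "heis \<Rightarrow> real" where
  "gauge_norm p = \<rho> 0 p"

lemma rho_eq_gauge_norm: "\<rho> p q = gauge_norm (- p \<cdot>\<^sub>H q)"
  using rho_left_invariant[of "- p" p q] by (simp add: gauge_norm_def)

lemma gauge_norm_nonneg [simp]: "gauge_norm p \<ge> 0" by (simp add: gauge_norm_def)

lemma gauge_norm_uminus [simp]: "gauge_norm (- p) = gauge_norm p"
  using rho_left_invariant[of p 0 "- p"] by (simp add: gauge_norm_def rho_commute)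

lemma gauge_norm_mult_le: "gauge_norm (p \<cdot>\<^sub>H q) \<le> gauge_norm p + gauge_norm q"
  using rho_triangle[of 0 "p \<cdot>\<^sub>H q" p] rho_left_invariant[of p 0 q] by (simp add: gauge_norm_def)

lemma gauge_norm_dil: "l \<ge> 0 \<Longrightarrow> gauge_norm (dil l p) = l * gauge_norm p"
  using rho_dil[of l 0 p] by (simp add: gauge_norm_def dil_def zero_prod_def)

lemma gauge_norm_rot: "a\<^sup>2 + b\<^sup>2 = 1 \<Longrightarrow> gauge_norm (rot a b p) = gauge_norm p"
  using rho_rot[of a b 0 p] by (simp add: gauge_norm_def rot_def zero_prod_def)

lemma gauge_norm_horizontal_le: "gauge_norm (a, b, 0) \<le> sqrt (a\<^sup>2 + b\<^sup>2)"
  using rho_le_control_length_unit[OF controlled_line(1)[of 0 a b]] controlled_line(2)[of a b]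
  by (simp add: gauge_norm_def zero_prod_def)

lemma gauge_norm_zero [simp]: "gauge_norm 0 = 0"
  by (rule antisym) (use gauge_norm_horizontal_le[of 0 0] in \<open>simp_all add: zero_prod_def\<close>)

lemma rho_self [simp]: "\<rho> p p = 0" by (simp add: rho_eq_gauge_norm)

section \<open>Comparison with the Koranyi gauge\<close>

lemma sqrt_lipschitz:
  assumes "m > 0" "A \<ge> m" "B \<ge> m"
  shows "\<bar>sqrt A - sqrt B\<bar> \<le> \<bar>A - B\<bar> / sqrt m"
proof -
  have "(sqrt A - sqrt B) * (sqrt A + sqrt B) = A - B"
    using assms by (simp add: algebra_simps)
  then have "\<bar>A - B\<bar> = \<bar>(sqrt A - sqrt B) * (sqrt A + sqrt B)\<bar>" by (simp only:)
  moreover have "sqrt A + sqrt B \<ge> 0" using assms by simp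
  ultimately have "\<bar>A - B\<bar> = \<bar>sqrt A - sqrt B\<bar> * (sqrt A + sqrt B)"
    by (simp only: abs_mult abs_of_nonneg)
  moreover have "sqrt m \<le> sqrt A + sqrt B"
    using assms real_sqrt_le_mono[of m A] real_sqrt_ge_zero[of B] by linarith
  ultimately have "\<bar>sqrt A - sqrt B\<bar> * sqrt m \<le> \<bar>A - B\<bar>"
    by (simp add: mult_left_mono)
  then show ?thesis using assms by (simp add: pos_le_divide_eq)
qed

definition koranyi4 :: "heis \<Rightarrow> real" where
  "koranyi4 p = ((fst p)\<^sup>2 + (fst (snd p))\<^sup>2)\<^sup>2 + (snd (snd p))\<^sup>2"

lemma koranyi4_nonneg [simp]: "koranyi4 p \<ge> 0" by (simp add: koranyi4_def)

text \<open>The horizontal gradient of the fourth root of \<open>koranyi4\<close> has norm at most \<open>1\<close>. This is a pointwise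
  inequality by Cauchy-Schwarz, since \<open>(x u + y w, y u - x w)\<close> has norm \<open>|(x, y)| |(u, w)|\<close>.\<close>

lemma koranyi_gradient_bound:
  fixes x y t u w \<epsilon> :: real
  defines "P \<equiv> (x\<^sup>2 + y\<^sup>2)\<^sup>2 + t\<^sup>2 + \<epsilon>"
  assumes "\<epsilon> > 0"
  shows "\<bar>4 * (x\<^sup>2 + y\<^sup>2) * (x * u + y * w) + 4 * t * (y * u - x * w)\<bar> \<le>
    4 * sqrt P * sqrt (sqrt P) * sqrt (u\<^sup>2 + w\<^sup>2)"
proof -
  define R where "R = sqrt P"
  have P0: "P > 0" using assms by (simp add: P_def add_nonneg_pos)
  have R: "R > 0" "R\<^sup>2 = P" using P0 by (simp_all add: R_def)
  have xyR: "x\<^sup>2 + y\<^sup>2 \<le> R"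
    unfolding R_def P_def by (rule real_le_rsqrt) (use assms in auto)
  let ?a = "x\<^sup>2 + y\<^sup>2" and ?b = "x * u + y * w" and ?c = "y * u - x * w"
  have "(?a * ?b + t * ?c)\<^sup>2 \<le> (?a\<^sup>2 + t\<^sup>2) * (?b\<^sup>2 + ?c\<^sup>2)"
  proof -
    have "(?a\<^sup>2 + t\<^sup>2) * (?b\<^sup>2 + ?c\<^sup>2) - (?a * ?b + t * ?c)\<^sup>2 = (?a * ?c - t * ?b)\<^sup>2"
      by (simp add: power2_eq_square algebra_simps)
    with zero_le_power2[of "?a * ?c - t * ?b"] show ?thesis by linarith
  qed
  also have "?b\<^sup>2 + ?c\<^sup>2 = ?a * (u\<^sup>2 + w\<^sup>2)"
    by (simp add: power2_eq_square algebra_simps)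
  also have "(?a\<^sup>2 + t\<^sup>2) * (?a * (u\<^sup>2 + w\<^sup>2)) \<le> R\<^sup>2 * (R * (u\<^sup>2 + w\<^sup>2))"
    using xyR R assms by (intro mult_mono mult_right_mono) (auto simp: P_def)
  also have "\<dots> = (R * sqrt R * sqrt (u\<^sup>2 + w\<^sup>2))\<^sup>2"
    using R by (simp add: power_mult_distrib algebra_simps)
  finally have "\<bar>?a * ?b + t * ?c\<bar>\<^sup>2 \<le> (R * sqrt R * sqrt (u\<^sup>2 + w\<^sup>2))\<^sup>2"
    by (simp only: power2_abs)
  then have "\<bar>?a * ?b + t * ?c\<bar> \<le> R * sqrt R * sqrt (u\<^sup>2 + w\<^sup>2)"
    by (rule power2_le_imp_le) (use R in simp)
  moreover have "4 * ?a * ?b + 4 * t * ?c = 4 * (?a * ?b + t * ?c)" by (simp add: algebra_simps)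
  then have "\<bar>4 * ?a * ?b + 4 * t * ?c\<bar> = 4 * \<bar>?a * ?b + t * ?c\<bar>"
    by (simp only: abs_mult abs_numeral)
  ultimately show ?thesis unfolding R_def by (simp only: mult.assoc)
qed

lemma controlled_curve_components:
  assumes c: "controlled_curve a b \<gamma> u w S"
  shows "abs_continuous_on_interval a b (\<lambda>s. fst (\<gamma> s))" "abs_continuous_on_interval a b (\<lambda>s. fst (snd (\<gamma> s)))"
    "abs_continuous_on_interval a b (\<lambda>s. snd (snd (\<gamma> s)))"
    and "s \<in> {a..b} - S \<Longrightarrow> ((\<lambda>s. fst (\<gamma> s)) has_real_derivative u s) (at s within {a..b})"
    and "s \<in> {a..b} - S \<Longrightarrow> ((\<lambda>s. fst (snd (\<gamma> s))) has_real_derivative w s) (at s within {a..b})"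
    and "s \<in> {a..b} - S \<Longrightarrow> ((\<lambda>s. snd (snd (\<gamma> s))) has_real_derivative
      2 * fst (snd (\<gamma> s)) * u s - 2 * fst (\<gamma> s) * w s) (at s within {a..b})"
proof -
  have ac: "abs_continuous_on_interval a b \<gamma>" using c by (simp add: controlled_curve_def)
  have d: "dist (fst p) (fst q) \<le> dist p q" "dist (fst (snd p)) (fst (snd q)) \<le> dist p q"
    "dist (snd (snd p)) (snd (snd q)) \<le> dist p q" for p q :: heis
    using dist_fst_le[of p q] dist_snd_le[of p q] dist_fst_le[of "snd p" "snd q"] dist_snd_le[of "snd p" "snd q"]
    by linarith+
  show "abs_continuous_on_interval a b (\<lambda>s. fst (\<gamma> s))" "abs_continuous_on_interval a b (\<lambda>s. fst (snd (\<gamma> s)))"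
    "abs_continuous_on_interval a b (\<lambda>s. snd (snd (\<gamma> s)))"
    by (rule abs_continuous_lipschitz_compose[OF ac, where C = 1]; use d in simp)+
  assume "s \<in> {a..b} - S"
  then have v: "(\<gamma> has_vector_derivative (u s, w s, 2 * fst (snd (\<gamma> s)) * u s - 2 * fst (\<gamma> s) * w s)) (at s within {a..b})"
    using c by (simp add: controlled_curve_def XY_field_eq)
  show "((\<lambda>s. fst (\<gamma> s)) has_real_derivative u s) (at s within {a..b})"
    using bounded_linear.has_vector_derivative[OF bounded_linear_fst v]
    by (simp add: has_real_derivative_iff_has_vector_derivative)
  note v2 = bounded_linear.has_vector_derivative[OF bounded_linear_snd v]
  show "((\<lambda>s. fst (snd (\<gamma> s))) has_real_derivative w s) (at s within {a..b})"
    using bounded_linear.has_vector_derivative[OF bounded_linear_fst v2]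
    by (simp add: has_real_derivative_iff_has_vector_derivative)
  show "((\<lambda>s. snd (snd (\<gamma> s))) has_real_derivative
      2 * fst (snd (\<gamma> s)) * u s - 2 * fst (\<gamma> s) * w s) (at s within {a..b})"
    using bounded_linear.has_vector_derivative[OF bounded_linear_snd v2]
    by (simp add: has_real_derivative_iff_has_vector_derivative)
qed

lemma controlled_curve_growth:
  fixes g :: "real \<Rightarrow> real"
  assumes c: "controlled_curve 0 1 \<gamma> u w S" and ac: "abs_continuous_on_interval 0 1 g"
    and d: "\<And>s. s \<in> {0..1} - S \<Longrightarrow> (g has_real_derivative g' s) (at s within {0..1})"
    and le: "\<And>s. s \<in> {0..1} - S \<Longrightarrow> g' s \<le> C * sqrt ((u s)\<^sup>2 + (w s)\<^sup>2)"
  shows "g 1 - g 0 \<le> C * control_length 0 1 u w"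
proof -
  define g'' where "g'' = (\<lambda>s. if s \<in> S then C * sqrt ((u s)\<^sup>2 + (w s)\<^sup>2) else g' s)"
  have "(g'' has_integral (g 1 - g 0)) {0..1}"
    by (rule abs_continuous_has_integral[OF _ ac])
      (use c d in \<open>auto simp: controlled_curve_def g''_def has_real_derivative_iff_has_vector_derivative\<close>)
  moreover have "((\<lambda>s. C * sqrt ((u s)\<^sup>2 + (w s)\<^sup>2)) has_integral C * control_length 0 1 u w) {0..1}"
    using controlled_curve_has_integral[OF c] by (intro has_integral_mult_right) simp
  ultimately show ?thesis
    by (rule has_integral_le) (use le in \<open>auto simp: g''_def\<close>)
qed

text \<open>Along a horizontal curve the Koranyi gauge grows at most as fast as the length. The gauge is not
  differentiable at the origin; adding a constant \<open>\<epsilon>\<close> to its fourth power removes the singularity.\<close>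

theorem koranyi_le_gauge_norm: "koranyi4 p \<le> gauge_norm p ^ 4"
proof -
  have "sqrt (sqrt (koranyi4 p)) \<le> gauge_norm p"
  proof (rule field_le_epsilon)
    fix e :: real assume "e > 0"
    then have "e / 2 > 0" by simp
    obtain \<gamma> u w S where c: "controlled_curve 0 1 \<gamma> u w S" "\<gamma> 0 = 0" "\<gamma> 1 = p"
      "control_length 0 1 u w < \<rho> 0 p + e / 2" using rho_nearly_attained[OF \<open>e / 2 > 0\<close>] .
    define \<epsilon> where "\<epsilon> = (e / 2) ^ 4"
    have "\<epsilon> > 0" using \<open>e > 0\<close> by (simp add: \<epsilon>_def)
    define P where "P = (\<lambda>s. koranyi4 (\<gamma> s) + \<epsilon>)"
    have P: "P s \<ge> \<epsilon>" for s by (simp add: P_def)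
    note comp = controlled_curve_components[OF c(1)]
    have acP: "abs_continuous_on_interval 0 1 P"
      unfolding P_def koranyi4_def power2_eq_square
      by (intro abs_continuous_add abs_continuous_mult comp(1-3) abs_continuous_lipschitz[where C = 0]) auto
    have acR: "abs_continuous_on_interval 0 1 (\<lambda>s. sqrt (P s))"
      by (rule abs_continuous_lipschitz_compose[OF acP, where C = "1 / sqrt \<epsilon>"])
        (use sqrt_lipschitz[OF \<open>\<epsilon> > 0\<close> P P] in \<open>simp add: dist_real_def\<close>)
    have R: "sqrt (P s) \<ge> sqrt \<epsilon>" for s using P by (rule real_sqrt_le_mono)
    have ac: "abs_continuous_on_interval 0 1 (\<lambda>s. sqrt (sqrt (P s)))"
      by (rule abs_continuous_lipschitz_compose[OF acR, where C = "1 / sqrt (sqrt \<epsilon>)"])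
        (use sqrt_lipschitz[OF _ R R] \<open>\<epsilon> > 0\<close> in \<open>simp add: dist_real_def\<close>)
    define P' where "P' = (\<lambda>s. 4 * ((fst (\<gamma> s))\<^sup>2 + (fst (snd (\<gamma> s)))\<^sup>2) * (fst (\<gamma> s) * u s + fst (snd (\<gamma> s)) * w s) +
       4 * snd (snd (\<gamma> s)) * (fst (snd (\<gamma> s)) * u s - fst (\<gamma> s) * w s))"
    have "sqrt (sqrt (P 1)) - sqrt (sqrt (P 0)) \<le> 1 * control_length 0 1 u w"
    proof (rule controlled_curve_growth[OF c(1) ac])
      fix s assume s: "s \<in> {0..1} - S"
      note dc = comp(4-6)[OF s]
      have Ps: "P s > 0" using P[of s] \<open>\<epsilon> > 0\<close> by linarith
      have dP: "(P has_real_derivative P' s) (at s within {0..1})"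
        unfolding P_def koranyi4_def
        by (rule derivative_eq_intros dc refl | simp add: P'_def algebra_simps power2_eq_square)+
      show "((\<lambda>s. sqrt (sqrt (P s))) has_real_derivative P' s / (4 * sqrt (P s) * sqrt (sqrt (P s)))) (at s within {0..1})"
        by (rule derivative_eq_intros dP refl | use Ps in \<open>simp add: field_simps\<close>)+
      have "\<bar>P' s\<bar> \<le> 4 * sqrt (P s) * sqrt (sqrt (P s)) * sqrt ((u s)\<^sup>2 + (w s)\<^sup>2)"
        unfolding P'_def P_def koranyi4_def by (rule koranyi_gradient_bound[OF \<open>\<epsilon> > 0\<close>])
      then have "P' s \<le> sqrt ((u s)\<^sup>2 + (w s)\<^sup>2) * (4 * sqrt (P s) * sqrt (sqrt (P s)))"
        by (simp add: algebra_simps)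
      then show "P' s / (4 * sqrt (P s) * sqrt (sqrt (P s))) \<le> 1 * sqrt ((u s)\<^sup>2 + (w s)\<^sup>2)"
        using Ps by (simp add: pos_divide_le_eq)
    qed
    moreover have "sqrt (sqrt (P 0)) = e / 2"
    proof -
      have "P 0 = ((e / 2)\<^sup>2)\<^sup>2" by (simp add: P_def c(2) koranyi4_def \<epsilon>_def)
      then show ?thesis using \<open>e > 0\<close> by (simp only: real_sqrt_abs) simp
    qed
    moreover have "sqrt (sqrt (koranyi4 p)) \<le> sqrt (sqrt (P 1))"
      using \<open>\<epsilon> > 0\<close> by (intro real_sqrt_le_mono) (simp add: P_def c(3))
    ultimately show "sqrt (sqrt (koranyi4 p)) \<le> gauge_norm p + e"
      using c(4) unfolding gauge_norm_def by linarith
  qed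
  then have "sqrt (sqrt (koranyi4 p)) ^ 4 \<le> gauge_norm p ^ 4" by (intro power_mono) auto
  moreover have "sqrt (sqrt (koranyi4 p)) ^ 4 = ((sqrt (sqrt (koranyi4 p)))\<^sup>2)\<^sup>2"
    by (simp only: power_mult[symmetric]) simp
  ultimately show ?thesis by simp
qed

lemma horizontal_sq_le_gauge_norm: "x\<^sup>2 + y\<^sup>2 \<le> (gauge_norm (x, y, t))\<^sup>2"
proof -
  have "(x\<^sup>2 + y\<^sup>2)\<^sup>2 \<le> ((gauge_norm (x, y, t))\<^sup>2)\<^sup>2"
    using koranyi_le_gauge_norm[of "(x, y, t)"] by (simp add: koranyi4_def) (smt (verit) zero_le_power2)
  then show ?thesis by (rule power2_le_imp_le) simp
qed

lemma abs_fst_le_gauge_norm: "\<bar>fst p\<bar> \<le> gauge_norm p"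
  and abs_snd_le_gauge_norm: "\<bar>fst (snd p)\<bar> \<le> gauge_norm p"
proof -
  have "(fst p)\<^sup>2 + (fst (snd p))\<^sup>2 \<le> (gauge_norm p)\<^sup>2"
    using horizontal_sq_le_gauge_norm[of "fst p" "fst (snd p)" "snd (snd p)"] by simp
  then have "(fst p)\<^sup>2 \<le> (gauge_norm p)\<^sup>2" "(fst (snd p))\<^sup>2 \<le> (gauge_norm p)\<^sup>2"
    by (smt (verit) zero_le_power2)+
  then show "\<bar>fst p\<bar> \<le> gauge_norm p" "\<bar>fst (snd p)\<bar> \<le> gauge_norm p"
    by (simp_all add: abs_le_square_iff[symmetric])
qed

lemma abs_vertical_le_gauge_norm: "\<bar>snd (snd p)\<bar> \<le> (gauge_norm p)\<^sup>2"
proof -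
  have "(snd (snd p))\<^sup>2 \<le> ((gauge_norm p)\<^sup>2)\<^sup>2"
    using koranyi_le_gauge_norm[of p] by (simp add: koranyi4_def) (smt (verit) zero_le_power2)
  then show ?thesis using abs_le_square_iff[of "snd (snd p)" "(gauge_norm p)\<^sup>2"] by simp
qed

section \<open>An upper bound for the gauge norm\<close>

lemma gauge_norm_radial:
  assumes "x\<^sup>2 + y\<^sup>2 = x'\<^sup>2 + y'\<^sup>2"
  shows "gauge_norm (x, y, t) = gauge_norm (x', y', t)"
proof (cases "x\<^sup>2 + y\<^sup>2 = 0")
  case True
  then have "x = 0" "y = 0" "x' = 0" "y' = 0" using assms by (auto simp: sum_power2_eq_zero_iff)
  then show ?thesis by simp
next
  case False
  define r where "r = x\<^sup>2 + y\<^sup>2"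
  define a where "a = (x * x' + y * y') / r"
  define b where "b = (x * y' - y * x') / r"
  have r: "r \<noteq> 0" using False by (simp add: r_def)
  have "(x * x' + y * y')\<^sup>2 + (x * y' - y * x')\<^sup>2 = r * (x'\<^sup>2 + y'\<^sup>2)"
    by (simp add: r_def power2_eq_square algebra_simps)
  also have "\<dots> = r\<^sup>2" using assms by (simp add: r_def power2_eq_square)
  finally have ab: "a\<^sup>2 + b\<^sup>2 = 1"
    using r by (simp add: a_def b_def power_divide flip: add_divide_distrib)
  have "(x * x' + y * y') * x - (x * y' - y * x') * y = r * x'"
    "(x * y' - y * x') * x + (x * x' + y * y') * y = r * y'"
    by (simp_all add: r_def power2_eq_square algebra_simps)
  moreover have "a * x - b * y = ((x * x' + y * y') * x - (x * y' - y * x') * y) / r"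
    "b * x + a * y = ((x * y' - y * x') * x + (x * x' + y * y') * y) / r"
    by (simp_all only: a_def b_def times_divide_eq_left diff_divide_distrib[symmetric] add_divide_distrib[symmetric])
  ultimately have "a * x - b * y = x'" "b * x + a * y = y'"
    using r by simp_all
  then have "rot a b (x, y, t) = (x', y', t)" by (simp add: rot_def)
  then show ?thesis using gauge_norm_rot[OF ab, of "(x, y, t)"] by simp
qed

lemma gauge_norm_flip: "gauge_norm (x, y, t) = gauge_norm (x, y, - t)"
  using gauge_norm_uminus[of "(x, y, t)"] gauge_norm_radial[of "- x" "- y" x y "- t"] by simp

definition vertical_const :: real where
  "vertical_const = gauge_norm (0, 0, 1)"

lemma gauge_norm_vertical: "gauge_norm (0, 0, t) = vertical_const * sqrt \<bar>t\<bar>"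
proof -
  have "gauge_norm (0, 0, \<bar>t\<bar>) = vertical_const * sqrt \<bar>t\<bar>"
    using gauge_norm_dil[of "sqrt \<bar>t\<bar>" "(0, 0, 1)"] by (simp add: dil_def vertical_const_def)
  then show ?thesis using gauge_norm_flip[of 0 0 t] by (auto simp: abs_if split: if_splits)
qed

lemma vertical_const_ge_1: "vertical_const \<ge> 1"
proof -
  have "1 ^ 2 \<le> vertical_const ^ 2"
    using abs_vertical_le_gauge_norm[of "(0, 0, 1)"] by (simp add: vertical_const_def)
  then show ?thesis by (rule power2_le_imp_le) (simp add: vertical_const_def)
qed

lemma vertical_const_le_2: "vertical_const \<le> 2"
proof -
  \<comment> \<open>a square loop with sides \<open>1 / 2\<close>\<close>
  have "vertical_const = gauge_norm ((((0, 1/2, 0) \<cdot>\<^sub>H (1/2, 0, 0)) \<cdot>\<^sub>H (0, -1/2, 0)) \<cdot>\<^sub>H (-1/2, 0, 0))"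
    by (simp add: vertical_const_def)
  then have "vertical_const \<le> gauge_norm (0, 1/2, 0) + gauge_norm (1/2, 0, 0) + gauge_norm (0, -1/2, 0)
      + gauge_norm (-1/2, 0, 0)"
    using gauge_norm_mult_le[of "((0, 1/2, 0) \<cdot>\<^sub>H (1/2, 0, 0)) \<cdot>\<^sub>H (0, -1/2, 0)" "(-1/2, 0, 0)"]
      gauge_norm_mult_le[of "(0, 1/2, 0) \<cdot>\<^sub>H (1/2, 0, 0)" "(0, -1/2, 0)"]
      gauge_norm_mult_le[of "(0, 1/2, 0)" "(1/2, 0, 0)"]
    by linarith
  also have "\<dots> \<le> 1/2 + 1/2 + 1/2 + 1/2"
    using gauge_norm_horizontal_le[of 0 "1/2"] gauge_norm_horizontal_le[of "1/2" 0]
      gauge_norm_horizontal_le[of 0 "-1/2"] gauge_norm_horizontal_le[of "-1/2" 0]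
    by (intro add_mono) simp_all
  finally show ?thesis by simp
qed

text \<open>A loop that encloses a given area must stray from its starting point: its area is at most half of the
  integral of the distance to that point.\<close>

lemma loop_has_far_point:
  assumes "t > 0" "e > 0"
  obtains p where "gauge_norm p + gauge_norm (- p \<cdot>\<^sub>H (0, 0, t)) \<le> vertical_const * sqrt t + e"
    "t \<le> 2 * sqrt ((fst p)\<^sup>2 + (fst (snd p))\<^sup>2) * (vertical_const * sqrt t + e)"
proof -
  obtain \<gamma> u w S where c: "controlled_curve 0 1 \<gamma> u w S" "\<gamma> 0 = 0" "\<gamma> 1 = (0, 0, t)"
      "control_length 0 1 u w < \<rho> 0 (0, 0, t) + e" using rho_nearly_attained[OF \<open>e > 0\<close>] .
  note comp = controlled_curve_components[OF c(1)]
  define m where "m = (\<lambda>s. sqrt ((fst (\<gamma> s))\<^sup>2 + (fst (snd (\<gamma> s)))\<^sup>2))"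
  have "continuous_on {0..1} m"
    unfolding m_def by (intro continuous_intros comp(1,2)[THEN abs_continuous_imp_continuous])
  then obtain s where s: "s \<in> {0..1}" and max: "\<And>s'. s' \<in> {0..1} \<Longrightarrow> m s' \<le> m s"
    using continuous_attains_sup[of "{0..1::real}" m] by (auto simp del: atLeastAtMost_iff)
  have m0: "m s \<ge> 0" for s by (simp add: m_def)
  have "snd (snd (\<gamma> 1)) - snd (snd (\<gamma> 0)) \<le> (2 * m s) * control_length 0 1 u w"
  proof (rule controlled_curve_growth[OF c(1) comp(3) comp(6)])
    fix s' assume s': "s' \<in> {0..1} - S"
    let ?x = "fst (\<gamma> s')" and ?y = "fst (snd (\<gamma> s'))"
    have "(?y * u s' - ?x * w s')\<^sup>2 \<le> (?x\<^sup>2 + ?y\<^sup>2) * ((u s')\<^sup>2 + (w s')\<^sup>2)"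
    proof -
      have "(?x\<^sup>2 + ?y\<^sup>2) * ((u s')\<^sup>2 + (w s')\<^sup>2) - (?y * u s' - ?x * w s')\<^sup>2 = (?x * u s' + ?y * w s')\<^sup>2"
        by (simp add: power2_eq_square algebra_simps)
      with zero_le_power2[of "?x * u s' + ?y * w s'"] show ?thesis by linarith
    qed
    then have "?y * u s' - ?x * w s' \<le> m s' * sqrt ((u s')\<^sup>2 + (w s')\<^sup>2)"
      unfolding m_def real_sqrt_mult[symmetric] by (rule real_le_rsqrt)
    also have "\<dots> \<le> m s * sqrt ((u s')\<^sup>2 + (w s')\<^sup>2)"
      using max[of s'] s' by (intro mult_right_mono) auto
    finally show "2 * ?y * u s' - 2 * ?x * w s' \<le> 2 * m s * sqrt ((u s')\<^sup>2 + (w s')\<^sup>2)"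
      by simp
  qed
  then have t: "t \<le> 2 * m s * control_length 0 1 u w" by (simp add: c(2,3))
  have "\<rho> 0 (0, 0, t) = vertical_const * sqrt t"
    using gauge_norm_vertical[of t] \<open>t > 0\<close> by (simp add: gauge_norm_def)
  then have L: "control_length 0 1 u w \<le> vertical_const * sqrt t + e" using c(4) by simp
  have "m s > 0" using t \<open>t > 0\<close> m0[of s] by (cases "m s = 0") auto
  then have "s \<noteq> 0" "s \<noteq> 1" using c(2,3) by (auto simp: m_def)
  then have "\<rho> (\<gamma> 0) (\<gamma> s) + \<rho> (\<gamma> s) (\<gamma> 1) \<le> control_length 0 1 u w"
    using s by (intro rho_split_curve[OF c(1)]) auto
  then have "gauge_norm (\<gamma> s) + gauge_norm (- \<gamma> s \<cdot>\<^sub>H (0, 0, t)) \<le> control_length 0 1 u w"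
    by (simp add: c(2,3) rho_eq_gauge_norm)
  moreover have "2 * m s * control_length 0 1 u w \<le> 2 * m s * (vertical_const * sqrt t + e)"
    using L m0 by (intro mult_left_mono) auto
  ultimately show ?thesis
    using t L by (intro that[of "\<gamma> s"]) (simp_all add: m_def)
qed

text \<open>The horizontal vector \<open>v\<close> is inserted into a nearly optimal loop at a point \<open>p\<close> far from its
  start. This costs \<open>|v|\<close> and moves the end point by \<open>v\<close>, but it also adds the area that is swept by the
  translation of the second half of the loop along \<open>v\<close>. The angle between \<open>v\<close> and \<open>p\<close> adjusts that area, and
  the loop itself only has to enclose the rest.\<close>

lemma gauge_norm_le_if_sq_less:
  assumes t: "t > 0" and r: "r \<ge> 0" and l: "l > 0" and lt: "r\<^sup>2 + vertical_const\<^sup>2 * t < l\<^sup>2"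
  shows "gauge_norm (r, 0, t) \<le> l"
proof -
  let ?c = vertical_const
  have c: "?c \<ge> 1" by (rule vertical_const_ge_1)
  have "0 < ?c\<^sup>2 * t" using c t by simp
  then have "r\<^sup>2 < l\<^sup>2" using lt by linarith
  then have rl: "r < l" using l by (simp add: power_less_imp_less_base)
  show ?thesis
  proof (cases "?c * sqrt t \<le> l - r")
    case True
    have "(r, 0, t) = (r, 0, 0) \<cdot>\<^sub>H (0, 0, t)" by simp
    then have "gauge_norm (r, 0, t) \<le> gauge_norm (r, 0, 0) + gauge_norm (0, 0, t)"
      using gauge_norm_mult_le[of "(r, 0, 0)" "(0, 0, t)"] by simp
    also have "\<dots> \<le> r + ?c * sqrt t"
      using gauge_norm_horizontal_le[of r 0] r t by (simp add: gauge_norm_vertical)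
    finally show ?thesis using True by simp
  next
    case False
    have "r > 0"
    proof (rule ccontr)
      assume "\<not> r > 0"
      then have "r = 0" using r by simp
      then have "(?c * sqrt t)\<^sup>2 < l\<^sup>2" using lt t by (simp add: power_mult_distrib)
      then have "?c * sqrt t < l" using l by (simp add: power_less_imp_less_base)
      then show False using False \<open>r = 0\<close> by simp
    qed
    \<comment> \<open>the strict inequality \<open>\<theta> < 1\<close> pays for the error \<open>e\<close> of the nearly optimal loop\<close>
    define \<theta> where "\<theta> = ?c\<^sup>2 * t / (l\<^sup>2 - r\<^sup>2)"
    have lr: "l\<^sup>2 - r\<^sup>2 > 0" using \<open>r\<^sup>2 < l\<^sup>2\<close> by simp
    have \<theta>: "0 < \<theta>" "\<theta> < 1" using \<open>0 < ?c\<^sup>2 * t\<close> lr lt by (auto simp: \<theta>_def)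
    define e where "e = (l - r) * (1 - \<theta>) / 2"
    have e: "e > 0" "e < l - r"
    proof -
      show "e > 0" using rl \<theta> by (simp add: e_def)
      have "(l - r) * (1 - \<theta>) < (l - r) * 2" using rl \<theta> by (intro mult_strict_left_mono) auto
      then show "e < l - r" by (simp add: e_def)
    qed
    \<comment> \<open>the height that a loop of length \<open>l - r - e\<close> reaches\<close>
    define t1 where "t1 = ((l - r - e) / ?c)\<^sup>2"
    have t1: "t1 > 0" using e c by (simp add: t1_def)
    have st1: "?c * sqrt t1 + e = l - r" using e c by (simp add: t1_def)
    have "sqrt t1 < sqrt t"
    proof -
      have "?c * sqrt t1 < ?c * sqrt t" using st1 False e by linarith
      then show ?thesis using c by simp
    qed
    then have "t1 < t" by simp
    obtain p where p: "gauge_norm p + gauge_norm (- p \<cdot>\<^sub>H (0, 0, t1)) \<le> l - r"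
      "t1 \<le> 2 * sqrt ((fst p)\<^sup>2 + (fst (snd p))\<^sup>2) * (l - r)"
      using loop_has_far_point[OF t1 \<open>e > 0\<close>] unfolding st1 by blast
    obtain x y s where xy: "p = (x, y, s)" by (cases p)
    define m where "m = sqrt (x\<^sup>2 + y\<^sup>2)"
    have m: "t1 \<le> 2 * m * (l - r)" using p(2) by (simp add: xy m_def)
    have m0: "m > 0"
    proof (rule ccontr)
      assume "\<not> m > 0"
      then have "m = 0" by (simp add: m_def not_less sum_power2_le_zero_iff)
      then show False using m t1 by simp
    qed
    have mm: "m\<^sup>2 = x\<^sup>2 + y\<^sup>2" by (simp add: m_def)
    \<comment> \<open>the sine of the angle between \<open>v\<close> and \<open>p\<close> for which the inserted segment adds the height \<open>t - t1\<close>\<close>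
    define k where "k = (t - t1) / (4 * r * m)"
    have "k \<ge> 0" using \<open>t1 < t\<close> \<open>r > 0\<close> m0 by (simp add: k_def)
    have "k \<le> 1"
    proof -
      have "4 * \<theta> \<le> (1 + \<theta>)\<^sup>2"
        using zero_le_power2[of "1 - \<theta>"] by (simp add: power2_eq_square algebra_simps)
      then have "\<theta> \<le> ((1 + \<theta>) / 2)\<^sup>2" by (simp add: power_divide)
      then have "\<theta> * (l - r)\<^sup>2 \<le> ((1 + \<theta>) / 2)\<^sup>2 * (l - r)\<^sup>2" by (rule mult_right_mono) simp
      also have "\<dots> = (l - r - e)\<^sup>2" by (simp add: e_def power_mult_distrib[symmetric] field_simps)
      also have "\<dots> = ?c\<^sup>2 * t1" using c by (simp add: t1_def power_divide)
      finally have "\<theta> * (l - r)\<^sup>2 \<le> ?c\<^sup>2 * t1" .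
      moreover have "\<theta> * (l\<^sup>2 - r\<^sup>2) = ?c\<^sup>2 * t" using lr by (simp add: \<theta>_def)
      moreover have "\<theta> * (l - r)\<^sup>2 * (l + r) = \<theta> * (l\<^sup>2 - r\<^sup>2) * (l - r)"
        by (simp add: power2_eq_square algebra_simps)
      ultimately have "?c\<^sup>2 * t * (l - r) \<le> ?c\<^sup>2 * t1 * (l + r)"
        using l r by (metis add_nonneg_nonneg less_imp_le mult_right_mono)
      then have "?c\<^sup>2 * (t * (l - r)) \<le> ?c\<^sup>2 * (t1 * (l + r))" by (simp add: mult.assoc)
      then have "t * (l - r) \<le> t1 * (l + r)" using c by (simp add: mult_le_cancel_left_pos)
      then have "(t - t1) * (l - r) \<le> 2 * r * t1" by (simp add: algebra_simps)
      also have "\<dots> \<le> 2 * r * (2 * m * (l - r))" using m r by (intro mult_left_mono) auto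
      finally have "(t - t1) * (l - r) \<le> (4 * r * m) * (l - r)" by (simp add: algebra_simps)
      then have "t - t1 \<le> 4 * r * m" using rl by simp
      then show ?thesis using \<open>r > 0\<close> m0 by (simp add: k_def)
    qed
    define q where "q = sqrt (1 - k\<^sup>2)"
    have kq: "k\<^sup>2 + q\<^sup>2 = 1" using \<open>k \<le> 1\<close> \<open>k \<ge> 0\<close> by (simp add: q_def power_le_one)
    define a where "a = r / m * (k * y + q * x)"
    define b where "b = r / m * (q * y - k * x)"
    have ab: "a\<^sup>2 + b\<^sup>2 = r\<^sup>2"
    proof -
      have "(k * y + q * x)\<^sup>2 + (q * y - k * x)\<^sup>2 = (k\<^sup>2 + q\<^sup>2) * (x\<^sup>2 + y\<^sup>2)"
        by (simp add: power2_eq_square algebra_simps)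
      then have "(k * y + q * x)\<^sup>2 + (q * y - k * x)\<^sup>2 = m\<^sup>2" by (simp add: kq mm)
      moreover have "a\<^sup>2 + b\<^sup>2 = (r / m)\<^sup>2 * ((k * y + q * x)\<^sup>2 + (q * y - k * x)\<^sup>2)"
        by (simp only: a_def b_def power_mult_distrib distrib_left[of "(r / m)\<^sup>2"])
      ultimately show ?thesis using m0 by (simp add: power_divide)
    qed
    have "y * a - x * b = r / m * (k * (x\<^sup>2 + y\<^sup>2))"
      by (simp add: a_def b_def power2_eq_square algebra_simps)
    also have "\<dots> = r / m * (k * m\<^sup>2)" by (simp only: mm)
    also have "\<dots> = k * r * m" using m0 by (simp add: power2_eq_square)
    finally have area: "4 * (y * a - x * b) = t - t1" using \<open>r > 0\<close> m0 by (simp add: k_def)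
    have "(a, b, t) = (p \<cdot>\<^sub>H (a, b, 0)) \<cdot>\<^sub>H (- p \<cdot>\<^sub>H (0, 0, t1))"
      using area by (simp add: xy algebra_simps)
    then have "gauge_norm (a, b, t) \<le> gauge_norm p + gauge_norm (a, b, 0) + gauge_norm (- p \<cdot>\<^sub>H (0, 0, t1))"
      using gauge_norm_mult_le[of "p \<cdot>\<^sub>H (a, b, 0)" "- p \<cdot>\<^sub>H (0, 0, t1)"] gauge_norm_mult_le[of p "(a, b, 0)"]
      by simp
    also have "\<dots> \<le> l"
      using p(1) gauge_norm_horizontal_le[of a b] r by (simp add: ab)
    finally show ?thesis using gauge_norm_radial[of a b r 0 t] ab by simp
  qed
qed

text \<open>After a rotation and a reflection the point is \<open>(r, 0, |t|)\<close>. The bound is an equality on the horizontal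
  plane and on the vertical axis.\<close>

theorem gauge_norm_sq_le: "(gauge_norm (x, y, t))\<^sup>2 \<le> x\<^sup>2 + y\<^sup>2 + vertical_const\<^sup>2 * \<bar>t\<bar>"
proof -
  define r where "r = sqrt (x\<^sup>2 + y\<^sup>2)"
  have r: "r \<ge> 0" "r\<^sup>2 = x\<^sup>2 + y\<^sup>2" by (simp_all add: r_def)
  have N: "gauge_norm (x, y, t) = gauge_norm (r, 0, \<bar>t\<bar>)"
    using gauge_norm_radial[of x y r 0 t] gauge_norm_flip[of r 0 t] r by (auto simp: abs_if)
  show ?thesis
  proof (cases "t = 0")
    case True
    have "gauge_norm (r, 0, 0) \<le> r" using gauge_norm_horizontal_le[of r 0] r(1) by simp
    then have "(gauge_norm (r, 0, 0))\<^sup>2 \<le> r\<^sup>2" by (intro power_mono) auto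
    then show ?thesis using N r True by simp
  next
    case False
    show ?thesis
    proof (rule ccontr)
      assume "\<not> ?thesis"
      then have "r\<^sup>2 + vertical_const\<^sup>2 * \<bar>t\<bar> < (gauge_norm (x, y, t))\<^sup>2" using r by simp
      then obtain z where z: "r\<^sup>2 + vertical_const\<^sup>2 * \<bar>t\<bar> < z" "z < (gauge_norm (x, y, t))\<^sup>2"
        using dense by blast
      have "z > 0" using z(1) by (smt (verit) mult_nonneg_nonneg zero_le_power2 abs_ge_zero)
      then have "gauge_norm (r, 0, \<bar>t\<bar>) \<le> sqrt z"
        using z(1) False r by (intro gauge_norm_le_if_sq_less) auto
      then have "(gauge_norm (r, 0, \<bar>t\<bar>))\<^sup>2 \<le> (sqrt z)\<^sup>2" by (intro power_mono) auto
      then show False using z(2) N \<open>z > 0\<close> by simp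
    qed
  qed
qed

section \<open>The topology of the distance\<close>

lemma heis_mult_eq: "p \<cdot>\<^sub>H q = (fst p + fst q, fst (snd p) + fst (snd q),
    snd (snd p) + snd (snd q) - 2 * fst p * fst (snd q) + 2 * fst q * fst (snd p))"
  by (cases p; cases q) simp

lemma continuous_on_heis_mult [continuous_intros]:
  "continuous_on A f \<Longrightarrow> continuous_on A g \<Longrightarrow> continuous_on A (\<lambda>x. f x \<cdot>\<^sub>H g x)"
  unfolding heis_mult_eq by (intro continuous_intros)

lemma gauge_norm_diff_le: "\<bar>gauge_norm p - gauge_norm q\<bar> \<le> gauge_norm (- p \<cdot>\<^sub>H q)"
proof -
  have "gauge_norm q \<le> gauge_norm p + gauge_norm (- p \<cdot>\<^sub>H q)"
    using gauge_norm_mult_le[of p "- p \<cdot>\<^sub>H q"] by simp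
  moreover have "gauge_norm p \<le> gauge_norm q + gauge_norm (- q \<cdot>\<^sub>H p)"
    using gauge_norm_mult_le[of q "- q \<cdot>\<^sub>H p"] by simp
  moreover have "gauge_norm (- q \<cdot>\<^sub>H p) = gauge_norm (- p \<cdot>\<^sub>H q)"
    using gauge_norm_uminus[of "- p \<cdot>\<^sub>H q"] by (simp add: uminus_heis_mult)
  ultimately show ?thesis by linarith
qed

text \<open>By \<open>gauge_norm_sq_le\<close> the norm tends to zero at the origin in the Euclidean topology; the triangle
  inequality transfers this to all points.\<close>

lemma continuous_on_gauge_norm: "continuous_on UNIV gauge_norm"
  unfolding continuous_on_eq_continuous_at[OF open_UNIV]
proof
  fix p :: heis
  define h where "h = (\<lambda>q. sqrt ((fst (- p \<cdot>\<^sub>H q))\<^sup>2 + (fst (snd (- p \<cdot>\<^sub>H q)))\<^sup>2 + vertical_const\<^sup>2 * \<bar>snd (snd (- p \<cdot>\<^sub>H q))\<bar>))"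
  have "continuous_on UNIV h" unfolding h_def by (intro continuous_intros)
  then have "isCont h p" using continuous_on_eq_continuous_at[OF open_UNIV] by blast
  then have "(h \<longlongrightarrow> h p) (at p)" by (simp add: isCont_def)
  moreover have "h p = 0" by (simp add: h_def)
  ultimately have h: "(h \<longlongrightarrow> 0) (at p)" by simp
  have "((\<lambda>q. gauge_norm q - gauge_norm p) \<longlongrightarrow> 0) (at p)"
  proof (rule Lim_null_comparison[OF always_eventually h], rule allI)
    fix q
    have "gauge_norm (- p \<cdot>\<^sub>H q) \<le> h q"
      unfolding h_def by (rule real_le_rsqrt)
        (use gauge_norm_sq_le[of "fst (- p \<cdot>\<^sub>H q)" "fst (snd (- p \<cdot>\<^sub>H q))" "snd (snd (- p \<cdot>\<^sub>H q))"] in simp)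
    then show "norm (gauge_norm q - gauge_norm p) \<le> h q"
      using gauge_norm_diff_le[of p q] by simp
  qed
  then show "isCont gauge_norm p" by (simp add: isCont_def LIM_zero_iff)
qed

lemma continuous_on_gauge_norm' [continuous_intros]:
  "continuous_on A f \<Longrightarrow> continuous_on A (\<lambda>x. gauge_norm (f x))"
  by (rule continuous_on_compose2[OF continuous_on_gauge_norm]) auto

lemma continuous_on_rho [continuous_intros]:
  "continuous_on A f \<Longrightarrow> continuous_on A g \<Longrightarrow> continuous_on A (\<lambda>x. \<rho> (f x) (g x))"
  unfolding rho_eq_gauge_norm by (intro continuous_intros)

lemma rho_eq_0_iff [simp]: "\<rho> p q = 0 \<longleftrightarrow> p = q"
proof
  assume "\<rho> p q = 0"
  then have "gauge_norm (- p \<cdot>\<^sub>H q) = 0" by (simp add: rho_eq_gauge_norm)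
  then have "- p \<cdot>\<^sub>H q = 0"
    using abs_fst_le_gauge_norm[of "- p \<cdot>\<^sub>H q"] abs_snd_le_gauge_norm[of "- p \<cdot>\<^sub>H q"]
      abs_vertical_le_gauge_norm[of "- p \<cdot>\<^sub>H q"] by (simp add: prod_eq_iff)
  then have "p \<cdot>\<^sub>H (- p \<cdot>\<^sub>H q) = p" by (simp only: heis_mult_zero)
  then show "p = q" by simp
qed simp

lemma norm_le_gauge_norm: "norm p \<le> 2 * gauge_norm p + (gauge_norm p)\<^sup>2"
proof -
  have "norm p \<le> \<bar>fst p\<bar> + (\<bar>fst (snd p)\<bar> + \<bar>snd (snd p)\<bar>)"
    using norm_Pair_le[of "fst p" "snd p"] norm_Pair_le[of "fst (snd p)" "snd (snd p)"] by simp
  then show ?thesis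
    using abs_fst_le_gauge_norm[of p] abs_snd_le_gauge_norm[of p] abs_vertical_le_gauge_norm[of p] by linarith
qed

lemma compact_gauge_ball: "compact {p. gauge_norm p \<le> r}"
  unfolding compact_eq_bounded_closed
proof
  have "norm p \<le> 2 * \<bar>r\<bar> + r\<^sup>2" if "gauge_norm p \<le> r" for p
  proof -
    have "(gauge_norm p)\<^sup>2 \<le> r\<^sup>2" using that by (intro power_mono) auto
    then show ?thesis using norm_le_gauge_norm[of p] that by linarith
  qed
  then show "bounded {p. gauge_norm p \<le> r}" by (auto simp: bounded_iff)
  show "closed {p. gauge_norm p \<le> r}"
    by (intro closed_Collect_le continuous_intros)
qed

lemma rho_eq_gauge_norm': "\<rho> p x = gauge_norm (- x \<cdot>\<^sub>H p)"
  by (rule trans[OF rho_commute rho_eq_gauge_norm])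

lemma rho_ball_eq: "\<rho>_ball x r = (\<lambda>p. x \<cdot>\<^sub>H p) ` {p. gauge_norm p \<le> r}"
proof (intro equalityI subsetI)
  fix p assume "p \<in> \<rho>_ball x r"
  then have "gauge_norm (- x \<cdot>\<^sub>H p) \<le> r" by (simp add: \<rho>_ball_def rho_eq_gauge_norm')
  moreover have "p = x \<cdot>\<^sub>H (- x \<cdot>\<^sub>H p)" by simp
  ultimately show "p \<in> (\<lambda>p. x \<cdot>\<^sub>H p) ` {p. gauge_norm p \<le> r}" by blast
qed (auto simp: \<rho>_ball_def rho_eq_gauge_norm')

lemma compact_rho_ball: "compact (\<rho>_ball x r)"
  unfolding rho_ball_eq by (intro compact_continuous_image compact_gauge_ball continuous_intros)

lemma closed_rho_ball: "closed (\<rho>_ball x r)"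
  by (rule compact_imp_closed[OF compact_rho_ball])

lemma open_rho_ball: "open {p. \<rho> p x < r}"
  by (intro open_Collect_less continuous_intros)

lemma rho_ball_subset_open:
  assumes "open U" "x \<in> U"
  obtains r where "r > 0" "\<rho>_ball x r \<subseteq> U"
proof -
  obtain e where e: "e > 0" "ball x e \<subseteq> U" using assms openE by blast
  obtain K where K: "K > 0" "\<And>v. norm (left_linear x v) \<le> norm v * K"
    using bounded_linear.pos_bounded[OF bounded_linear_left_linear] by blast
  define r where "r = min 1 (e / (4 * K))"
  have r: "r > 0" "r \<le> 1" "3 * r * K < e"
  proof -
    show "r > 0" "r \<le> 1" using e K by (auto simp: r_def)
    have "r * K \<le> e / (4 * K) * K" using K by (intro mult_right_mono) (auto simp: r_def)
    then have "r * K \<le> e / 4" using K by simp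
    then show "3 * r * K < e" using e by linarith
  qed
  have "\<rho>_ball x r \<subseteq> U"
  proof
    fix q assume "q \<in> \<rho>_ball x r"
    then obtain p where p: "q = x \<cdot>\<^sub>H p" "gauge_norm p \<le> r" by (auto simp: rho_ball_eq)
    have "(gauge_norm p)\<^sup>2 \<le> gauge_norm p * 1"
      unfolding power2_eq_square using p r by (intro mult_left_mono) auto
    then have "norm p \<le> 3 * r" using norm_le_gauge_norm[of p] p by linarith
    then have "norm p * K \<le> 3 * r * K" using K by (intro mult_right_mono) auto
    moreover have "dist x q = norm (left_linear x p)" by (simp add: p heis_mult_left_linear dist_norm)
    ultimately have "dist x q < e" using K(2)[of p] r by linarith
    then show "q \<in> U" using e by auto
  qed
  then show ?thesis using that r by blast
qed

section \<open>The vertical plane\<close>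

text \<open>The plane \<open>y = 0\<close> is an abelian subgroup isomorphic to the plane with its translations; every point
  \<open>p\<close> of the group is \<open>plane (proj p) \<cdot> (0, y, 0)\<close>.\<close>

definition plane :: "real \<times> real \<Rightarrow> heis" where
  "plane m = (fst m, 0, snd m)"

definition proj :: "heis \<Rightarrow> real \<times> real" where
  "proj p = (fst p, snd (snd p) + 2 * fst p * fst (snd p))"

lemma plane_proj: "plane (proj p) \<cdot>\<^sub>H (0, fst (snd p), 0) = p"
  by (cases p) (simp add: plane_def proj_def)

lemma plane_diff: "- plane m \<cdot>\<^sub>H plane m' = plane (m' - m)"
  by (simp add: plane_def)

lemma continuous_on_plane [continuous_intros]: "continuous_on A f \<Longrightarrow> continuous_on A (\<lambda>x. plane (f x))"
  unfolding plane_def by (intro continuous_intros)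

lemma continuous_on_proj [continuous_intros]: "continuous_on A f \<Longrightarrow> continuous_on A (\<lambda>x. proj (f x))"
  unfolding proj_def by (intro continuous_intros)

lemma sets_plane: "sets (lborel \<Otimes>\<^sub>M lborel) = sets (borel :: (real \<times> real) measure)"
  by (simp only: lborel_prod sets_lborel)

lemma emeasure_plane_eq:
  assumes "M \<in> sets borel"
  shows "emeasure lborel (M :: (real \<times> real) set) = (\<integral>\<^sup>+ x. (\<integral>\<^sup>+ y. indicator M (x, y) \<partial>lborel) \<partial>lborel)"
proof -
  have "emeasure (lborel \<Otimes>\<^sub>M lborel) M = (\<integral>\<^sup>+ x. (\<integral>\<^sup>+ y. indicator M (x, y) \<partial>lborel) \<partial>lborel)"
    using assms by (intro lborel.emeasure_pair_measure) (simp only: sets_plane)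
  then show ?thesis by (simp add: lborel_prod)
qed

text \<open>Translations and dilations of the group act on the projections of planar sets by maps of this form.\<close>

lemma emeasure_sheared_image:
  fixes M :: "(real \<times> real) set" and x0 s0 a b k :: real
  assumes M: "M \<in> sets borel" and ab: "a > 0" "b > 0"
  defines "T \<equiv> \<lambda>m. (x0 + a * fst m, s0 + b * snd m + k * fst m)"
  shows "emeasure lborel (T ` M) = ennreal (a * b) * emeasure lborel M" and "T ` M \<in> sets borel"
proof -
  define R where "R = (\<lambda>n. ((fst n - x0) / a, (snd n - s0 - k * ((fst n - x0) / a)) / b))"
  have RT: "R (T m) = m" and TR: "T (R n) = n" for m n
    using ab by (auto simp: R_def T_def prod_eq_iff)
  have TM: "T ` M = R -` M"
  proof (intro equalityI subsetI)
    fix n assume "n \<in> R -` M"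
    then have "T (R n) \<in> T ` M" by simp
    then show "n \<in> T ` M" by (simp only: TR)
  qed (auto simp: RT)
  have "continuous_on UNIV R"
    unfolding R_def using ab by (intro continuous_intros) auto
  then have "R \<in> borel_measurable borel" by (rule borel_measurable_continuous_onI)
  from measurable_sets[OF this M] show TMb: "T ` M \<in> sets borel" by (simp add: TM)
  have ind: "indicator (T ` M) (T m) = (indicator M m :: ennreal)" for m
    using RT by (auto simp: indicator_def TM)
  have meas: "(\<lambda>x. \<integral>\<^sup>+ y. indicator (T ` M) (x, y) \<partial>lborel) \<in> borel_measurable borel"
  proof -
    have "(\<lambda>z. indicator (T ` M) z :: ennreal) \<in> borel_measurable (lborel \<Otimes>\<^sub>M lborel)"
      using TMb by (intro borel_measurable_indicator) (simp only: sets_plane)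
    from lborel.borel_measurable_nn_integral_fst[OF this] show ?thesis by simp
  qed
  have "emeasure lborel (T ` M) = (\<integral>\<^sup>+ x. (\<integral>\<^sup>+ y. indicator (T ` M) (x, y) \<partial>lborel) \<partial>lborel)"
    by (rule emeasure_plane_eq[OF TMb])
  also have "\<dots> = ennreal \<bar>a\<bar> * (\<integral>\<^sup>+ x. (\<integral>\<^sup>+ y. indicator (T ` M) (x0 + a * x, y) \<partial>lborel) \<partial>lborel)"
    using ab by (intro nn_integral_real_affine meas) auto
  also have "(\<lambda>x. \<integral>\<^sup>+ y. indicator (T ` M) (x0 + a * x, y) \<partial>lborel) =
     (\<lambda>x. ennreal \<bar>b\<bar> * (\<integral>\<^sup>+ y. indicator (T ` M) (x0 + a * x, (s0 + k * x) + b * y) \<partial>lborel))"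
  proof
    fix x
    have "(\<lambda>y. indicator (T ` M) (x0 + a * x, y) :: ennreal) \<in> borel_measurable borel"
    proof -
      have "(\<lambda>y::real. (x0 + a * x, y)) \<in> borel_measurable borel"
        by (intro borel_measurable_continuous_onI continuous_intros)
      from measurable_compose[OF this borel_measurable_indicator[OF TMb]] show ?thesis .
    qed
    then show "(\<integral>\<^sup>+ y. indicator (T ` M) (x0 + a * x, y) \<partial>lborel) =
       ennreal \<bar>b\<bar> * (\<integral>\<^sup>+ y. indicator (T ` M) (x0 + a * x, (s0 + k * x) + b * y) \<partial>lborel)"
      using ab by (intro nn_integral_real_affine) auto
  qed
  also have "(\<lambda>x. ennreal \<bar>b\<bar> * (\<integral>\<^sup>+ y. indicator (T ` M) (x0 + a * x, (s0 + k * x) + b * y) \<partial>lborel)) =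
     (\<lambda>x. ennreal \<bar>b\<bar> * (\<integral>\<^sup>+ y. indicator M (x, y) \<partial>lborel))"
  proof -
    have "indicator (T ` M) (x0 + a * x, (s0 + k * x) + b * y) = (indicator M (x, y) :: ennreal)" for x y
      using ind[of "(x, y)"] by (simp add: T_def algebra_simps)
    then show ?thesis by simp
  qed
  also have "(\<integral>\<^sup>+ x. ennreal \<bar>b\<bar> * (\<integral>\<^sup>+ y. indicator M (x, y) \<partial>lborel) \<partial>lborel) =
     ennreal \<bar>b\<bar> * (\<integral>\<^sup>+ x. (\<integral>\<^sup>+ y. indicator M (x, y) \<partial>lborel) \<partial>lborel)"
  proof (rule nn_integral_cmult)
    have "(\<lambda>z. indicator M z :: ennreal) \<in> borel_measurable (lborel \<Otimes>\<^sub>M lborel)"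
      using M by (intro borel_measurable_indicator) (simp only: sets_plane)
    from lborel.borel_measurable_nn_integral_fst[OF this]
    show "(\<lambda>x. \<integral>\<^sup>+ y. indicator M (x, y) \<partial>lborel) \<in> borel_measurable lborel" by simp
  qed
  also have "(\<integral>\<^sup>+ x. (\<integral>\<^sup>+ y. indicator M (x, y) \<partial>lborel) \<partial>lborel) = emeasure lborel M"
    by (rule emeasure_plane_eq[OF M, symmetric])
  also have "ennreal \<bar>a\<bar> * (ennreal \<bar>b\<bar> * emeasure lborel M) = ennreal (a * b) * emeasure lborel M"
    using ab by (simp add: ennreal_mult mult.assoc)
  finally show "emeasure lborel (T ` M) = ennreal (a * b) * emeasure lborel M" .
qed

section \<open>A planar set of diameter two that is larger than the unit ball\<close>

definition plane_ball :: "(real \<times> real) set" where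
  "plane_ball = {m. gauge_norm (plane m) \<le> 1}"

definition ball_area :: real where
  "ball_area = measure lborel plane_ball"

text \<open>The vertical axis leaves the unit ball at the height \<open>1 / vertical_const\<^sup>2\<close>, and the box is a little
  longer than that. The margin \<open>1/200\<close> is chosen such that the errors that it causes stay below the gap
  \<open>1/16\<close> of the estimate \<open>plane_ball_bound\<close>.\<close>

definition large_set :: "(real \<times> real) set" where
  "large_set = {m. gauge_norm (plane m) < 1} \<union>
     {m. \<bar>fst m\<bar> < 1/200 \<and> \<bar>snd m\<bar> < 1 / vertical_const\<^sup>2 + 1/200}"

lemma compact_plane_gauge_ball: "compact {m. gauge_norm (plane m) \<le> r}"
proof -
  have "{m. gauge_norm (plane m) \<le> r} \<subseteq> (\<lambda>p. (fst p, snd (snd p))) ` {p. gauge_norm p \<le> r}"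
  proof
    fix m assume "m \<in> {m. gauge_norm (plane m) \<le> r}"
    then have "plane m \<in> {p. gauge_norm p \<le> r}" "m = (\<lambda>p. (fst p, snd (snd p))) (plane m)"
      by (auto simp: plane_def)
    then show "m \<in> (\<lambda>p. (fst p, snd (snd p))) ` {p. gauge_norm p \<le> r}" by blast
  qed
  moreover have "compact ((\<lambda>p::heis. (fst p, snd (snd p))) ` {p. gauge_norm p \<le> r})"
    by (intro compact_continuous_image compact_gauge_ball continuous_intros)
  moreover have "closed {m. gauge_norm (plane m) \<le> r}"
    by (intro closed_Collect_le continuous_intros)
  ultimately show ?thesis by (meson bounded_subset compact_eq_bounded_closed)
qed

lemma emeasure_plane_gauge_ball:
  assumes "r > 0"
  shows "emeasure lborel {m. gauge_norm (plane m) \<le> r} = ennreal (r ^ 3 * ball_area)"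
proof -
  let ?T = "\<lambda>m. (0 + r * fst m, 0 + r\<^sup>2 * snd m + 0 * fst m)"
  have pT: "plane (?T m) = dil r (plane m)" for m by (simp add: plane_def dil_def)
  have "{m. gauge_norm (plane m) \<le> r} = ?T ` plane_ball"
  proof (intro equalityI subsetI)
    fix m assume m: "m \<in> {m. gauge_norm (plane m) \<le> r}"
    define n where "n = (fst m / r, snd m / r\<^sup>2)"
    have mn: "m = ?T n" using assms by (simp add: n_def)
    have "gauge_norm (plane m) = r * gauge_norm (plane n)"
      by (subst mn) (simp only: pT gauge_norm_dil[OF less_imp_le[OF assms]])
    then have "r * gauge_norm (plane n) \<le> r * 1" using m by simp
    then have "n \<in> plane_ball" using assms by (simp add: plane_ball_def)
    then show "m \<in> ?T ` plane_ball" using mn by blast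
  next
    fix m assume "m \<in> ?T ` plane_ball"
    then obtain n where n: "n \<in> plane_ball" "m = ?T n" by blast
    have "gauge_norm (plane m) = r * gauge_norm (plane n)"
      by (subst n(2)) (simp only: pT gauge_norm_dil[OF less_imp_le[OF assms]])
    also have "\<dots> \<le> r * 1" using n assms by (intro mult_left_mono) (auto simp: plane_ball_def)
    finally show "m \<in> {m. gauge_norm (plane m) \<le> r}" by simp
  qed
  moreover have cpt: "compact plane_ball" unfolding plane_ball_def by (rule compact_plane_gauge_ball)
  then have "emeasure lborel (?T ` plane_ball) = ennreal (r * r\<^sup>2) * emeasure lborel plane_ball"
    using assms by (intro emeasure_sheared_image(1) borel_compact) auto
  moreover have "emeasure lborel plane_ball = ennreal ball_area"
    unfolding ball_area_def using emeasure_compact_finite[OF cpt] by (simp add: emeasure_eq_ennreal_measure)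
  ultimately show ?thesis
    using assms by (simp add: ennreal_mult'' power3_eq_cube power2_eq_square ball_area_def mult.assoc)
qed

lemma open_large_set: "open large_set"
  unfolding large_set_def
  by (intro open_Un open_Collect_less open_Collect_conj continuous_intros)

lemma vertical_const_sq: "1 \<le> vertical_const\<^sup>2" "vertical_const\<^sup>2 \<le> 4"
proof -
  have "1\<^sup>2 \<le> vertical_const\<^sup>2" "vertical_const\<^sup>2 \<le> 2\<^sup>2"
    using vertical_const_ge_1 vertical_const_le_2 by (intro power_mono; simp)+
  then show "1 \<le> vertical_const\<^sup>2" "vertical_const\<^sup>2 \<le> 4" by simp_all
qed

text \<open>The bound for \<open>c\<^sup>2 |t|\<close> is obtained in two ways: the points \<open>(x, t)\<close> and \<open>(- x, t)\<close> add up to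
  \<open>(0, 2 t)\<close>, and the Koranyi gauge makes \<open>t\<close> small when \<open>|x|\<close> is close to \<open>1\<close>.\<close>

lemma plane_ball_bound:
  assumes "gauge_norm (plane (x, t)) \<le> 1"
  shows "x\<^sup>2 + vertical_const\<^sup>2 * \<bar>t\<bar> \<le> 3 - 1/16" "\<bar>x\<bar> \<le> 1" "vertical_const\<^sup>2 * \<bar>t\<bar> \<le> 2"
proof -
  have N: "gauge_norm (x, 0, t) \<le> 1" using assms by (simp add: plane_def)
  show x: "\<bar>x\<bar> \<le> 1" using abs_fst_le_gauge_norm[of "(x, 0, t)"] N by simp
  have "gauge_norm (0, 0, 2 * t) \<le> gauge_norm (x, 0, t) + gauge_norm (- x, 0, t)"
    using gauge_norm_mult_le[of "(x, 0, t)" "(- x, 0, t)"] by simp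
  also have "gauge_norm (- x, 0, t) = gauge_norm (x, 0, t)" by (rule gauge_norm_radial) simp
  finally have "vertical_const * sqrt (2 * \<bar>t\<bar>) \<le> 2" using N by (simp add: gauge_norm_vertical abs_mult)
  then have "(vertical_const * sqrt (2 * \<bar>t\<bar>))\<^sup>2 \<le> 2\<^sup>2"
    using vertical_const_ge_1 by (intro power_mono) auto
  then show t2: "vertical_const\<^sup>2 * \<bar>t\<bar> \<le> 2" by (simp add: power_mult_distrib mult.commute)
  show "x\<^sup>2 + vertical_const\<^sup>2 * \<bar>t\<bar> \<le> 3 - 1/16"
  proof (cases "x\<^sup>2 \<le> 15/16")
    case True
    then show ?thesis using t2 by linarith
  next
    case False
    have "gauge_norm (x, 0, t) ^ 4 \<le> 1" using N by (intro power_le_one) auto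
    then have "(x\<^sup>2)\<^sup>2 + t\<^sup>2 \<le> 1" using koranyi_le_gauge_norm[of "(x, 0, t)"] by (simp add: koranyi4_def)
    moreover have "(15/16)\<^sup>2 \<le> (x\<^sup>2)\<^sup>2" using False by (intro power_mono) auto
    ultimately have "t\<^sup>2 \<le> (3/8)\<^sup>2" by (simp add: power2_eq_square)
    then have "\<bar>t\<bar> \<le> 3/8" by (simp add: abs_le_square_iff[of t "3/8", simplified])
    then have "vertical_const\<^sup>2 * \<bar>t\<bar> \<le> 4 * (3/8)"
      using vertical_const_sq by (intro mult_mono) auto
    moreover have "x\<^sup>2 \<le> 1" using x by (simp add: abs_square_le_1)
    ultimately show ?thesis by simp
  qed
qed

lemma plane_norm_le_2I:
  assumes "x\<^sup>2 + vertical_const\<^sup>2 * \<bar>t\<bar> \<le> 4"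
  shows "gauge_norm (plane (x, t)) \<le> 2"
proof -
  have "(gauge_norm (plane (x, t)))\<^sup>2 \<le> 2\<^sup>2"
    using gauge_norm_sq_le[of x 0 t] assms by (simp add: plane_def)
  then show ?thesis by (rule power2_le_imp_le) simp
qed

lemma box_bound:
  fixes x t :: real
  assumes "\<bar>x\<bar> < 1/200" "\<bar>t\<bar> < 1 / vertical_const\<^sup>2 + 1/200"
  shows "x\<^sup>2 \<le> 1/200" "vertical_const\<^sup>2 * \<bar>t\<bar> \<le> 1 + 4/200"
proof -
  have "x\<^sup>2 \<le> (1/200)\<^sup>2" using assms by (intro abs_le_square_iff[THEN iffD1]) auto
  then show "x\<^sup>2 \<le> 1/200" by (simp add: power2_eq_square)
  have "vertical_const\<^sup>2 * \<bar>t\<bar> \<le> vertical_const\<^sup>2 * (1 / vertical_const\<^sup>2 + 1/200)"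
    using assms by (intro mult_left_mono) auto
  also have "\<dots> = 1 + vertical_const\<^sup>2 / 200" using vertical_const_ge_1 by (simp add: field_simps)
  finally show "vertical_const\<^sup>2 * \<bar>t\<bar> \<le> 1 + 4/200" using vertical_const_sq by linarith
qed

lemma large_set_norm_le: "m \<in> large_set \<Longrightarrow> gauge_norm (plane m) \<le> 2"
proof (cases m)
  fix x t assume m: "m \<in> large_set" "m = (x, t)"
  show ?thesis
  proof (cases "gauge_norm (plane m) < 1")
    case False
    then have "\<bar>x\<bar> < 1/200" "\<bar>t\<bar> < 1 / vertical_const\<^sup>2 + 1/200" using m by (auto simp: large_set_def)
    from box_bound[OF this] show ?thesis unfolding m(2) by (intro plane_norm_le_2I) linarith
  qed simp
qed

text \<open>Only the distance of a point of the ball and a point of the box needs an argument: there the bound of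
  \<open>gauge_norm_sq_le\<close> adds up to at most \<open>(3 - 1/16) + 1\<close> and small errors.\<close>

lemma large_set_diameter:
  assumes "m \<in> large_set" "m' \<in> large_set"
  shows "gauge_norm (plane (m - m')) \<le> 2"
proof -
  have sym: "gauge_norm (plane (m - m')) = gauge_norm (plane (m' - m))" for m m' :: "real \<times> real"
    using gauge_norm_uminus[of "plane (m - m')"] by (simp add: plane_def)
  have mixed: "gauge_norm (plane (m - m')) \<le> 2"
    if m': "gauge_norm (plane m') \<le> 1" and m: "\<bar>fst m\<bar> < 1/200" "\<bar>snd m\<bar> < 1 / vertical_const\<^sup>2 + 1/200" for m m'
  proof -
    obtain x t x' t' where mm: "m = (x, t)" "m' = (x', t')" by (cases m; cases m')
    note b = plane_ball_bound[of x' t'] box_bound[of x t]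
    have b': "x'\<^sup>2 + vertical_const\<^sup>2 * \<bar>t'\<bar> \<le> 3 - 1/16" "\<bar>x'\<bar> \<le> 1"
      "x\<^sup>2 \<le> 1/200" "vertical_const\<^sup>2 * \<bar>t\<bar> \<le> 1 + 4/200" using b m m' mm by auto
    have "\<bar>x * x'\<bar> \<le> 1/200 * 1" unfolding abs_mult using b' m mm by (intro mult_mono) auto
    then have "(x - x')\<^sup>2 \<le> x'\<^sup>2 + 3/200"
      using b'(3) unfolding power2_diff abs_le_iff by simp
    moreover have "vertical_const\<^sup>2 * \<bar>t - t'\<bar> \<le> vertical_const\<^sup>2 * (\<bar>t\<bar> + \<bar>t'\<bar>)"
      by (intro mult_left_mono) auto
    ultimately have "(x - x')\<^sup>2 + vertical_const\<^sup>2 * \<bar>t - t'\<bar> \<le> 4"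
      using b' unfolding distrib_left by linarith
    then show ?thesis unfolding mm by (simp add: plane_norm_le_2I)
  qed
  have box: "gauge_norm (plane (m - m')) \<le> 2"
    if m: "\<bar>fst m\<bar> < 1/200" "\<bar>snd m\<bar> < 1 / vertical_const\<^sup>2 + 1/200"
      and m': "\<bar>fst m'\<bar> < 1/200" "\<bar>snd m'\<bar> < 1 / vertical_const\<^sup>2 + 1/200"
  proof -
    obtain x t x' t' where mm: "m = (x, t)" "m' = (x', t')" by (cases m; cases m')
    have "\<bar>x - x'\<bar> \<le> 1" using m m' mm by auto
    then have "(x - x')\<^sup>2 \<le> 1" by (simp add: abs_square_le_1)
    moreover have "vertical_const\<^sup>2 * \<bar>t - t'\<bar> \<le> vertical_const\<^sup>2 * (\<bar>t\<bar> + \<bar>t'\<bar>)"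
      by (intro mult_left_mono) auto
    ultimately have "(x - x')\<^sup>2 + vertical_const\<^sup>2 * \<bar>t - t'\<bar> \<le> 4"
      using box_bound(2)[of x t] box_bound(2)[of x' t'] m m' mm unfolding distrib_left by simp
    then show ?thesis unfolding mm by (simp add: plane_norm_le_2I)
  qed
  have ball: "gauge_norm (plane (m - m')) \<le> 2" if "gauge_norm (plane m) < 1" "gauge_norm (plane m') < 1"
  proof -
    have "gauge_norm (plane (m - m')) \<le> gauge_norm (- plane m') + gauge_norm (plane m)"
      using gauge_norm_mult_le[of "- plane m'" "plane m"] by (simp only: plane_diff)
    then show ?thesis using that by simp
  qed
  have m: "gauge_norm (plane m) < 1 \<or> \<bar>fst m\<bar> < 1/200 \<and> \<bar>snd m\<bar> < 1 / vertical_const\<^sup>2 + 1/200"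
    if "m \<in> large_set" for m
    using that unfolding large_set_def by blast
  show ?thesis
  proof (cases "gauge_norm (plane m) < 1")
    case True
    show ?thesis
      using m[OF assms(2)]
    proof (elim disjE conjE)
      assume "gauge_norm (plane m') < 1"
      with True show ?thesis by (rule ball)
    next
      assume "\<bar>fst m'\<bar> < 1/200" "\<bar>snd m'\<bar> < 1 / vertical_const\<^sup>2 + 1/200"
      with True have "gauge_norm (plane (m' - m)) \<le> 2" by (intro mixed) simp_all
      then show ?thesis by (simp only: sym[of m m'])
    qed
  next
    case False
    then have b: "\<bar>fst m\<bar> < 1/200" "\<bar>snd m\<bar> < 1 / vertical_const\<^sup>2 + 1/200" using m[OF assms(1)] by blast+
    show ?thesis
      using m[OF assms(2)]
    proof (elim disjE conjE)
      assume "gauge_norm (plane m') < 1"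
      then show ?thesis using b by (intro mixed) simp_all
    next
      assume "\<bar>fst m'\<bar> < 1/200" "\<bar>snd m'\<bar> < 1 / vertical_const\<^sup>2 + 1/200"
      with b show ?thesis by (rule box)
    qed
  qed
qed

text \<open>The open ball has the area of the closed ball, by comparison with slightly smaller balls. The box
  contains a point of the vertical axis outside of the closed ball, and with it a nonempty open set.\<close>

lemma large_set_area:
  "emeasure lborel large_set < \<infinity>" "ball_area < measure lborel large_set" "ball_area > 0"
proof -
  have "large_set \<subseteq> {m. gauge_norm (plane m) \<le> 2}" using large_set_norm_le by blast
  then have "emeasure lborel large_set \<le> emeasure lborel {m. gauge_norm (plane m) \<le> 2}"
    by (intro emeasure_mono) (auto intro!: borel_compact compact_plane_gauge_ball)
  then show fin: "emeasure lborel large_set < \<infinity>"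
    using emeasure_compact_finite[OF compact_plane_gauge_ball, of 2] by (rule le_less_trans)
  have pos: "emeasure lborel V > 0" if V: "open V" "V \<noteq> {}" for V :: "(real \<times> real) set"
  proof (rule ccontr)
    assume "\<not> ?thesis"
    then have "V \<in> null_sets lborel" using V by (auto simp: null_sets_def)
    then have "V \<in> null_sets lebesgue" by (rule null_sets_completionI)
    then have "negligible V" by (simp add: negligible_iff_null_sets)
    then show False using open_not_negligible V by blast
  qed
  have fin1: "emeasure lborel plane_ball < \<infinity>"
    unfolding plane_ball_def by (rule emeasure_compact_finite[OF compact_plane_gauge_ball])
  have "emeasure lborel {m. gauge_norm (plane m) < 1} > 0"
  proof (rule pos)
    show "open {m. gauge_norm (plane m) < 1}" by (intro open_Collect_less continuous_intros)
    have "0 \<in> {m. gauge_norm (plane m) < 1}" by (simp add: plane_def flip: zero_prod_def)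
    then show "{m. gauge_norm (plane m) < 1} \<noteq> {}" by blast
  qed
  also have "\<dots> \<le> emeasure lborel plane_ball"
    by (intro emeasure_mono) (auto simp: plane_ball_def intro!: borel_compact compact_plane_gauge_ball)
  also have "\<dots> = ennreal ball_area"
    unfolding ball_area_def using fin1 by (simp add: emeasure_eq_ennreal_measure)
  finally show A0: "ball_area > 0" by simp
  define W where "W = {m. gauge_norm (plane m) < 1}"
  define V where "V = {m. \<bar>fst m\<bar> < 1/200 \<and> \<bar>snd m\<bar> < 1 / vertical_const\<^sup>2 + 1/200} \<inter> {m. 1 < gauge_norm (plane m)}"
  have oW: "open W" unfolding W_def by (intro open_Collect_less continuous_intros)
  have oV: "open V" unfolding V_def by (intro open_Int open_Collect_conj open_Collect_less continuous_intros)
  have "(0, 1 / vertical_const\<^sup>2 + 1/400) \<in> V"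
  proof -
    have "1 < vertical_const\<^sup>2 * (1 / vertical_const\<^sup>2 + 1/400)"
      using vertical_const_ge_1 by (simp add: field_simps)
    then have "sqrt 1 < sqrt (vertical_const\<^sup>2 * (1 / vertical_const\<^sup>2 + 1/400))"
      by (rule real_sqrt_less_mono)
    then have "1 < vertical_const * sqrt (1 / vertical_const\<^sup>2 + 1/400)"
      using vertical_const_ge_1 by (simp only: real_sqrt_mult real_sqrt_abs) simp
    moreover have "0 \<le> 1 / vertical_const\<^sup>2 + 1/400" by simp
    ultimately show ?thesis
      using gauge_norm_vertical[of "1 / vertical_const\<^sup>2 + 1/400"] by (simp add: V_def plane_def)
  qed
  then have "emeasure lborel V > 0" using pos oV by blast
  have W: "ennreal ball_area \<le> emeasure lborel W"
  proof (rule LIMSEQ_le_const2)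
    show "(\<lambda>n. ennreal ((1 - 1 / real (Suc (Suc n))) ^ 3 * ball_area)) \<longlonglongrightarrow> ennreal ball_area"
    proof (rule tendsto_ennrealI)
      have "(\<lambda>n. (1 - 1 / real (Suc (Suc n))) ^ 3 * ball_area) \<longlonglongrightarrow> (1 - 0) ^ 3 * ball_area"
        by (intro tendsto_intros LIMSEQ_Suc lim_1_over_n[unfolded of_nat_id])
      then show "(\<lambda>n. (1 - 1 / real (Suc (Suc n))) ^ 3 * ball_area) \<longlonglongrightarrow> ball_area" by simp
    qed
    have "ennreal ((1 - 1 / real (Suc (Suc n))) ^ 3 * ball_area) \<le> emeasure lborel W" for n
    proof -
      have r: "0 < 1 - 1 / real (Suc (Suc n))" "1 - 1 / real (Suc (Suc n)) < 1" by simp_all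
      have "gauge_norm (plane m) < 1" if "gauge_norm (plane m) \<le> 1 - 1 / real (Suc (Suc n))" for m
        using that r(2) by linarith
      then have "{m. gauge_norm (plane m) \<le> 1 - 1 / real (Suc (Suc n))} \<subseteq> W" by (auto simp: W_def)
      then have "emeasure lborel {m. gauge_norm (plane m) \<le> 1 - 1 / real (Suc (Suc n))} \<le> emeasure lborel W"
        using oW by (intro emeasure_mono) auto
      then show ?thesis using emeasure_plane_gauge_ball[OF r(1)] by simp
    qed
    then show "\<exists>N. \<forall>n\<ge>N. ennreal ((1 - 1 / real (Suc (Suc n))) ^ 3 * ball_area) \<le> emeasure lborel W" by blast
  qed
  have sub: "W \<union> V \<subseteq> large_set" by (auto simp: W_def V_def large_set_def)
  have "emeasure lborel V \<le> emeasure lborel large_set"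
    using sub open_large_set by (intro emeasure_mono) auto
  then have Vfin: "emeasure lborel V < \<infinity>" using fin by (rule le_less_trans)
  have "ennreal ball_area < ennreal ball_area + emeasure lborel V"
  proof -
    obtain v where v: "emeasure lborel V = ennreal v" "v \<ge> 0"
      using Vfin by (cases "emeasure lborel V") auto
    then have "v > 0" using \<open>emeasure lborel V > 0\<close> by simp
    then show ?thesis using v A0 by (simp add: ennreal_less_iff flip: ennreal_plus)
  qed
  also have "\<dots> \<le> emeasure lborel W + emeasure lborel V" using W by (rule add_right_mono)
  also have "\<dots> = emeasure lborel (W \<union> V)"
    using oW oV by (intro plus_emeasure) (auto simp: W_def V_def)
  also have "\<dots> \<le> emeasure lborel large_set"
    using sub open_large_set by (intro emeasure_mono) auto
  also have "\<dots> = ennreal (measure lborel large_set)"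
    using fin by (simp add: emeasure_eq_ennreal_measure)
  finally show "ball_area < measure lborel large_set" using A0 by (simp add: ennreal_less_iff)
qed

section \<open>The Hausdorff measure without normalization\<close>

lemma ediam_le_iff: "ediam d B \<le> C \<longleftrightarrow> (\<forall>x\<in>B. \<forall>y\<in>B. ennreal (d x y) \<le> C)"
  by (auto simp: ediam_def SUP_le_iff)

lemma ediam_closure: "ediam \<rho> (closure A) = ediam \<rho> A"
proof (rule antisym)
  show "ediam \<rho> A \<le> ediam \<rho> (closure A)"
    unfolding ediam_le_iff[of \<rho> A] using ediam_le_iff[of \<rho> "closure A"] closure_subset[of A] by blast
  show "ediam \<rho> (closure A) \<le> ediam \<rho> A"
  proof (cases "ediam \<rho> A")
    case (real c)
    have A: "\<rho> x y \<le> c" if "x \<in> A" "y \<in> A" for x y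
    proof -
      have "ennreal (\<rho> x y) \<le> ediam \<rho> A" using ediam_le_iff[of \<rho> A "ediam \<rho> A"] that by blast
      then have "ennreal (\<rho> x y) \<le> ennreal c" by (simp only: real(2))
      then show ?thesis using real by (simp add: ennreal_le_iff)
    qed
    have 1: "\<rho> x y \<le> c" if "x \<in> A" "y \<in> closure A" for x y
    proof -
      have "closed {y. \<rho> x y \<le> c}" by (intro closed_Collect_le continuous_intros)
      moreover have "A \<subseteq> {y. \<rho> x y \<le> c}" using A that by blast
      ultimately have "closure A \<subseteq> {y. \<rho> x y \<le> c}" by (rule closure_minimal[rotated])
      then show ?thesis using that by blast
    qed
    have "\<rho> x y \<le> c" if "x \<in> closure A" "y \<in> closure A" for x y
    proof -
      have "closed {x. \<rho> x y \<le> c}" by (intro closed_Collect_le continuous_intros)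
      moreover have "A \<subseteq> {x. \<rho> x y \<le> c}" using 1 that by blast
      ultimately have "closure A \<subseteq> {x. \<rho> x y \<le> c}" by (rule closure_minimal[rotated])
      then show ?thesis using that by blast
    qed
    then show ?thesis unfolding ediam_le_iff real by (auto intro: ennreal_leI)
  qed simp
qed

text \<open>The covering sets contribute the cubes of their diameters, with the factor \<open>1\<close>.\<close>

definition hpre :: "real \<Rightarrow> heis set \<Rightarrow> ennreal" where
  "hpre \<delta> E = (INF B\<in>{B :: nat \<Rightarrow> heis set. E \<subseteq> (\<Union>j. B j) \<and>
     (\<forall>j. ediam \<rho> (B j) \<le> ennreal \<delta> \<and> closed (B j))}. (\<Sum>j. ediam \<rho> (B j) ^ 3))"

definition haus3 :: "heis set \<Rightarrow> ennreal" where
  "haus3 E = (SUP \<delta>\<in>{0::real<..}. hpre \<delta> E)"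

lemma small_cover_exists:
  assumes "\<delta> > 0"
  shows "\<exists>B :: nat \<Rightarrow> heis set. (\<Union>j. B j) = UNIV \<and> (\<forall>j. ediam \<rho> (B j) \<le> ennreal \<delta>) \<and> (\<forall>j. closed (B j))"
proof -
  define \<F> where "\<F> = range (\<lambda>x. {p. \<rho> p x < \<delta> / 2})"
  have "\<And>S. S \<in> \<F> \<Longrightarrow> open S" unfolding \<F>_def using open_rho_ball by blast
  then obtain \<F>' where F': "\<F>' \<subseteq> \<F>" "countable \<F>'" "\<Union>\<F>' = \<Union>\<F>" by (rule Lindelof)
  have "x \<in> {p. \<rho> p x < \<delta> / 2}" for x using assms by simp
  then have "\<Union>\<F> = UNIV" unfolding \<F>_def by blast
  then have "\<F>' \<noteq> {}" using F'(3) by auto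
  show ?thesis
  proof (intro exI[of _ "\<lambda>j. closure (from_nat_into \<F>' j)"] conjI allI)
    have "\<Union>\<F>' = (\<Union>j. from_nat_into \<F>' j)" using range_from_nat_into[OF \<open>\<F>' \<noteq> {}\<close> F'(2)] by simp
    also have "\<dots> \<subseteq> (\<Union>j. closure (from_nat_into \<F>' j))" by (intro UN_mono closure_subset subset_refl)
    finally show "(\<Union>j. closure (from_nat_into \<F>' j)) = UNIV"
      unfolding F'(3) \<open>\<Union>\<F> = UNIV\<close> by (rule top.extremum_uniqueI)
    fix j
    have "from_nat_into \<F>' j \<in> \<F>" using from_nat_into[OF \<open>\<F>' \<noteq> {}\<close>] F'(1) by blast
    then obtain x where x: "from_nat_into \<F>' j = {p. \<rho> p x < \<delta> / 2}" by (auto simp: \<F>_def)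
    have "\<rho> p q \<le> \<delta>" if "\<rho> p x < \<delta> / 2" "\<rho> q x < \<delta> / 2" for p q
      using rho_triangle[of p q x] rho_commute[of x q] that by linarith
    then have "ediam \<rho> (from_nat_into \<F>' j) \<le> ennreal \<delta>"
      unfolding ediam_le_iff x by (auto intro: ennreal_leI)
    then show "ediam \<rho> (closure (from_nat_into \<F>' j)) \<le> ennreal \<delta>" by (simp only: ediam_closure)
  qed simp
qed

text \<open>The factor is pulled out of the infimum. For \<open>c = 0\<close> this requires that coverings by small sets exist,
  since the infimum of the empty family is \<open>\<infinity>\<close>.\<close>

lemma hausdorff_measure_eq_haus3:
  assumes "c < \<infinity>"
  shows "hausdorff_measure \<rho> c 3 E = c * haus3 E"
proof -
  have eq: "(INF B\<in>{B :: nat \<Rightarrow> heis set. E \<subseteq> (\<Union>j. B j) \<and>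
       (\<forall>j. ediam \<rho> (B j) \<le> ennreal \<delta> \<and> closed (B j))}. (\<Sum>j. c * ediam \<rho> (B j) ^ 3)) = c * hpre \<delta> E"
    (is "(INF B\<in>?I. _) = _") if "\<delta> > 0" for \<delta>
  proof (cases "c = 0")
    case True
    obtain B :: "nat \<Rightarrow> heis set" where B: "(\<Union>j. B j) = UNIV" "\<forall>j. ediam \<rho> (B j) \<le> ennreal \<delta>" "\<forall>j. closed (B j)"
      using small_cover_exists[OF \<open>\<delta> > 0\<close>] by (elim exE conjE)
    have "(INF B\<in>?I. (\<Sum>j. c * ediam \<rho> (B j) ^ 3)) \<le> (\<Sum>j. c * ediam \<rho> (B j) ^ 3)"
      by (rule INF_lower) (use B in auto)
    then show ?thesis using True by simp
  next
    case False
    show ?thesis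
    proof (rule antisym)
      show "c * hpre \<delta> E \<le> (INF B\<in>?I. (\<Sum>j. c * ediam \<rho> (B j) ^ 3))"
      proof (rule INF_greatest)
        fix B assume B: "B \<in> ?I"
        have "c * hpre \<delta> E \<le> c * (\<Sum>j. ediam \<rho> (B j) ^ 3)"
          unfolding hpre_def by (intro mult_left_mono INF_lower B) simp
        then show "c * hpre \<delta> E \<le> (\<Sum>j. c * ediam \<rho> (B j) ^ 3)" by simp
      qed
      define J where "J = (INF B\<in>?I. (\<Sum>j. c * ediam \<rho> (B j) ^ 3))"
      have "J / c \<le> hpre \<delta> E"
        unfolding hpre_def
      proof (rule INF_greatest)
        fix B assume B: "B \<in> ?I"
        have "J \<le> (\<Sum>j. c * ediam \<rho> (B j) ^ 3)" unfolding J_def by (rule INF_lower[OF B])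
        then have "J / c \<le> (c * (\<Sum>j. ediam \<rho> (B j) ^ 3)) / c" by (simp add: divide_right_mono_ennreal)
        also have "\<dots> = (\<Sum>j. ediam \<rho> (B j) ^ 3)"
          using False assms by (simp add: mult.commute[of c] ennreal_mult_divide_eq)
        finally show "J / c \<le> (\<Sum>j. ediam \<rho> (B j) ^ 3)" .
      qed
      then have "c * (J / c) \<le> c * hpre \<delta> E" by (rule mult_left_mono) simp
      moreover have "c * (J / c) = J"
        using False assms ennreal_mult_divide_eq[of c J] by (simp add: ennreal_times_divide mult.commute)
      ultimately show "(INF B\<in>?I. (\<Sum>j. c * ediam \<rho> (B j) ^ 3)) \<le> c * hpre \<delta> E"
        by (simp only: J_def)
    qed
  qed
  have "hausdorff_measure \<rho> c 3 E = (SUP \<delta>\<in>{0::real<..}. c * hpre \<delta> E)"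
    unfolding hausdorff_measure_def by (rule SUP_cong[OF refl], rule eq) simp
  also have "\<dots> = c * haus3 E" unfolding haus3_def by (rule SUP_mult_left_ennreal[symmetric])
  finally show ?thesis .
qed

lemma hpre_le:
  assumes "E \<subseteq> (\<Union>j. B j)" "\<And>j. ediam \<rho> (B j) \<le> ennreal \<delta>"
  shows "hpre \<delta> E \<le> (\<Sum>j. ediam \<rho> (B j) ^ 3)"
proof -
  have "hpre \<delta> E \<le> (\<Sum>j. ediam \<rho> (closure (B j)) ^ 3)"
    unfolding hpre_def
  proof (rule INF_lower, safe)
    fix x assume "x \<in> E"
    then obtain j where "x \<in> B j" using assms(1) by blast
    then show "x \<in> (\<Union>j. closure (B j))" using closure_subset[of "B j"] by blast
  qed (use assms in \<open>auto simp: ediam_closure\<close>)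
  then show ?thesis by (simp add: ediam_closure)
qed

lemma hpre_antimono: "\<delta> \<le> \<delta>' \<Longrightarrow> hpre \<delta>' E \<le> hpre \<delta> E"
  unfolding hpre_def by (rule INF_superset_mono) (auto intro: order_trans ennreal_leI)

lemma hpre_mono: "E \<subseteq> F \<Longrightarrow> hpre \<delta> E \<le> hpre \<delta> F"
  unfolding hpre_def by (rule INF_superset_mono) auto

lemma hpre_le_haus3: "\<delta> > 0 \<Longrightarrow> hpre \<delta> E \<le> haus3 E"
  unfolding haus3_def by (rule SUP_upper) simp

lemma haus3_leI: "(\<And>\<delta>. \<delta> > 0 \<Longrightarrow> hpre \<delta> E \<le> C) \<Longrightarrow> haus3 E \<le> C"
  unfolding haus3_def by (rule SUP_least) simp

lemma haus3_mono: "E \<subseteq> F \<Longrightarrow> haus3 E \<le> haus3 F"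
  by (rule haus3_leI) (meson hpre_le_haus3 hpre_mono order_trans)

lemma ediam_empty [simp]: "ediam \<rho> {} = 0" by (simp add: ediam_def bot_ennreal)

lemma hpre_le_ediam:
  assumes "ediam \<rho> A \<le> ennreal \<delta>"
  shows "hpre \<delta> A \<le> ediam \<rho> A ^ 3"
proof -
  have "hpre \<delta> A \<le> (\<Sum>j. ediam \<rho> (if j = (0::nat) then A else {}) ^ 3)"
    by (rule hpre_le) (use assms in auto)
  also have "\<dots> = (\<Sum>j\<in>{0}. ediam \<rho> (if j = (0::nat) then A else {}) ^ 3)"
    by (rule suminf_finite) auto
  finally show ?thesis by simp
qed

lemma hpre_cover:
  assumes "hpre \<delta> E < C"
  shows "\<exists>B :: nat \<Rightarrow> heis set. E \<subseteq> (\<Union>j. B j) \<and> (\<forall>j. ediam \<rho> (B j) \<le> ennreal \<delta>) \<and>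
    (\<Sum>j. ediam \<rho> (B j) ^ 3) < C"
  using assms unfolding hpre_def INF_less_iff by blast

lemma hpre_UN:
  fixes A :: "nat \<Rightarrow> heis set"
  shows "hpre \<delta> (\<Union>n. A n) \<le> (\<Sum>n. hpre \<delta> (A n))"
proof (rule ennreal_le_epsilon)
  fix e :: real assume fin: "(\<Sum>n. hpre \<delta> (A n)) < top" and "e > 0"
  have "\<exists>B :: nat \<Rightarrow> heis set. A n \<subseteq> (\<Union>j. B j) \<and> (\<forall>j. ediam \<rho> (B j) \<le> ennreal \<delta>) \<and>
      (\<Sum>j. ediam \<rho> (B j) ^ 3) \<le> hpre \<delta> (A n) + ennreal (e * (1/2) ^ Suc n)" for n
  proof -
    have "hpre \<delta> (A n) < top" using fin by (rule ennreal_suminf_lessD)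
    then have "hpre \<delta> (A n) < hpre \<delta> (A n) + ennreal (e * (1/2) ^ Suc n)"
      using \<open>e > 0\<close> by (cases "hpre \<delta> (A n)") (auto simp: ennreal_less_iff simp flip: ennreal_plus)
    from hpre_cover[OF this] show ?thesis by (elim exE conjE) (blast intro: less_imp_le)
  qed
  then obtain B :: "nat \<Rightarrow> nat \<Rightarrow> heis set" where B: "\<And>n. A n \<subseteq> (\<Union>j. B n j)" "\<And>n j. ediam \<rho> (B n j) \<le> ennreal \<delta>"
    "\<And>n. (\<Sum>j. ediam \<rho> (B n j) ^ 3) \<le> hpre \<delta> (A n) + ennreal (e * (1/2) ^ Suc n)"
    by metis
  define B' where "B' = (\<lambda>i. case prod_decode i of (n, j) \<Rightarrow> B n j)"
  have "hpre \<delta> (\<Union>n. A n) \<le> (\<Sum>i. ediam \<rho> (B' i) ^ 3)"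
  proof (rule hpre_le)
    show "(\<Union>n. A n) \<subseteq> (\<Union>i. B' i)"
    proof
      fix x assume "x \<in> (\<Union>n. A n)"
      then obtain n j where "x \<in> B n j" using B(1) by blast
      then have "x \<in> B' (prod_encode (n, j))" by (simp add: B'_def)
      then show "x \<in> (\<Union>i. B' i)" by blast
    qed
  qed (use B(2) in \<open>simp add: B'_def split: prod.split\<close>)
  also have "\<dots> = (\<Sum>i. case_prod (\<lambda>n j. ediam \<rho> (B n j) ^ 3) (prod_decode i))"
    by (simp add: B'_def case_prod_unfold)
  also have "\<dots> = (\<Sum>n. (\<Sum>j. ediam \<rho> (B n j) ^ 3))"
    using suminf_ennreal_2dimen[of "\<lambda>n. (\<Sum>j. ediam \<rho> (B n j) ^ 3)" "case_prod (\<lambda>n j. ediam \<rho> (B n j) ^ 3)"]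
    by (simp add: o_def)
  also have "\<dots> \<le> (\<Sum>n. hpre \<delta> (A n) + ennreal (e * (1/2) ^ Suc n))"
    using B(3) by (intro suminf_le) simp_all
  also have "\<dots> = (\<Sum>n. hpre \<delta> (A n)) + (\<Sum>n. ennreal (e * (1/2) ^ Suc n))"
    by (rule suminf_add[symmetric]) auto
  also have "(\<Sum>n. ennreal (e * (1/2) ^ Suc n)) = ennreal e"
  proof (rule suminf_ennreal_eq)
    show "(\<lambda>n. e * (1 / 2) ^ Suc n) sums e"
      using sums_mult[OF power_half_series, of e] by simp
  qed (use \<open>e > 0\<close> in simp)
  finally show "hpre \<delta> (\<Union>n. A n) \<le> (\<Sum>n. hpre \<delta> (A n)) + ennreal e" .
qed

lemma hpre_empty [simp]: "hpre \<delta> {} = 0"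
proof -
  have "hpre \<delta> {} \<le> ediam \<rho> {} ^ 3" by (rule hpre_le_ediam) simp
  then show ?thesis by simp
qed

lemma hpre_Un: "hpre \<delta> (A \<union> B) \<le> hpre \<delta> A + hpre \<delta> B"
proof -
  have "hpre \<delta> (\<Union>n. binaryset A B n) \<le> (\<Sum>n. hpre \<delta> (binaryset A B n))" by (rule hpre_UN)
  also have "\<dots> = hpre \<delta> A + hpre \<delta> B" by (rule suminf_binaryset_eq) simp
  finally show ?thesis by (simp add: UN_binaryset_eq)
qed

lemma hpre_finite_UN: "finite I \<Longrightarrow> hpre \<delta> (\<Union>i\<in>I. A i) \<le> (\<Sum>i\<in>I. hpre \<delta> (A i))"
proof (induction I rule: finite_induct)
  case (insert i I)
  have "hpre \<delta> (\<Union>i\<in>insert i I. A i) \<le> hpre \<delta> (A i) + hpre \<delta> (\<Union>i\<in>I. A i)"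
    using hpre_Un by simp
  also have "\<dots> \<le> hpre \<delta> (A i) + (\<Sum>i\<in>I. hpre \<delta> (A i))" by (intro add_left_mono insert)
  finally show ?case using insert by simp
qed simp

lemma haus3_UN:
  fixes A :: "nat \<Rightarrow> heis set"
  shows "haus3 (\<Union>n. A n) \<le> (\<Sum>n. haus3 (A n))"
proof (rule haus3_leI)
  fix \<delta> :: real assume "\<delta> > 0"
  have "hpre \<delta> (\<Union>n. A n) \<le> (\<Sum>n. hpre \<delta> (A n))" by (rule hpre_UN)
  also have "\<dots> \<le> (\<Sum>n. haus3 (A n))" by (rule suminf_le) (auto intro: hpre_le_haus3 \<open>\<delta> > 0\<close>)
  finally show "hpre \<delta> (\<Union>n. A n) \<le> (\<Sum>n. haus3 (A n))" .
qed

lemma haus3_empty [simp]: "haus3 {} = 0"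
proof -
  have "haus3 {} \<le> 0" by (rule haus3_leI) simp
  then show ?thesis by simp
qed

lemma haus3_Un: "haus3 (A \<union> B) \<le> haus3 A + haus3 B"
proof (rule haus3_leI)
  fix \<delta> :: real assume "\<delta> > 0"
  have "hpre \<delta> (A \<union> B) \<le> hpre \<delta> A + hpre \<delta> B" by (rule hpre_Un)
  also have "\<dots> \<le> haus3 A + haus3 B" by (intro add_mono hpre_le_haus3 \<open>\<delta> > 0\<close>)
  finally show "hpre \<delta> (A \<union> B) \<le> haus3 A + haus3 B" .
qed

lemma haus3_countable_null:
  assumes "countable I" "\<And>i. i \<in> I \<Longrightarrow> haus3 (A i) = 0"
  shows "haus3 (\<Union>i\<in>I. A i) = 0"
proof (cases "I = {}")
  case False
  have "(\<Union>i\<in>I. A i) = (\<Union>i\<in>range (from_nat_into I). A i)"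
    by (simp only: range_from_nat_into[OF False assms(1)])
  also have "\<dots> = (\<Union>n. A (from_nat_into I n))" by blast
  also have "haus3 \<dots> \<le> (\<Sum>n. haus3 (A (from_nat_into I n)))" by (rule haus3_UN)
  finally have "haus3 (\<Union>i\<in>I. A i) \<le> (\<Sum>n. haus3 (A (from_nat_into I n)))" .
  also have "\<dots> = 0" using assms(2) from_nat_into[OF False] by simp
  finally show ?thesis by simp
qed simp

text \<open>A set of diameter smaller than the distance of \<open>A\<close> and \<open>B\<close> meets only one of them.\<close>

lemma haus3_metric_additive:
  assumes "d > 0" and AB: "\<And>x y. x \<in> A \<Longrightarrow> y \<in> B \<Longrightarrow> d \<le> \<rho> x y"
  shows "haus3 A + haus3 B \<le> haus3 (A \<union> B)"
proof -
  have le: "hpre \<delta> A + hpre \<delta> B \<le> haus3 (A \<union> B)" if \<delta>: "0 < \<delta>" "\<delta> < d" for \<delta>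
  proof -
    have "hpre \<delta> A + hpre \<delta> B \<le> hpre \<delta> (A \<union> B)"
      unfolding hpre_def[of \<delta> "A \<union> B"]
    proof (rule INF_greatest, safe)
      fix C :: "nat \<Rightarrow> heis set"
      assume C: "A \<union> B \<subseteq> (\<Union>j. C j)" "\<forall>j. ediam \<rho> (C j) \<le> ennreal \<delta> \<and> closed (C j)"
      define C1 where "C1 = (\<lambda>j. if C j \<inter> A \<noteq> {} then C j else {})"
      define C2 where "C2 = (\<lambda>j. if C j \<inter> A = {} then C j else {})"
      have "hpre \<delta> A \<le> (\<Sum>j. ediam \<rho> (C1 j) ^ 3)"
      proof (rule hpre_le)
        show "A \<subseteq> (\<Union>j. C1 j)"
        proof
          fix x assume "x \<in> A"
          then obtain j where "x \<in> C j" using C(1) by blast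
          then have "x \<in> C1 j" using \<open>x \<in> A\<close> by (auto simp: C1_def)
          then show "x \<in> (\<Union>j. C1 j)" by blast
        qed
      qed (use C(2) in \<open>simp add: C1_def\<close>)
      moreover have "hpre \<delta> B \<le> (\<Sum>j. ediam \<rho> (C2 j) ^ 3)"
      proof (rule hpre_le)
        show "B \<subseteq> (\<Union>j. C2 j)"
        proof
          fix y assume "y \<in> B"
          then obtain j where j: "y \<in> C j" using C(1) by blast
          have "C j \<inter> A = {}"
          proof (rule ccontr)
            assume "C j \<inter> A \<noteq> {}"
            then obtain x where x: "x \<in> C j" "x \<in> A" by blast
            have "ennreal (\<rho> x y) \<le> ennreal \<delta>" using C(2) x j ediam_le_iff[of \<rho> "C j" "ennreal \<delta>"] by blast
            then have "\<rho> x y \<le> \<delta>" using \<delta> by (simp add: ennreal_le_iff)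
            then show False using AB[OF x(2) \<open>y \<in> B\<close>] \<delta> by simp
          qed
          then have "y \<in> C2 j" using j by (simp add: C2_def)
          then show "y \<in> (\<Union>j. C2 j)" by blast
        qed
      qed (use C(2) in \<open>simp add: C2_def\<close>)
      ultimately have "hpre \<delta> A + hpre \<delta> B \<le> (\<Sum>j. ediam \<rho> (C1 j) ^ 3) + (\<Sum>j. ediam \<rho> (C2 j) ^ 3)"
        by (rule add_mono)
      also have "\<dots> = (\<Sum>j. ediam \<rho> (C1 j) ^ 3 + ediam \<rho> (C2 j) ^ 3)"
        by (rule suminf_add) auto
      also have "\<dots> = (\<Sum>j. ediam \<rho> (C j) ^ 3)"
        by (rule suminf_cong) (simp add: C1_def C2_def)
      finally show "hpre \<delta> A + hpre \<delta> B \<le> (\<Sum>j. ediam \<rho> (C j) ^ 3)" .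
    qed
    also have "\<dots> \<le> haus3 (A \<union> B)" by (rule hpre_le_haus3) fact
    finally show ?thesis .
  qed
  have le': "hpre \<delta> A + hpre \<delta>' B \<le> haus3 (A \<union> B)" if "0 < \<delta>" "0 < \<delta>'" for \<delta> \<delta>'
  proof -
    define \<eta> where "\<eta> = min (min \<delta> \<delta>') (d / 2)"
    have "hpre \<delta> A + hpre \<delta>' B \<le> hpre \<eta> A + hpre \<eta> B"
      by (intro add_mono hpre_antimono) (auto simp: \<eta>_def)
    also have "\<dots> \<le> haus3 (A \<union> B)" using that \<open>d > 0\<close> by (intro le) (auto simp: \<eta>_def min_def)
    finally show ?thesis .
  qed
  have "haus3 A + haus3 B = (SUP \<delta>\<in>{0::real<..}. hpre \<delta> A + haus3 B)"
    unfolding haus3_def[of A] by (subst ennreal_SUP_add_left) (auto intro: exI[of _ 1])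
  also have "\<dots> = (SUP \<delta>\<in>{0::real<..}. SUP \<delta>'\<in>{0::real<..}. hpre \<delta> A + hpre \<delta>' B)"
    unfolding haus3_def[of B] by (subst ennreal_SUP_add_right) (auto intro: exI[of _ 1])
  also have "\<dots> \<le> haus3 (A \<union> B)" by (intro SUP_least le') auto
  finally show ?thesis .
qed

lemma haus3_isometry_image_le:
  assumes iso: "\<And>p q. \<rho> (\<phi> p) (\<phi> q) = \<rho> p q"
  shows "haus3 (\<phi> ` E) \<le> haus3 E"
proof (rule haus3_leI)
  fix \<delta> :: real assume "\<delta> > 0"
  have ed: "ediam \<rho> (\<phi> ` B) = ediam \<rho> B" for B by (simp add: ediam_def image_image iso)
  have "hpre \<delta> (\<phi> ` E) \<le> hpre \<delta> E"
    unfolding hpre_def[of \<delta> E]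
  proof (rule INF_greatest, safe)
    fix B :: "nat \<Rightarrow> heis set"
    assume B: "E \<subseteq> (\<Union>j. B j)" "\<forall>j. ediam \<rho> (B j) \<le> ennreal \<delta> \<and> closed (B j)"
    have "hpre \<delta> (\<phi> ` E) \<le> (\<Sum>j. ediam \<rho> (\<phi> ` B j) ^ 3)"
    proof (rule hpre_le)
      have "\<phi> ` E \<subseteq> \<phi> ` (\<Union>j. B j)" using B(1) by (rule image_mono)
      then show "\<phi> ` E \<subseteq> (\<Union>j. \<phi> ` B j)" by (simp only: image_UN)
    qed (use B(2) ed in simp)
    then show "hpre \<delta> (\<phi> ` E) \<le> (\<Sum>j. ediam \<rho> (B j) ^ 3)" by (simp add: ed)
  qed
  also have "\<dots> \<le> haus3 E" by (rule hpre_le_haus3) fact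
  finally show "hpre \<delta> (\<phi> ` E) \<le> haus3 E" .
qed

text \<open>Disjoint compact sets have positive distance, so that the outer measure is additive on the traces of
  finitely many of them.\<close>

lemma disjoint_compact_rho:
  assumes "compact C" "compact D" "C \<inter> D = {}"
  shows "\<exists>d>0. \<forall>x\<in>C. \<forall>y\<in>D. d \<le> \<rho> x y"
proof (cases "C = {} \<or> D = {}")
  case True
  then have "\<forall>x\<in>C. \<forall>y\<in>D. 1 \<le> \<rho> x y" by blast
  then show ?thesis by (intro exI[of _ 1] conjI zero_less_one)
next
  case False
  then have ne: "C \<times> D \<noteq> {}" by blast
  have "continuous_on (C \<times> D) (\<lambda>z. \<rho> (fst z) (snd z))" by (intro continuous_intros)
  from continuous_attains_inf[OF compact_Times[OF assms(1,2)] ne this]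
  obtain z where z: "z \<in> C \<times> D" "\<forall>z'\<in>C \<times> D. \<rho> (fst z) (snd z) \<le> \<rho> (fst z') (snd z')"
    by (rule bexE)
  obtain x y where xy: "z = (x, y)" by (rule prod.exhaust)
  have "x \<in> C" using z(1) unfolding xy by (rule SigmaD1)
  moreover have "y \<in> D" using z(1) unfolding xy by (rule SigmaD2)
  ultimately have "x \<noteq> y" using assms(3) by blast
  then have "\<rho> x y > 0" using rho_nonneg[of x y] by (simp add: less_le)
  moreover have "\<rho> x y \<le> \<rho> x' y'" if "x' \<in> C" "y' \<in> D" for x' y'
  proof -
    have "(x', y') \<in> C \<times> D" using that by (rule SigmaI)
    from bspec[OF z(2) this] show ?thesis by (simp add: xy)
  qed
  ultimately show ?thesis by (intro exI[of _ "\<rho> x y"] conjI ballI)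
qed

lemma haus3_finite_additive:
  assumes "finite I" "\<And>i. i \<in> I \<Longrightarrow> compact (C i)" "disjoint_family_on C I"
  shows "(\<Sum>i\<in>I. haus3 (A \<inter> C i)) \<le> haus3 (A \<inter> (\<Union>i\<in>I. C i))"
  using assms
proof (induction I rule: finite_induct)
  case (insert i I)
  have "C i \<inter> C j = {}" if "j \<in> I" for j
    using insert.hyps(2) that by (intro disjoint_family_onD[OF insert.prems(2)]) auto
  then have dj: "C i \<inter> (\<Union>i\<in>I. C i) = {}" by blast
  have "compact (\<Union>i\<in>I. C i)" using insert.hyps(1) insert.prems(1) by (intro compact_UN) auto
  from disjoint_compact_rho[OF insert.prems(1)[OF insertI1] this dj]
  obtain d where d: "d > 0" "\<forall>x\<in>C i. \<forall>y\<in>(\<Union>i\<in>I. C i). d \<le> \<rho> x y" by (elim exE conjE) (rule that)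
  have "(\<Sum>i\<in>I. haus3 (A \<inter> C i)) \<le> haus3 (A \<inter> (\<Union>i\<in>I. C i))"
    by (rule insert.IH, rule insert.prems(1), erule insertI2,
      rule disjoint_family_on_mono[OF subset_insertI insert.prems(2)])
  then have "(\<Sum>i\<in>insert i I. haus3 (A \<inter> C i)) \<le> haus3 (A \<inter> C i) + haus3 (A \<inter> (\<Union>i\<in>I. C i))"
    unfolding sum.insert[OF insert.hyps] by (rule add_left_mono)
  also have "\<dots> \<le> haus3 ((A \<inter> C i) \<union> (A \<inter> (\<Union>i\<in>I. C i)))"
  proof (rule haus3_metric_additive[OF d(1)])
    fix x y assume "x \<in> A \<inter> C i" "y \<in> A \<inter> (\<Union>i\<in>I. C i)"
    then have "x \<in> C i" "y \<in> (\<Union>i\<in>I. C i)" by (simp_all only: Int_iff)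
    then show "d \<le> \<rho> x y" by (rule d(2)[THEN bspec, THEN bspec])
  qed
  also have "(A \<inter> C i) \<union> (A \<inter> (\<Union>i\<in>I. C i)) = A \<inter> (\<Union>i\<in>insert i I. C i)"
    unfolding UN_insert Int_Un_distrib ..
  finally show ?case .
qed simp

section \<open>Intrinsic cone sets\<close>

text \<open>Near each of its points and up to a rotation, a regular hypersurface is such a set with
  \<open>\<epsilon>\<close> as small as desired: in the direction normal to the tangent plane \<open>y = 0\<close> its points differ
  by little compared with their distance.\<close>

definition cone_set :: "real \<Rightarrow> heis set \<Rightarrow> bool" where
  "cone_set \<epsilon> E \<longleftrightarrow> (\<forall>p\<in>E. \<forall>q\<in>E. \<bar>fst (snd p) - fst (snd q)\<bar> \<le> \<epsilon> * \<rho> p q)"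

lemma cone_set_subset: "cone_set \<epsilon> E \<Longrightarrow> F \<subseteq> E \<Longrightarrow> cone_set \<epsilon> F"
  unfolding cone_set_def by blast

lemma cone_setD: "cone_set \<epsilon> E \<Longrightarrow> p \<in> E \<Longrightarrow> q \<in> E \<Longrightarrow> \<bar>fst (snd p) - fst (snd q)\<bar> \<le> \<epsilon> * \<rho> p q"
  unfolding cone_set_def by blast

text \<open>The chart sends a planar set to the projection of its translate to \<open>q\<close> at scale \<open>s\<close>. It is a shear
  whose slope depends on \<open>q\<close>.\<close>

definition chart :: "heis \<Rightarrow> real \<Rightarrow> real \<times> real \<Rightarrow> real \<times> real" where
  "chart q s m = (fst q + s * fst m,
     (snd (snd q) + 2 * fst q * fst (snd q)) + s\<^sup>2 * snd m + (4 * fst (snd q) * s) * fst m)"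

lemma chart_eq: "chart q s m = proj (q \<cdot>\<^sub>H dil s (plane m))"
  by (cases q; cases m) (simp add: chart_def proj_def dil_def plane_def algebra_simps)

lemma emeasure_chart:
  assumes "M \<in> sets borel" "s > 0"
  shows "emeasure lborel (chart q s ` M) = ennreal (s ^ 3) * emeasure lborel M" "chart q s ` M \<in> sets borel"
  using emeasure_sheared_image[OF assms(1), of s "s\<^sup>2" "fst q" "snd (snd q) + 2 * fst q * fst (snd q)" "4 * fst (snd q) * s"]
    assms(2) unfolding chart_def[abs_def] by (simp_all add: power3_eq_cube power2_eq_square mult.assoc)

lemma proj_mult_y [simp]: "proj (p \<cdot>\<^sub>H (0, b, 0)) = proj p"
  by (cases p) (simp add: proj_def algebra_simps)

text \<open>The two points lie on a common horizontal line in the direction of \<open>Y\<close>.\<close>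

lemma rho_le_if_proj_eq:
  assumes "proj p = proj q"
  shows "\<rho> p q \<le> \<bar>fst (snd p) - fst (snd q)\<bar>"
proof -
  have "q = plane (proj p) \<cdot>\<^sub>H (0, fst (snd q), 0)" using plane_proj[of q] assms by simp
  also have "plane (proj p) = p \<cdot>\<^sub>H (0, - fst (snd p), 0)"
  proof -
    have "p \<cdot>\<^sub>H (0, - fst (snd p), 0) = (plane (proj p) \<cdot>\<^sub>H (0, fst (snd p), 0)) \<cdot>\<^sub>H (0, - fst (snd p), 0)"
      by (simp only: plane_proj)
    also have "\<dots> = plane (proj p)" by (simp add: heis_mult_assoc flip: zero_prod_def)
    finally show ?thesis ..
  qed
  finally have "q = p \<cdot>\<^sub>H (0, fst (snd q) - fst (snd p), 0)" by (simp add: heis_mult_assoc)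
  then have "\<rho> p q = gauge_norm (0, fst (snd q) - fst (snd p), 0)"
    by (metis heis_mult_cancel(1) rho_eq_gauge_norm)
  also have "\<dots> \<le> \<bar>fst (snd p) - fst (snd q)\<bar>"
    using gauge_norm_horizontal_le[of 0 "fst (snd q) - fst (snd p)"] by simp
  finally show ?thesis .
qed

lemma snd_mult_dil_plane [simp]: "fst (snd (q \<cdot>\<^sub>H dil s (plane m))) = fst (snd q)"
  by (cases q) (simp add: dil_def plane_def)

lemma rho_mult_dil_plane: "s \<ge> 0 \<Longrightarrow> \<rho> q (q \<cdot>\<^sub>H dil s (plane m)) = s * gauge_norm (plane m)"
  by (simp add: rho_eq_gauge_norm gauge_norm_dil)

context
  fixes \<epsilon> :: real and E :: "heis set"
  assumes cone: "cone_set \<epsilon> E" and eps: "0 \<le> \<epsilon>" "\<epsilon> \<le> 1/2"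
begin

text \<open>The point of the translated plane over which \<open>p\<close> lies differs from \<open>p\<close> by a \<open>Y\<close>-line, whose length is
  controlled by the cone condition. So \<open>E\<close> is close to the translated plane at every scale \<open>s\<close>.\<close>

lemma cone_chart_close:
  assumes "p \<in> E" "q \<in> E" "proj p = chart q s m" "s > 0" "gauge_norm (plane m) \<le> 2"
  shows "\<rho> p q \<le> 4 * s" "\<rho> p (q \<cdot>\<^sub>H dil s (plane m)) \<le> 4 * \<epsilon> * s"
proof -
  let ?q = "q \<cdot>\<^sub>H dil s (plane m)"
  have 1: "\<rho> p ?q \<le> \<epsilon> * \<rho> p q"
    using rho_le_if_proj_eq[of p ?q] cone_setD[OF cone assms(1,2)] assms(3) by (simp add: chart_eq)
  have "\<epsilon> * \<rho> p q \<le> 1/2 * \<rho> p q" using eps by (intro mult_right_mono) auto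
  moreover have "\<rho> p q \<le> \<rho> p ?q + s * gauge_norm (plane m)"
    using rho_triangle[of p q ?q] rho_mult_dil_plane[of s q m] assms(4) by (simp add: rho_commute[of q])
  moreover have "s * gauge_norm (plane m) \<le> s * 2" using assms(4,5) by (intro mult_left_mono) auto
  ultimately show pq: "\<rho> p q \<le> 4 * s" using 1 by linarith
  have "\<epsilon> * \<rho> p q \<le> \<epsilon> * (4 * s)" using eps pq by (intro mult_left_mono) auto
  then show "\<rho> p ?q \<le> 4 * \<epsilon> * s" using 1 by simp
qed

lemma cone_chart_diameter:
  assumes "p \<in> E" "p' \<in> E" "q \<in> E" "proj p \<in> chart q s ` large_set" "proj p' \<in> chart q s ` large_set" "s > 0"
  shows "\<rho> p p' \<le> (2 + 8 * \<epsilon>) * s"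
proof -
  obtain m where m: "m \<in> large_set" "proj p = chart q s m" using assms(4) by (rule imageE)
  obtain m' where m': "m' \<in> large_set" "proj p' = chart q s m'" using assms(5) by (rule imageE)
  let ?q = "q \<cdot>\<^sub>H dil s (plane m)" and ?q' = "q \<cdot>\<^sub>H dil s (plane m')"
  have "\<rho> p ?q \<le> 4 * \<epsilon> * s"
    using assms m large_set_norm_le by (intro cone_chart_close(2)) auto
  moreover have "\<rho> p' ?q' \<le> 4 * \<epsilon> * s"
    using assms m' large_set_norm_le by (intro cone_chart_close(2)) auto
  moreover have "\<rho> ?q ?q' \<le> 2 * s"
  proof -
    have "\<rho> ?q ?q' = s * \<rho> (plane m) (plane m')" using rho_dil[of s] assms(6) by simp
    also have "\<rho> (plane m) (plane m') = gauge_norm (plane (m' - m))"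
      by (simp add: rho_eq_gauge_norm plane_diff)
    also have "s * \<dots> \<le> s * 2"
      using large_set_diameter[OF m'(1) m(1)] assms(6) by (intro mult_left_mono) auto
    finally show ?thesis by simp
  qed
  moreover have "\<rho> p p' \<le> \<rho> p ?q + (\<rho> ?q ?q' + \<rho> ?q' p')"
    using rho_triangle[of p p' ?q] rho_triangle[of ?q p' ?q'] by linarith
  ultimately show ?thesis by (simp add: rho_commute[of ?q' p'] distrib_right)
qed

lemma cone_chart_disjoint:
  assumes "q \<in> E" "q' \<in> E" "8 * s < \<rho> q q'" "s > 0"
  shows "chart q s ` large_set \<inter> chart q' s ` large_set = {}"
proof (rule ccontr)
  assume "\<not> ?thesis"
  then obtain n where n: "n \<in> chart q s ` large_set" "n \<in> chart q' s ` large_set" by blast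
  obtain m where m: "m \<in> large_set" "n = chart q s m" using n(1) by (rule imageE)
  obtain m' where m': "m' \<in> large_set" "n = chart q' s m'" using n(2) by (rule imageE)
  let ?q = "q \<cdot>\<^sub>H dil s (plane m)" and ?q' = "q' \<cdot>\<^sub>H dil s (plane m')"
  have "\<rho> ?q ?q' \<le> \<epsilon> * \<rho> q q'"
    using rho_le_if_proj_eq[of ?q ?q'] cone_setD[OF cone assms(1,2)] m(2) m'(2) by (simp add: chart_eq)
  also have "\<dots> \<le> 1/2 * \<rho> q q'" using eps by (intro mult_right_mono) auto
  finally have 1: "\<rho> ?q ?q' \<le> 1/2 * \<rho> q q'" .
  have "\<rho> q q' \<le> \<rho> q ?q + (\<rho> ?q ?q' + \<rho> ?q' q')"
    using rho_triangle[of q q' ?q] rho_triangle[of ?q q' ?q'] by linarith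
  moreover have "\<rho> q ?q \<le> s * 2" "\<rho> q' ?q' \<le> s * 2"
    using rho_mult_dil_plane[of s q m] rho_mult_dil_plane[of s q' m'] assms(4)
      large_set_norm_le[OF m(1)] large_set_norm_le[OF m'(1)] by (simp_all add: mult_left_mono)
  ultimately show False using 1 assms(3) rho_commute[of ?q' q'] by linarith
qed

text \<open>Removing the \<open>Y\<close>-component of \<open>- q \<cdot> p\<close>, which is small by the cone condition, increases its norm by
  a factor of at most \<open>1 + \<epsilon>\<close>.\<close>

lemma cone_proj_ball:
  assumes "p \<in> E" "q \<in> E" "\<rho> p q \<le> R"
  shows "proj p \<in> chart q 1 ` {m. gauge_norm (plane m) \<le> (1 + \<epsilon>) * R}"
proof -
  define d where "d = - q \<cdot>\<^sub>H p"
  have p: "p = q \<cdot>\<^sub>H d" by (simp add: d_def)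
  define m where "m = proj d"
  define b where "b = fst (snd d)"
  have d: "d = plane m \<cdot>\<^sub>H (0, b, 0)" by (simp add: m_def b_def plane_proj)
  have "dil 1 (plane m) = plane m" by (simp add: dil_def)
  then have "chart q 1 m = proj ((q \<cdot>\<^sub>H plane m) \<cdot>\<^sub>H (0, b, 0))" by (simp only: proj_mult_y chart_eq)
  also have "\<dots> = proj p" by (simp only: p d heis_mult_assoc)
  finally have eq: "proj p = chart q 1 m" ..
  have N: "gauge_norm d = \<rho> p q" by (simp add: d_def rho_eq_gauge_norm')
  have "b = fst (snd p) - fst (snd q)" by (simp add: b_def d_def heis_mult_eq)
  then have b: "\<bar>b\<bar> \<le> \<epsilon> * \<rho> p q" using cone_setD[OF cone assms(1,2)] by simp
  have "plane m = d \<cdot>\<^sub>H (0, - b, 0)"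
    by (simp add: d heis_mult_assoc flip: zero_prod_def)
  then have "gauge_norm (plane m) \<le> gauge_norm d + \<bar>b\<bar>"
    using gauge_norm_mult_le[of d "(0, - b, 0)"] gauge_norm_horizontal_le[of 0 "- b"] by simp
  also have "\<dots> \<le> (1 + \<epsilon>) * \<rho> p q" using b N by (simp add: distrib_right)
  also have "\<dots> \<le> (1 + \<epsilon>) * R" using assms(3) eps by (intro mult_left_mono) auto
  finally show ?thesis unfolding eq by (intro imageI CollectI)
qed

end

definition proj_area :: "heis set \<Rightarrow> real" where
  "proj_area E = measure lborel (proj ` E)"

lemma compact_proj: "compact E \<Longrightarrow> compact (proj ` E)"
  by (intro compact_continuous_image continuous_intros)

lemma emeasure_proj: "compact E \<Longrightarrow> emeasure lborel (proj ` E) = ennreal (proj_area E)"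
  unfolding proj_area_def
  using emeasure_compact_finite[OF compact_proj] by (intro emeasure_eq_ennreal_measure) (auto simp: less_top)

lemma proj_area_nonneg [simp]: "proj_area E \<ge> 0" by (simp add: proj_area_def)

definition large_area :: real where "large_area = measure lborel large_set"

lemma emeasure_large_set: "emeasure lborel large_set = ennreal large_area"
  unfolding large_area_def using large_set_area(1) by (intro emeasure_eq_ennreal_measure) (auto simp: less_top)

lemma large_area_pos: "large_area > 0" "ball_area < large_area"
  using large_set_area by (simp_all add: large_area_def)

lemma chart_dist:
  assumes "0 < s" "s \<le> 1" "m \<in> large_set" "\<bar>fst (snd q)\<bar> \<le> Y"
  shows "dist (proj q) (chart q s m) \<le> s * (6 + 8 * Y)"
proof -
  have N: "gauge_norm (plane m) \<le> 2" using assms(3) by (rule large_set_norm_le)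
  have a: "\<bar>fst m\<bar> \<le> 2" using abs_fst_le_gauge_norm[of "plane m"] N by (simp add: plane_def)
  have "(gauge_norm (plane m))\<^sup>2 \<le> 2\<^sup>2" using N by (intro power_mono) auto
  then have b: "\<bar>snd m\<bar> \<le> 4" using abs_vertical_le_gauge_norm[of "plane m"] by (simp add: plane_def)
  have "proj q - chart q s m = (- (s * fst m), - (s\<^sup>2 * snd m + (4 * fst (snd q) * s) * fst m))"
    by (simp add: proj_def chart_def)
  then have "dist (proj q) (chart q s m) \<le> \<bar>s * fst m\<bar> + \<bar>s\<^sup>2 * snd m + (4 * fst (snd q) * s) * fst m\<bar>"
    using norm_Pair_le[of "- (s * fst m)" "- (s\<^sup>2 * snd m + (4 * fst (snd q) * s) * fst m)"]
    by (simp add: dist_norm)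
  also have "\<dots> \<le> \<bar>s * fst m\<bar> + (\<bar>s\<^sup>2 * snd m\<bar> + \<bar>(4 * fst (snd q) * s) * fst m\<bar>)"
    by (intro add_left_mono abs_triangle_ineq)
  also have "\<dots> \<le> s * 2 + (s * 4 + s * (8 * Y))"
  proof (intro add_mono)
    show "\<bar>s * fst m\<bar> \<le> s * 2" using a assms(1) by (simp add: abs_mult)
    have "s\<^sup>2 \<le> s" using assms(1,2) by (simp add: power2_eq_square mult_left_le)
    then show "\<bar>s\<^sup>2 * snd m\<bar> \<le> s * 4" unfolding abs_mult using b assms(1) by (intro mult_mono) auto
    have "\<bar>fst (snd q)\<bar> * \<bar>fst m\<bar> \<le> Y * 2" using a assms(4) by (intro mult_mono) auto
    then have "(4 * s) * (\<bar>fst (snd q)\<bar> * \<bar>fst m\<bar>) \<le> (4 * s) * (Y * 2)" using assms(1) by (intro mult_left_mono) auto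
    then show "\<bar>(4 * fst (snd q) * s) * fst m\<bar> \<le> s * (8 * Y)" using assms(1) by (simp add: abs_mult algebra_simps)
  qed
  finally show ?thesis by (simp add: distrib_left)
qed

text \<open>A maximal family of points of \<open>E\<close> at mutual distance greater than \<open>8 s\<close>. The charts of the large set at
  these points are disjoint, and they fill at least a fixed proportion of the projection of \<open>E\<close>: the balls
  of radius \<open>8 s\<close> cover \<open>E\<close>, and each projects into a translated ball of radius \<open>12 s\<close>, where
  \<open>12\<^sup>3 = 1728\<close>. The scale \<open>s\<close> is so small that the charts stay in an open neighbourhood \<open>U\<close> of the projection
  with almost the same area.\<close>

lemma chart_packing:
  fixes \<epsilon> \<eta> s0 :: real
  assumes E: "compact E" "cone_set \<epsilon> E" "0 \<le> \<epsilon>" "\<epsilon> \<le> 1/2" and "\<eta> > 0" "s0 > 0"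
  obtains s :: real and G where "0 < s" "s \<le> s0" "finite G" "G \<subseteq> E" "E \<subseteq> (\<Union>q\<in>G. \<rho>_ball q (8 * s))"
    "proj_area E / 1728 \<le> real (card G) * s ^ 3 * large_area"
    "real (card G) * s ^ 3 * large_area \<le> proj_area E + \<eta>"
    "compact (E - (\<Union>q\<in>G. proj -` (chart q s ` large_set)))"
    "proj_area (E - (\<Union>q\<in>G. proj -` (chart q s ` large_set))) \<le> proj_area E + \<eta> - real (card G) * s ^ 3 * large_area"
proof -
  have cpt: "compact (proj ` E)" by (rule compact_proj[OF E(1)])
  have "proj ` E \<in> sets borel" using cpt by (rule borel_compact)
  then obtain U where U: "open U" "proj ` E \<subseteq> U" "emeasure lborel (U - proj ` E) < ennreal \<eta>"
    using outer_regular_lborel[of "proj ` E" \<eta>] \<open>\<eta> > 0\<close> by metis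
  have Um: "emeasure lborel U \<le> ennreal (proj_area E + \<eta>)"
  proof -
    have "U = proj ` E \<union> (U - proj ` E)" using U(2) by blast
    then have "emeasure lborel U \<le> emeasure lborel (proj ` E) + emeasure lborel (U - proj ` E)"
      using emeasure_subadditive[of "proj ` E" lborel "U - proj ` E"] \<open>proj ` E \<in> sets borel\<close> U(1) by simp
    also have "\<dots> \<le> ennreal (proj_area E) + ennreal \<eta>"
      using U(3) by (intro add_mono) (simp_all add: emeasure_proj[OF E(1)])
    finally show ?thesis using \<open>\<eta> > 0\<close> by simp
  qed
  obtain e where e: "e > 0" "(\<Union>x\<in>proj ` E. ball x e) \<subseteq> U"
    using compact_subset_open_imp_ball_epsilon_subset[OF cpt U(1,2)] by metis
  have "bounded ((\<lambda>q. fst (snd q)) ` E)"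
    by (intro compact_imp_bounded compact_continuous_image continuous_intros E(1))
  then obtain Y where Y: "\<And>q. q \<in> E \<Longrightarrow> \<bar>fst (snd q)\<bar> \<le> Y" unfolding bounded_iff by fastforce
  define Y' where "Y' = \<bar>Y\<bar>"
  define s where "s = min (min s0 1) (e / (2 * (6 + 8 * Y')))"
  have Y': "Y' \<ge> 0" "Y \<le> Y'" by (auto simp: Y'_def)
  have s: "0 < s" "s \<le> s0" "s \<le> 1" "s * (6 + 8 * Y') < e"
  proof -
    show "0 < s" "s \<le> s0" "s \<le> 1" using \<open>s0 > 0\<close> e(1) Y' by (auto simp: s_def)
    have "s * (6 + 8 * Y') \<le> e / (2 * (6 + 8 * Y')) * (6 + 8 * Y')"
      using Y' by (intro mult_right_mono) (auto simp: s_def)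
    also have "\<dots> = e / 2" using Y' by (simp add: field_simps)
    finally show "s * (6 + 8 * Y') < e" using e(1) by simp
  qed
  let ?C = "\<lambda>q. chart q s ` large_set"
  have CU: "?C q \<subseteq> U" if "q \<in> E" for q
  proof
    fix n assume "n \<in> ?C q"
    then obtain m where m: "m \<in> large_set" "n = chart q s m" by (rule imageE)
    have "dist (proj q) n \<le> s * (6 + 8 * Y')"
      unfolding m(2) using Y[OF that] Y' by (intro chart_dist s m) auto
    then have "n \<in> ball (proj q) e" using s(4) by simp
    then show "n \<in> U" using e(2) that by blast
  qed
  have lb: "large_set \<in> sets borel" using open_large_set by simp
  have Cb: "?C q \<in> sets borel" for q by (rule emeasure_chart(2)[OF lb s(1)])
  have Cm: "emeasure lborel (?C q) = ennreal (s ^ 3 * large_area)" for q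
    using emeasure_chart(1)[OF lb s(1), of q] emeasure_large_set s(1) by (simp add: ennreal_mult')
  define sep where "sep G \<longleftrightarrow> finite G \<and> G \<subseteq> E \<and> (\<forall>q\<in>G. \<forall>q'\<in>G. q \<noteq> q' \<longrightarrow> 8 * s < \<rho> q q')" for G
  have dj: "disjoint_family_on ?C G" if "sep G" for G
    unfolding disjoint_family_on_def
  proof (intro ballI impI)
    fix q q' assume q: "q \<in> G" "q' \<in> G" "q \<noteq> q'"
    then have "q \<in> E" "q' \<in> E" "8 * s < \<rho> q q'" using that unfolding sep_def by blast+
    then show "?C q \<inter> ?C q' = {}" using s(1) by (intro cone_chart_disjoint[OF E(2-4)])
  qed
  have union: "emeasure lborel (\<Union>q\<in>G. ?C q) = ennreal (real (card G) * s ^ 3 * large_area)" if "sep G" for G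
  proof -
    have "emeasure lborel (\<Union>q\<in>G. ?C q) = (\<Sum>q\<in>G. emeasure lborel (?C q))"
      using that by (intro sum_emeasure[symmetric] dj) (auto simp: sep_def Cb)
    also have "\<dots> = ennreal (real (card G) * s ^ 3 * large_area)"
      unfolding Cm using s(1) large_area_pos by (simp add: ennreal_of_nat_eq_real_of_nat ennreal_mult' mult.assoc)
    finally show ?thesis .
  qed
  have sub: "(\<Union>q\<in>G. ?C q) \<subseteq> U" if "sep G" for G
    using CU that unfolding sep_def by blast
  have bound: "real (card G) * s ^ 3 * large_area \<le> proj_area E + \<eta>" if "sep G" for G
  proof -
    have "emeasure lborel (\<Union>q\<in>G. ?C q) \<le> emeasure lborel U"
      using sub[OF that] U(1) by (intro emeasure_mono) auto
    then have "ennreal (real (card G) * s ^ 3 * large_area) \<le> ennreal (proj_area E + \<eta>)"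
      using union[OF that] Um by (metis order_trans)
    then show ?thesis using \<open>\<eta> > 0\<close> by (subst (asm) ennreal_le_iff) (auto intro: add_nonneg_nonneg)
  qed
  obtain B :: nat where B: "(proj_area E + \<eta>) / (s ^ 3 * large_area) \<le> real B" using real_arch_simple by blast
  have "card G \<le> B" if "sep G" for G
  proof -
    have "real (card G) \<le> (proj_area E + \<eta>) / (s ^ 3 * large_area)"
      using bound[OF that] s(1) large_area_pos by (simp add: field_simps)
    then show ?thesis using B by linarith
  qed
  moreover have "sep {}" by (simp add: sep_def)
  ultimately obtain G where G: "sep G" "\<And>H. sep H \<Longrightarrow> card H \<le> card G"
    using ex_has_greatest_nat[of sep "{}" card "Suc B"] by (metis le_imp_less_Suc)
  have fin: "finite G" "G \<subseteq> E" using G(1) by (auto simp: sep_def)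
  have cover: "E \<subseteq> (\<Union>q\<in>G. \<rho>_ball q (8 * s))"
  proof
    fix p assume p: "p \<in> E"
    show "p \<in> (\<Union>q\<in>G. \<rho>_ball q (8 * s))"
    proof (rule ccontr)
      assume "p \<notin> (\<Union>q\<in>G. \<rho>_ball q (8 * s))"
      then have far: "8 * s < \<rho> p q" if "q \<in> G" for q
        using that unfolding \<rho>_ball_def by force
      have "p \<notin> G"
      proof
        assume "p \<in> G"
        from far[OF this] show False using s(1) by simp
      qed
      have "sep (insert p G)"
        unfolding sep_def
      proof (intro conjI ballI impI)
        fix q q' assume "q \<in> insert p G" "q' \<in> insert p G" "q \<noteq> q'"
        then consider "q = p" "q' \<in> G" | "q \<in> G" "q' = p" | "q \<in> G" "q' \<in> G" by blast
        then show "8 * s < \<rho> q q'"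
        proof cases
          case 3
          then show ?thesis using G(1) \<open>q \<noteq> q'\<close> unfolding sep_def by blast
        next
          case 1
          then show ?thesis using far by simp
        next
          case 2
          then show ?thesis using far[of q] rho_commute[of q p] by simp
        qed
      qed (use fin p in simp_all)
      from G(2)[OF this] show False using fin \<open>p \<notin> G\<close> by simp
    qed
  qed
  have low: "proj_area E / 1728 \<le> real (card G) * s ^ 3 * large_area"
  proof -
    let ?D = "\<lambda>q. chart q 1 ` {m. gauge_norm (plane m) \<le> 12 * s}"
    have Db: "{m. gauge_norm (plane m) \<le> 12 * s} \<in> sets borel" by (intro borel_compact compact_plane_gauge_ball)
    have "proj ` E \<subseteq> (\<Union>q\<in>G. ?D q)"
    proof
      fix n assume "n \<in> proj ` E"
      then obtain p where p: "p \<in> E" "n = proj p" by (rule imageE)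
      then obtain q where q: "q \<in> G" "\<rho> p q \<le> 8 * s" using cover unfolding \<rho>_ball_def by blast
      have "n \<in> chart q 1 ` {m. gauge_norm (plane m) \<le> (1 + \<epsilon>) * (8 * s)}"
        unfolding p(2) using q fin by (intro cone_proj_ball[OF E(2-4) p(1)]) auto
      moreover have le: "(1 + \<epsilon>) * (8 * s) \<le> (3/2) * (8 * s)" using E(4) s(1) by (intro mult_right_mono) auto
      have "{m. gauge_norm (plane m) \<le> (1 + \<epsilon>) * (8 * s)} \<subseteq> {m. gauge_norm (plane m) \<le> 12 * s}"
        by (rule Collect_mono) (use le in linarith)
      ultimately have "n \<in> ?D q" by blast
      then show "n \<in> (\<Union>q\<in>G. ?D q)" using q(1) by blast
    qed
    then have "emeasure lborel (proj ` E) \<le> emeasure lborel (\<Union>q\<in>G. ?D q)"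
      using emeasure_chart(2)[OF Db, of 1] fin by (intro emeasure_mono) auto
    also have "\<dots> \<le> (\<Sum>q\<in>G. emeasure lborel (?D q))"
      using emeasure_chart(2)[OF Db, of 1] fin by (intro emeasure_subadditive_finite) auto
    also have "\<dots> = (\<Sum>q\<in>G. ennreal ((12 * s) ^ 3 * ball_area))"
      using emeasure_chart(1)[OF Db, of 1] emeasure_plane_gauge_ball[of "12 * s"] s(1) by simp
    also have "\<dots> = ennreal (real (card G) * ((12 * s) ^ 3 * ball_area))"
      using s(1) large_set_area(3) by (simp add: ennreal_of_nat_eq_real_of_nat ennreal_mult')
    finally have "proj_area E \<le> real (card G) * ((12 * s) ^ 3 * ball_area)"
      unfolding emeasure_proj[OF E(1)] using s(1) large_set_area(3) by (subst (asm) ennreal_le_iff) auto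
    also have "\<dots> = 1728 * (real (card G) * s ^ 3 * ball_area)" by (simp add: power_mult_distrib)
    also have "\<dots> \<le> 1728 * (real (card G) * s ^ 3 * large_area)"
      using large_area_pos s(1) by (intro mult_left_mono) auto
    finally show ?thesis by simp
  qed
  define E' where "E' = E - (\<Union>q\<in>G. proj -` (?C q))"
  have Ub: "(\<Union>q\<in>G. ?C q) \<in> sets borel" by (intro sets.finite_UN fin Cb)
  have openC: "open (?C q)" for q
  proof -
    define R where "R = (\<lambda>n. ((fst n - fst q) / s, (snd n - (snd (snd q) + 2 * fst q * fst (snd q)) - (4 * fst (snd q) * s) * ((fst n - fst q) / s)) / s\<^sup>2))"
    have RT: "R (chart q s m) = m" for m
      using s(1) by (simp add: R_def chart_def)
    have TR: "chart q s (R n) = n" for n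
      using s(1) by (simp add: R_def chart_def)
    have "?C q = R -` large_set"
    proof (intro equalityI subsetI)
      fix n assume "n \<in> R -` large_set"
      then have "chart q s (R n) \<in> ?C q" by simp
      then show "n \<in> ?C q" by (simp only: TR)
    qed (auto simp: RT)
    moreover have "open (R -` large_set)"
    proof (rule open_vimage[OF open_large_set])
      show "continuous_on UNIV R" unfolding R_def using s(1) by (intro continuous_intros) auto
    qed
    ultimately show ?thesis by simp
  qed
  have "open (\<Union>q\<in>G. proj -` (?C q))"
    by (intro open_UN ballI open_vimage openC continuous_intros)
  then have cE': "compact E'" unfolding E'_def by (rule compact_diff[OF E(1)])
  have "proj ` E' \<subseteq> U - (\<Union>q\<in>G. ?C q)"
  proof
    fix n assume "n \<in> proj ` E'"
    then obtain p where p: "p \<in> E'" "n = proj p" by (rule imageE)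
    have "p \<in> E" using p(1) unfolding E'_def by (rule DiffD1)
    then have "n \<in> U" using U(2) p(2) by blast
    moreover have "n \<notin> (\<Union>q\<in>G. ?C q)"
    proof
      assume "n \<in> (\<Union>q\<in>G. ?C q)"
      then obtain q where "q \<in> G" "proj p \<in> ?C q" unfolding p(2) by (rule UN_E)
      then have "p \<in> (\<Union>q\<in>G. proj -` (?C q))" by (intro UN_I vimageI2)
      then show False by (rule DiffD2[OF p(1)[unfolded E'_def]])
    qed
    ultimately show "n \<in> U - (\<Union>q\<in>G. ?C q)" by (rule DiffI)
  qed
  then have "emeasure lborel (proj ` E') \<le> emeasure lborel (U - (\<Union>q\<in>G. ?C q))"
    using U(1) Ub by (intro emeasure_mono) (simp_all add: sets.Diff)
  also have "\<dots> = emeasure lborel U - emeasure lborel (\<Union>q\<in>G. ?C q)"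
    using U(1) Ub sub[OF G(1)] union[OF G(1)] by (intro emeasure_Diff) simp_all
  also have "\<dots> \<le> ennreal (proj_area E + \<eta>) - ennreal (real (card G) * s ^ 3 * large_area)"
    unfolding union[OF G(1)] using Um by (rule ennreal_minus_mono) simp
  also have "\<dots> = ennreal (proj_area E + \<eta> - real (card G) * s ^ 3 * large_area)"
    using s(1) large_area_pos by (intro ennreal_minus) auto
  finally have "proj_area E' \<le> proj_area E + \<eta> - real (card G) * s ^ 3 * large_area"
    unfolding emeasure_proj[OF cE'] using bound[OF G(1)] by (subst (asm) ennreal_le_iff) auto
  with cE' show ?thesis
    using that[OF s(1,2) fin cover low bound[OF G(1)]] unfolding E'_def by simp
qed

lemma sum_ennreal_cube: "0 \<le> c \<Longrightarrow> (\<Sum>q\<in>G. ennreal c ^ 3) = ennreal (real (card G) * c ^ 3)"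
  by (simp add: ennreal_power ennreal_of_nat_eq_real_of_nat ennreal_mult')

lemma hpre_chart_pieces:
  fixes \<epsilon> \<delta> s :: real
  assumes E: "cone_set \<epsilon> E" "0 \<le> \<epsilon>" "\<epsilon> \<le> 1/2" and G: "finite G" "G \<subseteq> E" and s: "s > 0" "(2 + 8 * \<epsilon>) * s \<le> \<delta>"
  shows "hpre \<delta> (\<Union>q\<in>G. E \<inter> proj -` (chart q s ` large_set)) \<le> ennreal (real (card G) * ((2 + 8 * \<epsilon>) * s) ^ 3)"
proof -
  have "hpre \<delta> (\<Union>q\<in>G. E \<inter> proj -` (chart q s ` large_set)) \<le>
      (\<Sum>q\<in>G. hpre \<delta> (E \<inter> proj -` (chart q s ` large_set)))"
    by (rule hpre_finite_UN[OF G(1)])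
  also have "\<dots> \<le> (\<Sum>q\<in>G. ennreal ((2 + 8 * \<epsilon>) * s) ^ 3)"
  proof (rule sum_mono)
    fix q assume "q \<in> G"
    have d: "ediam \<rho> (E \<inter> proj -` (chart q s ` large_set)) \<le> ennreal ((2 + 8 * \<epsilon>) * s)"
      unfolding ediam_le_iff
    proof (intro ballI ennreal_leI)
      fix p p' assume p: "p \<in> E \<inter> proj -` (chart q s ` large_set)" "p' \<in> E \<inter> proj -` (chart q s ` large_set)"
      show "\<rho> p p' \<le> (2 + 8 * \<epsilon>) * s"
      proof (rule cone_chart_diameter[OF E _ _ _ _ _ s(1)])
        show "p \<in> E" "p' \<in> E" using p by (simp_all only: Int_iff)
        show "q \<in> E" using \<open>q \<in> G\<close> G(2) by (rule rev_subsetD)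
        show "proj p \<in> chart q s ` large_set" "proj p' \<in> chart q s ` large_set"
          using p by (simp_all only: Int_iff vimage_eq)
      qed
    qed
    have "hpre \<delta> (E \<inter> proj -` (chart q s ` large_set)) \<le> ediam \<rho> (E \<inter> proj -` (chart q s ` large_set)) ^ 3"
      using d s(2) by (intro hpre_le_ediam) (metis ennreal_leI order_trans)
    also have "\<dots> \<le> ennreal ((2 + 8 * \<epsilon>) * s) ^ 3" using d by (intro power_mono) auto
    finally show "hpre \<delta> (E \<inter> proj -` (chart q s ` large_set)) \<le> ennreal ((2 + 8 * \<epsilon>) * s) ^ 3" .
  qed
  also have "\<dots> = ennreal (real (card G) * ((2 + 8 * \<epsilon>) * s) ^ 3)"
    using E(2) s(1) by (intro sum_ennreal_cube) simp
  finally show ?thesis .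
qed

text \<open>The balls of radius \<open>8 s\<close> around the packing cover \<open>E\<close>. They have diameter \<open>16 s\<close>, and \<open>16\<^sup>3 = 4096\<close>.\<close>

lemma cone_area_crude_bound:
  fixes \<epsilon> :: real
  assumes E: "compact E" "cone_set \<epsilon> E" "0 \<le> \<epsilon>" "\<epsilon> \<le> 1/2"
  shows "haus3 E \<le> ennreal (4096 / large_area * proj_area E)"
proof (rule haus3_leI, rule ennreal_le_epsilon)
  fix \<delta> e :: real assume "\<delta> > 0" "e > 0"
  define \<eta> where "\<eta> = e * large_area / 4096"
  have "\<eta> > 0" "\<delta> / 16 > 0" using \<open>e > 0\<close> \<open>\<delta> > 0\<close> large_area_pos by (simp_all add: \<eta>_def)
  from chart_packing[OF E this] obtain s :: real and G where G: "0 < s" "s \<le> \<delta> / 16" "finite G" "G \<subseteq> E"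
    "E \<subseteq> (\<Union>q\<in>G. \<rho>_ball q (8 * s))" "real (card G) * s ^ 3 * large_area \<le> proj_area E + \<eta>"
    by metis
  have "hpre \<delta> E \<le> hpre \<delta> (\<Union>q\<in>G. \<rho>_ball q (8 * s))" by (rule hpre_mono) fact
  also have "\<dots> \<le> (\<Sum>q\<in>G. hpre \<delta> (\<rho>_ball q (8 * s)))" by (rule hpre_finite_UN) fact
  also have "\<dots> \<le> (\<Sum>q\<in>G. ennreal (16 * s) ^ 3)"
  proof (rule sum_mono)
    fix q
    have d: "ediam \<rho> (\<rho>_ball q (8 * s)) \<le> ennreal (16 * s)"
      unfolding ediam_le_iff
    proof (intro ballI ennreal_leI)
      fix p p' assume "p \<in> \<rho>_ball q (8 * s)" "p' \<in> \<rho>_ball q (8 * s)"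
      then show "\<rho> p p' \<le> 16 * s"
        using rho_triangle[of p p' q] rho_commute[of q p'] by (simp add: \<rho>_ball_def)
    qed
    have "16 * s \<le> \<delta>" using G(2) by simp
    then have "hpre \<delta> (\<rho>_ball q (8 * s)) \<le> ediam \<rho> (\<rho>_ball q (8 * s)) ^ 3"
      using d by (intro hpre_le_ediam) (metis ennreal_leI order_trans)
    also have "\<dots> \<le> ennreal (16 * s) ^ 3" using d by (intro power_mono) auto
    finally show "hpre \<delta> (\<rho>_ball q (8 * s)) \<le> ennreal (16 * s) ^ 3" .
  qed
  also have "\<dots> = ennreal (real (card G) * (16 * s) ^ 3)"
    using G(1) by (intro sum_ennreal_cube) simp
  also have "\<dots> \<le> ennreal (4096 / large_area * proj_area E + e)"
  proof (rule ennreal_leI)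
    have "real (card G) * (16 * s) ^ 3 = 4096 / large_area * (real (card G) * s ^ 3 * large_area)"
      using large_area_pos by (simp add: power_mult_distrib)
    also have "\<dots> \<le> 4096 / large_area * (proj_area E + \<eta>)"
      using G(6) large_area_pos by (intro mult_left_mono) auto
    also have "\<dots> = 4096 / large_area * proj_area E + e"
      using large_area_pos by (simp add: \<eta>_def distrib_left)
    finally show "real (card G) * (16 * s) ^ 3 \<le> 4096 / large_area * proj_area E + e" .
  qed
  also have "\<dots> = ennreal (4096 / large_area * proj_area E) + ennreal e"
    using large_area_pos \<open>e > 0\<close> by (intro ennreal_plus) auto
  finally show "hpre \<delta> E \<le> ennreal (4096 / large_area * proj_area E) + ennreal e" .
qed

text \<open>A bound with constant \<open>M\<close> for all compact cone sets improves itself: small pieces over the charts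
  have the efficient constant \<open>\<kappa>\<close>, and \<open>M\<close> is only needed for the remainder, whose projection
  is smaller by a fixed factor.\<close>

lemma cone_area_bound_improve:
  fixes \<epsilon> M :: real
  assumes eps: "0 \<le> \<epsilon>" "\<epsilon> \<le> 1/2"
  defines "\<kappa> \<equiv> (2 + 8 * \<epsilon>) ^ 3 / large_area"
  assumes "\<kappa> \<le> M"
    and M: "\<And>E. compact E \<Longrightarrow> cone_set \<epsilon> E \<Longrightarrow> haus3 E \<le> ennreal (M * proj_area E)"
    and E: "compact E" "cone_set \<epsilon> E"
  shows "haus3 E \<le> ennreal ((M - (M - \<kappa>) / 1728) * proj_area E)"
proof (rule haus3_leI, rule ennreal_le_epsilon)
  fix \<delta> e :: real assume "\<delta> > 0" "e > 0"
  have "\<kappa> > 0" using eps large_area_pos by (simp add: \<kappa>_def)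
  then have "M > 0" using \<open>\<kappa> \<le> M\<close> by linarith
  define \<eta> where "\<eta> = e / M"
  have pos: "\<eta> > 0" "\<delta> / 6 > 0" using \<open>e > 0\<close> \<open>\<delta> > 0\<close> \<open>M > 0\<close> by (simp_all add: \<eta>_def)
  obtain s :: real and G where G: "0 < s" "s \<le> \<delta> / 6" "finite G" "G \<subseteq> E"
    and low: "proj_area E / 1728 \<le> real (card G) * s ^ 3 * large_area"
    and up: "real (card G) * s ^ 3 * large_area \<le> proj_area E + \<eta>"
    and rest: "compact (E - (\<Union>q\<in>G. proj -` (chart q s ` large_set)))"
    "proj_area (E - (\<Union>q\<in>G. proj -` (chart q s ` large_set))) \<le> proj_area E + \<eta> - real (card G) * s ^ 3 * large_area"
    using chart_packing[OF E eps pos] by metis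
  define a where "a = real (card G) * s ^ 3 * large_area"
  define E' where "E' = E - (\<Union>q\<in>G. proj -` (chart q s ` large_set))"
  have "(2 + 8 * \<epsilon>) * s \<le> 6 * s" using eps G(1) by (intro mult_right_mono) auto
  then have s\<delta>: "(2 + 8 * \<epsilon>) * s \<le> \<delta>" using G(2) by linarith
  have "hpre \<delta> E \<le> hpre \<delta> ((\<Union>q\<in>G. E \<inter> proj -` (chart q s ` large_set)) \<union> E')"
    by (rule hpre_mono) (unfold E'_def, blast)
  also have "\<dots> \<le> hpre \<delta> (\<Union>q\<in>G. E \<inter> proj -` (chart q s ` large_set)) + hpre \<delta> E'"
    by (rule hpre_Un)
  also have "\<dots> \<le> ennreal (\<kappa> * a) + ennreal (M * (proj_area E + \<eta> - a))"
  proof (rule add_mono)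
    have "real (card G) * ((2 + 8 * \<epsilon>) * s) ^ 3 = \<kappa> * a"
      using large_area_pos by (simp add: \<kappa>_def a_def power_mult_distrib)
    then show "hpre \<delta> (\<Union>q\<in>G. E \<inter> proj -` (chart q s ` large_set)) \<le> ennreal (\<kappa> * a)"
      using hpre_chart_pieces[OF E(2) eps G(3,4,1) s\<delta>] by simp
    have "hpre \<delta> E' \<le> haus3 E'" by (rule hpre_le_haus3) fact
    also have "\<dots> \<le> ennreal (M * proj_area E')"
      using rest(1) cone_set_subset[OF E(2), of E'] by (intro M) (auto simp: E'_def)
    also have "\<dots> \<le> ennreal (M * (proj_area E + \<eta> - a))"
      using rest(2) \<open>M > 0\<close> by (intro ennreal_leI mult_left_mono) (auto simp: E'_def a_def)
    finally show "hpre \<delta> E' \<le> ennreal (M * (proj_area E + \<eta> - a))" .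
  qed
  also have "\<dots> = ennreal (\<kappa> * a + M * (proj_area E + \<eta> - a))"
    using \<open>\<kappa> > 0\<close> \<open>M > 0\<close> up G(1) large_area_pos by (intro ennreal_plus[symmetric]) (auto simp: a_def)
  also have "\<dots> \<le> ennreal ((M - (M - \<kappa>) / 1728) * proj_area E + e)"
  proof (rule ennreal_leI)
    have "(M - \<kappa>) * (proj_area E / 1728) \<le> (M - \<kappa>) * a"
      using low \<open>\<kappa> \<le> M\<close> by (intro mult_left_mono) (auto simp: a_def)
    moreover have eq: "(M - (M - \<kappa>) / 1728) * proj_area E = M * proj_area E - (M - \<kappa>) * (proj_area E / 1728)"
      by (simp add: left_diff_distrib)
    moreover have "\<kappa> * a + M * (proj_area E + \<eta> - a) = M * proj_area E + e - (M - \<kappa>) * a"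
      using \<open>M > 0\<close> by (simp add: \<eta>_def algebra_simps)
    ultimately show "\<kappa> * a + M * (proj_area E + \<eta> - a) \<le> (M - (M - \<kappa>) / 1728) * proj_area E + e"
      unfolding eq by linarith
  qed
  also have "\<dots> = ennreal ((M - (M - \<kappa>) / 1728) * proj_area E) + ennreal e"
  proof (rule ennreal_plus)
    have "0 \<le> M - (M - \<kappa>) / 1728" using \<open>M > 0\<close> \<open>\<kappa> > 0\<close> by simp
    then show "0 \<le> (M - (M - \<kappa>) / 1728) * proj_area E" by simp
  qed (use \<open>e > 0\<close> in simp)
  finally show "hpre \<delta> E \<le> ennreal ((M - (M - \<kappa>) / 1728) * proj_area E) + ennreal e" .
qed

text \<open>Each application of the improvement moves the constant by the fraction \<open>1 / 1728\<close> towards \<open>\<kappa>\<close>, so that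
  the constants converge to \<open>\<kappa>\<close>.\<close>

theorem cone_area_bound:
  fixes \<epsilon> :: real
  assumes E: "compact E" "cone_set \<epsilon> E" and eps: "0 \<le> \<epsilon>" "\<epsilon> \<le> 1/2"
  shows "haus3 E \<le> ennreal ((2 + 8 * \<epsilon>) ^ 3 / large_area * proj_area E)"
proof -
  define \<kappa> where "\<kappa> = (2 + 8 * \<epsilon>) ^ 3 / large_area"
  define M where "M n = \<kappa> + (4096 / large_area - \<kappa>) * (1727/1728) ^ n" for n :: nat
  have k: "\<kappa> \<le> 4096 / large_area"
  proof -
    have "(2 + 8 * \<epsilon>) ^ 3 \<le> 6 ^ 3" using eps by (intro power_mono) auto
    then show ?thesis unfolding \<kappa>_def using large_area_pos by (intro divide_right_mono) auto
  qed
  have M: "haus3 E \<le> ennreal (M n * proj_area E)" if "compact E" "cone_set \<epsilon> E" for n E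
    using that
  proof (induction n arbitrary: E)
    case 0
    then show ?case using cone_area_crude_bound[OF _ _ eps, of E] by (simp add: M_def)
  next
    case (Suc n)
    have "0 \<le> (4096 / large_area - \<kappa>) * (1727/1728) ^ n" using k by (intro mult_nonneg_nonneg) auto
    then have le: "(2 + 8 * \<epsilon>) ^ 3 / large_area \<le> M n" by (simp add: M_def \<kappa>_def)
    have "haus3 E \<le> ennreal ((M n - (M n - \<kappa>) / 1728) * proj_area E)"
      unfolding \<kappa>_def by (rule cone_area_bound_improve[OF eps le Suc.IH Suc.prems])
    also have "M n - (M n - \<kappa>) / 1728 = M (Suc n)" by (simp add: M_def field_simps)
    finally show ?case .
  qed
  have "(\<lambda>n. M n) \<longlonglongrightarrow> \<kappa> + (4096 / large_area - \<kappa>) * 0"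
    unfolding M_def by (intro tendsto_intros LIMSEQ_realpow_zero) auto
  then have "(\<lambda>n. ennreal (M n * proj_area E)) \<longlonglongrightarrow> ennreal (\<kappa> * proj_area E)"
    by (intro tendsto_ennrealI tendsto_mult_right) simp
  then show ?thesis
    unfolding \<kappa>_def[symmetric] by (rule LIMSEQ_le_const) (use M[OF E] in blast)
qed

section \<open>Smooth test functions\<close>

lemma Ck_SucI:
  assumes "\<And>x. (\<phi> has_derivative D x) (at x)" "\<And>e. e \<in> Basis \<Longrightarrow> Ck k (\<lambda>x. D x e)"
  shows "Ck (Suc k) \<phi>"
proof -
  have "frechet_derivative \<phi> (at x) = D x" for x
    using frechet_derivative_at[OF assms(1)] by simp
  moreover have "\<phi> differentiable (at x)" for x
    using assms(1) by (auto simp: differentiable_def)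
  ultimately show ?thesis using assms(2) by simp
qed

lemma Ck_SucD:
  assumes "Ck (Suc k) \<phi>"
  shows "(\<phi> has_derivative frechet_derivative \<phi> (at x)) (at x)"
    "e \<in> Basis \<Longrightarrow> Ck k (\<lambda>x. frechet_derivative \<phi> (at x) e)"
  using assms by (simp_all add: frechet_derivative_works[symmetric])

lemma Ck_continuous: "Ck k \<phi> \<Longrightarrow> continuous_on UNIV \<phi>"
proof (cases k)
  case (Suc j)
  assume "Ck k \<phi>"
  then have "\<And>x. \<phi> differentiable (at x)" using Suc by simp
  then show ?thesis
    by (intro continuous_at_imp_continuous_on ballI differentiable_imp_continuous_within)
qed simp

lemma Ck_Suc_imp_Ck: "Ck (Suc k) \<phi> \<Longrightarrow> Ck k \<phi>"
proof (induction k arbitrary: \<phi>)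
  case 0
  then show ?case using Ck_continuous[OF 0] by simp
next
  case (Suc k)
  show ?case
    by (rule Ck_SucI[OF Ck_SucD(1)[OF Suc.prems]]) (intro Suc.IH Ck_SucD(2)[OF Suc.prems])
qed

lemma Ck_const: "Ck k (\<lambda>x. c)"
proof (induction k arbitrary: c)
  case (Suc k)
  show ?case by (rule Ck_SucI[OF has_derivative_const]) (rule Suc)
qed simp

lemma Ck_linear: "bounded_linear l \<Longrightarrow> Ck k l"
proof (cases k)
  case (Suc j)
  assume "bounded_linear l"
  then show ?thesis unfolding Suc
    by (intro Ck_SucI[OF bounded_linear_imp_has_derivative] Ck_const)
qed (simp add: linear_continuous_on)

lemma Ck_add: "Ck k f \<Longrightarrow> Ck k g \<Longrightarrow> Ck k (\<lambda>x. f x + g x)"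
proof (induction k arbitrary: f g)
  case 0
  then show ?case by (simp add: continuous_on_add)
next
  case (Suc k)
  show ?case
    by (rule Ck_SucI[OF has_derivative_add[OF Ck_SucD(1)[OF Suc.prems(1)] Ck_SucD(1)[OF Suc.prems(2)]]])
      (intro Suc.IH Ck_SucD(2)[OF Suc.prems(1)] Ck_SucD(2)[OF Suc.prems(2)])
qed

lemma Ck_mult: "Ck k f \<Longrightarrow> Ck k g \<Longrightarrow> Ck k (\<lambda>x. f x * g x)"
proof (induction k arbitrary: f g)
  case 0
  then show ?case by (simp add: continuous_on_mult)
next
  case (Suc k)
  show ?case
    by (rule Ck_SucI[OF has_derivative_mult[OF Ck_SucD(1)[OF Suc.prems(1)] Ck_SucD(1)[OF Suc.prems(2)]]])
      (intro Ck_add Suc.IH Ck_SucD(2)[OF Suc.prems(1)] Ck_SucD(2)[OF Suc.prems(2)]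
        Ck_Suc_imp_Ck[OF Suc.prems(1)] Ck_Suc_imp_Ck[OF Suc.prems(2)])
qed

lemma Ck_compose:
  fixes f :: "real \<Rightarrow> real"
  shows "(\<And>k. Ck k f) \<Longrightarrow> Ck k u \<Longrightarrow> Ck k (\<lambda>x. f (u x))"
proof (induction k arbitrary: f u)
  case 0
  have "continuous_on UNIV f" using Ck_continuous[OF 0(1)[of 0]] .
  then show ?case using 0(2) by (simp add: continuous_on_compose2)
next
  case (Suc k)
  define f' where "f' = (\<lambda>y. frechet_derivative f (at y) 1)"
  have f': "Ck k f'" for k using Ck_SucD(2)[OF Suc.prems(1)[of "Suc k"], of 1] by (simp add: f'_def)
  have f: "(f has_derivative frechet_derivative f (at y)) (at y)" for y
    by (rule Ck_SucD(1)[OF Suc.prems(1)[of "Suc 0"]])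
  have lin: "frechet_derivative f (at y) t = t * f' y" for y t
    using linear_scale[OF has_derivative_linear[OF f[of y]], of t 1] by (simp add: f'_def)
  have d: "((\<lambda>x. f (u x)) has_derivative (\<lambda>e. frechet_derivative u (at x) e * f' (u x))) (at x)" for x
    using has_derivative_compose[OF Ck_SucD(1)[OF Suc.prems(2), of x] f[of "u x"]]
    by (simp add: lin)
  have "Ck k (\<lambda>x. f' (u x))" by (rule Suc.IH[OF f' Ck_Suc_imp_Ck[OF Suc.prems(2)]])
  then show ?case
    by (intro Ck_SucI[OF d] Ck_mult Ck_SucD(2)[OF Suc.prems(2)])
qed

text \<open>The functions \<open>p(1/x) exp(-1/x)\<close> on the positive half-line, extended by zero. The class is closed under
  differentiation.\<close>

definition flat :: "real poly \<Rightarrow> real \<Rightarrow> real" where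
  "flat p x = (if x > 0 then poly p (1 / x) * exp (- (1 / x)) else 0)"

lemma poly_div_exp_tendsto_0: "((\<lambda>y::real. poly p y * exp (- y)) \<longlongrightarrow> 0) at_top"
proof -
  have "((\<lambda>y::real. \<Sum>i\<le>degree p. coeff p i * (y ^ i / exp y)) \<longlongrightarrow> (\<Sum>i\<le>degree p. coeff p i * 0)) at_top"
    by (intro tendsto_intros tendsto_power_div_exp_0)
  then show ?thesis
    by (simp add: poly_altdef sum_distrib_right exp_minus divide_inverse mult.assoc)
qed

lemma flat_has_derivative: "(flat p has_real_derivative flat ((p - pderiv p) * [:0, 0, 1:]) x) (at x)"
proof -
  consider "x > 0" | "x < 0" | "x = 0" by linarith
  then show ?thesis
  proof cases
    case 1
    have "((\<lambda>x. poly p (1 / x) * exp (- (1 / x))) has_real_derivative flat ((p - pderiv p) * [:0, 0, 1:]) x) (at x)"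
      using 1 by (auto intro!: derivative_eq_intros simp: flat_def field_simps power2_eq_square)
    then show ?thesis
      by (rule has_field_derivative_transform_within_open[of _ _ _ "{0<..}"]) (use 1 in \<open>auto simp: flat_def\<close>)
  next
    case 2
    have "((\<lambda>x. 0) has_real_derivative 0) (at x)" by simp
    then have "(flat p has_real_derivative 0) (at x)"
      by (rule has_field_derivative_transform_within_open[of _ _ _ "{..<0}"]) (use 2 in \<open>auto simp: flat_def\<close>)
    then show ?thesis using 2 by (simp add: flat_def)
  next
    case 3
    have "((\<lambda>y. poly (p * [:0, 1:]) y * exp (- y)) \<longlongrightarrow> 0) at_top" by (rule poly_div_exp_tendsto_0)
    then have "((\<lambda>x. poly (p * [:0, 1:]) (inverse x) * exp (- inverse x)) \<longlongrightarrow> 0) (at_right 0)"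
      by (rule filterlim_compose[OF _ filterlim_inverse_at_top_right])
    then have r: "((\<lambda>h. flat p h / h) \<longlongrightarrow> 0) (at_right 0)"
    proof (rule tendsto_cong[THEN iffD1, rotated])
      show "\<forall>\<^sub>F x in at_right 0. poly (p * [:0, 1:]) (inverse x) * exp (- inverse x) = flat p x / x"
        unfolding eventually_at_filter by (rule always_eventually) (simp add: flat_def divide_inverse)
    qed
    have "((\<lambda>h::real. 0::real) \<longlongrightarrow> 0) (at_left 0)" by simp
    then have l: "((\<lambda>h. flat p h / h) \<longlongrightarrow> 0) (at_left 0)"
    proof (rule tendsto_cong[THEN iffD1, rotated])
      show "\<forall>\<^sub>F x in at_left 0. 0 = flat p x / x"
        unfolding eventually_at_filter by (rule always_eventually) (simp add: flat_def)
    qed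
    have "((\<lambda>h. flat p h / h) \<longlongrightarrow> 0) (at 0)" using l r by (rule filterlim_split_at)
    then show ?thesis using 3 by (simp add: has_field_derivative_iff flat_def)
  qed
qed

lemma Ck_real_SucI:
  fixes f :: "real \<Rightarrow> real"
  assumes "\<And>x. (f has_real_derivative f' x) (at x)" "Ck k f'"
  shows "Ck (Suc k) f"
  by (rule Ck_SucI[OF assms(1)[unfolded has_field_derivative_def]]) (use assms(2) in simp)

lemma Ck_flat: "Ck k (flat p)"
proof (induction k arbitrary: p)
  case 0
  have "isCont (flat p) x" for x by (rule DERIV_isCont[OF flat_has_derivative])
  then show ?case by (simp add: continuous_at_imp_continuous_on)
next
  case (Suc k)
  show ?case by (rule Ck_real_SucI[OF flat_has_derivative Suc])
qed

definition bump :: "real \<Rightarrow> real" where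
  "bump x = flat 1 (1 + x) * flat 1 (1 - x)"

lemma Ck_affine: "Ck k (\<lambda>x::real. a * x + b)"
  by (intro Ck_add Ck_const Ck_linear bounded_linear_mult_right)

lemma Ck_bump: "Ck k bump"
proof -
  have "Ck k (\<lambda>x. flat 1 (1 * x + 1) * flat 1 ((- 1) * x + 1))"
    by (rule Ck_mult[OF Ck_compose[OF Ck_flat Ck_affine] Ck_compose[OF Ck_flat Ck_affine]])
  then show ?thesis by (simp add: bump_def[abs_def] add.commute)
qed

lemma bump_nonneg: "bump x \<ge> 0" by (simp add: bump_def flat_def)

lemma bump_pos_iff: "bump x > 0 \<longleftrightarrow> \<bar>x\<bar> < 1" by (auto simp: bump_def flat_def)

lemma bump_eq_0: "\<bar>x\<bar> \<ge> 1 \<Longrightarrow> bump x = 0" by (auto simp: bump_def flat_def)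

text \<open>The normalized bump of width \<open>h\<close>.\<close>

definition bump_mass :: real where "bump_mass = integral {-1..1} bump"

definition moll :: "real \<Rightarrow> real \<Rightarrow> real" where
  "moll h x = bump (x / h) / (h * bump_mass)"

lemma continuous_on_bump: "continuous_on A bump"
  using Ck_continuous[OF Ck_bump[of 0]] continuous_on_subset by blast

lemma bump_mass_pos: "bump_mass > 0"
proof -
  have "bump_mass \<noteq> 0"
  proof
    assume "bump_mass = 0"
    have "(bump has_integral bump_mass) (cbox (-1) 1)"
      unfolding bump_mass_def using integrable_continuous_real[OF continuous_on_bump, of "-1" 1] by (simp add: integrable_integral)
    then have "bump 0 = 0"
      using has_integral_0_cbox_imp_0[of "-1" 1 bump 0] continuous_on_bump bump_nonneg \<open>bump_mass = 0\<close>
      by (auto simp: box_real)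
    then show False using bump_pos_iff[of 0] by simp
  qed
  moreover have "bump_mass \<ge> 0"
    unfolding bump_mass_def by (rule integral_nonneg[OF integrable_continuous_real[OF continuous_on_bump]]) (rule bump_nonneg)
  ultimately show ?thesis by simp
qed

lemma Ck_moll: "Ck k (moll h)"
proof -
  have "Ck k (\<lambda>x. bump ((1 / h) * x + 0) * (1 / (h * bump_mass)))"
    by (rule Ck_mult[OF Ck_compose[OF Ck_bump Ck_affine] Ck_const])
  then show ?thesis by (simp add: moll_def[abs_def])
qed

lemma continuous_on_moll: "continuous_on A (moll h)"
  using Ck_continuous[OF Ck_moll[of 0]] continuous_on_subset by blast

lemma moll_nonneg: "h > 0 \<Longrightarrow> moll h x \<ge> 0"
  using bump_mass_pos bump_nonneg by (simp add: moll_def)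

lemma moll_eq_0: "h > 0 \<Longrightarrow> h \<le> \<bar>x\<bar> \<Longrightarrow> moll h x = 0"
  by (simp add: moll_def bump_eq_0 abs_divide)

lemma moll_has_integral: "h > 0 \<Longrightarrow> (moll h has_integral 1) {- h..h}"
proof -
  assume h: "h > 0"
  have "(bump has_integral bump_mass) (cbox (-1) 1)"
    unfolding bump_mass_def using integrable_continuous_real[OF continuous_on_bump, of "-1" 1] by (simp add: integrable_integral)
  from has_integral_affinity[OF this, of "1 / h" 0] h
  have "((\<lambda>x. bump (x / h)) has_integral h * bump_mass) ((\<lambda>x. h * x) ` {-1..1})" by simp
  moreover have "(\<lambda>x. h * x) ` {-1..1} = {- h..h}"
    using h image_mult_atLeastAtMost[of h "-1" 1] by simp
  ultimately have "((\<lambda>x. bump (x / h)) has_integral h * bump_mass) {- h..h}" by simp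
  from has_integral_divide[OF this, of "h * bump_mass"] show ?thesis
    using h bump_mass_pos by (simp add: moll_def[abs_def])
qed

text \<open>A smooth step from \<open>0\<close> to \<open>1\<close>, the integral of the mollifier.\<close>

definition step :: "real \<Rightarrow> real \<Rightarrow> real" where
  "step h x = integral {- 2 * h..x} (moll h)"

lemma step_eq_0: "h > 0 \<Longrightarrow> x \<le> - h \<Longrightarrow> step h x = 0"
proof -
  assume h: "h > 0" and x: "x \<le> - h"
  have "step h x = integral {- 2 * h..x} (\<lambda>_. 0)"
    unfolding step_def using h x by (intro Henstock_Kurzweil_Integration.integral_cong moll_eq_0) auto
  then show ?thesis by simp
qed

lemma step_eq_1: "h > 0 \<Longrightarrow> h \<le> x \<Longrightarrow> step h x = 1"
proof -
  assume h: "h > 0" and x: "h \<le> x"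
  have "(moll h has_integral 1) {- 2 * h..x}"
    by (rule has_integral_on_superset[OF moll_has_integral[OF h]])
      (use h x in \<open>auto intro!: moll_eq_0\<close>)
  then show ?thesis unfolding step_def by (rule integral_unique)
qed

lemma step_has_derivative: "h > 0 \<Longrightarrow> (step h has_real_derivative moll h x) (at x)"
proof -
  assume h: "h > 0"
  show ?thesis
  proof (cases "x < - h")
    case True
    have "((\<lambda>x. 0) has_real_derivative 0) (at x)" by simp
    then have "(step h has_real_derivative 0) (at x)"
      by (rule has_field_derivative_transform_within_open[of _ _ _ "{..<- h}"])
        (use True h in \<open>auto simp: step_eq_0\<close>)
    then show ?thesis using True h by (simp add: moll_eq_0)
  next
    case False
    have "((\<lambda>u. integral {- 2 * h..u} (moll h)) has_real_derivative moll h x) (at x within {- 2 * h..x + 1})"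
      by (rule integral_has_real_derivative[OF continuous_on_moll]) (use False h in auto)
    moreover have "at x within {- 2 * h..x + 1} = at x"
      by (rule at_within_interior) (use False h in auto)
    ultimately show ?thesis unfolding step_def[abs_def] by simp
  qed
qed

lemma step_mono: "h > 0 \<Longrightarrow> x \<le> y \<Longrightarrow> step h x \<le> step h y"
proof -
  assume h: "h > 0" and "x \<le> y"
  show ?thesis
  proof (rule DERIV_nonneg_imp_nondecreasing[OF \<open>x \<le> y\<close>])
    fix z
    show "\<exists>D. (step h has_real_derivative D) (at z) \<and> D \<ge> 0"
      by (intro exI[of _ "moll h z"] conjI step_has_derivative[OF h] moll_nonneg[OF h])
  qed
qed

lemma step_bounds:
  assumes "h > 0"
  shows "0 \<le> step h x" "step h x \<le> 1"
proof -
  have "step h (min x (- h)) = 0" "step h (max x h) = 1"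
    using assms by (simp_all add: step_eq_0 step_eq_1)
  moreover have "step h (min x (- h)) \<le> step h x" "step h x \<le> step h (max x h)"
    using assms by (intro step_mono; simp)+
  ultimately show "0 \<le> step h x" "step h x \<le> 1" by linarith+
qed

lemma Ck_step: "h > 0 \<Longrightarrow> Ck k (step h)"
  using Ck_Suc_imp_Ck[OF Ck_real_SucI[OF step_has_derivative Ck_moll]] .

definition plateau :: "real \<Rightarrow> real \<Rightarrow> real \<Rightarrow> real \<Rightarrow> real" where
  "plateau h s0 s1 x = step h (x - s0) - step h (x - s1)"

lemma plateau_has_derivative:
  assumes "h > 0"
  shows "(plateau h s0 s1 has_real_derivative moll h (x - s0) - moll h (x - s1)) (at x)"
proof -
  have "((\<lambda>x. step h (x - s)) has_real_derivative moll h (x - s) * 1) (at x)" for s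
    by (rule DERIV_chain2[OF step_has_derivative[OF assms]]) (auto intro!: derivative_eq_intros)
  from DERIV_diff[OF this[of s0] this[of s1]] show ?thesis by (simp add: plateau_def[abs_def])
qed

lemma Ck_plateau: "h > 0 \<Longrightarrow> Ck k (plateau h s0 s1)"
proof -
  assume "h > 0"
  then have "Ck k (\<lambda>x. step h (1 * x + (- s0)) + (- 1) * step h (1 * x + (- s1)))"
    by (intro Ck_add[OF Ck_compose[OF _ Ck_affine] Ck_mult[OF Ck_const Ck_compose[OF _ Ck_affine]]] Ck_step)
  then show ?thesis by (simp add: plateau_def[abs_def])
qed

lemma plateau_bounds:
  assumes "h > 0" "s0 \<le> s1"
  shows "0 \<le> plateau h s0 s1 x" "plateau h s0 s1 x \<le> 1"
    "x \<le> s0 - h \<Longrightarrow> plateau h s0 s1 x = 0" "s1 + h \<le> x \<Longrightarrow> plateau h s0 s1 x = 0"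
    "s0 + h \<le> x \<Longrightarrow> x \<le> s1 - h \<Longrightarrow> plateau h s0 s1 x = 1"
proof -
  show "0 \<le> plateau h s0 s1 x" using step_mono[of h "x - s1" "x - s0"] assms by (simp add: plateau_def)
  show "plateau h s0 s1 x \<le> 1"
    using step_bounds[OF assms(1), of "x - s0"] step_bounds[OF assms(1), of "x - s1"] by (simp add: plateau_def)
  show "x \<le> s0 - h \<Longrightarrow> plateau h s0 s1 x = 0"
    using step_eq_0[OF assms(1), of "x - s0"] step_eq_0[OF assms(1), of "x - s1"] assms(2) by (simp add: plateau_def)
  show "s1 + h \<le> x \<Longrightarrow> plateau h s0 s1 x = 0"
    using step_eq_1[OF assms(1), of "x - s0"] step_eq_1[OF assms(1), of "x - s1"] assms(2) by (simp add: plateau_def)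
  show "s0 + h \<le> x \<Longrightarrow> x \<le> s1 - h \<Longrightarrow> plateau h s0 s1 x = 1"
    using step_eq_1[OF assms(1), of "x - s0"] step_eq_0[OF assms(1), of "x - s1"] by (simp add: plateau_def)
qed

lemma continuous_on_plateau: "h > 0 \<Longrightarrow> continuous_on A (plateau h s0 s1)"
  using Ck_continuous[OF Ck_plateau[of h 0]] continuous_on_subset by blast

lemma nn_integral_moll: "h > 0 \<Longrightarrow> (\<integral>\<^sup>+ x. ennreal (moll h (x - s)) \<partial>lborel) = 1"
proof -
  assume h: "h > 0"
  have m: "moll h \<in> borel_measurable borel"
    by (intro borel_measurable_continuous_onI continuous_on_moll)
  have "(moll h has_integral 1) UNIV"
    by (rule has_integral_on_superset[OF moll_has_integral[OF h]])
      (use h in \<open>auto intro!: moll_eq_0\<close>)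
  then have 1: "(\<integral>\<^sup>+ x. ennreal (moll h x) \<partial>lborel) = 1"
    using nn_integral_has_integral_lborel[OF m] moll_nonneg[OF h] by simp
  have "(\<integral>\<^sup>+ x. ennreal (moll h (x - s)) \<partial>lborel) =
      ennreal \<bar>1\<bar> * (\<integral>\<^sup>+ x. ennreal (moll h ((s + 1 * x) - s)) \<partial>lborel)"
    by (intro nn_integral_real_affine borel_measurable_continuous_onI measurable_compose[OF _ measurable_ennreal]
      continuous_on_compose2[OF continuous_on_moll] continuous_intros) auto
  then show ?thesis using 1 by simp
qed

lemma nn_integral_plateau:
  assumes h: "h > 0" and s: "s0 \<le> s1"
  shows "(\<integral>\<^sup>+ x. ennreal (plateau h s0 s1 x) \<partial>lborel) \<le> ennreal (s1 - s0 + 2 * h)"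
    "ennreal (s1 - s0 - 2 * h) \<le> (\<integral>\<^sup>+ x. ennreal (plateau h s0 s1 x) \<partial>lborel)"
proof -
  have "(\<integral>\<^sup>+ x. ennreal (plateau h s0 s1 x) \<partial>lborel) \<le> (\<integral>\<^sup>+ x. indicator {s0 - h..s1 + h} x \<partial>lborel)"
  proof (rule nn_integral_mono)
    fix x
    show "ennreal (plateau h s0 s1 x) \<le> indicator {s0 - h..s1 + h} x"
      using plateau_bounds[OF h s, of x] by (cases "x \<in> {s0 - h..s1 + h}") auto
  qed
  also have "\<dots> = ennreal (s1 - s0 + 2 * h)" using h s by simp
  finally show "(\<integral>\<^sup>+ x. ennreal (plateau h s0 s1 x) \<partial>lborel) \<le> ennreal (s1 - s0 + 2 * h)" .
  have "ennreal (s1 - s0 - 2 * h) \<le> (\<integral>\<^sup>+ x. indicator {s0 + h..s1 - h} x \<partial>lborel)"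
    by (cases "s0 + h \<le> s1 - h") (auto simp: ennreal_neg)
  also have "\<dots> \<le> (\<integral>\<^sup>+ x. ennreal (plateau h s0 s1 x) \<partial>lborel)"
  proof (rule nn_integral_mono)
    fix x
    show "indicator {s0 + h..s1 - h} x \<le> ennreal (plateau h s0 s1 x)"
      using plateau_bounds[OF h s, of x] by (cases "x \<in> {s0 + h..s1 - h}") auto
  qed
  finally show "ennreal (s1 - s0 - 2 * h) \<le> (\<integral>\<^sup>+ x. ennreal (plateau h s0 s1 x) \<partial>lborel)" .
qed

section \<open>Functions with continuous distributional derivatives along the frame\<close>

lemma nn_integral_sheared_product:
  fixes A B C :: "real \<Rightarrow> real"
  assumes "A \<in> borel_measurable borel" "B \<in> borel_measurable borel" "C \<in> borel_measurable borel"
    and "\<And>x. A x \<ge> 0" "\<And>x. B x \<ge> 0" "\<And>x. C x \<ge> 0"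
  shows "(\<integral>\<^sup>+ p. ennreal (A (fst p) * B (fst (snd p)) * C (snd (snd p) + \<sigma> * fst p * fst (snd p))) \<partial>lborel) =
     (\<integral>\<^sup>+ x. ennreal (A x) \<partial>lborel) * (\<integral>\<^sup>+ y. ennreal (B y) \<partial>lborel) * (\<integral>\<^sup>+ t. ennreal (C t) \<partial>lborel)"
proof -
  note [measurable] = assms(1-3)
  have C: "(\<integral>\<^sup>+ t. ennreal (C t) \<partial>lborel) = (\<integral>\<^sup>+ t. ennreal (C (t + c)) \<partial>lborel)" for c
    using nn_integral_real_affine[of "\<lambda>t. ennreal (C t)" 1 c] by (simp add: add.commute)
  have sf: "sigma_finite_measure (lborel \<Otimes>\<^sub>M lborel :: (real \<times> real) measure)"
    by (simp only: lborel_prod lborel.sigma_finite_measure_axioms)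
  have meas: "(\<lambda>p::heis. ennreal (A (fst p) * B (fst (snd p)) * C (snd (snd p) + \<sigma> * fst p * fst (snd p))))
      \<in> borel_measurable (lborel \<Otimes>\<^sub>M (lborel \<Otimes>\<^sub>M lborel))"
    by measurable
  have "(\<integral>\<^sup>+ p. ennreal (A (fst p) * B (fst (snd p)) * C (snd (snd p) + \<sigma> * fst p * fst (snd p))) \<partial>lborel) =
    (\<integral>\<^sup>+ p. ennreal (A (fst p) * B (fst (snd p)) * C (snd (snd p) + \<sigma> * fst p * fst (snd p))) \<partial>(lborel \<Otimes>\<^sub>M (lborel \<Otimes>\<^sub>M lborel)))"
    by (simp only: lborel_prod)
  also have "\<dots> = (\<integral>\<^sup>+ x. \<integral>\<^sup>+ z. ennreal (A x * B (fst z) * C (snd z + \<sigma> * x * fst z)) \<partial>(lborel \<Otimes>\<^sub>M lborel) \<partial>lborel)"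
    using sigma_finite_measure.nn_integral_fst[OF sf meas, symmetric] by simp
  also have "\<dots> = (\<integral>\<^sup>+ x. \<integral>\<^sup>+ y. \<integral>\<^sup>+ t. ennreal (A x * B y * C (t + \<sigma> * x * y)) \<partial>lborel \<partial>lborel \<partial>lborel)"
  proof (rule nn_integral_cong)
    fix x
    have "(\<lambda>z. ennreal (A x * B (fst z) * C (snd z + \<sigma> * x * fst z))) \<in> borel_measurable (lborel \<Otimes>\<^sub>M lborel)"
      by measurable
    from lborel.nn_integral_fst[OF this, symmetric]
    show "(\<integral>\<^sup>+ z. ennreal (A x * B (fst z) * C (snd z + \<sigma> * x * fst z)) \<partial>(lborel \<Otimes>\<^sub>M lborel)) =
      (\<integral>\<^sup>+ y. \<integral>\<^sup>+ t. ennreal (A x * B y * C (t + \<sigma> * x * y)) \<partial>lborel \<partial>lborel)" by simp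
  qed
  also have "\<dots> = (\<integral>\<^sup>+ x. \<integral>\<^sup>+ y. ennreal (A x) * (ennreal (B y) * (\<integral>\<^sup>+ t. ennreal (C t) \<partial>lborel)) \<partial>lborel \<partial>lborel)"
  proof (intro nn_integral_cong)
    fix x y
    have "(\<integral>\<^sup>+ t. ennreal (A x * B y * C (t + \<sigma> * x * y)) \<partial>lborel) =
        (\<integral>\<^sup>+ t. ennreal (A x * B y) * ennreal (C (t + \<sigma> * x * y)) \<partial>lborel)"
      using assms(4-6) by (simp add: ennreal_mult)
    also have "\<dots> = ennreal (A x * B y) * (\<integral>\<^sup>+ t. ennreal (C (t + \<sigma> * x * y)) \<partial>lborel)"
      by (rule nn_integral_cmult) measurable
    finally show "(\<integral>\<^sup>+ t. ennreal (A x * B y * C (t + \<sigma> * x * y)) \<partial>lborel) =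
      ennreal (A x) * (ennreal (B y) * (\<integral>\<^sup>+ t. ennreal (C t) \<partial>lborel))"
      using assms(4-6) C[of "\<sigma> * x * y"] by (simp add: ennreal_mult mult.assoc)
  qed
  also have "\<dots> = (\<integral>\<^sup>+ x. ennreal (A x) \<partial>lborel) * (\<integral>\<^sup>+ y. ennreal (B y) \<partial>lborel) * (\<integral>\<^sup>+ t. ennreal (C t) \<partial>lborel)"
    by (simp add: nn_integral_cmult nn_integral_multc mult.assoc)
  finally show ?thesis .
qed

lemma weighted_average:
  fixes w g :: "heis \<Rightarrow> real"
  assumes w: "w \<in> borel_measurable borel" "\<And>p. w p \<ge> 0" "(\<integral>\<^sup>+ p. ennreal (w p) \<partial>lborel) = ennreal W" "W \<ge> 0"
    and U: "open U" "continuous_on U g"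
    and close: "\<And>p. w p \<noteq> 0 \<Longrightarrow> p \<in> U \<and> \<bar>g p - c\<bar> \<le> e"
  shows "set_integrable lborel U (\<lambda>p. g p * w p)"
    "\<bar>(LINT p:U|lborel. g p * w p) - c * W\<bar> \<le> e * W"
proof -
  have wm: "w \<in> borel_measurable lborel" using w(1) by simp
  have hb: "has_bochner_integral lborel w W"
    by (rule has_bochner_integral_nn_integral[OF wm _ w(4,3)]) (simp add: w(2))
  then have wi: "integrable lborel w" "integral\<^sup>L lborel w = W"
    by (auto simp: has_bochner_integral_iff)
  define G where "G = (\<lambda>p. indicator U p *\<^sub>R (g p * w p))"
  have gm: "(\<lambda>p. indicator U p *\<^sub>R g p) \<in> borel_measurable borel"
    by (rule borel_measurable_continuous_on_indicator) (use U in auto)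
  have Gm: "G \<in> borel_measurable lborel"
  proof -
    have "(\<lambda>p. (indicator U p *\<^sub>R g p) * w p) \<in> borel_measurable borel"
      by (intro borel_measurable_times gm w(1))
    moreover have "G = (\<lambda>p. (indicator U p *\<^sub>R g p) * w p)" by (simp add: G_def fun_eq_iff)
    ultimately have "G \<in> borel_measurable borel" by simp
    then show ?thesis by simp
  qed
  have bound: "\<bar>G p - c * w p\<bar> \<le> e * w p" for p
  proof (cases "w p = 0")
    case False
    then have "G p - c * w p = (g p - c) * w p" using close[of p] by (simp add: G_def left_diff_distrib)
    then show ?thesis using close[OF False] w(2)[of p] by (simp add: abs_mult mult_right_mono)
  qed (simp add: G_def)
  have Gi: "integrable lborel G"
  proof (rule Bochner_Integration.integrable_bound[OF _ Gm])
    show "integrable lborel (\<lambda>p. (\<bar>c\<bar> + \<bar>e\<bar>) * w p)" using wi(1) by simp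
    have "norm (G p) \<le> norm ((\<bar>c\<bar> + \<bar>e\<bar>) * w p)" for p
    proof -
      have "\<bar>G p\<bar> \<le> e * w p + \<bar>c * w p\<bar>" using bound[of p] by linarith
      also have "\<dots> \<le> \<bar>e\<bar> * w p + \<bar>c\<bar> * w p"
        using w(2)[of p] by (intro add_mono mult_right_mono) (auto simp: abs_mult)
      also have "\<dots> = (\<bar>c\<bar> + \<bar>e\<bar>) * w p" by (simp add: distrib_right)
      finally show ?thesis using w(2)[of p] by simp
    qed
    then show "AE p in lborel. norm (G p) \<le> norm ((\<bar>c\<bar> + \<bar>e\<bar>) * w p)" by simp
  qed
  then show "set_integrable lborel U (\<lambda>p. g p * w p)"
    unfolding set_integrable_def G_def .
  have "(LINT p:U|lborel. g p * w p) - c * W = (\<integral>p. G p - c * w p \<partial>lborel)"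
    using Gi wi by (simp add: set_lebesgue_integral_def G_def)
  also have "\<bar>\<dots>\<bar> \<le> (\<integral>p. \<bar>G p - c * w p\<bar> \<partial>lborel)"
    by (rule integral_abs_bound)
  also have "\<dots> \<le> (\<integral>p. e * w p \<partial>lborel)"
    using Gi wi bound by (intro integral_mono) auto
  also have "\<dots> = e * W" using wi by simp
  finally show "\<bar>(LINT p:U|lborel. g p * w p) - c * W\<bar> \<le> e * W" .
qed

text \<open>In the coordinates \<open>(u, v, \<tau>)\<close> the field \<open>V\<close> is the first partial derivative. The test functions
  are products of a smooth plateau in \<open>u\<close> and of narrow bumps in \<open>v\<close> and \<open>\<tau>\<close>; the derivative of
  the plateau consists of two bumps at the end points of the segment.\<close>

lemma line_estimate:
  fixes u v \<tau> :: "heis \<Rightarrow> real" and P :: "real \<times> real \<times> real \<Rightarrow> heis"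
  assumes der: "\<And>p. (u has_derivative u' p) (at p)" "\<And>p. (v has_derivative v' p) (at p)"
      "\<And>p. (\<tau> has_derivative \<tau>' p) (at p)"
    and V: "\<And>p. u' p (V p) = 1" "\<And>p. v' p (V p) = 0" "\<And>p. \<tau>' p (V p) = 0"
    and smooth: "\<And>k. Ck k u" "\<And>k. Ck k v" "\<And>k. Ck k \<tau>"
    and P: "continuous_on UNIV P" "\<And>p. P (u p, v p, \<tau> p) = p"
    and tonelli: "\<And>A B C :: real \<Rightarrow> real. A \<in> borel_measurable borel \<Longrightarrow> B \<in> borel_measurable borel \<Longrightarrow>
      C \<in> borel_measurable borel \<Longrightarrow> (\<And>x. A x \<ge> 0) \<Longrightarrow> (\<And>x. B x \<ge> 0) \<Longrightarrow> (\<And>x. C x \<ge> 0) \<Longrightarrow>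
      (\<integral>\<^sup>+ p. ennreal (A (u p) * B (v p) * C (\<tau> p)) \<partial>lborel) =
        (\<integral>\<^sup>+ x. ennreal (A x) \<partial>lborel) * (\<integral>\<^sup>+ x. ennreal (B x) \<partial>lborel) * (\<integral>\<^sup>+ x. ennreal (C x) \<partial>lborel)"
    and U: "open U" "continuous_on U f" "continuous_on U g" "distributional_derivative_on U V f g"
    and U': "open U'" "U' \<subseteq> U" "\<And>p. p \<in> U' \<Longrightarrow> \<bar>g p - m\<bar> \<le> \<epsilon>"
    and s: "s0 \<le> s1" "\<And>s. s0 \<le> s \<Longrightarrow> s \<le> s1 \<Longrightarrow> P (s, v0, t0) \<in> U'"
  shows "\<bar>f (P (s1, v0, t0)) - f (P (s0, v0, t0)) - m * (s1 - s0)\<bar> \<le> \<epsilon> * (s1 - s0)"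
proof (rule field_le_epsilon)
  fix e' :: real assume "e' > 0"
  have "P (s0, v0, t0) \<in> U'" using s by simp
  from U'(3)[OF this] have "\<epsilon> \<ge> 0" by linarith
  define e where "e = e' / (2 * \<epsilon> + 2 + 2 * \<bar>m\<bar>)"
  have den: "2 * \<epsilon> + 2 + 2 * \<bar>m\<bar> > 0" using \<open>\<epsilon> \<ge> 0\<close> by simp
  then have "e > 0" using \<open>e' > 0\<close> by (simp add: e_def)
  define near where "near a = U' \<inter> f -` ball (f (P (a, v0, t0))) e" for a
  have near_open: "open (near a)" for a
    unfolding near_def
    by (rule continuous_open_preimage[OF continuous_on_subset[OF U(2) U'(2)] U'(1) open_ball])
  have pre: "open (P -` Q)" if "open Q" for Q by (rule open_vimage[OF that P(1)])
  \<comment> \<open>a width \<open>h\<close> for which the supports stay in the regions where \<open>g\<close> and \<open>f\<close> are controlled\<close>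
  define seg where "seg = (\<lambda>x. (x, v0, t0)) ` {s0..s1}"
  have "compact seg" unfolding seg_def by (intro compact_continuous_image continuous_intros) simp
  moreover have "seg \<subseteq> P -` U'" using s(2) by (auto simp: seg_def)
  ultimately obtain d1 where d1: "d1 > 0" "(\<Union>z\<in>seg. ball z d1) \<subseteq> P -` U'"
    using compact_subset_open_imp_ball_epsilon_subset[OF _ pre[OF U'(1)]] by metis
  have near_ball: "\<exists>d>0. ball (a, v0, t0) d \<subseteq> P -` near a" if "P (a, v0, t0) \<in> U'" for a
  proof -
    have "(a, v0, t0) \<in> P -` near a" using that \<open>e > 0\<close> by (simp add: near_def)
    then show ?thesis using pre[OF near_open[of a]] open_contains_ball by blast
  qed
  obtain d2 where d2: "d2 > 0" "ball (s0, v0, t0) d2 \<subseteq> P -` near s0"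
    using near_ball[OF s(2)[of s0]] s(1) by auto
  obtain d3 where d3: "d3 > 0" "ball (s1, v0, t0) d3 \<subseteq> P -` near s1"
    using near_ball[OF s(2)[of s1]] s(1) by auto
  define h where "h = min e (min d1 (min d2 d3) / 4)"
  have h: "h > 0" "h \<le> e" "3 * h < d1" "3 * h < d2" "3 * h < d3"
    using \<open>e > 0\<close> d1(1) d2(1) d3(1) by (auto simp: h_def min_def)
  have box: "dist (a, v0, t0) (x, y, t) \<le> 3 * h"
    if "\<bar>x - a\<bar> \<le> h" "\<bar>y - v0\<bar> \<le> h" "\<bar>t - t0\<bar> \<le> h" for a x y t
  proof -
    have "dist (a, v0, t0) (x, y, t) = norm (a - x, v0 - y, t0 - t)" by (simp add: dist_norm)
    also have "\<dots> \<le> \<bar>a - x\<bar> + (\<bar>v0 - y\<bar> + \<bar>t0 - t\<bar>)"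
      using norm_Pair_le[of "a - x" "(v0 - y, t0 - t)"] norm_Pair_le[of "v0 - y" "t0 - t"] by simp
    finally show ?thesis using that by linarith
  qed
  have moll0: "\<bar>x\<bar> \<le> h" if "moll h x \<noteq> 0" for x
  proof (rule ccontr)
    assume "\<not> \<bar>x\<bar> \<le> h"
    then show False using moll_eq_0[OF h(1), of x] that by simp
  qed
  define w where "w a p = moll h (u p - a) * moll h (v p - v0) * moll h (\<tau> p - t0)" for a p
  define wp where "wp p = plateau h s0 s1 (u p) * moll h (v p - v0) * moll h (\<tau> p - t0)" for p
  have cont: "continuous_on UNIV u" "continuous_on UNIV v" "continuous_on UNIV \<tau>"
    using Ck_continuous smooth by blast+
  have cm: "continuous_on UNIV (\<lambda>p. moll h (k p - a))" if "continuous_on UNIV k" for k :: "heis \<Rightarrow> real" and a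
    by (rule continuous_on_compose2[OF continuous_on_moll[of UNIV]]) (auto intro!: continuous_intros that)
  have wm: "w a \<in> borel_measurable borel" for a
    unfolding w_def by (intro borel_measurable_continuous_onI continuous_on_mult cm cont)
  have "continuous_on UNIV (\<lambda>p. plateau h s0 s1 (u p))"
    by (rule continuous_on_compose2[OF continuous_on_plateau[OF h(1), of UNIV]]) (auto intro: cont)
  then have wpm: "wp \<in> borel_measurable borel"
    unfolding wp_def by (intro borel_measurable_continuous_onI continuous_on_mult cm cont)
  have w0: "w a p \<ge> 0" for a p unfolding w_def by (intro mult_nonneg_nonneg moll_nonneg h)
  have wp0: "wp p \<ge> 0" for p
    unfolding wp_def by (intro mult_nonneg_nonneg moll_nonneg h plateau_bounds s)
  have mm: "(\<lambda>x. moll h (x - a)) \<in> borel_measurable borel" for a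
    by (intro borel_measurable_continuous_onI continuous_on_compose2[OF continuous_on_moll[of UNIV]] continuous_intros) auto
  have wint: "(\<integral>\<^sup>+ p. ennreal (w a p) \<partial>lborel) = ennreal 1" for a
    unfolding w_def
    by (subst tonelli[OF mm mm mm]) (simp_all add: moll_nonneg h nn_integral_moll)
  define Wp where "Wp = (\<integral>\<^sup>+ x. ennreal (plateau h s0 s1 x) \<partial>lborel)"
  have Wp: "Wp \<le> ennreal (s1 - s0 + 2 * h)" "ennreal (s1 - s0 - 2 * h) \<le> Wp"
    unfolding Wp_def by (rule nn_integral_plateau[OF h(1) s(1)])+
  define W where "W = enn2real Wp"
  have "Wp < \<infinity>" using Wp(1) by (rule le_less_trans) simp
  then have W: "Wp = ennreal W" "W \<ge> 0" by (simp_all add: W_def)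
  have Wb: "W \<le> s1 - s0 + 2 * h" "s1 - s0 - 2 * h \<le> W"
  proof -
    show "W \<le> s1 - s0 + 2 * h" using Wp(1) s(1) h(1) unfolding W(1) by (subst (asm) ennreal_le_iff) auto
    show "s1 - s0 - 2 * h \<le> W"
      using Wp(2) W(2) unfolding W(1) by (cases "0 \<le> s1 - s0 - 2 * h") (auto simp: ennreal_le_iff)
  qed
  have pm: "plateau h s0 s1 \<in> borel_measurable borel"
    by (intro borel_measurable_continuous_onI continuous_on_plateau h)
  have wpint: "(\<integral>\<^sup>+ p. ennreal (wp p) \<partial>lborel) = ennreal W"
    unfolding wp_def W(1)[symmetric] Wp_def
    by (subst tonelli[OF pm mm mm]) (simp_all add: moll_nonneg h nn_integral_moll plateau_bounds s)
  have wsupp: "p \<in> near a" if "w a p \<noteq> 0" "ball (a, v0, t0) d \<subseteq> P -` near a" "3 * h < d" for a p d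
  proof -
    have "moll h (u p - a) \<noteq> 0" "moll h (v p - v0) \<noteq> 0" "moll h (\<tau> p - t0) \<noteq> 0"
      using that(1) by (simp_all add: w_def)
    then have "dist (a, v0, t0) (u p, v p, \<tau> p) \<le> 3 * h" by (intro box moll0)
    then have "(u p, v p, \<tau> p) \<in> ball (a, v0, t0) d" using that(3) by simp
    then have "P (u p, v p, \<tau> p) \<in> near a" using that(2) by blast
    then show ?thesis by (simp add: P(2))
  qed
  define Q where "Q = cbox (s0 - h, v0 - h, t0 - h) (s1 + h, v0 + h, t0 + h)"
  have QU: "P ` Q \<subseteq> U'"
  proof
    fix p assume "p \<in> P ` Q"
    then obtain z where z: "z \<in> Q" "p = P z" by (rule imageE)
    obtain x y t where xyt: "z = (x, y, t)" by (cases z)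
    have zb: "s0 - h \<le> x" "x \<le> s1 + h" "\<bar>y - v0\<bar> \<le> h" "\<bar>t - t0\<bar> \<le> h"
      using z(1) by (auto simp: Q_def xyt cbox_Pair_eq)
    define a where "a = max s0 (min s1 x)"
    have "a \<in> {s0..s1}" "\<bar>x - a\<bar> \<le> h" using s(1) zb h(1) by (auto simp: a_def)
    then have "dist (a, v0, t0) z \<le> 3 * h" unfolding xyt using zb by (intro box) auto
    then have "z \<in> ball (a, v0, t0) d1" using h(3) by simp
    moreover have "(a, v0, t0) \<in> seg" using \<open>a \<in> {s0..s1}\<close> by (simp add: seg_def)
    ultimately show "p \<in> U'" using d1(2) z(2) by blast
  qed
  have wpsupp: "p \<in> P ` Q" if "wp p \<noteq> 0" for p
  proof -
    have n0: "plateau h s0 s1 (u p) \<noteq> 0" "moll h (v p - v0) \<noteq> 0" "moll h (\<tau> p - t0) \<noteq> 0"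
      using that by (simp_all add: wp_def)
    have "s0 - h \<le> u p" "u p \<le> s1 + h"
      using plateau_bounds(3,4)[OF h(1) s(1), of "u p"] n0(1) by linarith+
    then have "(u p, v p, \<tau> p) \<in> Q"
      using moll0[OF n0(2)] moll0[OF n0(3)] by (auto simp: Q_def cbox_Pair_eq)
    then have "P (u p, v p, \<tau> p) \<in> P ` Q" by (rule imageI)
    then show ?thesis by (simp only: P(2))
  qed
  have test: "test_function U wp"
    unfolding test_function_def
  proof (intro conjI allI)
    fix k
    have "Ck k (\<lambda>p. moll h (l p - a))" if l: "\<And>k. Ck k l" for l :: "heis \<Rightarrow> real" and a
    proof -
      have "Ck k (\<lambda>p. l p + (- a))" by (intro Ck_add Ck_const l)
      from Ck_compose[OF Ck_moll this] show ?thesis by simp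
    qed
    from this[OF smooth(2)] this[OF smooth(3)] show "Ck k wp"
      unfolding wp_def by (intro Ck_mult Ck_compose[OF Ck_plateau[OF h(1)] smooth(1)])
    have cpt: "compact (P ` Q)"
      unfolding Q_def by (intro compact_continuous_image compact_cbox continuous_on_subset[OF P(1)]) simp
    have "{p. wp p \<noteq> 0} \<subseteq> P ` Q" using wpsupp by blast
    then have cl: "closure {p. wp p \<noteq> 0} \<subseteq> P ` Q"
      by (rule closure_minimal) (rule compact_imp_closed[OF cpt])
    then show "compact (closure {p. wp p \<noteq> 0})"
      using cpt closed_closure by (metis compact_Int_closed inf.absorb_iff2 inf_commute)
    show "closure {p. wp p \<noteq> 0} \<subseteq> U" using cl QU U'(2) by (meson order_trans)
  qed
  have dwp: "frechet_derivative wp (at p) (V p) = w s0 p - w s1 p" for p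
  proof -
    have c: "((\<lambda>p. k (l p)) has_derivative (\<lambda>e. l' e * D)) (at p)"
      if "(k has_real_derivative D) (at (l p))" "(l has_derivative l') (at p)" for k :: "real \<Rightarrow> real" and l l' D
    proof -
      have "(k has_derivative (\<lambda>x. x * D)) (at (l p))"
        using that(1) by (simp add: has_field_derivative_def mult_commute_abs)
      from has_derivative_compose[OF that(2) this] show ?thesis .
    qed
    have mder: "\<exists>D. ((\<lambda>x. moll h (x - a)) has_real_derivative D) (at x)" for a x
    proof -
      have "Ck (Suc 0) (\<lambda>x. moll h (1 * x + (- a)))" by (rule Ck_compose[OF Ck_moll Ck_affine])
      then have "(\<lambda>x. moll h (x - a)) differentiable (at x)" by simp
      then show ?thesis by (simp add: real_differentiable_def)
    qed
    obtain D2 where D2: "((\<lambda>x. moll h (x - v0)) has_real_derivative D2) (at (v p))" using mder by blast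
    obtain D3 where D3: "((\<lambda>x. moll h (x - t0)) has_real_derivative D3) (at (\<tau> p))" using mder by blast
    note h1 = c[OF plateau_has_derivative[OF h(1), of s0 s1 "u p"] der(1)]
    note h2 = c[OF D2 der(2)] and h3 = c[OF D3 der(3)]
    have "frechet_derivative wp (at p) = (\<lambda>e. plateau h s0 s1 (u p) * moll h (v p - v0) * (\<tau>' p e * D3) +
        (plateau h s0 s1 (u p) * (v' p e * D2) + u' p e * (moll h (u p - s0) - moll h (u p - s1)) * moll h (v p - v0)) * moll h (\<tau> p - t0))"
      unfolding wp_def[abs_def]
      by (rule frechet_derivative_at[symmetric, OF has_derivative_mult[OF has_derivative_mult[OF h1 h2] h3]])
    then show ?thesis by (simp add: V w_def left_diff_distrib)
  qed
  have wp_avg: "\<bar>(LINT p:U|lborel. g p * wp p) - m * W\<bar> \<le> \<epsilon> * W"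
  proof (rule weighted_average(2)[OF wpm wp0 wpint W(2) U(1,3)])
    fix p assume "wp p \<noteq> 0"
    then have "p \<in> U'" using wpsupp QU by blast
    then show "p \<in> U \<and> \<bar>g p - m\<bar> \<le> \<epsilon>" using U'(2,3) by blast
  qed
  have near: "p \<in> U \<and> \<bar>f p - f (P (a, v0, t0))\<bar> \<le> e" if "p \<in> near a" for a p
    using that U'(2) by (auto simp: near_def dist_real_def)
  note w0_avg = weighted_average[OF wm[of s0] w0[of s0] wint[of s0] zero_le_one U(1,2) near[OF wsupp[OF _ d2(2) h(4)]]]
  note w1_avg = weighted_average[OF wm[of s1] w0[of s1] wint[of s1] zero_le_one U(1,2) near[OF wsupp[OF _ d3(2) h(5)]]]
  have "(LINT p:U|lborel. g p * wp p) = - (LINT p:U|lborel. f p * frechet_derivative wp (at p) (V p))"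
    using U(4) test unfolding distributional_derivative_on_def by blast
  also have "\<dots> = - (LINT p:U|lborel. f p * w s0 p - f p * w s1 p)"
    by (simp add: dwp right_diff_distrib)
  also have "\<dots> = (LINT p:U|lborel. f p * w s1 p) - (LINT p:U|lborel. f p * w s0 p)"
    using set_integral_diff(2)[OF w0_avg(1) w1_avg(1)] by simp
  finally have "\<bar>f (P (s1, v0, t0)) - f (P (s0, v0, t0)) - m * W\<bar> \<le> \<epsilon> * W + 2 * e"
    using w0_avg(2) w1_avg(2) wp_avg by simp
  moreover have "\<bar>m * W - m * (s1 - s0)\<bar> \<le> \<bar>m\<bar> * (2 * e)"
    unfolding right_diff_distrib[symmetric] abs_mult using Wb h(2) by (intro mult_left_mono) auto
  moreover have "\<epsilon> * W \<le> \<epsilon> * (s1 - s0 + 2 * e)"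
    using Wb h(2) \<open>\<epsilon> \<ge> 0\<close> by (intro mult_left_mono) auto
  ultimately have "\<bar>f (P (s1, v0, t0)) - f (P (s0, v0, t0)) - m * (s1 - s0)\<bar> \<le>
      \<epsilon> * (s1 - s0 + 2 * e) + 2 * e + \<bar>m\<bar> * (2 * e)" by linarith
  also have "\<dots> = \<epsilon> * (s1 - s0) + e * (2 * \<epsilon> + 2 + 2 * \<bar>m\<bar>)" by (simp add: algebra_simps)
  also have "\<dots> = \<epsilon> * (s1 - s0) + e'" using den by (simp add: e_def)
  finally show "\<bar>f (P (s1, v0, t0)) - f (P (s0, v0, t0)) - m * (s1 - s0)\<bar> \<le> \<epsilon> * (s1 - s0) + e'" .
qed

lemma Ck_coordinates: "Ck k (\<lambda>p::heis. fst p)" "Ck k (\<lambda>p::heis. fst (snd p))" "Ck k (\<lambda>p::heis. snd (snd p))"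
  by (intro Ck_linear bounded_linear_intros)+

lemma X_line_nonneg:
  assumes U: "open U" "continuous_on U f" "continuous_on U g" "distributional_derivative_on U X_field f g"
    and U': "open U'" "U' \<subseteq> U" "\<And>p. p \<in> U' \<Longrightarrow> \<bar>g p - m\<bar> \<le> \<epsilon>"
    and h: "h \<ge> 0" "\<And>s. 0 \<le> s \<Longrightarrow> s \<le> h \<Longrightarrow> q \<cdot>\<^sub>H (s, 0, 0) \<in> U'"
  shows "\<bar>f (q \<cdot>\<^sub>H (h, 0, 0)) - f q - m * h\<bar> \<le> \<epsilon> * h"
proof -
  obtain x y t where q: "q = (x, y, t)" by (cases q)
  let ?P = "\<lambda>z::heis. (fst z, fst (snd z), snd (snd z) + 2 * fst z * fst (snd z))"
  have P: "?P (x + s, y, t - 2 * x * y) = q \<cdot>\<^sub>H (s, 0, 0)" for s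
    by (simp add: q algebra_simps)
  have "\<bar>f (?P (x + h, y, t - 2 * x * y)) - f (?P (x, y, t - 2 * x * y)) - m * (x + h - x)\<bar> \<le> \<epsilon> * (x + h - x)"
  proof (rule line_estimate[where u = "\<lambda>p. fst p" and v = "\<lambda>p. fst (snd p)" and V = X_field and g = g and U = U and U' = U'
        and \<tau> = "\<lambda>p. snd (snd p) + (- 2) * fst p * fst (snd p)" and P = ?P
        and u' = "\<lambda>p e. fst e" and v' = "\<lambda>p e. fst (snd e)"
        and \<tau>' = "\<lambda>p e. snd (snd e) + (- 2) * (fst e * fst (snd p) + fst p * fst (snd e))"])
    show "((\<lambda>p. snd (snd p) + (- 2) * fst p * fst (snd p)) has_derivative
        (\<lambda>e. snd (snd e) + (- 2) * (fst e * fst (snd p) + fst p * fst (snd e)))) (at p)" for p :: heis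
      by (auto intro!: derivative_eq_intros simp: algebra_simps)
    show "Ck k (\<lambda>p::heis. snd (snd p) + (- 2) * fst p * fst (snd p))" for k
      by (intro Ck_add Ck_mult Ck_const Ck_coordinates)
    show "continuous_on UNIV ?P" by (intro continuous_intros)
    show "?P (s, y, t - 2 * x * y) \<in> U'" if "x \<le> s" "s \<le> x + h" for s
      using h(2)[of "s - x"] P[of "s - x"] that by simp
    fix A B C :: "real \<Rightarrow> real"
    assume "A \<in> borel_measurable borel" "B \<in> borel_measurable borel" "C \<in> borel_measurable borel"
      "\<And>x. A x \<ge> 0" "\<And>x. B x \<ge> 0" "\<And>x. C x \<ge> 0"
    from nn_integral_sheared_product[OF this, of "- 2"]
    show "(\<integral>\<^sup>+ p. ennreal (A (fst p) * B (fst (snd p)) * C (snd (snd p) + (- 2) * fst p * fst (snd p))) \<partial>lborel) =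
        (\<integral>\<^sup>+ x. ennreal (A x) \<partial>lborel) * (\<integral>\<^sup>+ x. ennreal (B x) \<partial>lborel) * (\<integral>\<^sup>+ x. ennreal (C x) \<partial>lborel)" .
  qed (use U U' h in \<open>simp_all add: Ck_coordinates X_field_eq bounded_linear_imp_has_derivative bounded_linear_intros\<close>)
  then show ?thesis using P[of h] P[of 0] by (simp flip: zero_prod_def)
qed

lemma Y_line_nonneg:
  assumes U: "open U" "continuous_on U f" "continuous_on U g" "distributional_derivative_on U Y_field f g"
    and U': "open U'" "U' \<subseteq> U" "\<And>p. p \<in> U' \<Longrightarrow> \<bar>g p - m\<bar> \<le> \<epsilon>"
    and h: "h \<ge> 0" "\<And>s. 0 \<le> s \<Longrightarrow> s \<le> h \<Longrightarrow> q \<cdot>\<^sub>H (0, s, 0) \<in> U'"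
  shows "\<bar>f (q \<cdot>\<^sub>H (0, h, 0)) - f q - m * h\<bar> \<le> \<epsilon> * h"
proof -
  obtain x y t where q: "q = (x, y, t)" by (cases q)
  let ?P = "\<lambda>z::heis. (fst (snd z), fst z, snd (snd z) - 2 * fst z * fst (snd z))"
  have P: "?P (y + s, x, t + 2 * x * y) = q \<cdot>\<^sub>H (0, s, 0)" for s
    by (simp add: q algebra_simps)
  have "\<bar>f (?P (y + h, x, t + 2 * x * y)) - f (?P (y, x, t + 2 * x * y)) - m * (y + h - y)\<bar> \<le> \<epsilon> * (y + h - y)"
  proof (rule line_estimate[where u = "\<lambda>p. fst (snd p)" and v = "\<lambda>p. fst p" and V = Y_field and g = g and U = U and U' = U'
        and \<tau> = "\<lambda>p. snd (snd p) + 2 * fst p * fst (snd p)" and P = ?P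
        and u' = "\<lambda>p e. fst (snd e)" and v' = "\<lambda>p e. fst e"
        and \<tau>' = "\<lambda>p e. snd (snd e) + 2 * (fst e * fst (snd p) + fst p * fst (snd e))"])
    show "((\<lambda>p. snd (snd p) + 2 * fst p * fst (snd p)) has_derivative
        (\<lambda>e. snd (snd e) + 2 * (fst e * fst (snd p) + fst p * fst (snd e)))) (at p)" for p :: heis
      by (auto intro!: derivative_eq_intros simp: algebra_simps)
    show "Ck k (\<lambda>p::heis. snd (snd p) + 2 * fst p * fst (snd p))" for k
      by (intro Ck_add Ck_mult Ck_const Ck_coordinates)
    show "continuous_on UNIV ?P" by (intro continuous_intros)
    show "?P (s, x, t + 2 * x * y) \<in> U'" if "y \<le> s" "s \<le> y + h" for s
      using h(2)[of "s - y"] P[of "s - y"] that by simp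
    fix A B C :: "real \<Rightarrow> real"
    assume m: "A \<in> borel_measurable borel" "B \<in> borel_measurable borel" "C \<in> borel_measurable borel"
      "\<And>x. A x \<ge> 0" "\<And>x. B x \<ge> 0" "\<And>x. C x \<ge> 0"
    from nn_integral_sheared_product[OF m(2,1,3,5,4,6), of 2]
    show "(\<integral>\<^sup>+ p. ennreal (A (fst (snd p)) * B (fst p) * C (snd (snd p) + 2 * fst p * fst (snd p))) \<partial>lborel) =
        (\<integral>\<^sup>+ x. ennreal (A x) \<partial>lborel) * (\<integral>\<^sup>+ x. ennreal (B x) \<partial>lborel) * (\<integral>\<^sup>+ x. ennreal (C x) \<partial>lborel)"
      by (simp only: mult.commute)
  qed (use U U' h in \<open>simp_all add: Ck_coordinates Y_field_eq bounded_linear_imp_has_derivative bounded_linear_intros\<close>)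
  then show ?thesis using P[of h] P[of 0] by (simp flip: zero_prod_def)
qed

text \<open>The same for segments traversed in either direction.\<close>

lemma X_line:
  assumes U: "open U" "continuous_on U f" "continuous_on U g" "distributional_derivative_on U X_field f g"
    and U': "open U'" "U' \<subseteq> U" "\<And>p. p \<in> U' \<Longrightarrow> \<bar>g p - m\<bar> \<le> \<epsilon>"
    and h: "\<And>s. \<bar>s\<bar> \<le> \<bar>h\<bar> \<Longrightarrow> q \<cdot>\<^sub>H (s, 0, 0) \<in> U'"
  shows "\<bar>f (q \<cdot>\<^sub>H (h, 0, 0)) - f q - m * h\<bar> \<le> \<epsilon> * \<bar>h\<bar>"
proof (cases "h \<ge> 0")
  case True
  then show ?thesis using X_line_nonneg[OF U U' True, of q] h by simp
next
  case False
  have e: "(q \<cdot>\<^sub>H (h, 0, 0)) \<cdot>\<^sub>H (s, 0, 0) = q \<cdot>\<^sub>H (h + s, 0, 0)" for s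
    by (simp add: heis_mult_assoc)
  have "\<bar>f ((q \<cdot>\<^sub>H (h, 0, 0)) \<cdot>\<^sub>H (- h, 0, 0)) - f (q \<cdot>\<^sub>H (h, 0, 0)) - m * (- h)\<bar> \<le> \<epsilon> * (- h)"
  proof (rule X_line_nonneg[OF U U'])
    fix s assume "0 \<le> s" "s \<le> - h"
    then show "(q \<cdot>\<^sub>H (h, 0, 0)) \<cdot>\<^sub>H (s, 0, 0) \<in> U'" unfolding e using False by (intro h) auto
  qed (use False in auto)
  then show ?thesis using False unfolding e by (simp flip: zero_prod_def)
qed

lemma Y_line:
  assumes U: "open U" "continuous_on U f" "continuous_on U g" "distributional_derivative_on U Y_field f g"
    and U': "open U'" "U' \<subseteq> U" "\<And>p. p \<in> U' \<Longrightarrow> \<bar>g p - m\<bar> \<le> \<epsilon>"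
    and h: "\<And>s. \<bar>s\<bar> \<le> \<bar>h\<bar> \<Longrightarrow> q \<cdot>\<^sub>H (0, s, 0) \<in> U'"
  shows "\<bar>f (q \<cdot>\<^sub>H (0, h, 0)) - f q - m * h\<bar> \<le> \<epsilon> * \<bar>h\<bar>"
proof (cases "h \<ge> 0")
  case True
  then show ?thesis using Y_line_nonneg[OF U U' True, of q] h by simp
next
  case False
  have e: "(q \<cdot>\<^sub>H (0, h, 0)) \<cdot>\<^sub>H (0, s, 0) = q \<cdot>\<^sub>H (0, h + s, 0)" for s
    by (simp add: heis_mult_assoc)
  have "\<bar>f ((q \<cdot>\<^sub>H (0, h, 0)) \<cdot>\<^sub>H (0, - h, 0)) - f (q \<cdot>\<^sub>H (0, h, 0)) - m * (- h)\<bar> \<le> \<epsilon> * (- h)"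
  proof (rule Y_line_nonneg[OF U U'])
    fix s assume "0 \<le> s" "s \<le> - h"
    then show "(q \<cdot>\<^sub>H (0, h, 0)) \<cdot>\<^sub>H (0, s, 0) \<in> U'" unfolding e using False by (intro h) auto
  qed (use False in auto)
  then show ?thesis using False unfolding e by (simp flip: zero_prod_def)
qed

text \<open>Two points at distance \<open>r\<close> are connected by six segments along the frame of total length at most
  \<open>6 r\<close>: two of them realize the horizontal displacement, and the other four are the sides of a rectangle
  that corrects the height.\<close>

lemma frame_differentiability:
  assumes U: "open U" "continuous_on U f" "continuous_on U Xf" "continuous_on U Yf"
    "distributional_derivative_on U X_field f Xf" "distributional_derivative_on U Y_field f Yf"
    and U': "open U'" "U' \<subseteq> U" "\<And>p. p \<in> U' \<Longrightarrow> \<bar>Xf p - mx\<bar> \<le> \<epsilon>" "\<And>p. p \<in> U' \<Longrightarrow> \<bar>Yf p - my\<bar> \<le> \<epsilon>"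
    and near: "\<And>p. \<rho> q p \<le> 6 * \<rho> q q' \<Longrightarrow> p \<in> U'"
  shows "\<bar>f q' - f q - (mx * (fst q' - fst q) + my * (fst (snd q') - fst (snd q)))\<bar> \<le> 6 * \<epsilon> * \<rho> q q'"
proof -
  define r where "r = \<rho> q q'"
  obtain a b c where g: "- q \<cdot>\<^sub>H q' = (a, b, c)" by (cases "- q \<cdot>\<^sub>H q'")
  have q': "q' = q \<cdot>\<^sub>H (a, b, c)" by (simp flip: g)
  have ab: "a = fst q' - fst q" "b = fst (snd q') - fst (snd q)" by (simp_all add: q' heis_mult_eq)
  have r: "r = gauge_norm (a, b, c)" by (simp add: r_def rho_eq_gauge_norm g)
  have r0: "r \<ge> 0" by (simp add: r_def)
  have a: "\<bar>a\<bar> \<le> r" and b: "\<bar>b\<bar> \<le> r" and c: "\<bar>c\<bar> \<le> r\<^sup>2"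
    unfolding r using abs_fst_le_gauge_norm[of "(a, b, c)"] abs_snd_le_gauge_norm[of "(a, b, c)"]
      abs_vertical_le_gauge_norm[of "(a, b, c)"] by simp_all
  have "q \<in> U'" using near[of q] by simp
  then have "\<epsilon> \<ge> 0" using U'(3)[of q] by linarith
  \<comment> \<open>after the steps \<open>a X\<close> and \<open>b Y\<close> the height \<open>T\<close> is missing; a commutator of \<open>k Y\<close> and \<open>l X\<close> supplies it\<close>
  define T where "T = c + 2 * a * b"
  define k where "k = sqrt \<bar>T\<bar> / 2"
  define l where "l = sgn T * k"
  have k0: "k \<ge> 0" by (simp add: k_def)
  have kl: "4 * (k * l) = T"
  proof -
    have "4 * (k * l) = sgn T * (sqrt \<bar>T\<bar> * sqrt \<bar>T\<bar>)" by (simp add: k_def l_def)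
    also have "\<dots> = sgn T * \<bar>T\<bar>" by simp
    finally show ?thesis by (simp add: sgn_mult_abs)
  qed
  have l: "\<bar>l\<bar> \<le> k" using k0 by (cases "T = 0") (auto simp: l_def abs_mult abs_sgn_eq)
  have "\<bar>a * b\<bar> \<le> r * r" unfolding abs_mult using a b by (intro mult_mono) auto
  then have "\<bar>T\<bar> \<le> 4 * r\<^sup>2" using c unfolding T_def power2_eq_square by linarith
  then have "sqrt \<bar>T\<bar> \<le> 2 * r" using real_sqrt_le_mono[of "\<bar>T\<bar>" "4 * r\<^sup>2"] r0 by (simp add: real_sqrt_mult)
  then have k: "k \<le> r" by (simp add: k_def)
  define q1 where "q1 = q \<cdot>\<^sub>H (a, 0, 0)"
  define q2 where "q2 = q1 \<cdot>\<^sub>H (0, b, 0)"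
  define q3 where "q3 = q2 \<cdot>\<^sub>H (0, k, 0)"
  define q4 where "q4 = q3 \<cdot>\<^sub>H (l, 0, 0)"
  define q5 where "q5 = q4 \<cdot>\<^sub>H (0, - k, 0)"
  have q6: "q' = q5 \<cdot>\<^sub>H (- l, 0, 0)"
  proof -
    have "q5 \<cdot>\<^sub>H (- l, 0, 0) = q \<cdot>\<^sub>H ((a, 0, 0) \<cdot>\<^sub>H ((0, b, 0) \<cdot>\<^sub>H ((0, k, 0) \<cdot>\<^sub>H ((l, 0, 0) \<cdot>\<^sub>H ((0, - k, 0) \<cdot>\<^sub>H (- l, 0, 0))))))"
      by (simp only: q1_def q2_def q3_def q4_def q5_def heis_mult_assoc)
    also have "(a, 0, 0) \<cdot>\<^sub>H ((0, b, 0) \<cdot>\<^sub>H ((0, k, 0) \<cdot>\<^sub>H ((l, 0, 0) \<cdot>\<^sub>H ((0, - k, 0) \<cdot>\<^sub>H (- l, 0, 0))))) = (a, b, c)"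
      using kl by (simp add: T_def algebra_simps)
    finally show ?thesis by (simp add: q')
  qed
  have stepX: "\<rho> p (p \<cdot>\<^sub>H (s, 0, 0)) \<le> \<bar>s\<bar>" for p s
    using gauge_norm_horizontal_le[of s 0] by (simp add: rho_eq_gauge_norm)
  have stepY: "\<rho> p (p \<cdot>\<^sub>H (0, s, 0)) \<le> \<bar>s\<bar>" for p s
    using gauge_norm_horizontal_le[of 0 s] by (simp add: rho_eq_gauge_norm)
  have d1: "\<rho> q q1 \<le> r" using stepX[of q a] a by (simp add: q1_def)
  have d2: "\<rho> q q2 \<le> 2 * r" using rho_triangle[of q q2 q1] d1 stepY[of q1 b] b by (simp add: q2_def)
  have d3: "\<rho> q q3 \<le> 3 * r" using rho_triangle[of q q3 q2] d2 stepY[of q2 k] k k0 by (simp add: q3_def)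
  have d4: "\<rho> q q4 \<le> 4 * r" using rho_triangle[of q q4 q3] d3 stepX[of q3 l] l k by (simp add: q4_def)
  have d5: "\<rho> q q5 \<le> 5 * r" using rho_triangle[of q q5 q4] d4 stepY[of q4 "- k"] k k0 by (simp add: q5_def)
  have inX: "p \<cdot>\<^sub>H (s, 0, 0) \<in> U'" if "\<rho> q p \<le> 5 * r" "\<bar>s\<bar> \<le> r" for p s
    using rho_triangle[of q "p \<cdot>\<^sub>H (s, 0, 0)" p] stepX[of p s] that by (intro near) (simp add: r_def)
  have inY: "p \<cdot>\<^sub>H (0, s, 0) \<in> U'" if "\<rho> q p \<le> 5 * r" "\<bar>s\<bar> \<le> r" for p s
    using rho_triangle[of q "p \<cdot>\<^sub>H (0, s, 0)" p] stepY[of p s] that by (intro near) (simp add: r_def)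
  have X: "\<bar>f (p \<cdot>\<^sub>H (h, 0, 0)) - f p - mx * h\<bar> \<le> \<epsilon> * r" if "\<rho> q p \<le> 5 * r" "\<bar>h\<bar> \<le> r" for p h
  proof -
    have "\<bar>f (p \<cdot>\<^sub>H (h, 0, 0)) - f p - mx * h\<bar> \<le> \<epsilon> * \<bar>h\<bar>"
      by (rule X_line[OF U(1,2,3,5) U'(1-3)]) (use that inX in auto)
    also have "\<dots> \<le> \<epsilon> * r" using that \<open>\<epsilon> \<ge> 0\<close> by (intro mult_left_mono)
    finally show ?thesis .
  qed
  have Y: "\<bar>f (p \<cdot>\<^sub>H (0, h, 0)) - f p - my * h\<bar> \<le> \<epsilon> * r" if "\<rho> q p \<le> 5 * r" "\<bar>h\<bar> \<le> r" for p h
  proof -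
    have "\<bar>f (p \<cdot>\<^sub>H (0, h, 0)) - f p - my * h\<bar> \<le> \<epsilon> * \<bar>h\<bar>"
      by (rule Y_line[OF U(1,2,4,6) U'(1,2,4)]) (use that inY in auto)
    also have "\<dots> \<le> \<epsilon> * r" using that \<open>\<epsilon> \<ge> 0\<close> by (intro mult_left_mono)
    finally show ?thesis .
  qed
  have "\<bar>f q1 - f q - mx * a\<bar> \<le> \<epsilon> * r" unfolding q1_def using a r0 by (intro X) auto
  moreover have "\<bar>f q2 - f q1 - my * b\<bar> \<le> \<epsilon> * r" unfolding q2_def using b d1 r0 by (intro Y) auto
  moreover have "\<bar>f q3 - f q2 - my * k\<bar> \<le> \<epsilon> * r" unfolding q3_def using k k0 d2 r0 by (intro Y) auto
  moreover have "\<bar>f q4 - f q3 - mx * l\<bar> \<le> \<epsilon> * r" unfolding q4_def using k l d3 r0 by (intro X) auto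
  moreover have "\<bar>f q5 - f q4 - my * (- k)\<bar> \<le> \<epsilon> * r" unfolding q5_def using k k0 d4 r0 by (intro Y) auto
  moreover have "\<bar>f q' - f q5 - mx * (- l)\<bar> \<le> \<epsilon> * r" unfolding q6 using k l d5 r0 by (intro X) auto
  ultimately have "\<bar>f q' - f q - (mx * a + my * b)\<bar> \<le> 6 * (\<epsilon> * r)" by (simp add: abs_le_iff)
  then show ?thesis unfolding ab r_def by simp
qed

section \<open>The density of a regular hypersurface\<close>

text \<open>A rotation turns the horizontal normal at \<open>x\<close> into the \<open>y\<close>-axis. Then the hypersurface is a cone
  set near \<open>x\<close>, and its part in a ball of radius \<open>r\<close> projects into the slightly larger ball of the
  plane.\<close>

lemma hypersurface_density:
  fixes \<epsilon> :: real
  assumes S: "H_regular_hypersurface S" "x \<in> S" and eps: "0 < \<epsilon>" "\<epsilon> \<le> 1/2"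
  shows "\<exists>r0>0. \<forall>r. 0 < r \<and> r < r0 \<longrightarrow> compact (S \<inter> \<rho>_ball x r) \<and>
    haus3 (S \<inter> \<rho>_ball x r) \<le> ennreal ((2 + 8 * \<epsilon>) ^ 3 / large_area * (((1 + \<epsilon>) * r) ^ 3 * ball_area))"
proof -
  from S(1)[unfolded H_regular_hypersurface_def, THEN bspec, OF S(2)]
  obtain U f Xf Yf where U: "open U" "continuous_on U f" "continuous_on U Xf" "continuous_on U Yf"
    "distributional_derivative_on U X_field f Xf" "distributional_derivative_on U Y_field f Yf"
    and "x \<in> U" and nz: "\<forall>q\<in>U. (Xf q, Yf q) \<noteq> (0, 0)" and SU: "S \<inter> U = {q\<in>U. f q = 0}"
    by (elim exE conjE) (rule that)
  define mx where "mx = Xf x"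
  define my where "my = Yf x"
  define n where "n = sqrt (mx\<^sup>2 + my\<^sup>2)"
  have "mx \<noteq> 0 \<or> my \<noteq> 0" using bspec[OF nz \<open>x \<in> U\<close>] by (simp add: mx_def my_def)
  then have n2: "mx\<^sup>2 + my\<^sup>2 > 0" by (simp add: sum_power2_gt_zero_iff)
  then have n: "n > 0" "n\<^sup>2 = mx\<^sup>2 + my\<^sup>2" by (simp_all add: n_def)
  define \<eta> where "\<eta> = \<epsilon> * n / 6"
  have "\<eta> > 0" using eps n by (simp add: \<eta>_def)
  define U' where "U' = (U \<inter> Xf -` ball mx \<eta>) \<inter> (U \<inter> Yf -` ball my \<eta>)"
  have oU': "open U'"
    unfolding U'_def by (intro open_Int continuous_open_preimage U open_ball)
  have U'U: "U' \<subseteq> U" by (auto simp: U'_def)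
  have U'b: "\<bar>Xf p - mx\<bar> \<le> \<eta>" "\<bar>Yf p - my\<bar> \<le> \<eta>" if "p \<in> U'" for p
    using that by (simp_all add: U'_def dist_real_def abs_minus_commute)
  have "x \<in> U'" using \<open>x \<in> U\<close> \<open>\<eta> > 0\<close> by (simp add: U'_def mx_def my_def)
  obtain R where R: "R > 0" "\<rho>_ball x R \<subseteq> U'" using rho_ball_subset_open[OF oU' \<open>x \<in> U'\<close>] by metis
  show ?thesis
    \<comment> \<open>points of the ball of radius \<open>r\<close> are joined inside the ball of radius \<open>6 * 2 r + r\<close>\<close>
  proof (intro exI[of _ "R / 13"] conjI allI impI)
    show "R / 13 > 0" using R by simp
    fix r assume "0 < r \<and> r < R / 13"
    then have r: "0 < r" "13 * r < R" by auto
    define E where "E = S \<inter> \<rho>_ball x r"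
    have "\<rho>_ball x r \<subseteq> \<rho>_ball x R" using r by (auto simp: \<rho>_ball_def)
    then have BU: "\<rho>_ball x r \<subseteq> U" using R(2) U'U by blast
    have E_eq: "E = {q \<in> \<rho>_ball x r. f q = 0}" using BU SU unfolding E_def by blast
    have "closed E"
      unfolding E_eq by (rule continuous_closed_preimage_constant[OF continuous_on_subset[OF U(2) BU] closed_rho_ball])
    then have cE: "compact E" using compact_Int_closed[OF compact_rho_ball[of x r], of E] by (simp add: E_def Int_absorb1 inf.absorb2)
    then show "compact (S \<inter> \<rho>_ball x r)" by (simp add: E_def)
    define \<alpha> where "\<alpha> = my / n"
    define \<beta> where "\<beta> = mx / n"
    have ab: "\<alpha>\<^sup>2 + \<beta>\<^sup>2 = 1"
    proof -
      have "\<alpha>\<^sup>2 + \<beta>\<^sup>2 = (my\<^sup>2 + mx\<^sup>2) / n\<^sup>2" by (simp only: \<alpha>_def \<beta>_def power_divide add_divide_distrib)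
      also have "my\<^sup>2 + mx\<^sup>2 = n\<^sup>2" using n(2) by simp
      finally show ?thesis using n(1) by simp
    qed
    define \<phi> where "\<phi> p = rot \<alpha> \<beta> (- x \<cdot>\<^sub>H p)" for p
    define \<psi> where "\<psi> p = x \<cdot>\<^sub>H rot \<alpha> (- \<beta>) p" for p
    have iso: "\<rho> (\<phi> p) (\<phi> q) = \<rho> p q" for p q by (simp add: \<phi>_def rho_rot[OF ab])
    have iso': "\<rho> (\<psi> p) (\<psi> q) = \<rho> p q" for p q using ab by (simp add: \<psi>_def rho_rot)
    have inv: "\<psi> (\<phi> p) = p" for p by (simp add: \<phi>_def \<psi>_def rot_inverse[OF ab])
    have y: "fst (snd (\<phi> p)) = (mx * (fst p - fst x) + my * (fst (snd p) - fst (snd x))) / n" for p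
      by (simp add: \<phi>_def rot_def heis_mult_eq \<alpha>_def \<beta>_def add_divide_distrib)
    have est: "\<bar>mx * (fst q' - fst q) + my * (fst (snd q') - fst (snd q))\<bar> \<le> 6 * \<eta> * \<rho> q q'"
      if q: "q \<in> E" "q' \<in> E" for q q'
    proof -
      have "f q = 0" "f q' = 0" using q unfolding E_eq by blast+
      have qx: "\<rho> q x \<le> r" "\<rho> q' x \<le> r" using q unfolding E_def \<rho>_ball_def by blast+
      have qq: "\<rho> q q' \<le> 2 * r" using rho_triangle[of q q' x] rho_commute[of x q'] qx by linarith
      have "\<bar>f q' - f q - (mx * (fst q' - fst q) + my * (fst (snd q') - fst (snd q)))\<bar> \<le> 6 * \<eta> * \<rho> q q'"
      proof (rule frame_differentiability[OF U oU' U'U U'b])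
        fix p assume "\<rho> q p \<le> 6 * \<rho> q q'"
        then have "\<rho> p x \<le> R" using rho_triangle[of p x q] rho_commute[of p q] qx qq r by linarith
        then show "p \<in> U'" using R(2) unfolding \<rho>_ball_def by blast
      qed
      then show ?thesis using \<open>f q = 0\<close> \<open>f q' = 0\<close> by simp
    qed
    have cone: "cone_set \<epsilon> (\<phi> ` E)"
      unfolding cone_set_def
    proof (intro ballI)
      fix p' q' assume "p' \<in> \<phi> ` E" "q' \<in> \<phi> ` E"
      then obtain p q where p: "p \<in> E" "p' = \<phi> p" and q: "q \<in> E" "q' = \<phi> q" by (elim imageE)
      have "fst (snd p') - fst (snd q') = (mx * (fst p - fst q) + my * (fst (snd p) - fst (snd q))) / n"
        unfolding p(2) q(2) y by (simp add: diff_divide_distrib[symmetric] algebra_simps)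
      then have "\<bar>fst (snd p') - fst (snd q')\<bar> \<le> 6 * \<eta> * \<rho> q p / n"
        using est[OF q(1) p(1)] n by (simp add: divide_right_mono)
      also have "\<dots> = \<epsilon> * \<rho> p' q'"
        using n by (simp add: \<eta>_def p(2) q(2) iso rho_commute[of q p])
      finally show "\<bar>fst (snd p') - fst (snd q')\<bar> \<le> \<epsilon> * \<rho> p' q'" .
    qed
    have "continuous_on E \<phi>"
      unfolding \<phi>_def rot_def by (intro continuous_intros)
    then have cphi: "compact (\<phi> ` E)" by (rule compact_continuous_image[OF _ cE])
    have "E = \<psi> ` \<phi> ` E" by (simp add: image_image inv)
    then have "haus3 E \<le> haus3 (\<phi> ` E)" using haus3_isometry_image_le[of \<psi> "\<phi> ` E", OF iso'] by simp
    also have "\<dots> \<le> ennreal ((2 + 8 * \<epsilon>) ^ 3 / large_area * proj_area (\<phi> ` E))"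
      using eps by (intro cone_area_bound[OF cphi cone]) auto
    also have "\<dots> \<le> ennreal ((2 + 8 * \<epsilon>) ^ 3 / large_area * (((1 + \<epsilon>) * r) ^ 3 * ball_area))"
    proof (intro ennreal_leI mult_left_mono)
      have xE: "x \<in> E" using S(2) r by (simp add: E_def \<rho>_ball_def)
      have Db: "{m. gauge_norm (plane m) \<le> (1 + \<epsilon>) * r} \<in> sets borel" by (intro borel_compact compact_plane_gauge_ball)
      have "proj ` \<phi> ` E \<subseteq> chart (\<phi> x) 1 ` {m. gauge_norm (plane m) \<le> (1 + \<epsilon>) * r}"
      proof
        fix z assume "z \<in> proj ` \<phi> ` E"
        then obtain p where p: "p \<in> E" "z = proj (\<phi> p)" by (elim imageE) blast
        have "\<rho> p x \<le> r" using p(1) unfolding E_def \<rho>_ball_def by blast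
        then show "z \<in> chart (\<phi> x) 1 ` {m. gauge_norm (plane m) \<le> (1 + \<epsilon>) * r}"
          unfolding p(2) using eps by (intro cone_proj_ball[OF cone] imageI p xE) (simp_all add: iso)
      qed
      then have "emeasure lborel (proj ` \<phi> ` E) \<le> emeasure lborel (chart (\<phi> x) 1 ` {m. gauge_norm (plane m) \<le> (1 + \<epsilon>) * r})"
        using emeasure_chart(2)[OF Db, of 1] by (intro emeasure_mono) auto
      also have "\<dots> = ennreal (((1 + \<epsilon>) * r) ^ 3 * ball_area)"
        using emeasure_chart(1)[OF Db, of 1] emeasure_plane_gauge_ball[of "(1 + \<epsilon>) * r"] eps r by simp
      finally show "proj_area (\<phi> ` E) \<le> ((1 + \<epsilon>) * r) ^ 3 * ball_area"
        unfolding emeasure_proj[OF cphi] using eps r large_set_area(3) by (subst (asm) ennreal_le_iff) auto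
    qed (use eps large_area_pos in simp)
    finally show "haus3 (S \<inter> \<rho>_ball x r) \<le> ennreal ((2 + 8 * \<epsilon>) ^ 3 / large_area * (((1 + \<epsilon>) * r) ^ 3 * ball_area))"
      by (simp add: E_def)
  qed
qed

section \<open>A density theorem\<close>

text \<open>The Vitali selection. Zorn's lemma is applied to the disjoint subfamilies with the property that a ball of
  \<open>\<F>\<close> that meets a member also meets a member of at least half its radius.\<close>

lemma vitali_selection:
  fixes F :: "'a set" and rad :: "'a \<Rightarrow> real" and meets :: "'a \<Rightarrow> 'a \<Rightarrow> bool"
  assumes rad: "\<And>b. b \<in> F \<Longrightarrow> 0 < rad b \<and> rad b \<le> M"
    and refl: "\<And>b. b \<in> F \<Longrightarrow> meets b b" and sym: "\<And>b c. meets b c \<Longrightarrow> meets c b"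
  shows "\<exists>G\<subseteq>F. (\<forall>g\<in>G. \<forall>g'\<in>G. g \<noteq> g' \<longrightarrow> \<not> meets g g') \<and> (\<forall>b\<in>F. \<exists>g\<in>G. meets b g \<and> rad b \<le> 2 * rad g)"
proof -
  define A where "A = {G. G \<subseteq> F \<and> (\<forall>g\<in>G. \<forall>g'\<in>G. g \<noteq> g' \<longrightarrow> \<not> meets g g') \<and>
     (\<forall>b\<in>F. (\<exists>g\<in>G. meets b g) \<longrightarrow> (\<exists>g\<in>G. meets b g \<and> rad b \<le> 2 * rad g))}"
  have A1: "X \<subseteq> F" if "X \<in> A" for X using that unfolding A_def mem_Collect_eq by (elim conjE)
  have A2: "\<forall>g\<in>X. \<forall>g'\<in>X. g \<noteq> g' \<longrightarrow> \<not> meets g g'" if "X \<in> A" for X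
    using that unfolding A_def mem_Collect_eq by (elim conjE)
  have A3: "\<forall>b\<in>F. (\<exists>g\<in>X. meets b g) \<longrightarrow> (\<exists>g\<in>X. meets b g \<and> rad b \<le> 2 * rad g)" if "X \<in> A" for X
    using that unfolding A_def mem_Collect_eq by (elim conjE)
  have "\<exists>U\<in>A. \<forall>X\<in>C. X \<subseteq> U" if C: "subset.chain A C" for C
  proof (rule bexI[of _ "\<Union>C"])
    have CA: "C \<subseteq> A" and lin: "\<And>X Y. X \<in> C \<Longrightarrow> Y \<in> C \<Longrightarrow> X \<subseteq> Y \<or> Y \<subseteq> X"
      using C unfolding subset_chain_def by blast+
    show "\<Union>C \<in> A"
      unfolding A_def mem_Collect_eq
    proof (intro conjI ballI impI)
      show "\<Union>C \<subseteq> F" using CA A1 by (intro Union_least) (rule A1, rule subsetD)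
    next
      fix g g' assume "g \<in> \<Union>C" "g' \<in> \<Union>C" "g \<noteq> g'"
      then obtain X where "X \<in> C" "g \<in> X" "g' \<in> X" using lin by blast
      then show "\<not> meets g g'" using A2[OF subsetD[OF CA \<open>X \<in> C\<close>]] \<open>g \<noteq> g'\<close> by simp
    next
      fix b assume "b \<in> F" "\<exists>g\<in>\<Union>C. meets b g"
      then obtain X where "X \<in> C" "\<exists>g\<in>X. meets b g" by blast
      from A3[OF subsetD[OF CA this(1)], THEN bspec, OF \<open>b \<in> F\<close>, THEN mp, OF this(2)]
      obtain g where "g \<in> X" "meets b g \<and> rad b \<le> 2 * rad g" by (rule bexE)
      then show "\<exists>g\<in>\<Union>C. meets b g \<and> rad b \<le> 2 * rad g" using \<open>X \<in> C\<close> by (intro bexI[of _ g] UnionI)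
    qed
  qed blast
  from subset_Zorn[OF this] obtain G where G: "G \<in> A" and max: "\<And>X. X \<in> A \<Longrightarrow> G \<subseteq> X \<Longrightarrow> X = G" by blast
  note GF = A1[OF G] and dj = A2[OF G] and half = A3[OF G]
  have "\<exists>g\<in>G. meets b g" if "b \<in> F" for b
  proof (rule ccontr)
    assume nb: "\<not> ?thesis"
    define B where "B = {b\<in>F. \<not> (\<exists>g\<in>G. meets b g)}"
    have "B \<noteq> {}" using nb that by (auto simp: B_def)
    have bdd: "bdd_above (rad ` B)" using rad by (intro bdd_aboveI[of _ M]) (auto simp: B_def)
    define s where "s = Sup (rad ` B)"
    have le: "rad c \<le> s" if "c \<in> B" for c unfolding s_def by (rule cSUP_upper[OF that bdd])
    obtain b1 where "b1 \<in> B" using \<open>B \<noteq> {}\<close> by blast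
    then have "s > 0" using le[of b1] rad[of b1] by (auto simp: B_def)
    then have "s / 2 < Sup (rad ` B)" by (simp add: s_def)
    then obtain b0 where b0: "b0 \<in> B" "s / 2 < rad b0" using less_cSUP_iff[OF \<open>B \<noteq> {}\<close> bdd] by blast
    have b0F: "b0 \<in> F" and b0G: "\<And>g. g \<in> G \<Longrightarrow> \<not> meets b0 g" using b0(1) by (auto simp: B_def)
    have "insert b0 G \<in> A"
      unfolding A_def mem_Collect_eq
    proof (intro conjI ballI impI)
      show "insert b0 G \<subseteq> F" using GF b0F by blast
    next
      fix g g' assume "g \<in> insert b0 G" "g' \<in> insert b0 G" "g \<noteq> g'"
      then consider "g = b0" "g' \<in> G" | "g \<in> G" "g' = b0" | "g \<in> G" "g' \<in> G" by blast
      then show "\<not> meets g g'"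
      proof cases
        case 1
        then show ?thesis using b0G by simp
      next
        case 2
        then show ?thesis using b0G[of g] sym[of g b0] by blast
      next
        case 3
        then show ?thesis using dj \<open>g \<noteq> g'\<close> by simp
      qed
    next
      fix b assume b: "b \<in> F" "\<exists>g\<in>insert b0 G. meets b g"
      show "\<exists>g\<in>insert b0 G. meets b g \<and> rad b \<le> 2 * rad g"
      proof (cases "\<exists>g\<in>G. meets b g")
        case True
        from half[THEN bspec, OF b(1), THEN mp, OF this] obtain g where "g \<in> G" "meets b g \<and> rad b \<le> 2 * rad g"
          by (rule bexE)
        then show ?thesis by (intro bexI[of _ g] insertI2)
      next
        case False
        then have "meets b b0" "b \<in> B" using b by (auto simp: B_def)
        then show ?thesis using le[of b] b0(2) by (intro bexI[of _ b0]) auto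
      qed
    qed
    then have "insert b0 G = G" by (rule max) blast
    then show False using b0G refl[OF b0F] by blast
  qed
  then have "\<forall>b\<in>F. \<exists>g\<in>G. meets b g \<and> rad b \<le> 2 * rad g" using half by simp
  then show ?thesis by (intro exI[of _ G] conjI GF dj)
qed

lemma hpre_countable_UN:
  assumes "countable I" "\<And>J. finite J \<Longrightarrow> J \<subseteq> I \<Longrightarrow> (\<Sum>i\<in>J. hpre \<delta> (B i)) \<le> K"
  shows "hpre \<delta> (\<Union>i\<in>I. B i) \<le> K"
proof -
  define e where "e = to_nat_on I"
  have inj: "inj_on e I" unfolding e_def by (rule inj_on_to_nat_on[OF assms(1)])
  define B' where "B' n = (\<Union>i\<in>{i\<in>I. e i = n}. B i)" for n
  have "(\<Union>i\<in>I. B i) = (\<Union>n. B' n)" unfolding B'_def by blast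
  then have "hpre \<delta> (\<Union>i\<in>I. B i) \<le> (\<Sum>n. hpre \<delta> (B' n))" by (simp only: hpre_UN)
  also have "\<dots> \<le> K"
  proof (rule suminf_le_const)
    show "summable (\<lambda>n. hpre \<delta> (B' n))" by (rule summableI)
    fix N
    define J where "J = {i\<in>I. e i < N}"
    have "finite (e ` J)" by (rule finite_subset[of _ "{..<N}"]) (auto simp: J_def)
    then have J: "finite J" "J \<subseteq> I"
      using finite_imageD[OF _ inj_on_subset[OF inj]] by (auto simp: J_def)
    have "(\<Sum>n<N. hpre \<delta> (B' n)) = (\<Sum>n\<in>e ` J. hpre \<delta> (B' n))"
    proof (rule sum.mono_neutral_right)
      show "\<forall>n\<in>{..<N} - e ` J. hpre \<delta> (B' n) = 0"
      proof
        fix n assume "n \<in> {..<N} - e ` J"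
        then have "{i\<in>I. e i = n} = {}" by (auto simp: J_def)
        then show "hpre \<delta> (B' n) = 0" by (simp only: B'_def UN_empty hpre_empty)
      qed
    qed (auto simp: J_def)
    also have "\<dots> = (\<Sum>i\<in>J. hpre \<delta> (B' (e i)))"
      by (rule sum.reindex_cong[of e]) (use inj_on_subset[OF inj J(2)] in auto)
    also have "\<dots> = (\<Sum>i\<in>J. hpre \<delta> (B i))"
    proof (rule sum.cong[OF refl])
      fix i assume "i \<in> J"
      then have "{i'\<in>I. e i' = e i} = {i}" using inj J(2) by (auto simp: inj_on_def)
      then show "hpre \<delta> (B' (e i)) = hpre \<delta> (B i)" by (simp only: B'_def UN_insert UN_empty Un_empty_right)
    qed
    also have "\<dots> \<le> K" by (rule assms(2)[OF J])
    finally show "(\<Sum>n<N. hpre \<delta> (B' n)) \<le> K" .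
  qed
  finally show ?thesis .
qed

lemma ennreal_summable_tail:
  fixes f :: "nat \<Rightarrow> ennreal"
  assumes bound: "\<And>n. (\<Sum>k<n. f k) \<le> K" and K: "K < \<infinity>" and e: "(0::real) < e"
  shows "\<exists>N. (\<Sum>k. f (k + N)) \<le> ennreal e"
proof -
  have fin: "f k < \<infinity>" for k
    using order_trans[OF member_le_sum[of k "{..<Suc k}" f] bound[of "Suc k"]] K by (auto simp: le_less_trans)
  define g where "g k = enn2real (f k)" for k
  have fg: "f k = ennreal (g k)" for k unfolding g_def using fin[of k] by simp
  have "summable g"
  proof (rule summableI_nonneg_bounded)
    fix n
    have "ennreal (\<Sum>k<n. g k) = (\<Sum>k<n. f k)" unfolding fg by (rule sum_ennreal[symmetric]) (simp add: g_def)
    also have "\<dots> \<le> ennreal (enn2real K)" using bound[of n] K by simp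
    finally show "(\<Sum>k<n. g k) \<le> enn2real K" by (subst (asm) ennreal_le_iff) simp_all
  qed (simp add: g_def)
  from suminf_exist_split[OF e this] obtain N where N: "norm (\<Sum>k. g (k + N)) < e" by blast
  have "(\<Sum>k. f (k + N)) = ennreal (\<Sum>k. g (k + N))"
    unfolding fg
    by (rule suminf_ennreal2[OF _ summable_ignore_initial_segment[OF \<open>summable g\<close>]]) (simp add: g_def)
  also have "\<dots> \<le> ennreal e" using N by (intro ennreal_leI) simp
  finally show ?thesis by (rule exI)
qed

definition tube :: "heis set \<Rightarrow> real \<Rightarrow> heis set" where
  "tube C t = {p. \<exists>c\<in>C. \<rho> p c \<le> t}"

lemma tube_mono: "s \<le> t \<Longrightarrow> tube C s \<subseteq> tube C t"
  unfolding tube_def by (rule Collect_mono) (meson order_trans)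

text \<open>Every shell lies at a positive distance from the earlier ones, since \<open>b k - a (Suc k)\<close> is the width of a
  gap between them. So the measure is additive on the shells although \<open>A\<close> may not be measurable.\<close>

lemma haus3_shells:
  fixes a b :: "nat \<Rightarrow> real"
  assumes ab: "\<And>k. a (Suc k) < b k" and ba: "\<And>k. b k \<le> a k"
  shows "(\<Sum>k<n. haus3 (A \<inter> (tube C (a k) - tube C (b k)))) \<le> haus3 A"
proof -
  have "(\<Sum>k<Suc n. haus3 (A \<inter> (tube C (a k) - tube C (b k)))) \<le> haus3 (A - tube C (b n))" for n
  proof (induction n)
    case 0
    have "(\<Sum>k<Suc 0. haus3 (A \<inter> (tube C (a k) - tube C (b k)))) = haus3 (A \<inter> (tube C (a 0) - tube C (b 0)))"
      by simp
    also have "\<dots> \<le> haus3 (A - tube C (b 0))" by (rule haus3_mono) blast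
    finally show ?case .
  next
    case (Suc n)
    have "(\<Sum>k<Suc (Suc n). haus3 (A \<inter> (tube C (a k) - tube C (b k))))
        \<le> haus3 (A - tube C (b n)) + haus3 (A \<inter> (tube C (a (Suc n)) - tube C (b (Suc n))))"
      by (subst sum.lessThan_Suc) (intro add_mono Suc order_refl)
    also have "\<dots> \<le> haus3 ((A - tube C (b n)) \<union> (A \<inter> (tube C (a (Suc n)) - tube C (b (Suc n)))))"
    proof (rule haus3_metric_additive[of "b n - a (Suc n)"])
      fix p q assume p: "p \<in> A - tube C (b n)" and q: "q \<in> A \<inter> (tube C (a (Suc n)) - tube C (b (Suc n)))"
      from q have "\<exists>c\<in>C. \<rho> q c \<le> a (Suc n)" by (simp add: tube_def)
      then obtain c where c: "c \<in> C" "\<rho> q c \<le> a (Suc n)" by (rule bexE)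
      from p have "\<not> (\<exists>c\<in>C. \<rho> p c \<le> b n)" by (simp add: tube_def)
      with c(1) have "b n < \<rho> p c" using not_le by blast
      then show "b n - a (Suc n) \<le> \<rho> p q" using rho_triangle[of p c q] c(2) by linarith
    qed (use ab[of n] in simp)
    also have "\<dots> \<le> haus3 (A - tube C (b (Suc n)))"
    proof (rule haus3_mono)
      have "tube C (b (Suc n)) \<subseteq> tube C (b n)" using ab[of n] ba[of "Suc n"] by (intro tube_mono) linarith
      then show "(A - tube C (b n)) \<union> (A \<inter> (tube C (a (Suc n)) - tube C (b (Suc n)))) \<subseteq> A - tube C (b (Suc n))"
        by blast
    qed
    finally show ?case .
  qed
  then have "(\<Sum>k<Suc n. haus3 (A \<inter> (tube C (a k) - tube C (b k)))) \<le> haus3 A" for n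
    by (rule order_trans) (rule haus3_mono, blast)
  then show ?thesis by (cases n) (simp_all del: sum.lessThan_Suc)
qed

text \<open>The tubes around \<open>C\<close> shrink to \<open>C\<close>, which misses \<open>A\<close>, but continuity from above is not available for an
  outer measure on arbitrary sets. The tube of radius \<open>t\<^sub>N\<close> consists of shells between consecutive radii;
  shells of the same parity are separated by gaps, so that the measures of the shells have a finite
  sum and small tails.\<close>

lemma haus3_tube_small:
  fixes e :: real
  assumes C: "compact C" and AC: "A \<inter> C = {}" and fin: "haus3 A < \<infinity>" and e: "e > 0"
  shows "\<exists>d>0. haus3 (A \<inter> tube C d) \<le> ennreal e"
proof -
  define t where "t k = 1 / (real k + 1)" for k
  define R where "R k = A \<inter> (tube C (t k) - tube C (t (Suc k)))" for k
  have t: "t (Suc k) < t k" for k unfolding t_def by (simp add: field_simps)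
  have ev: "(\<Sum>k<n. haus3 (R (2 * k))) \<le> haus3 A" for n
    unfolding R_def
  proof (rule haus3_shells[of "\<lambda>k. t (2 * k)" "\<lambda>k. t (Suc (2 * k))"])
    fix k
    show "t (2 * Suc k) < t (Suc (2 * k))" using t[of "Suc (2 * k)"] by simp
    show "t (Suc (2 * k)) \<le> t (2 * k)" using t[of "2 * k"] by simp
  qed
  have od: "(\<Sum>k<n. haus3 (R (Suc (2 * k)))) \<le> haus3 A" for n
    unfolding R_def
  proof (rule haus3_shells[of "\<lambda>k. t (Suc (2 * k))" "\<lambda>k. t (Suc (Suc (2 * k)))"])
    fix k
    show "t (Suc (2 * Suc k)) < t (Suc (Suc (2 * k)))" using t[of "Suc (Suc (2 * k))"] by simp
    show "t (Suc (Suc (2 * k))) \<le> t (Suc (2 * k))" using t[of "Suc (2 * k)"] by simp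
  qed
  have "(\<Sum>k<n. haus3 (R k)) \<le> 2 * haus3 A" for n
  proof -
    have "(\<Sum>k<n. haus3 (R k)) \<le> (\<Sum>k<2 * n. haus3 (R k))" by (rule sum_mono2) auto
    also have "\<dots> = (\<Sum>k<n. haus3 (R (2 * k))) + (\<Sum>k<n. haus3 (R (Suc (2 * k))))"
      by (induction n) (simp_all add: ac_simps)
    also have "\<dots> \<le> haus3 A + haus3 A" by (intro add_mono ev od)
    finally show ?thesis by (simp add: mult_2)
  qed
  from ennreal_summable_tail[OF this _ e] obtain N where N: "(\<Sum>k. haus3 (R (k + N))) \<le> ennreal e"
    using fin by (auto simp: ennreal_mult_less_top)
  have "A \<inter> tube C (t N) \<subseteq> (\<Union>k. R (k + N))"
  proof
    fix p assume p: "p \<in> A \<inter> tube C (t N)"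
    have "\<exists>d>0. \<forall>x\<in>{p}. \<forall>y\<in>C. d \<le> \<rho> x y"
      by (rule disjoint_compact_rho) (use C AC p in auto)
    then obtain d where d: "d > 0" "\<forall>y\<in>C. d \<le> \<rho> p y" by auto
    obtain n where n: "1 / real (Suc n) < d" using d(1) nat_approx_posE by blast
    have "p \<notin> tube C (t n)"
    proof
      assume "p \<in> tube C (t n)"
      then obtain c where "c \<in> C" "\<rho> p c \<le> t n" unfolding tube_def by blast
      then show False using d(2) n by (auto simp: t_def add.commute dest!: bspec)
    qed
    define m where "m = (LEAST m. p \<notin> tube C (t m))"
    have m: "p \<notin> tube C (t m)" unfolding m_def by (rule LeastI[of "\<lambda>m. p \<notin> tube C (t m)"]) fact
    have lm: "p \<in> tube C (t k)" if "k < m" for k using not_less_Least[OF that[unfolded m_def]] by simp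
    have "N < m"
    proof (rule ccontr)
      assume "\<not> N < m"
      then have "t N \<le> t m" by (simp add: t_def field_simps)
      then show False using p m tube_mono by blast
    qed
    then obtain k where k: "m = Suc (k + N)" using less_imp_Suc_add[of N m] by (auto simp: add.commute)
    have "p \<in> R (k + N)" unfolding R_def using p m lm[of "k + N"] unfolding k by simp
    then show "p \<in> (\<Union>k. R (k + N))" by (rule UN_I[OF UNIV_I])
  qed
  then have "haus3 (A \<inter> tube C (t N)) \<le> (\<Sum>k. haus3 (R (k + N)))"
    by (rule order_trans[OF haus3_mono haus3_UN])
  also note N
  finally show ?thesis by (intro exI[of _ "t N"]) (simp add: t_def)
qed

text \<open>A maximal family of disjoint balls with much mass of \<open>A\<close> is selected. Balls of three times the radius
  cover the centres \<open>F\<close>, so that \<open>(6 s)\<^sup>3 = 27 (2 s)\<^sup>3\<close> is the contribution of a ball of radius \<open>s\<close>, and the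
  mass of \<open>A\<close> in the disjoint balls adds up to at most its mass in the tube around \<open>C\<close>.\<close>

lemma density_zero_covering:
  fixes \<eta> d :: real
  assumes \<eta>: "\<eta> > 0" and d: "d > 0" and FC: "F \<subseteq> C"
    and dense: "\<And>x r0. x \<in> F \<Longrightarrow> 0 < r0 \<Longrightarrow>
      \<exists>r. 0 < r \<and> r < r0 \<and> ennreal (\<eta> * (2 * r) ^ 3) \<le> haus3 (A \<inter> \<rho>_ball x r)"
  shows "haus3 F \<le> ennreal (27 / \<eta>) * haus3 (A \<inter> tube C d)"
proof (rule haus3_leI)
  fix \<delta> :: real assume \<delta>: "\<delta> > 0"
  define M where "M = min (\<delta> / 6) d"
  have M: "M > 0" "M \<le> \<delta> / 6" "M \<le> d" using \<delta> d by (simp_all add: M_def)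
  define B where "B = {b. fst b \<in> F \<and> 0 < snd b \<and> snd b \<le> M \<and>
    ennreal (\<eta> * (2 * snd b) ^ 3) \<le> haus3 (A \<inter> \<rho>_ball (fst b) (snd b))}"
  define D where "D b = \<rho>_ball (fst b) (snd b)" for b
  have BD: "fst b \<in> F" "0 < snd b" "snd b \<le> M" "ennreal (\<eta> * (2 * snd b) ^ 3) \<le> haus3 (A \<inter> D b)"
    if "b \<in> B" for b using that unfolding B_def D_def mem_Collect_eq by simp_all
  have cen: "fst b \<in> D b" if "b \<in> B" for b
    unfolding D_def \<rho>_ball_def mem_Collect_eq using BD(2)[OF that] by (simp add: rho_self)
  have "\<exists>G\<subseteq>B. (\<forall>g\<in>G. \<forall>g'\<in>G. g \<noteq> g' \<longrightarrow> \<not> D g \<inter> D g' \<noteq> {}) \<and>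
      (\<forall>b\<in>B. \<exists>g\<in>G. D b \<inter> D g \<noteq> {} \<and> snd b \<le> 2 * snd g)"
  proof (rule vitali_selection[of B snd M])
    fix b assume "b \<in> B"
    then show "0 < snd b \<and> snd b \<le> M" using BD by simp
    show "D b \<inter> D b \<noteq> {}" using cen[OF \<open>b \<in> B\<close>] by (simp only: Int_absorb) (rule ex_in_conv[THEN iffD1], rule exI)
  next
    fix b c show "D b \<inter> D c \<noteq> {} \<Longrightarrow> D c \<inter> D b \<noteq> {}" by (simp only: Int_commute not_False_eq_True)
  qed
  then obtain G where GB: "G \<subseteq> B" and dj: "\<And>g g'. g \<in> G \<Longrightarrow> g' \<in> G \<Longrightarrow> g \<noteq> g' \<Longrightarrow> D g \<inter> D g' = {}"
    and sel: "\<And>b. b \<in> B \<Longrightarrow> \<exists>g\<in>G. D b \<inter> D g \<noteq> {} \<and> snd b \<le> 2 * snd g"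
    by (elim exE conjE) (rule that, assumption, simp_all only: not_not not_False_eq_True)
  \<comment> \<open>disjoint nonempty open sets form a countable family\<close>
  have "countable G"
  proof (rule countable_image_inj_on)
    define O' where "O' g = {p. \<rho> p (fst g) < snd g}" for g :: "heis \<times> real"
    have sub: "O' g \<subseteq> D g" for g unfolding O'_def D_def \<rho>_ball_def by (rule Collect_mono) (rule impI, simp)
    have ne: "fst g \<in> O' g" if "g \<in> G" for g
      unfolding O'_def mem_Collect_eq using BD(2)[OF subsetD[OF GB that]] by (simp add: rho_self)
    show "inj_on O' G"
    proof (rule inj_onI, rule ccontr)
      fix g g' assume g: "g \<in> G" "g' \<in> G" "O' g = O' g'" "g \<noteq> g'"
      have "fst g \<in> D g" "fst g \<in> D g'" using ne[OF g(1)] g(3) sub by blast+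
      then show False using dj[OF g(1,2,4)] by blast
    qed
    show "countable (O' ` G)"
    proof (rule countable_disjoint_open_subsets)
      fix S assume "S \<in> O' ` G"
      then show "open S" by (rule imageE) (simp only: O'_def open_rho_ball)
    next
      show "pairwise disjnt (O' ` G)"
      proof (rule pairwiseI)
        fix S T assume "S \<in> O' ` G" "T \<in> O' ` G" "S \<noteq> T"
        then obtain g g' where "g \<in> G" "g' \<in> G" "g \<noteq> g'" "S = O' g" "T = O' g'" by blast
        then show "disjnt S T" using dj[of g g'] sub[of g] sub[of g'] unfolding disjnt_def by blast
      qed
    qed
  qed
  have "F \<subseteq> (\<Union>g\<in>G. \<rho>_ball (fst g) (3 * snd g))"
  proof
    fix x assume x: "x \<in> F"
    from dense[OF x M(1)] obtain r where r: "0 < r" "r < M" "ennreal (\<eta> * (2 * r) ^ 3) \<le> haus3 (A \<inter> \<rho>_ball x r)"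
      by (elim exE conjE)
    have "(x, r) \<in> B" unfolding B_def mem_Collect_eq fst_conv snd_conv using x r by (intro conjI) simp_all
    from sel[OF this] obtain g where g: "g \<in> G" "D (x, r) \<inter> D g \<noteq> {}" "r \<le> 2 * snd g"
      unfolding snd_conv by (elim bexE conjE)
    from g(2) obtain z where "z \<in> D (x, r)" "z \<in> D g" by blast
    then have z: "\<rho> z x \<le> r" "\<rho> z (fst g) \<le> snd g" by (simp_all add: D_def \<rho>_ball_def)
    have "\<rho> x (fst g) \<le> 3 * snd g"
      using z g(3) rho_triangle[of x "fst g" z] rho_commute[of x z] by linarith
    then have "x \<in> \<rho>_ball (fst g) (3 * snd g)" unfolding \<rho>_ball_def by (rule CollectI)
    with g(1) show "x \<in> (\<Union>g\<in>G. \<rho>_ball (fst g) (3 * snd g))" by (rule UN_I)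
  qed
  then have "hpre \<delta> F \<le> hpre \<delta> (\<Union>g\<in>G. \<rho>_ball (fst g) (3 * snd g))" by (rule hpre_mono)
  also have "\<dots> \<le> ennreal (27 / \<eta>) * haus3 (A \<inter> tube C d)"
  proof (rule hpre_countable_UN[OF \<open>countable G\<close>])
    fix J assume J: "finite J" "J \<subseteq> G"
    have JB: "g \<in> B" if "g \<in> J" for g using that J(2) GB by blast
    have "(\<Sum>g\<in>J. hpre \<delta> (\<rho>_ball (fst g) (3 * snd g))) \<le> (\<Sum>g\<in>J. ennreal (27 / \<eta>) * haus3 (A \<inter> D g))"
    proof (rule sum_mono)
      fix g assume "g \<in> J"
      note g = BD[OF JB[OF this]]
      have dia: "ediam \<rho> (\<rho>_ball (fst g) (3 * snd g)) \<le> ennreal (6 * snd g)"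
        unfolding ediam_le_iff
      proof (intro ballI ennreal_leI)
        fix p q assume "p \<in> \<rho>_ball (fst g) (3 * snd g)" "q \<in> \<rho>_ball (fst g) (3 * snd g)"
        then have "\<rho> p (fst g) \<le> 3 * snd g" "\<rho> q (fst g) \<le> 3 * snd g" by (simp_all add: \<rho>_ball_def)
        then show "\<rho> p q \<le> 6 * snd g"
          using rho_triangle[of p q "fst g"] rho_commute[of "fst g" q] by linarith
      qed
      have "ediam \<rho> (\<rho>_ball (fst g) (3 * snd g)) \<le> ennreal \<delta>"
        using order_trans[OF dia ennreal_leI[of "6 * snd g" \<delta>]] g(3) M(2) by simp
      then have "hpre \<delta> (\<rho>_ball (fst g) (3 * snd g)) \<le> ediam \<rho> (\<rho>_ball (fst g) (3 * snd g)) ^ 3"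
        by (rule hpre_le_ediam)
      also have "\<dots> \<le> ennreal (6 * snd g) ^ 3" by (rule power_mono[OF dia]) simp
      also have "\<dots> = ennreal (27 / \<eta>) * ennreal (\<eta> * (2 * snd g) ^ 3)"
        using \<eta> g(2) by (simp add: ennreal_power ennreal_mult[symmetric] power_mult_distrib)
      also have "\<dots> \<le> ennreal (27 / \<eta>) * haus3 (A \<inter> D g)" by (rule mult_left_mono[OF g(4)]) simp
      finally show "hpre \<delta> (\<rho>_ball (fst g) (3 * snd g)) \<le> ennreal (27 / \<eta>) * haus3 (A \<inter> D g)" .
    qed
    also have "\<dots> = ennreal (27 / \<eta>) * (\<Sum>g\<in>J. haus3 (A \<inter> D g))" by (rule sum_distrib_left[symmetric])
    also have "\<dots> \<le> ennreal (27 / \<eta>) * haus3 (A \<inter> (\<Union>g\<in>J. D g))"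
    proof (rule mult_left_mono[OF haus3_finite_additive[OF J(1)]])
      fix g show "compact (D g)" unfolding D_def by (rule compact_rho_ball)
    next
      show "disjoint_family_on D J"
        unfolding disjoint_family_on_def using dj J(2) by (intro ballI impI) (rule dj, auto)
    qed simp
    also have "\<dots> \<le> ennreal (27 / \<eta>) * haus3 (A \<inter> tube C d)"
    proof (rule mult_left_mono[OF haus3_mono])
      have "D g \<subseteq> tube C d" if "g \<in> J" for g
      proof
        fix p assume "p \<in> D g"
        then have "\<rho> p (fst g) \<le> d" using BD(3)[OF JB[OF that]] M(3) by (simp add: D_def \<rho>_ball_def)
        moreover have "fst g \<in> C" using BD(1)[OF JB[OF that]] FC by blast
        ultimately show "p \<in> tube C d" unfolding tube_def mem_Collect_eq by (rule bexI)
      qed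
      then show "A \<inter> (\<Union>g\<in>J. D g) \<subseteq> A \<inter> tube C d" by blast
    qed simp
    finally show "(\<Sum>g\<in>J. hpre \<delta> (\<rho>_ball (fst g) (3 * snd g))) \<le> ennreal (27 / \<eta>) * haus3 (A \<inter> tube C d)" .
  qed
  finally show "hpre \<delta> F \<le> ennreal (27 / \<eta>) * haus3 (A \<inter> tube C d)" .
qed

text \<open>The tube around \<open>C\<close> in the covering estimate has as little mass of \<open>A\<close> as desired.\<close>

lemma density_zero:
  fixes \<eta> :: real
  assumes C: "compact C" "A \<inter> C = {}" and fin: "haus3 A < \<infinity>" and \<eta>: "\<eta> > 0" and FC: "F \<subseteq> C"
    and dense: "\<And>x r0. x \<in> F \<Longrightarrow> 0 < r0 \<Longrightarrow>
      \<exists>r. 0 < r \<and> r < r0 \<and> ennreal (\<eta> * (2 * r) ^ 3) \<le> haus3 (A \<inter> \<rho>_ball x r)"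
  shows "haus3 F = 0"
proof -
  have "haus3 F \<le> 0"
  proof (rule ennreal_le_epsilon)
    fix e :: real assume e: "e > 0"
    then have "\<eta> / 27 * e > 0" using \<eta> by simp
    from haus3_tube_small[OF C fin this] obtain d where d: "d > 0" "haus3 (A \<inter> tube C d) \<le> ennreal (\<eta> / 27 * e)"
      by (elim exE conjE)
    have "haus3 F \<le> ennreal (27 / \<eta>) * haus3 (A \<inter> tube C d)" by (rule density_zero_covering[OF \<eta> d(1) FC dense])
    also have "\<dots> \<le> ennreal (27 / \<eta>) * ennreal (\<eta> / 27 * e)" by (rule mult_left_mono[OF d(2)]) simp
    also have "\<dots> = ennreal e" using \<eta> e by (subst ennreal_mult[symmetric]) simp_all
    finally show "haus3 F \<le> 0 + ennreal e" by simp
  qed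
  then show ?thesis by simp
qed

section \<open>The density of rectifiable sets\<close>

definition density_le :: "real \<Rightarrow> heis set \<Rightarrow> heis \<Rightarrow> bool" where
  "density_le \<gamma> E x \<longleftrightarrow> (\<exists>r0>0. \<forall>r. 0 < r \<and> r < r0 \<longrightarrow> haus3 (\<rho>_ball x r \<inter> E) \<le> ennreal (\<gamma> * (2 * r) ^ 3))"

text \<open>In a small ball around a point \<open>i\<close> of \<open>S\<close> the set splits into a part of \<open>S\<close>, which has density at most
  \<open>K\<close>, and the part \<open>A\<close> outside of \<open>S\<close>, which has density at most \<open>\<eta>\<close> at almost all points of \<open>S\<close>; here
  \<open>K + \<eta> < \<gamma>\<close>. Countably many such balls suffice by the Lindelof property.\<close>

lemma hypersurface_piece_density:
  fixes \<gamma> :: real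
  assumes S: "H_regular_hypersurface S" and \<gamma>: "ball_area / large_area < \<gamma>"
  shows "haus3 {x \<in> E \<inter> S. (\<exists>R>0. haus3 (\<rho>_ball x R \<inter> E) < \<infinity>) \<and> \<not> density_le \<gamma> E x} = 0"
proof -
  define P where "P = {x \<in> E \<inter> S. (\<exists>R>0. haus3 (\<rho>_ball x R \<inter> E) < \<infinity>) \<and> \<not> density_le \<gamma> E x}"
  define \<gamma>0 where "\<gamma>0 = ball_area / large_area"
  define \<eta> where "\<eta> = (\<gamma> - \<gamma>0) / 2"
  have \<gamma>0: "\<gamma>0 < \<gamma>" using \<gamma> by (simp add: \<gamma>0_def)
  then have \<eta>: "\<eta> > 0" "\<gamma>0 < \<gamma> - \<eta>" by (simp_all add: \<eta>_def field_simps)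
  \<comment> \<open>the density bound of \<open>hypersurface_density\<close> tends to \<open>\<gamma>0\<close> as \<open>\<epsilon>\<close> tends to zero\<close>
  have "((\<lambda>\<epsilon>::real. (1 + 4 * \<epsilon>) ^ 3 * (1 + \<epsilon>) ^ 3 * \<gamma>0) \<longlongrightarrow> \<gamma>0) (at_right 0)"
    by (auto intro!: tendsto_eq_intros)
  from eventually_conj[OF order_tendstoD(2)[OF this \<eta>(2)] eventually_at_right_real[of 0 "1/2"]]
  have "\<exists>\<epsilon>::real. (1 + 4 * \<epsilon>) ^ 3 * (1 + \<epsilon>) ^ 3 * \<gamma>0 < \<gamma> - \<eta> \<and> \<epsilon> \<in> {0<..<1/2}"
    by (intro eventually_happens'[OF trivial_limit_at_right_real]) simp
  then obtain \<epsilon> :: real where eps: "(1 + 4 * \<epsilon>) ^ 3 * (1 + \<epsilon>) ^ 3 * \<gamma>0 < \<gamma> - \<eta>" "0 < \<epsilon>" "\<epsilon> \<le> 1/2"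
    by auto
  define K where "K = (1 + 4 * \<epsilon>) ^ 3 * (1 + \<epsilon>) ^ 3 * \<gamma>0"
  have K0: "K \<ge> 0" unfolding K_def \<gamma>0_def using eps(2) large_set_area(3) large_area_pos by simp
  have Keq: "(2 + 8 * \<epsilon>) ^ 3 / large_area * (((1 + \<epsilon>) * r) ^ 3 * ball_area) = K * (2 * r) ^ 3" for r
  proof -
    have "2 + 8 * \<epsilon> = 2 * (1 + 4 * \<epsilon>)" by simp
    then show ?thesis by (simp only: power_mult_distrib K_def \<gamma>0_def) simp
  qed
  have hyp: "\<exists>r0>0. \<forall>r. 0 < r \<and> r < r0 \<longrightarrow> compact (S \<inter> \<rho>_ball x r) \<and> haus3 (S \<inter> \<rho>_ball x r) \<le> ennreal (K * (2 * r) ^ 3)"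
    if "x \<in> S" for x
    using hypersurface_density[OF S that eps(2,3)] unfolding Keq .
  have "\<exists>R. 0 < R \<and> haus3 (E \<inter> \<rho>_ball x R) < \<infinity> \<and> compact (S \<inter> \<rho>_ball x (R / 2))" if "x \<in> P" for x
  proof -
    have "x \<in> S" "\<exists>R>0. haus3 (\<rho>_ball x R \<inter> E) < \<infinity>" using that unfolding P_def by simp_all
    from this(2) obtain R where R: "R > 0" "haus3 (\<rho>_ball x R \<inter> E) < \<infinity>" by (elim exE conjE)
    from hyp[OF \<open>x \<in> S\<close>] obtain r0 where r0: "r0 > 0" "\<And>r. 0 < r \<Longrightarrow> r < r0 \<Longrightarrow> compact (S \<inter> \<rho>_ball x r)"
      by (elim exE conjE) simp
    have sub: "E \<inter> \<rho>_ball x (min R r0) \<subseteq> \<rho>_ball x R \<inter> E" unfolding \<rho>_ball_def by (rule subsetI) simp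
    have "haus3 (E \<inter> \<rho>_ball x (min R r0)) < \<infinity>" by (rule le_less_trans[OF haus3_mono[OF sub] R(2)])
    then show ?thesis using R(1) r0 by (intro exI[of _ "min R r0"]) simp
  qed
  then have "\<forall>x\<in>P. \<exists>R. 0 < R \<and> haus3 (E \<inter> \<rho>_ball x R) < \<infinity> \<and> compact (S \<inter> \<rho>_ball x (R / 2))" by (rule ballI)
  from bchoice[OF this] obtain R where
    R: "\<And>x. x \<in> P \<Longrightarrow> 0 < R x \<and> haus3 (E \<inter> \<rho>_ball x (R x)) < \<infinity> \<and> compact (S \<inter> \<rho>_ball x (R x / 2))"
    by (elim exE) (rule that, rule bspec)
  define O' where "O' x = {p. \<rho> p x < R x / 2}" for x
  obtain F' where F': "F' \<subseteq> O' ` P" "countable F'" "\<Union>F' = \<Union>(O' ` P)"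
  proof (rule Lindelof[of "O' ` P"])
    fix U assume "U \<in> O' ` P"
    then show "open U" by (rule imageE) (simp only: O'_def open_rho_ball)
  qed
  from F'(1,2) obtain I where I: "countable I" "I \<subseteq> P" "F' = O' ` I" using countable_subset_image by metis
  have cover: "P \<subseteq> (\<Union>i\<in>I. P \<inter> O' i)"
  proof
    fix x assume x: "x \<in> P"
    then have "x \<in> O' x" using R[OF x] by (simp add: O'_def rho_self)
    then have "x \<in> \<Union>F'" unfolding F'(3) using x by blast
    then show "x \<in> (\<Union>i\<in>I. P \<inter> O' i)" unfolding I(3) using x by blast
  qed
  have "haus3 (\<Union>i\<in>I. P \<inter> O' i) = 0"
  proof (rule haus3_countable_null[OF I(1)])
    fix i assume "i \<in> I"
    then have i: "0 < R i" "haus3 (E \<inter> \<rho>_ball i (R i)) < \<infinity>" "compact (S \<inter> \<rho>_ball i (R i / 2))"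
      using R I(2) by blast+
    define A where "A = (E \<inter> \<rho>_ball i (R i)) - S"
    show "haus3 (P \<inter> O' i) = 0"
    proof (rule density_zero[of "S \<inter> \<rho>_ball i (R i / 2)" A \<eta>])
      show "A \<inter> (S \<inter> \<rho>_ball i (R i / 2)) = {}" unfolding A_def by blast
      show "haus3 A < \<infinity>" unfolding A_def by (rule le_less_trans[OF haus3_mono i(2)]) blast
      show "P \<inter> O' i \<subseteq> S \<inter> \<rho>_ball i (R i / 2)"
      proof
        fix x assume x: "x \<in> P \<inter> O' i"
        then have "x \<in> S" by (simp add: P_def)
        moreover have "\<rho> x i \<le> R i / 2" using x by (simp add: O'_def)
        ultimately show "x \<in> S \<inter> \<rho>_ball i (R i / 2)" by (simp add: \<rho>_ball_def)
      qed
      fix x and r0 :: real assume x: "x \<in> P \<inter> O' i" and r0: "0 < r0"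
      have xS: "x \<in> S" and nd: "\<not> density_le \<gamma> E x" and xi: "\<rho> x i \<le> R i / 2"
        using x by (simp_all add: O'_def P_def)
      from hyp[OF xS] obtain r1 where r1: "r1 > 0"
        "\<And>r. 0 < r \<Longrightarrow> r < r1 \<Longrightarrow> haus3 (S \<inter> \<rho>_ball x r) \<le> ennreal (K * (2 * r) ^ 3)"
        by (elim exE conjE) simp
      define r2 where "r2 = min r0 (min r1 (R i / 2))"
      have "r2 > 0" using r0 r1(1) i(1) by (simp add: r2_def)
      with nd have "\<exists>r. 0 < r \<and> r < r2 \<and> \<not> haus3 (\<rho>_ball x r \<inter> E) \<le> ennreal (\<gamma> * (2 * r) ^ 3)"
        unfolding density_le_def by simp
      then obtain r where r: "0 < r" "r < r2" "\<not> haus3 (\<rho>_ball x r \<inter> E) \<le> ennreal (\<gamma> * (2 * r) ^ 3)"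
        by (elim exE conjE)
      have rr: "r < r0" "r < r1" "r < R i / 2" using r(2) by (simp_all add: r2_def)
      have "ennreal (\<eta> * (2 * r) ^ 3) \<le> haus3 (A \<inter> \<rho>_ball x r)"
      proof (rule ccontr)
        assume "\<not> ?thesis"
        then have le: "haus3 (A \<inter> \<rho>_ball x r) \<le> ennreal (\<eta> * (2 * r) ^ 3)" by simp
        have "\<rho>_ball x r \<inter> E \<subseteq> (S \<inter> \<rho>_ball x r) \<union> (A \<inter> \<rho>_ball x r)"
        proof
          fix p assume p: "p \<in> \<rho>_ball x r \<inter> E"
          then have "\<rho> p x \<le> r" by (simp add: \<rho>_ball_def)
          then have "\<rho> p i \<le> R i" using rho_triangle[of p i x] xi rr(3) by linarith
          then have "p \<in> \<rho>_ball i (R i)" by (simp add: \<rho>_ball_def)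
          then show "p \<in> (S \<inter> \<rho>_ball x r) \<union> (A \<inter> \<rho>_ball x r)" using p unfolding A_def by blast
        qed
        then have "haus3 (\<rho>_ball x r \<inter> E) \<le> haus3 (S \<inter> \<rho>_ball x r) + haus3 (A \<inter> \<rho>_ball x r)"
          by (rule order_trans[OF haus3_mono haus3_Un])
        also have "\<dots> \<le> ennreal (K * (2 * r) ^ 3) + ennreal (\<eta> * (2 * r) ^ 3)"
          by (intro add_mono r1(2) le r(1) rr(2))
        also have "\<dots> = ennreal ((K + \<eta>) * (2 * r) ^ 3)"
          using K0 \<eta>(1) r(1) by (subst ennreal_plus[symmetric]) (simp_all add: distrib_right)
        also have "\<dots> \<le> ennreal (\<gamma> * (2 * r) ^ 3)"
          using eps(1) r(1) by (intro ennreal_leI mult_right_mono) (simp_all add: K_def)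
        finally show False using r(3) by simp
      qed
      then show "\<exists>r. 0 < r \<and> r < r0 \<and> ennreal (\<eta> * (2 * r) ^ 3) \<le> haus3 (A \<inter> \<rho>_ball x r)"
        using r(1) rr(1) by (intro exI[of _ r] conjI)
    qed (use i(3) \<eta>(1) in auto)
  qed
  then have "haus3 P \<le> 0" using haus3_mono[OF cover] by simp
  then show ?thesis unfolding P_def by simp
qed

lemma rectifiable_density:
  fixes \<gamma> :: real and S :: "nat \<Rightarrow> heis set"
  assumes S: "\<And>j. H_regular_hypersurface (S j)" and null: "haus3 (E - (\<Union>j. S j)) = 0"
    and fin: "haus3 {x \<in> E. \<not> (\<exists>R>0. haus3 (\<rho>_ball x R \<inter> E) < \<infinity>)} = 0"
    and \<gamma>: "ball_area / large_area < \<gamma>"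
  shows "haus3 {x \<in> E. \<not> density_le \<gamma> E x} = 0"
proof -
  define P where "P j = {x \<in> E \<inter> S j. (\<exists>R>0. haus3 (\<rho>_ball x R \<inter> E) < \<infinity>) \<and> \<not> density_le \<gamma> E x}" for j
  define L where "L = {x \<in> E. \<not> (\<exists>R>0. haus3 (\<rho>_ball x R \<inter> E) < \<infinity>)}"
  have "{x \<in> E. \<not> density_le \<gamma> E x} \<subseteq> ((E - (\<Union>j. S j)) \<union> L) \<union> (\<Union>j. P j)"
  proof
    fix x assume "x \<in> {x \<in> E. \<not> density_le \<gamma> E x}"
    then have x: "x \<in> E" "\<not> density_le \<gamma> E x" by simp_all
    show "x \<in> ((E - (\<Union>j. S j)) \<union> L) \<union> (\<Union>j. P j)"
    proof (cases "x \<in> (\<Union>j. S j) \<and> x \<notin> L")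
      case True
      then obtain j where "x \<in> S j" by blast
      then have "x \<in> P j" using True x unfolding P_def L_def by simp
      then show ?thesis by blast
    next
      case False
      then show ?thesis using x(1) by blast
    qed
  qed
  then have "haus3 {x \<in> E. \<not> density_le \<gamma> E x} \<le> haus3 (((E - (\<Union>j. S j)) \<union> L) \<union> (\<Union>j. P j))"
    by (rule haus3_mono)
  also have "\<dots> \<le> haus3 ((E - (\<Union>j. S j)) \<union> L) + haus3 (\<Union>j. P j)" by (rule haus3_Un)
  also have "\<dots> \<le> (haus3 (E - (\<Union>j. S j)) + haus3 L) + haus3 (\<Union>j. P j)" by (intro add_mono haus3_Un order_refl)
  also have "haus3 (\<Union>j. P j) = 0"
    unfolding P_def by (intro haus3_countable_null hypersurface_piece_density S \<gamma>) simp
  finally show ?thesis using null fin by (simp add: L_def)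
qed

lemma H3_empty: "H3 {} = 0"
proof (cases "c\<^sub>3 < \<infinity>")
  case True
  then show ?thesis by (simp add: H3_def hausdorff_measure_eq_haus3)
next
  case False
  have "H3 {} \<le> 0"
    unfolding H3_def hausdorff_measure_def
    by (rule SUP_least, rule INF_lower2[of "\<lambda>_. {}"]) auto
  then show ?thesis by simp
qed

text \<open>For \<open>0 < c\<^sub>3 < \<infinity>\<close> the factor \<open>c\<^sub>3\<close> of the measure cancels against the one in the denominator. Any
  \<open>\<gamma>\<close> strictly between the ratio of the areas and \<open>1\<close> is possible.\<close>

theorem theorem1p1:
  shows "\<exists>\<gamma>::real. 0 < \<gamma> \<and> \<gamma> < 1 \<and>
           (\<forall>\<Sigma>::heis set. H_rectifiable \<Sigma> \<and> H3_locally_finite_ae \<Sigma> \<longrightarrow>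
              H3_ae_on \<Sigma> (\<lambda>x. upper_density3 (H3 \<llcorner> \<Sigma>) x \<le> ennreal \<gamma>))"
proof -
  define \<gamma> where "\<gamma> = (ball_area / large_area + 1) / 2"
  have q: "0 < ball_area / large_area" "ball_area / large_area < 1"
    using large_set_area(3) large_area_pos by (simp_all add: field_simps)
  have "0 < (a + 1) / 2 \<and> (a + 1) / 2 < 1 \<and> a < (a + 1) / 2" if "0 < a" "a < 1" for a :: real
    using that by simp
  from this[OF q] have "0 < \<gamma> \<and> \<gamma> < 1 \<and> ball_area / large_area < \<gamma>"
    unfolding \<gamma>_def .
  note \<gamma> = this[THEN conjunct1] this[THEN conjunct2, THEN conjunct1] this[THEN conjunct2, THEN conjunct2]
  have "H3_ae_on \<Sigma> (\<lambda>x. upper_density3 (H3 \<llcorner> \<Sigma>) x \<le> ennreal \<gamma>)"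
    if rec: "H_rectifiable \<Sigma>" and lf: "H3_locally_finite_ae \<Sigma>" for \<Sigma>
  proof -
    consider "c\<^sub>3 = \<infinity>" | "c\<^sub>3 = 0" | "0 < c\<^sub>3" "c\<^sub>3 < \<infinity>"
      by (metis infinity_ennreal_def top.not_eq_extremum zero_less_iff_neq_zero)
    then show ?thesis
    proof cases
      \<comment> \<open>for \<open>c\<^sub>3 = \<infinity>\<close> the denominators are infinite, so that all quotients vanish\<close>
      case 1
      have "upper_density3 (H3 \<llcorner> \<Sigma>) x \<le> ennreal \<gamma>" for x
        unfolding upper_density3_def
      proof (rule Limsup_bounded)
        show "\<forall>\<^sub>F r in at_right 0. (H3 \<llcorner> \<Sigma>) (\<rho>_ball x r) / (c\<^sub>3 * ennreal ((2 * r) ^ 3)) \<le> ennreal \<gamma>"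
          using eventually_at_right_less[of "0::real"]
        proof (rule eventually_mono)
          fix r :: real assume "0 < r"
          then have "c\<^sub>3 * ennreal ((2 * r) ^ 3) = top" using 1 by (simp add: ennreal_top_mult)
          then show "(H3 \<llcorner> \<Sigma>) (\<rho>_ball x r) / (c\<^sub>3 * ennreal ((2 * r) ^ 3)) \<le> ennreal \<gamma>" by simp
        qed
      qed
      then show ?thesis by (simp add: H3_ae_on_def H3_empty)
    next
      \<comment> \<open>for \<open>c\<^sub>3 = 0\<close> every set is null\<close>
      case 2
      then show ?thesis by (simp add: H3_ae_on_def H3_def hausdorff_measure_eq_haus3)
    next
      case 3
      have H3: "H3 A = c\<^sub>3 * haus3 A" for A
        unfolding H3_def by (rule hausdorff_measure_eq_haus3[OF 3(2)])
      have H3_null: "H3 A = 0 \<longleftrightarrow> haus3 A = 0" for A using 3(1) by (auto simp: H3)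
      have H3_fin: "haus3 A < \<infinity>" if "H3 A < \<infinity>" for A
      proof (rule ccontr)
        assume "\<not> haus3 A < \<infinity>"
        then have "H3 A = top" unfolding H3 using 3(1) by (simp add: less_top[symmetric] ennreal_mult_top)
        then show False using that by simp
      qed
      from rec obtain S where S: "\<And>j. H_regular_hypersurface (S j)" "H3 (\<Sigma> - (\<Union>j::nat. S j)) = 0"
        unfolding H_rectifiable_def by (elim exE conjE) (rule that, rule spec)
      have "haus3 {x \<in> \<Sigma>. \<not> density_le \<gamma> \<Sigma> x} = 0"
      proof (rule rectifiable_density[OF S(1) _ _ \<gamma>(3)])
        show "haus3 (\<Sigma> - (\<Union>j. S j)) = 0" using S(2) H3_null by simp
        have "haus3 {x \<in> \<Sigma>. \<not> (\<exists>r>0. H3 (\<rho>_ball x r \<inter> \<Sigma>) < \<infinity>)} = 0"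
          using lf unfolding H3_locally_finite_ae_def H3_ae_on_def measure_restriction_def H3_null .
        moreover have "haus3 {x \<in> \<Sigma>. \<not> (\<exists>R>0. haus3 (\<rho>_ball x R \<inter> \<Sigma>) < \<infinity>)}
            \<le> haus3 {x \<in> \<Sigma>. \<not> (\<exists>r>0. H3 (\<rho>_ball x r \<inter> \<Sigma>) < \<infinity>)}"
          by (rule haus3_mono, rule Collect_mono) (use H3_fin in blast)
        ultimately show "haus3 {x \<in> \<Sigma>. \<not> (\<exists>R>0. haus3 (\<rho>_ball x R \<inter> \<Sigma>) < \<infinity>)} = 0" by simp
      qed
      moreover have "upper_density3 (H3 \<llcorner> \<Sigma>) x \<le> ennreal \<gamma>" if "density_le \<gamma> \<Sigma> x" for x
        unfolding upper_density3_def
      proof (rule Limsup_bounded)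
        from that obtain r0 where r0: "r0 > 0"
          "\<And>r. 0 < r \<Longrightarrow> r < r0 \<Longrightarrow> haus3 (\<rho>_ball x r \<inter> \<Sigma>) \<le> ennreal (\<gamma> * (2 * r) ^ 3)"
          unfolding density_le_def by (elim exE conjE) simp
        show "\<forall>\<^sub>F r in at_right 0. (H3 \<llcorner> \<Sigma>) (\<rho>_ball x r) / (c\<^sub>3 * ennreal ((2 * r) ^ 3)) \<le> ennreal \<gamma>"
          using eventually_at_right_real[OF r0(1)]
        proof (rule eventually_mono)
          fix r assume "r \<in> {0<..<r0}"
          then have r: "0 < r" "r < r0" by simp_all
          have "c\<^sub>3 * haus3 (\<rho>_ball x r \<inter> \<Sigma>) \<le> c\<^sub>3 * ennreal (\<gamma> * (2 * r) ^ 3)"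
            by (rule mult_left_mono[OF r0(2)[OF r]]) simp
          also have "\<dots> = c\<^sub>3 * ennreal ((2 * r) ^ 3) * ennreal \<gamma>"
            using r \<gamma>(1) by (simp add: ennreal_mult ac_simps)
          finally show "(H3 \<llcorner> \<Sigma>) (\<rho>_ball x r) / (c\<^sub>3 * ennreal ((2 * r) ^ 3)) \<le> ennreal \<gamma>"
            unfolding measure_restriction_def H3 using 3(1) r
            by (intro divide_le_posI_ennreal) (simp_all add: ennreal_zero_less_mult_iff)
        qed
      qed
      then have "{x \<in> \<Sigma>. \<not> upper_density3 (H3 \<llcorner> \<Sigma>) x \<le> ennreal \<gamma>} \<subseteq> {x \<in> \<Sigma>. \<not> density_le \<gamma> \<Sigma> x}"
        by (intro Collect_mono) blast
      then have "haus3 {x \<in> \<Sigma>. \<not> upper_density3 (H3 \<llcorner> \<Sigma>) x \<le> ennreal \<gamma>} \<le> haus3 {x \<in> \<Sigma>. \<not> density_le \<gamma> \<Sigma> x}"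
        by (rule haus3_mono)
      ultimately show ?thesis by (simp add: H3_ae_on_def H3_null)
    qed
  qed
  then show ?thesis using \<gamma>(1,2) by (intro exI[of _ \<gamma>]) simp
qed

end
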